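(* Let $N=2$ and assume that $(A_0)$ and $(A_1)$ (both written out in the context) hold. Then problem (Q) admits at least one weak solution $(\theta,\phi)$ in the class $\mathcal S$.
   Context: Notation: $\mathbb R^+=[0,\infty)$. $D:=\operatorname{div}\mathbf u$ and $F:=\frac12|\nabla\mathbf u+(\nabla\mathbf u)^T|^2-\frac23D^2$, where $|A|^2=\sum_{i,j}a_{ij}^2$ for a matrix $A=(a_{ij})$. Problem (Q): find $(\theta,\phi)$ such that $$\rho\mathbf u\cdot\nabla\theta-\operatorname{div}\Big(\big(\nu+\tfrac{C_\theta}{\theta\phi}\big)\nabla\theta\Big)=-C_3F\theta^2+C_4\theta D+C_5\ \text{ in }\Omega,$$ $$\rho\mathbf u\cdot\nabla\phi-\operatorname{div}\Big(\big(\nu+\tfrac{C_\phi}{\theta\phi}\big)\nabla\phi\Big)=-\phi\,(C_6\theta F-C_7D+C_8\theta^{-1})\ \text{ in }\Omega,$$ $$\theta=a,\quad \phi=b\ \text{ on }\partial\Omega,$$ where $C_\theta=C_\theta(x,\theta,\phi)$, $C_\phi=C_\phi(x,\theta,\phi)$, $C_i=C_i(x)$ for $i=3,\dots,8$. The coefficients are of the form $C_i=\rho c_i$. Assumption $(A_0)$ (here with $N=2$): $r>N/2$ is a fixed number, and - $\Omega\subset\mathbb R^N$ is open, bounded, with Lipschitz boundary $\partial\Omega$ and outward normal $\mathbf n$; - $\nu\ge0$ is a real number ($\nu=0$ is allowed); $F,\rho:\Omega\to\mathbb R^+$, $\rho,\rho^{-1}\in L^\infty(\Omega)$, $F\in L^r(\Omega)$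 (in particular $F$ makes sense as a function); - $\mathbf u\in(L^3(\Omega))^N$, $D\in L^r(\Omega)$, $\operatorname{div}(\rho\mathbf u)=0$ in $\Omega$, $\mathbf u\cdot\mathbf n=0$ on $\partial\Omega$; - $a,b\in H^{1/2}(\partial\Omega)\cap L^\infty(\partial\Omega)$ and $a,b\ge\delta$ a.e. on $\partial\Omega$, for a fixed number $\delta>0$; - $C_i:\Omega\to\mathbb R^+$, with $C_5,C_8\in L^r(\Omega)$ and $C_i\in L^\infty(\Omega)$ for $i=3,4,6,7$; - for $\mathrm{ind}\in\{\theta,\phi\}$, $C_{\mathrm{ind}}:\Omega\times(\mathbb R^+)^2\to\mathbb R^+$ is Carathéodory (measurable in $x$ for all $(v,w)$, continuous in $(v,w)$ for a.a. $x$); there is a constant $\alpha_{\mathrm{ind}}>0$ with $C_{\mathrm{ind}}(x,v,w)\ge\alpha_{\mathrm{ind}}$ for all $v,w\in\mathbb R^+$ and a.a. $x$; and $x\mapsto C_{\mathrm{ind}}(x,v,w)\in L^\infty(\Omega)$ for all $v,w\in\mathbb R^+$, this last condition being understood as: $C_{\mathrm{ind}}(\cdot,\theta,\phi)$ is bounded whenever $\theta,\phi$ are bounded (nonnegative, measurable). Assumption $(A_1)$: $\frac{C_4^2}{C_3}\in L^r(\Omega)$, and $c_6=0.014$, $c_7=0.104$, $c_8=0.84$ (constants), i.e. $C_6=0.014\,\rho$, $C_7=0.104\,\rho$, $C_8=0.84\,\rho$. Class $\mathcal S$: functions $f:\Omega\to\mathbb R^+$ with $f\in H^1(\Omega)\cap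 L^\infty(\Omega)$ and $f^{-1}\in L^\infty(\Omega)$. A weak solution of (Q) in the class $\mathcal S$ is a pair $(\theta,\phi)$ with $\theta,\phi\in\mathcal S$ satisfying the two equations in the sense of distributions and the boundary conditions in the sense of traces. *)

theory Defs
  imports "HOL-Analysis.Analysis"
begin

definition Lp :: "'a measure \<Rightarrow> real \<Rightarrow> ('a \<Rightarrow> 'b::euclidean_space) \<Rightarrow> bool" where
  "Lp M p f \<longleftrightarrow> f \<in> borel_measurable M \<and> integrable M (\<lambda>x. norm (f x) powr p)"

definition Linf :: "'a measure \<Rightarrow> ('a \<Rightarrow> 'b::euclidean_space) \<Rightarrow> bool" where
  "Linf M f \<longleftrightarrow> f \<in> borel_measurable M \<and> (\<exists>B. AE x in M. norm (f x) \<le> B)"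

text \<open>Since \<open>inverse 0 = 0\<close> in HOL, the reciprocal being essentially bounded must be
  accompanied by \<open>f \<noteq> 0\<close> almost everywhere.\<close>

definition inverse_Linf :: "'a measure \<Rightarrow> ('a \<Rightarrow> real) \<Rightarrow> bool" where
  "inverse_Linf M f \<longleftrightarrow> (AE x in M. f x \<noteq> 0) \<and> Linf M (\<lambda>x. inverse (f x))"

definition L2_converges ::
    "'a measure \<Rightarrow> (nat \<Rightarrow> 'a \<Rightarrow> 'b::euclidean_space) \<Rightarrow> ('a \<Rightarrow> 'b) \<Rightarrow> bool" where
  "L2_converges M fs f \<longleftrightarrow>
     (\<lambda>k. \<integral>\<^sup>+ x. ennreal ((norm (fs k x - f x))\<^sup>2) \<partial>M) \<longlonglongrightarrow> 0"

definition locally_integrable ::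
    "'a::euclidean_space set \<Rightarrow> ('a \<Rightarrow> 'b::euclidean_space) \<Rightarrow> bool" where
  "locally_integrable \<Omega> f \<longleftrightarrow> (\<forall>K. compact K \<and> K \<subseteq> \<Omega> \<longrightarrow> integrable (lebesgue_on K) f)"

definition grad :: "('a::euclidean_space \<Rightarrow> real) \<Rightarrow> 'a \<Rightarrow> 'a" where
  "grad f x = (THE d. GDERIV f x :> d)"

primrec C_k :: "nat \<Rightarrow> ('a::euclidean_space \<Rightarrow> real) \<Rightarrow> bool" where
  "C_k 0 f \<longleftrightarrow> continuous_on UNIV f"
| "C_k (Suc k) f \<longleftrightarrow> (\<forall>x. f differentiable (at x)) \<and> (\<forall>b\<in>Basis. C_k k (\<lambda>x. grad f x \<bullet> b))"

definition smooth :: "('a::euclidean_space \<Rightarrow> real) \<Rightarrow> bool" where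
  "smooth f \<longleftrightarrow> (\<forall>k. C_k k f)"

definition test_function :: "'a::euclidean_space set \<Rightarrow> ('a \<Rightarrow> real) \<Rightarrow> bool" where
  "test_function \<Omega> \<psi> \<longleftrightarrow>
     smooth \<psi> \<and> compact (closure {x. \<psi> x \<noteq> 0}) \<and> closure {x. \<psi> x \<noteq> 0} \<subseteq> \<Omega>"

definition has_weak_grad ::
    "'a::euclidean_space set \<Rightarrow> ('a \<Rightarrow> real) \<Rightarrow> ('a \<Rightarrow> 'a) \<Rightarrow> bool" where
  "has_weak_grad \<Omega> f g \<longleftrightarrow> locally_integrable \<Omega> f \<and> locally_integrable \<Omega> g \<and>
     (\<forall>\<psi>. test_function \<Omega> \<psi> \<longrightarrow>
        (\<integral>x. f x *\<^sub>R grad \<psi> x \<partial>lebesgue_on \<Omega>) = - (\<integral>x. \<psi> x *\<^sub>R g x \<partial>lebesgue_on \<Omega>))"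

text \<open>\<open>J x $ i $ j\<close> is the \<open>j\<close>-th partial derivative of the \<open>i\<close>-th component of \<open>u\<close>.\<close>

definition has_weak_jacobian ::
    "(real^'n) set \<Rightarrow> (real^'n \<Rightarrow> real^'n) \<Rightarrow> (real^'n \<Rightarrow> real^'n^'n) \<Rightarrow> bool" where
  "has_weak_jacobian \<Omega> u J \<longleftrightarrow> (\<forall>i. has_weak_grad \<Omega> (\<lambda>x. u x $ i) (\<lambda>x. J x $ i))"

definition has_weak_div ::
    "'a::euclidean_space set \<Rightarrow> ('a \<Rightarrow> 'a) \<Rightarrow> ('a \<Rightarrow> real) \<Rightarrow> bool" where
  "has_weak_div \<Omega> w d \<longleftrightarrow> locally_integrable \<Omega> w \<and> locally_integrable \<Omega> d \<and>
     (\<forall>\<psi>. test_function \<Omega> \<psi> \<longrightarrow>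
        (\<integral>x. w x \<bullet> grad \<psi> x \<partial>lebesgue_on \<Omega>) = - (\<integral>x. d x * \<psi> x \<partial>lebesgue_on \<Omega>))"

text \<open>The normal trace of an integrable field \<open>w\<close> with integrable divergence \<open>d\<close> is the functional
  \<open>\<psi> \<mapsto> \<integral>\<^sub>\<Omega> (w \<bullet> \<nabla>\<psi> + d \<psi>)\<close> of Green's formula, where \<open>\<psi>\<close> need not vanish on the boundary.\<close>

definition normal_trace_zero ::
    "'a::euclidean_space set \<Rightarrow> ('a \<Rightarrow> 'a) \<Rightarrow> ('a \<Rightarrow> real) \<Rightarrow> bool" where
  "normal_trace_zero \<Omega> w d \<longleftrightarrow>
     (\<forall>\<psi>. test_function UNIV \<psi> \<longrightarrow>
        (\<integral>x. w x \<bullet> grad \<psi> x \<partial>lebesgue_on \<Omega>) + (\<integral>x. d x * \<psi> x \<partial>lebesgue_on \<Omega>) = 0)"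

text \<open>\<open>g\<close> is the weak gradient of the \<open>H\<^sup>1\<close> function \<open>f\<close>.\<close>

definition H1 :: "'a::euclidean_space set \<Rightarrow> ('a \<Rightarrow> real) \<Rightarrow> ('a \<Rightarrow> 'a) \<Rightarrow> bool" where
  "H1 \<Omega> f g \<longleftrightarrow> Lp (lebesgue_on \<Omega>) 2 f \<and> Lp (lebesgue_on \<Omega>) 2 g \<and> has_weak_grad \<Omega> f g"

text \<open>Near each boundary point the set is the part lying above the graph of a Lipschitz function
  defined on the hyperplane orthogonal to a unit vector \<open>e\<close>.\<close>

definition lipschitz_boundary :: "'a::euclidean_space set \<Rightarrow> bool" where
  "lipschitz_boundary \<Omega> \<longleftrightarrow>
     (\<forall>p\<in>frontier \<Omega>. \<exists>e \<epsilon> L \<gamma>. norm e = 1 \<and> \<epsilon> > 0 \<and> L-lipschitz_on {y. y \<bullet> e = 0} \<gamma> \<and>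
        (\<forall>x\<in>ball p \<epsilon>. x \<in> \<Omega> \<longleftrightarrow> \<gamma> (x - (x \<bullet> e) *\<^sub>R e) < x \<bullet> e))"

text \<open>The surface measure on the boundary of a plane domain is one-dimensional Hausdorff measure,
  taken on its Caratheodory-measurable sets. Boundedness of the covering sets is required
  because \<open>diameter\<close> is unspecified on unbounded sets.\<close>

definition hausdorff1_outer :: "'a::euclidean_space set \<Rightarrow> ennreal" where
  "hausdorff1_outer A =
     (SUP \<delta>\<in>{0<..}. INF U\<in>{U. A \<subseteq> (\<Union>i::nat. U i) \<and> (\<forall>i. bounded (U i) \<and> diameter (U i) \<le> \<delta>)}.
        \<Sum>i. ennreal (diameter (U i)))"

definition hausdorff1 :: "'a::euclidean_space measure" where
  "hausdorff1 = measure_of UNIV (lambda_system UNIV (Pow UNIV) hausdorff1_outer) hausdorff1_outer"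

definition boundary_measure :: "(real^2) set \<Rightarrow> (real^2) measure" where
  "boundary_measure \<Omega> = restrict_space hausdorff1 (frontier \<Omega>)"

text \<open>The trace operator on \<open>H\<^sup>1(\<Omega>)\<close> is the continuous extension of the restriction of smooth
  functions to the boundary, whence this characterisation of its graph by approximation.\<close>

definition has_trace :: "(real^2) set \<Rightarrow> (real^2 \<Rightarrow> real) \<Rightarrow> (real^2 \<Rightarrow> real) \<Rightarrow> bool" where
  "has_trace \<Omega> f a \<longleftrightarrow> Lp (boundary_measure \<Omega>) 2 a \<and>
     (\<exists>g \<psi>. H1 \<Omega> f g \<and> (\<forall>k. smooth (\<psi> k)) \<and>
        L2_converges (lebesgue_on \<Omega>) \<psi> f \<and>
        L2_converges (lebesgue_on \<Omega>) (\<lambda>k. grad (\<psi> k)) g \<and>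
        L2_converges (boundary_measure \<Omega>) \<psi> a)"

text \<open>The fractional space on the boundary of order one half, as the range of the trace operator.\<close>

definition H_half_boundary :: "(real^2) set \<Rightarrow> (real^2 \<Rightarrow> real) \<Rightarrow> bool" where
  "H_half_boundary \<Omega> a \<longleftrightarrow> (\<exists>f. has_trace \<Omega> f a)"

text \<open>In the following two definitions \<open>J\<close> stands for the weak Jacobian \<open>\<nabla>u\<close>.\<close>

definition div_J :: "(real^'n \<Rightarrow> real^'n^'n) \<Rightarrow> real^'n \<Rightarrow> real" where
  "div_J J x = trace (J x)"

definition strain_F :: "(real^'n \<Rightarrow> real^'n^'n) \<Rightarrow> real^'n \<Rightarrow> real" where
  "strain_F J x =
     1/2 * (\<Sum>i\<in>UNIV. \<Sum>j\<in>UNIV. ((J x + transpose (J x)) $ i $ j)\<^sup>2) - 2/3 * (div_J J x)\<^sup>2"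

definition diffusion_coefficient ::
    "'a::euclidean_space set \<Rightarrow> ('a \<Rightarrow> real \<Rightarrow> real \<Rightarrow> real) \<Rightarrow> bool" where
  "diffusion_coefficient \<Omega> C \<longleftrightarrow>
     (\<forall>v\<ge>0. \<forall>w\<ge>0. (\<lambda>x. C x v w) \<in> borel_measurable (lebesgue_on \<Omega>)) \<and>
     (AE x in lebesgue_on \<Omega>. continuous_on ({0..} \<times> {0..}) (\<lambda>(v, w). C x v w)) \<and>
     (\<exists>\<alpha>>0. AE x in lebesgue_on \<Omega>. \<forall>v\<ge>0. \<forall>w\<ge>0. \<alpha> \<le> C x v w) \<and>
     (\<forall>\<theta> \<phi>. (\<forall>x\<in>\<Omega>. 0 \<le> \<theta> x \<and> 0 \<le> \<phi> x) \<and> Linf (lebesgue_on \<Omega>) \<theta> \<and> Linf (lebesgue_on \<Omega>) \<phi>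
        \<longrightarrow> Linf (lebesgue_on \<Omega>) (\<lambda>x. C x (\<theta> x) (\<phi> x)))"

definition class_S :: "'a::euclidean_space set \<Rightarrow> ('a \<Rightarrow> real) \<Rightarrow> bool" where
  "class_S \<Omega> f \<longleftrightarrow> (\<forall>x\<in>\<Omega>. 0 \<le> f x) \<and> (\<exists>g. H1 \<Omega> f g) \<and>
     Linf (lebesgue_on \<Omega>) f \<and> inverse_Linf (lebesgue_on \<Omega>) f"

text \<open>\<open>\<rho> u \<bullet> \<nabla>f - div (\<kappa> \<nabla>f) = h\<close> in the sense of distributions on \<open>\<Omega>\<close>.\<close>

definition weak_equation ::
    "'a::euclidean_space set \<Rightarrow> ('a \<Rightarrow> real) \<Rightarrow> ('a \<Rightarrow> 'a) \<Rightarrow> ('a \<Rightarrow> real) \<Rightarrow>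
     ('a \<Rightarrow> real) \<Rightarrow> ('a \<Rightarrow> real) \<Rightarrow> bool" where
  "weak_equation \<Omega> \<rho> u \<kappa> f h \<longleftrightarrow>
     (\<exists>g. H1 \<Omega> f g \<and>
        (\<forall>\<psi>. test_function \<Omega> \<psi> \<longrightarrow>
           (\<integral>x. \<rho> x * (u x \<bullet> g x) * \<psi> x \<partial>lebesgue_on \<Omega>)
             + (\<integral>x. \<kappa> x * (g x \<bullet> grad \<psi> x) \<partial>lebesgue_on \<Omega>)
           = (\<integral>x. h x * \<psi> x \<partial>lebesgue_on \<Omega>)))"

definition weak_solution_Q ::
    "(real^2) set \<Rightarrow> real \<Rightarrow> (real^2 \<Rightarrow> real) \<Rightarrow> (real^2 \<Rightarrow> real^2) \<Rightarrow> (real^2 \<Rightarrow> real^2^2) \<Rightarrow>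
     (real^2 \<Rightarrow> real \<Rightarrow> real \<Rightarrow> real) \<Rightarrow> (real^2 \<Rightarrow> real \<Rightarrow> real \<Rightarrow> real) \<Rightarrow>
     (nat \<Rightarrow> real^2 \<Rightarrow> real) \<Rightarrow> (real^2 \<Rightarrow> real) \<Rightarrow> (real^2 \<Rightarrow> real) \<Rightarrow>
     (real^2 \<Rightarrow> real) \<Rightarrow> (real^2 \<Rightarrow> real) \<Rightarrow> bool" where
  "weak_solution_Q \<Omega> \<nu> \<rho> u J C\<^sub>\<theta> C\<^sub>\<phi> C a b \<theta> \<phi> \<longleftrightarrow>
     class_S \<Omega> \<theta> \<and> class_S \<Omega> \<phi> \<and>
     weak_equation \<Omega> \<rho> u (\<lambda>x. \<nu> + C\<^sub>\<theta> x (\<theta> x) (\<phi> x) / (\<theta> x * \<phi> x)) \<theta>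
       (\<lambda>x. - C 3 x * strain_F J x * (\<theta> x)\<^sup>2 + C 4 x * \<theta> x * div_J J x + C 5 x) \<and>
     weak_equation \<Omega> \<rho> u (\<lambda>x. \<nu> + C\<^sub>\<phi> x (\<theta> x) (\<phi> x) / (\<theta> x * \<phi> x)) \<phi>
       (\<lambda>x. - \<phi> x * (C 6 x * \<theta> x * strain_F J x - C 7 x * div_J J x + C 8 x * inverse (\<theta> x))) \<and>
     has_trace \<Omega> \<theta> a \<and> has_trace \<Omega> \<phi> b"

end

theory Submission
  imports Defs "HOL-Complex_Analysis.Great_Picard"
begin

text \<open>The arguments \<open>\<theta>\<close> and \<open>\<phi>\<close> in the coefficients and sources are truncated to intervals \<open>[m1, N1]\<close> and
  \<open>[m2, N2]\<close>. The truncated system is uniformly elliptic with sources bounded in \<open>L\<^sup>r\<close>, and since the drift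
  \<open>\<rho> u\<close> is divergence free it is coercive; Galerkin approximation and compactness give a solution. The
  truncation turns out to be inactive if the bounds are chosen in the order \<open>N2\<close>, \<open>N1\<close>, \<open>m1\<close>, \<open>m2\<close>, each of
  them depending only on the data and on the previous ones. In two dimensions \<open>D\<^sup>2 \<le> 3 F\<close>, and
  \<open>3 \<sqdot> 0.104\<^sup>2 < 4 \<sqdot> 0.014 \<sqdot> 0.84\<close> makes the source of \<open>\<phi>\<close> nonpositive, so the maximum principle bounds
  \<open>\<phi>\<close> by its boundary values. Also \<open>- C\<^sub>3 F \<theta>\<^sup>2 + C\<^sub>4 \<theta> D \<le> 3 C\<^sub>4\<^sup>2 / (4 C\<^sub>3)\<close>. The degenerate coefficient
  \<open>1 / (\<theta> \<phi>)\<close> loses a factor \<open>1 / \<theta>\<close>, which is regained by estimating the level sets of \<open>ln \<theta>\<close>, \<open>- ln \<theta>\<close>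
  and \<open>- ln \<phi>\<close> with Stampacchia's method. Truncations of \<open>\<theta>\<close> are admissible test functions because a
  function with zero trace is small on thin boundary strips and hence a limit of test functions.\<close>

text \<open>The obstacle is circularity: the ellipticity constant
  \<open>\<alpha> / (N1 * N2)\<close> of the truncated system contains the bounds that are to be
  proved. For \<phi> from above only the sign of the source enters, and the resulting bound does not
  contain that constant. For \<theta> from above the source is dominated by the data alone, and the
  coefficient is multiplied by \<theta>: where \<theta> exceeds 1 this product is at least
  \<open>\<alpha> / N2\<close>, without N1. N1 and N2 may then enter the lower bounds. There each
  source carries, up to the nonnegative \<open>C 5\<close>, a factor of its own unknown, which the
  weight exp in the level estimate cancels; the reciprocal of \<theta> in the source of \<phi> puts
  m1 before m2. The space of test functions is never completed. Elements of its closure are pairs of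
  a function and a gradient, bounded functionals are maps on test functions, and a weak limit is
  first a Cauchy sequence of test functions. Lower order terms are controlled because in the plane
  every exponent above 1 pairs with the closure of the test functions.\<close>

text \<open>Brouwer's theorem is stated for a dimension that is a type. Here the dimension varies, so Kuhn's
  lemma is applied directly, with the labels given by the signs of \<open>P\<close> on a grid.\<close>

lemma coercive_field_has_zero_nat:
  fixes P :: "(nat \<Rightarrow> real) \<Rightarrow> nat \<Rightarrow> real"
  assumes R: "R > 0"
    and cont: "\<And>x y i. \<lbrakk>\<And>j. (\<lambda>k. x k j) \<longlonglongrightarrow> y j; \<And>k j. \<bar>x k j\<bar> \<le> R; i < m\<rbrakk>
      \<Longrightarrow> (\<lambda>k. P (x k) i) \<longlonglongrightarrow> P y i"
    and coercive: "\<And>c i. \<lbrakk>\<And>j. \<bar>c j\<bar> \<le> R; i < m; \<bar>c i\<bar> = R\<rbrakk> \<Longrightarrow> 0 < (\<Sum>j<m. P c j * c j)"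
  shows "\<exists>c. (\<forall>j. \<bar>c j\<bar> \<le> R) \<and> (\<forall>i<m. P c i = 0)"
proof -
  define pt :: "nat \<Rightarrow> (nat \<Rightarrow> nat) \<Rightarrow> nat \<Rightarrow> real"
    where "pt p x j = (if j < m then 2 * R * (real (x j) / real p) - R else 0)" for p x j
  \<comment> \<open>Kuhn's lemma prescribes label 0 on the lower and 1 on the upper faces; only in
    between does the sign of \<open>P\<close> decide. Hence in the limit the sign is known up to the
    alternative that the point lies on a face.\<close>
  define lab :: "nat \<Rightarrow> (nat \<Rightarrow> nat) \<Rightarrow> nat \<Rightarrow> nat"
    where "lab p x i = (if x i = 0 then 0 else if x i = p then 1 else if P (pt p x) i \<le> 0 then 0 else 1)" for p x i
  define good where "good p q r s \<longleftrightarrow> (\<forall>j<m. q j \<le> p) \<and> (\<forall>i<m. (\<forall>j<m. r i j \<le> p \<and> s i j \<le> p) \<and>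
     (\<forall>j<m. q j \<le> r i j \<and> r i j \<le> q j + 1) \<and> (\<forall>j<m. q j \<le> s i j \<and> s i j \<le> q j + 1) \<and>
     lab p (r i) i = 0 \<and> lab p (s i) i = 1)" for p :: nat and q and r s :: "nat \<Rightarrow> nat \<Rightarrow> nat"
  have "\<exists>q r s. good p q r s" if p0: "p > 0" for p
  proof -
    obtain q where q: "\<forall>i<m. q i < p" and
       *: "\<forall>i<m. \<exists>r s. (\<forall>j<m. q j \<le> r j \<and> r j \<le> q j + 1) \<and> (\<forall>j<m. q j \<le> s j \<and> s j \<le> q j + 1) \<and> lab p r i \<noteq> lab p s i"
      by (rule kuhn_lemma[OF p0, of m "lab p"]) (use p0 in \<open>auto simp: lab_def\<close>)
    have "\<exists>r s. (\<forall>j<m. q j \<le> r j \<and> r j \<le> q j + 1) \<and> (\<forall>j<m. q j \<le> s j \<and> s j \<le> q j + 1) \<and> lab p r i = 0 \<and> lab p s i = 1" if i: "i < m" for i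
    proof -
      obtain r s where rs: "\<forall>j<m. q j \<le> r j \<and> r j \<le> q j + 1" "\<forall>j<m. q j \<le> s j \<and> s j \<le> q j + 1" "lab p r i \<noteq> lab p s i"
        using * i by blast
      have "(lab p r i = 0 \<or> lab p r i = 1) \<and> (lab p s i = 0 \<or> lab p s i = 1)" unfolding lab_def by auto
      then show ?thesis using rs by metis
    qed
    then obtain r s where rs: "\<And>i. i < m \<Longrightarrow> (\<forall>j<m. q j \<le> r i j \<and> r i j \<le> q j + 1) \<and> (\<forall>j<m. q j \<le> s i j \<and> s i j \<le> q j + 1) \<and> lab p (r i) i = 0 \<and> lab p (s i) i = 1"
      by metis
    have "r i j \<le> p \<and> s i j \<le> p" if "i < m" "j < m" for i j
    proof -
      have "q j < p" "r i j \<le> q j + 1" "s i j \<le> q j + 1" using rs[OF that(1)] q that(2) by blast+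
      then show ?thesis by linarith
    qed
    then show ?thesis using rs q by (intro exI[of _ q] exI[of _ r] exI[of _ s]) (auto simp: less_imp_le good_def)
  qed
  then have "\<exists>q r s. good (Suc p) q r s" for p by simp
  then obtain q r s where good: "\<And>p. good (Suc p) (q p) (r p) (s p)" by metis
  have q: "\<And>p j. j < m \<Longrightarrow> q p j \<le> Suc p"
    and le: "\<And>p i j. i < m \<Longrightarrow> j < m \<Longrightarrow> r p i j \<le> Suc p \<and> s p i j \<le> Suc p"
    and near: "\<And>p i j. i < m \<Longrightarrow> j < m \<Longrightarrow> q p j \<le> r p i j \<and> r p i j \<le> q p j + 1 \<and> q p j \<le> s p i j \<and> s p i j \<le> q p j + 1"
    and lab: "\<And>p i. i < m \<Longrightarrow> lab (Suc p) (r p i) i = 0 \<and> lab (Suc p) (s p i) i = 1"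
    using good unfolding good_def by auto
  have bd: "\<bar>pt (Suc p) x j\<bar> \<le> R" if "\<And>j. j < m \<Longrightarrow> x j \<le> Suc p" for p x j
  proof (cases "j < m")
    case True
    define t where "t = real (x j) / real (Suc p)"
    have "0 \<le> t" "t \<le> 1" using that[OF True] unfolding t_def by (auto simp: field_simps)
    moreover have "pt (Suc p) x j = 2 * R * t - R" unfolding pt_def t_def using True by simp
    moreover have "2 * R * t \<le> 2 * R" "0 \<le> 2 * R * t" using R \<open>0 \<le> t\<close> \<open>t \<le> 1\<close> by (auto simp: mult_le_cancel_left1)
    ultimately show ?thesis by linarith
  qed (use R in \<open>simp add: pt_def\<close>)
  obtain k where k: "strict_mono k" and lim: "\<And>x. x \<in> (UNIV::nat set) \<Longrightarrow> \<exists>l. (\<lambda>n. pt (Suc (k n)) (q (k n)) x) \<longlonglongrightarrow> l"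
    by (rule function_convergent_subsequence[of UNIV "\<lambda>n. pt (Suc n) (q n)" R]) (use bd q in auto)
  then obtain z where z: "\<And>j. (\<lambda>n. pt (Suc (k n)) (q (k n)) j) \<longlonglongrightarrow> z j" by (metis UNIV_I)
  have inv: "(\<lambda>n. 1 / real (Suc (k n))) \<longlonglongrightarrow> 0"
    using LIMSEQ_subseq_LIMSEQ[OF LIMSEQ_inverse_real_of_nat k] by (simp add: o_def inverse_eq_divide)
  have conv: "(\<lambda>n. pt (Suc (k n)) (x n) j) \<longlonglongrightarrow> z j"
    if "\<And>n j. j < m \<Longrightarrow> q (k n) j \<le> x n j \<and> x n j \<le> q (k n) j + 1" for x j
  proof (cases "j < m")
    case True
    have "\<bar>pt (Suc (k n)) (x n) j - pt (Suc (k n)) (q (k n)) j\<bar> \<le> 2 * R * (1 / real (Suc (k n)))" for n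
    proof -
      have "pt (Suc (k n)) (x n) j - pt (Suc (k n)) (q (k n)) j = 2 * R * ((real (x n j) - real (q (k n) j)) / real (Suc (k n)))"
        using True by (simp add: pt_def algebra_simps diff_divide_distrib)
      moreover have "\<bar>(real (x n j) - real (q (k n) j)) / real (Suc (k n))\<bar> \<le> 1 / real (Suc (k n))"
        unfolding abs_divide using that[OF True, of n] by (intro frac_le) auto
      then have "2 * R * \<bar>(real (x n j) - real (q (k n) j)) / real (Suc (k n))\<bar> \<le> 2 * R * (1 / real (Suc (k n)))"
        using R by (intro mult_left_mono) auto
      moreover have "\<bar>2 * R * t\<bar> = 2 * R * \<bar>t\<bar>" for t :: real using R by (simp add: abs_mult)
      ultimately show ?thesis by (simp only:)
    qed
    moreover have "(\<lambda>n. 2 * R * (1 / real (Suc (k n)))) \<longlonglongrightarrow> 0" using tendsto_mult_right_zero[OF inv] by blast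
    ultimately have "(\<lambda>n. pt (Suc (k n)) (x n) j - pt (Suc (k n)) (q (k n)) j) \<longlonglongrightarrow> 0"
      by (auto intro: Lim_null_comparison[rotated])
    from tendsto_add[OF this z[of j]] show ?thesis by simp
  next
    case False
    then have "pt (Suc (k n)) (x n) j = pt (Suc (k n)) (q (k n)) j" for n by (simp add: pt_def)
    then show ?thesis using z by simp
  qed
  have zb: "\<bar>z j\<bar> \<le> R" for j
    by (rule LIMSEQ_le_const2[OF tendsto_rabs[OF z[of j]]]) (use bd q in blast)
  have sgn: "(z i = -R \<or> P z i \<le> 0) \<and> (z i = R \<or> P z i \<ge> 0)" if i: "i < m" for i
  proof
    let ?x = "\<lambda>n. pt (Suc (k n)) (r (k n) i)" and ?y = "\<lambda>n. pt (Suc (k n)) (s (k n) i)"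
    have cx: "\<And>j. (\<lambda>n. ?x n j) \<longlonglongrightarrow> z j" by (rule conv) (use near i in blast)
    have cy: "\<And>j. (\<lambda>n. ?y n j) \<longlonglongrightarrow> z j" by (rule conv) (use near i in blast)
    have px: "(\<lambda>n. P (?x n) i) \<longlonglongrightarrow> P z i" by (rule cont[OF cx _ i]) (use bd le i in blast)
    have py: "(\<lambda>n. P (?y n) i) \<longlonglongrightarrow> P z i" by (rule cont[OF cy _ i]) (use bd le i in blast)
    \<comment> \<open>The minimum encodes the alternative "lower face or \<open>P\<close>
      nonpositive" as a single closed inequality, which survives the limit.\<close>
    have "min (?x n i + R) (P (?x n) i) \<le> 0" for n
      using lab[OF i, of "k n"] i R unfolding lab_def by (auto simp: pt_def split: if_splits)
    then have "min (z i + R) (P z i) \<le> 0"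
      by (intro LIMSEQ_le_const2[OF tendsto_min[OF tendsto_add[OF cx[of i] tendsto_const] px]]) auto
    then show "z i = -R \<or> P z i \<le> 0" using zb[of i] by (auto simp: min_def split: if_splits)
    have "0 \<le> max (?y n i - R) (P (?y n) i)" for n
      using lab[OF i, of "k n"] i R unfolding lab_def by (auto simp: pt_def max_def split: if_splits)
    then have "0 \<le> max (z i - R) (P z i)"
      by (intro LIMSEQ_le_const[OF tendsto_max[OF tendsto_diff[OF cy[of i] tendsto_const] py]]) auto
    then show "z i = R \<or> P z i \<ge> 0" using zb[of i] by (auto simp: max_def split: if_splits)
  qed
  \<comment> \<open>On a face \<open>sgn\<close> gives \<open>P z i\<close> the sign opposite to
    \<open>z i\<close>, elsewhere it gives \<open>P z i = 0\<close>. So the sum is nonpositive,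
    which coercivity excludes as soon as one coordinate has absolute value R.\<close>
  have nonpos: "P z i * z i \<le> 0" if "i < m" "\<bar>z i\<bar> = R \<or> P z i = 0" for i
    using sgn[OF that(1)] that(2) R by (auto simp: abs_if mult_le_0_iff split: if_splits)
  have "P z i * z i \<le> 0" if "i < m" for i
    using nonpos[OF that] sgn[OF that] R by force
  then have "(\<Sum>j<m. P z j * z j) \<le> 0" by (intro sum_nonpos) auto
  then have "\<bar>z i\<bar> \<noteq> R" if "i < m" for i using coercive[of z i] zb that by force
  then have "P z i = 0" if "i < m" for i using sgn[OF that] that R by force
  then show ?thesis using zb by blast
qed

subsection \<open>Square integrable functions\<close>

text \<open>The integral defaults to 0 when the square is not integrable, so a bound on
  \<open>L2n\<close> has content only next to \<open>Lp M 2 f\<close>.\<close>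

definition L2n :: "'a measure \<Rightarrow> ('a \<Rightarrow> 'b::euclidean_space) \<Rightarrow> real" where
  "L2n M f = sqrt (LINT x|M. (norm (f x))\<^sup>2)"

abbreviation L2lim :: "'a measure \<Rightarrow> (nat \<Rightarrow> 'a \<Rightarrow> 'b::euclidean_space) \<Rightarrow> ('a \<Rightarrow> 'b) \<Rightarrow> bool" where
  "L2lim M fs f \<equiv> (\<lambda>k. L2n M (\<lambda>x. fs k x - f x)) \<longlonglongrightarrow> 0"

lemma norm_powr_2: "norm x powr 2 = (norm x)\<^sup>2"
  by (cases "norm x = 0") (simp_all add: powr_numeral)

lemma Lp2_iff: "Lp M 2 f \<longleftrightarrow> f \<in> borel_measurable M \<and> integrable M (\<lambda>x. (norm (f x))\<^sup>2)"
  by (simp add: Lp_def norm_powr_2)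

lemma Lp2_measurable [measurable_dest]: "Lp M 2 f \<Longrightarrow> f \<in> borel_measurable M"
  by (simp add: Lp_def)

lemma Lp2_integrable: "Lp M 2 f \<Longrightarrow> integrable M (\<lambda>x. (norm (f x))\<^sup>2)"
  by (simp add: Lp2_iff)

lemma L2n_nonneg [simp]: "0 \<le> L2n M f"
  by (simp add: L2n_def)

lemma L2n_sq: "(L2n M f)\<^sup>2 = (LINT x|M. (norm (f x))\<^sup>2)"
  by (simp add: L2n_def)

lemma Lp2_mono:
  assumes "Lp M 2 g" "f \<in> borel_measurable M" "AE x in M. norm (f x) \<le> norm (g x)"
  shows "Lp M 2 f" "L2n M f \<le> L2n M g"
proof -
  have i: "integrable M (\<lambda>x. (norm (g x))\<^sup>2)" using assms by (simp add: Lp2_iff)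
  have ae: "AE x in M. (norm (f x))\<^sup>2 \<le> (norm (g x))\<^sup>2"
    using assms(3) by eventually_elim (simp add: power_mono)
  have "integrable M (\<lambda>x. (norm (f x))\<^sup>2)"
    by (rule Bochner_Integration.integrable_bound[OF i]) (use assms(2) ae in auto)
  then show "Lp M 2 f" using assms by (simp add: Lp2_iff)
  show "L2n M f \<le> L2n M g" unfolding L2n_def
    by (intro real_sqrt_le_mono integral_mono_AE ae i) fact
qed

lemma L2n_cong_AE: "AE x in M. f x = g x \<Longrightarrow> f \<in> borel_measurable M \<Longrightarrow> g \<in> borel_measurable M \<Longrightarrow> L2n M f = L2n M g"
  unfolding L2n_def by (rule arg_cong[of _ _ sqrt], rule integral_cong_AE) auto

lemma L2n_minus_commute: "L2n M (\<lambda>x. f x - g x) = L2n M (\<lambda>x. g x - f x)"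
  by (simp add: L2n_def norm_minus_commute)

lemma L2_product:
  assumes "Lp M 2 f" "Lp M 2 g"
  shows "integrable M (\<lambda>x. norm (f x) * norm (g x))"
    and "(LINT x|M. norm (f x) * norm (g x)) \<le> L2n M f * L2n M g"
proof -
  have [measurable]: "f \<in> borel_measurable M" "g \<in> borel_measurable M"
    and i: "integrable M (\<lambda>x. (norm (f x))\<^sup>2)" "integrable M (\<lambda>x. (norm (g x))\<^sup>2)"
    using assms by (auto simp: Lp2_iff)
  show I: "integrable M (\<lambda>x. norm (f x) * norm (g x))"
  proof (rule Bochner_Integration.integrable_bound[OF Bochner_Integration.integrable_add[OF i]])
    have "norm (f x) * norm (g x) \<le> (norm (f x))\<^sup>2 + (norm (g x))\<^sup>2" for x
    proof -
      have "0 \<le> norm (f x) * norm (g x)" by simp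
      then show ?thesis using sum_squares_bound[of "norm (f x)" "norm (g x)"] by linarith
    qed
    then show "AE x in M. norm (norm (f x) * norm (g x)) \<le> norm ((norm (f x))\<^sup>2 + (norm (g x))\<^sup>2)" by auto
  qed simp
  have "(\<integral>\<^sup>+x. ennreal (norm (f x)) * ennreal (norm (g x)) \<partial>M)\<^sup>2
     \<le> (\<integral>\<^sup>+x. (ennreal (norm (f x)))\<^sup>2 \<partial>M) * (\<integral>\<^sup>+x. (ennreal (norm (g x)))\<^sup>2 \<partial>M)"
    by (rule Cauchy_Schwarz_nn_integral) auto
  then have "(ennreal (LINT x|M. norm (f x) * norm (g x)))\<^sup>2 \<le> ennreal ((L2n M f)\<^sup>2) * ennreal ((L2n M g)\<^sup>2)"
    unfolding L2n_sq using nn_integral_eq_integral[OF I] nn_integral_eq_integral[OF i(1)] nn_integral_eq_integral[OF i(2)]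
    by (simp add: ennreal_mult ennreal_power)
  then have "(LINT x|M. norm (f x) * norm (g x))\<^sup>2 \<le> (L2n M f * L2n M g)\<^sup>2"
    by (simp add: ennreal_power flip: ennreal_mult power_mult_distrib)
  then show "(LINT x|M. norm (f x) * norm (g x)) \<le> L2n M f * L2n M g"
    by (rule power2_le_imp_le) simp
qed

text \<open>Kept general because three products occur: the inner product, and multiplication of a
  vector field by a scalar function in either order, as in the definition of a weak
  gradient.\<close>

lemma L2_bilinear:
  fixes f :: "'a \<Rightarrow> 'b::euclidean_space" and g :: "'a \<Rightarrow> 'c::euclidean_space" and prod :: "'b \<Rightarrow> 'c \<Rightarrow> 'd::euclidean_space"
  assumes p: "bounded_bilinear prod" "\<And>a b. norm (prod a b) \<le> norm a * norm b" and f: "Lp M 2 f" "Lp M 2 g"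
  shows "integrable M (\<lambda>x. prod (f x) (g x))" "norm (LINT x|M. prod (f x) (g x)) \<le> L2n M f * L2n M g"
proof -
  have m: "(\<lambda>x. prod (f x) (g x)) \<in> borel_measurable M"
    by (rule borel_measurable_continuous_Pair) (use f in \<open>auto simp: Lp_def intro!: bounded_bilinear.continuous_on[OF p(1)] continuous_intros\<close>)
  show i: "integrable M (\<lambda>x. prod (f x) (g x))"
    by (rule Bochner_Integration.integrable_bound[OF L2_product(1)[OF f] m]) (use p(2) in auto)
  have "norm (LINT x|M. prod (f x) (g x)) \<le> (LINT x|M. norm (prod (f x) (g x)))" by (rule integral_norm_bound)
  also have "\<dots> \<le> (LINT x|M. norm (f x) * norm (g x))"
    by (intro integral_mono L2_product(1)[OF f] integrable_norm i p(2))
  also note L2_product(2)[OF f]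
  finally show "norm (LINT x|M. prod (f x) (g x)) \<le> L2n M f * L2n M g" .
qed

lemma L2_inner:
  assumes "Lp M 2 f" "Lp M 2 g"
  shows "integrable M (\<lambda>x. f x \<bullet> g x)" and "\<bar>(LINT x|M. f x \<bullet> g x)\<bar> \<le> L2n M f * L2n M g"
  using L2_bilinear[OF bounded_bilinear_inner _ assms] by (simp_all add: Cauchy_Schwarz_ineq2)

lemma L2_add:
  assumes "Lp M 2 f" "Lp M 2 g"
  shows "Lp M 2 (\<lambda>x. f x + g x)" and "L2n M (\<lambda>x. f x + g x) \<le> L2n M f + L2n M g"
proof -
  have [measurable]: "f \<in> borel_measurable M" "g \<in> borel_measurable M"
    and i: "integrable M (\<lambda>x. (norm (f x))\<^sup>2)" "integrable M (\<lambda>x. (norm (g x))\<^sup>2)"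
    using assms by (auto simp: Lp2_iff)
  note I = L2_product(1)[OF assms]
  have le: "(norm (f x + g x))\<^sup>2 \<le> (norm (f x))\<^sup>2 + (norm (g x))\<^sup>2 + 2 * (norm (f x) * norm (g x))" for x
    using power_mono[OF norm_triangle_ineq[of "f x" "g x"], of 2] by (simp add: power2_sum)
  have J: "integrable M (\<lambda>x. (norm (f x))\<^sup>2 + (norm (g x))\<^sup>2 + 2 * (norm (f x) * norm (g x)))"
    using i I by simp
  have K: "integrable M (\<lambda>x. (norm (f x + g x))\<^sup>2)"
    by (rule Bochner_Integration.integrable_bound[OF J]) (use le in \<open>auto intro!: AE_I2 order_trans[OF le]\<close>)
  then show "Lp M 2 (\<lambda>x. f x + g x)" by (simp add: Lp2_iff)
  have "(L2n M (\<lambda>x. f x + g x))\<^sup>2 \<le> (LINT x|M. (norm (f x))\<^sup>2 + (norm (g x))\<^sup>2 + 2 * (norm (f x) * norm (g x)))"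
    unfolding L2n_sq by (intro integral_mono K J le)
  also have "\<dots> = (L2n M f)\<^sup>2 + (L2n M g)\<^sup>2 + 2 * (LINT x|M. norm (f x) * norm (g x))"
    using i I by (simp add: L2n_sq)
  also have "\<dots> \<le> (L2n M f + L2n M g)\<^sup>2"
    using L2_product(2)[OF assms] by (simp add: power2_sum)
  finally show "L2n M (\<lambda>x. f x + g x) \<le> L2n M f + L2n M g" by (rule power2_le_imp_le) simp
qed

lemma L2_scaleR:
  assumes "Lp M 2 f"
  shows "Lp M 2 (\<lambda>x. c *\<^sub>R f x)" and "L2n M (\<lambda>x. c *\<^sub>R f x) = \<bar>c\<bar> * L2n M f"
  using assms by (auto simp: Lp2_iff L2n_def power_mult_distrib real_sqrt_mult)

lemma L2_mult_left:
  fixes f :: "'a \<Rightarrow> real" assumes "Lp M 2 f"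
  shows "Lp M 2 (\<lambda>x. c * f x)" and "L2n M (\<lambda>x. c * f x) = \<bar>c\<bar> * L2n M f"
  using L2_scaleR[OF assms, of c] by auto

lemma L2_diff:
  assumes "Lp M 2 f" "Lp M 2 g"
  shows "Lp M 2 (\<lambda>x. f x - g x)" and "L2n M (\<lambda>x. f x - g x) \<le> L2n M f + L2n M g"
  using L2_add[OF assms(1) L2_scaleR(1)[OF assms(2), of "-1"]] L2_scaleR(2)[OF assms(2), of "-1"] by auto

lemma L2_diff_triangle:
  assumes "Lp M 2 f" "Lp M 2 g" "Lp M 2 h"
  shows "L2n M (\<lambda>x. f x - h x) \<le> L2n M (\<lambda>x. f x - g x) + L2n M (\<lambda>x. g x - h x)"
  using L2_add(2)[OF L2_diff(1)[OF assms(1,2)] L2_diff(1)[OF assms(2,3)]] by simp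

lemma L2_bounded_scaleR:
  assumes "Lp M 2 f" "k \<in> borel_measurable M" "AE x in M. \<bar>k x\<bar> \<le> B"
  shows "Lp M 2 (\<lambda>x. k x *\<^sub>R f x)" and "B \<ge> 0 \<Longrightarrow> L2n M (\<lambda>x. k x *\<^sub>R f x) \<le> B * L2n M f"
proof -
  have "AE x in M. norm (k x *\<^sub>R f x) \<le> norm (B *\<^sub>R f x)"
    using assms(3) by eventually_elim (auto intro!: mult_right_mono)
  note * = Lp2_mono[OF L2_scaleR(1)[OF assms(1)] _ this] L2_scaleR(2)[OF assms(1), of B]
  show "Lp M 2 (\<lambda>x. k x *\<^sub>R f x)" "B \<ge> 0 \<Longrightarrow> L2n M (\<lambda>x. k x *\<^sub>R f x) \<le> B * L2n M f"
    using * assms by (auto simp: Lp2_iff)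
qed

lemma L2n_zero_imp_AE:
  assumes "Lp M 2 f" "L2n M f = 0" shows "AE x in M. f x = 0"
proof -
  have "(LINT x|M. (norm (f x))\<^sup>2) = 0" using assms(2) by (metis L2n_sq zero_power2)
  then have "AE x in M. (norm (f x))\<^sup>2 = 0"
    using integral_nonneg_eq_0_iff_AE[of M "\<lambda>x. (norm (f x))\<^sup>2"] assms(1) by (auto simp: Lp2_iff)
  then show ?thesis by simp
qed

lemma L2n_LIMSEQ_0:
  assumes "b \<longlonglongrightarrow> 0" "\<And>k. L2n M (F k) \<le> b k" shows "(\<lambda>k. L2n M (F k)) \<longlonglongrightarrow> 0"
  by (rule Lim_null_comparison[OF _ assms(1)]) (simp add: assms(2))

lemma L2_bilinear_tendsto:
  fixes prod :: "'b::euclidean_space \<Rightarrow> 'c::euclidean_space \<Rightarrow> 'd::euclidean_space"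
  assumes p: "bounded_bilinear prod" "\<And>a b. norm (prod a b) \<le> norm a * norm b"
    and f: "\<And>k. Lp M 2 (fs k)" "Lp M 2 f" "L2lim M fs f" and g: "Lp M 2 g"
  shows "(\<lambda>k. (LINT x|M. prod (fs k x) (g x))) \<longlonglongrightarrow> (LINT x|M. prod (f x) (g x))"
proof (rule LIM_zero_cancel, rule Lim_null_comparison[OF _ tendsto_mult_left_zero[OF f(3)]], intro always_eventually allI)
  fix k
  have "(LINT x|M. prod (fs k x) (g x)) - (LINT x|M. prod (f x) (g x)) = (LINT x|M. prod (fs k x - f x) (g x))"
    unfolding bounded_bilinear.diff_left[OF p(1)] using L2_bilinear(1)[OF p f(1) g] L2_bilinear(1)[OF p f(2) g] by simp
  then show "norm ((LINT x|M. prod (fs k x) (g x)) - (LINT x|M. prod (f x) (g x))) \<le> L2n M (\<lambda>x. fs k x - f x) * L2n M g"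
    using L2_bilinear(2)[OF p L2_diff(1)[OF f(1,2)] g] by simp
qed

lemma L2_inner_tendsto:
  assumes "\<And>k. Lp M 2 (fs k)" "Lp M 2 f" "Lp M 2 G" "L2lim M fs f"
  shows "(\<lambda>k. (LINT x|M. G x \<bullet> fs k x)) \<longlonglongrightarrow> (LINT x|M. G x \<bullet> f x)"
  using L2_bilinear_tendsto[OF bounded_bilinear_inner Cauchy_Schwarz_ineq2[folded real_norm_def] assms(1,2,4,3)] by (simp add: inner_commute)

lemma L2n_le_nn:
  assumes [measurable]: "f \<in> borel_measurable M" and "(\<integral>\<^sup>+x. ennreal ((norm (f x))\<^sup>2) \<partial>M) \<le> ennreal (c\<^sup>2)" "c \<ge> 0"
  shows "Lp M 2 f" "L2n M f \<le> c"
proof -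
  have I: "integrable M (\<lambda>x. (norm (f x))\<^sup>2)"
    by (intro integrableI_bounded) (use assms(2) in \<open>auto simp: less_top[symmetric] top_unique\<close>)
  then show "Lp M 2 f" by (simp add: Lp2_iff)
  have "ennreal ((L2n M f)\<^sup>2) \<le> ennreal (c\<^sup>2)" unfolding L2n_sq using assms(2) nn_integral_eq_integral[OF I] by simp
  then have "(L2n M f)\<^sup>2 \<le> c\<^sup>2" by simp
  then show "L2n M f \<le> c" using assms(3) by (rule power2_le_imp_le)
qed

lemma nn_integral_L2n:
  assumes "Lp M 2 f" shows "(\<integral>\<^sup>+x. ennreal ((norm (f x))\<^sup>2) \<partial>M) = ennreal ((L2n M f)\<^sup>2)"
  unfolding L2n_sq by (rule nn_integral_eq_integral[OF Lp2_integrable[OF assms]]) auto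

text \<open>Fatou's lemma for real integrands. It yields integrability of a limit together with a
  bound, both for completeness of L2 and for the extension of dual pairings.\<close>

lemma nn_integral_limit_le:
  fixes f :: "nat \<Rightarrow> 'a \<Rightarrow> real"
  assumes "\<And>k. f k \<in> borel_measurable M" "AE x in M. (\<lambda>k. f k x) \<longlonglongrightarrow> f' x"
    and b: "\<forall>\<^sub>F k in sequentially. (\<integral>\<^sup>+x. ennreal (f k x) \<partial>M) \<le> B"
  shows "(\<integral>\<^sup>+x. ennreal (f' x) \<partial>M) \<le> B"
proof -
  have "(\<integral>\<^sup>+x. ennreal (f' x) \<partial>M) \<le> (\<integral>\<^sup>+x. liminf (\<lambda>k. ennreal (f k x)) \<partial>M)"
  proof (rule nn_integral_mono_AE, use assms(2) in eventually_elim)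
    fix x assume "(\<lambda>k. f k x) \<longlonglongrightarrow> f' x"
    then show "ennreal (f' x) \<le> liminf (\<lambda>k. ennreal (f k x))"
      by (simp only: lim_imp_Liminf[OF trivial_limit_sequentially tendsto_ennrealI] order_refl)
  qed
  also have "\<dots> \<le> liminf (\<lambda>k. \<integral>\<^sup>+x. ennreal (f k x) \<partial>M)" by (rule nn_integral_liminf) (use assms(1) in simp)
  also have "\<dots> \<le> B" by (rule Liminf_le[OF _ b]) simp
  finally show ?thesis .
qed

lemma L2_converges_iff:
  assumes "Lp M 2 f"  "\<And>k. Lp M 2 (fs k)"
  shows "L2_converges M fs f \<longleftrightarrow> L2lim M fs f"
proof -
  let ?l = "\<lambda>k. L2n M (\<lambda>x. fs k x - f x)"
  have "L2_converges M fs f \<longleftrightarrow> (\<lambda>k. (?l k)\<^sup>2) \<longlonglongrightarrow> 0"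
    unfolding L2_converges_def nn_integral_L2n[OF L2_diff(1)[OF assms(2,1)]]
    using tendsto_ennreal_iff[of "\<lambda>k. (?l k)\<^sup>2" sequentially 0] by simp
  also have "\<dots> \<longleftrightarrow> ?l \<longlonglongrightarrow> 0"
  proof
    assume "(\<lambda>k. (?l k)\<^sup>2) \<longlonglongrightarrow> 0"
    from tendsto_real_sqrt[OF this] show "?l \<longlonglongrightarrow> 0" by simp
  next
    assume "?l \<longlonglongrightarrow> 0"
    from tendsto_power[OF this, of 2] show "(\<lambda>k. (?l k)\<^sup>2) \<longlonglongrightarrow> 0" by simp
  qed
  finally show ?thesis .
qed

lemma (in finite_measure) L2_norm_integrable:
  assumes "Lp M 2 f"
  shows "integrable M (\<lambda>x. norm (f x))" "integrable M f" "(LINT x|M. norm (f x)) \<le> sqrt (measure M (space M)) * L2n M f"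
proof -
  have c: "Lp M 2 (\<lambda>x. 1::real)" "L2n M (\<lambda>x. 1::real) = sqrt (measure M (space M))"
    by (auto simp: Lp2_iff L2n_def)
  show *: "integrable M (\<lambda>x. norm (f x))" using L2_product(1)[OF c(1) assms] by simp
  show "integrable M f" by (rule integrable_norm_cancel[OF *]) (use assms in \<open>simp add: Lp_def\<close>)
  show "(LINT x|M. norm (f x)) \<le> sqrt (measure M (space M)) * L2n M f"
    using L2_product(2)[OF c(1) assms] by (simp add: c)
qed

lemma (in finite_measure) L2_tendsto_AE_subseq:
  assumes "\<And>k. Lp M 2 (fs k)" "Lp M 2 f" "L2lim M fs f"
  shows "\<exists>r::nat\<Rightarrow>nat. strict_mono r \<and> (AE x in M. (\<lambda>n. fs (r n) x) \<longlonglongrightarrow> f x)"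
proof -
  have d: "Lp M 2 (\<lambda>x. fs k x - f x)" for k using L2_diff(1) assms by blast
  have "(\<lambda>k. sqrt (measure M (space M)) * L2n M (\<lambda>x. fs k x - f x)) \<longlonglongrightarrow> 0"
    using tendsto_mult_right_zero[OF assms(3)] by blast
  then have "(\<lambda>k. (LINT x|M. norm (fs k x - f x))) \<longlonglongrightarrow> 0"
    by (rule Lim_null_comparison[rotated]) (use L2_norm_integrable(3)[OF d] in auto)
  from tendsto_L1_AE_subseq[OF L2_norm_integrable(2)[OF d] this]
  show ?thesis by (simp add: LIM_zero_iff)
qed

text \<open>On a finite measure a Cauchy sequence in L2 is Cauchy in L1, which provides an almost
  everywhere convergent subsequence; Fatou's lemma then shows that its limit is the L2 limit of the
  whole sequence.\<close>

lemma (in finite_measure) L2_complete: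
  fixes fs :: "nat \<Rightarrow> 'a \<Rightarrow> 'b::euclidean_space"
  assumes L: "\<And>k. Lp M 2 (fs k)"
    and C: "\<And>e. e > 0 \<Longrightarrow> \<exists>N. \<forall>i\<ge>N. \<forall>j\<ge>N. L2n M (\<lambda>x. fs i x - fs j x) < e"
  shows "\<exists>f. Lp M 2 f \<and> L2lim M fs f"
proof -
  note [measurable] = Lp2_measurable[OF L]
  have d: "Lp M 2 (\<lambda>x. fs i x - fs j x)" for i j using L2_diff(1) L by blast
  define s where "s = sqrt (measure M (space M)) + 1"
  have "s > 0" unfolding s_def by (simp add: add_nonneg_pos)
  have "\<exists>N. \<forall>i\<ge>N. \<forall>j\<ge>N. LINT x|M. norm (fs i x - fs j x) < e" if "e > 0" for e
  proof -
    obtain N where N: "\<And>i j. i \<ge> N \<Longrightarrow> j \<ge> N \<Longrightarrow> L2n M (\<lambda>x. fs i x - fs j x) < e / s"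
      using C[of "e / s"] \<open>e > 0\<close> \<open>s > 0\<close> by auto
    have "(LINT x|M. norm (fs i x - fs j x)) < e" if "i \<ge> N" "j \<ge> N" for i j
    proof -
      have "(LINT x|M. norm (fs i x - fs j x)) \<le> s * L2n M (\<lambda>x. fs i x - fs j x)"
        by (rule order_trans[OF L2_norm_integrable(3)[OF d]]) (auto simp: s_def intro!: mult_right_mono)
      also have "\<dots> < e" using N[OF that] \<open>s > 0\<close> by (simp add: field_simps)
      finally show ?thesis .
    qed
    then show ?thesis by blast
  qed
  from cauchy_L1_AE_cauchy_subseq[OF L2_norm_integrable(2)[OF L] this]
  obtain r where r: "strict_mono r" and ae: "AE x in M. Cauchy (\<lambda>i. fs (r i) x)" by blast
  define f where "f x = lim (\<lambda>i. fs (r i) x)" for x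
  have [measurable]: "f \<in> borel_measurable M"
    unfolding f_def by (rule borel_measurable_lim_metric) simp
  have lim: "AE x in M. (\<lambda>i. fs (r i) x) \<longlonglongrightarrow> f x"
    using ae by eventually_elim (simp add: f_def Cauchy_convergent_iff convergent_LIMSEQ_iff)
  have key: "Lp M 2 (\<lambda>x. fs i x - f x) \<and> L2n M (\<lambda>x. fs i x - f x) \<le> e"
    if e: "e > 0" and N: "\<And>i j. i \<ge> N \<Longrightarrow> j \<ge> N \<Longrightarrow> L2n M (\<lambda>x. fs i x - fs j x) < e" and i: "i \<ge> N" for e N i
  proof -
    have "(\<integral>\<^sup>+x. ennreal ((norm (fs i x - f x))\<^sup>2) \<partial>M) \<le> ennreal (e\<^sup>2)"
    proof (rule nn_integral_limit_le)
      show "AE x in M. (\<lambda>k. (norm (fs i x - fs (r k) x))\<^sup>2) \<longlonglongrightarrow> (norm (fs i x - f x))\<^sup>2"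
        using lim by eventually_elim (intro tendsto_intros)
      have "(\<integral>\<^sup>+x. ennreal ((norm (fs i x - fs (r k) x))\<^sup>2) \<partial>M) \<le> ennreal (e\<^sup>2)" if "k \<ge> N" for k
      proof -
        have "r k \<ge> N" using that seq_suble[OF r, of k] by simp
        then have "L2n M (\<lambda>x. fs i x - fs (r k) x) \<le> e" using N[OF i] by (simp add: less_imp_le)
        then show ?thesis unfolding nn_integral_L2n[OF d] by (simp add: ennreal_leI power_mono)
      qed
      then show "\<forall>\<^sub>F k in sequentially. (\<integral>\<^sup>+x. ennreal ((norm (fs i x - fs (r k) x))\<^sup>2) \<partial>M) \<le> ennreal (e\<^sup>2)"
        using eventually_sequentially by blast
    qed simp
    then show ?thesis using L2n_le_nn[of "\<lambda>x. fs i x - f x" M e] e by simp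
  qed
  obtain N1 where "\<And>i j. i \<ge> N1 \<Longrightarrow> j \<ge> N1 \<Longrightarrow> L2n M (\<lambda>x. fs i x - fs j x) < 1" using C[of 1] by auto
  then have "Lp M 2 (\<lambda>x. fs N1 x - f x)" using key[of 1 N1 N1] by auto
  from L2_diff(1)[OF L[of N1] this] have "Lp M 2 f" by simp
  moreover have "L2lim M fs f"
  proof (rule LIMSEQ_I)
    fix e :: real assume "e > 0"
    then obtain N where "\<And>i j. i \<ge> N \<Longrightarrow> j \<ge> N \<Longrightarrow> L2n M (\<lambda>x. fs i x - fs j x) < e/2" using C[of "e/2"] by auto
    then have "L2n M (\<lambda>x. fs i x - f x) \<le> e/2" if "i \<ge> N" for i using key[of "e/2" N i] that \<open>e > 0\<close> by auto
    then show "\<exists>no. \<forall>n\<ge>no. norm (L2n M (\<lambda>x. fs n x - f x) - 0) < e" using \<open>e > 0\<close> by (intro exI[of _ N]) force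
  qed
  ultimately show ?thesis by blast
qed

text \<open>The source of all strong convergence of nonlinear coefficients: bounded multipliers
  converging almost everywhere converge strongly once applied to one fixed square integrable
  field.\<close>

lemma L2_dominated_convergence:
  fixes h :: "'a \<Rightarrow> 'b::euclidean_space"
  assumes h: "Lp M 2 h" and [measurable]: "\<And>n. k n \<in> borel_measurable M" "k' \<in> borel_measurable M"
    and bd: "\<And>n. AE x in M. \<bar>k n x\<bar> \<le> B" and lim: "AE x in M. (\<lambda>n. k n x) \<longlonglongrightarrow> k' x"
  shows "(\<lambda>n. L2n M (\<lambda>x. (k n x - k' x) *\<^sub>R h x)) \<longlonglongrightarrow> 0"
proof -
  have [measurable]: "h \<in> borel_measurable M" using h by (simp add: Lp_def)
  have bk: "AE x in M. \<forall>n. \<bar>k n x\<bar> \<le> B" using bd by (simp add: AE_all_countable)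
  have bd': "AE x in M. \<bar>k n x - k' x\<bar> \<le> 2 * B" for n
    using bk lim
  proof eventually_elim
    case (elim x)
    have "\<bar>k' x\<bar> \<le> B" by (rule LIMSEQ_le_const2[OF tendsto_rabs[OF elim(2)]]) (use elim in auto)
    then show ?case using elim(1)[rule_format, of n] by linarith
  qed
  have "(\<lambda>n. (LINT x|M. (norm ((k n x - k' x) *\<^sub>R h x))\<^sup>2)) \<longlonglongrightarrow> (LINT x|M. 0)"
  proof (rule integral_dominated_convergence)
    show "integrable M (\<lambda>x. (2 * B)\<^sup>2 * (norm (h x))\<^sup>2)" using Lp2_integrable[OF h] by simp
    show "AE x in M. norm ((norm ((k n x - k' x) *\<^sub>R h x))\<^sup>2) \<le> (2 * B)\<^sup>2 * (norm (h x))\<^sup>2" for n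
      using bd'[of n]
    proof eventually_elim
      case (elim x)
      have "(\<bar>k n x - k' x\<bar>)\<^sup>2 \<le> (2 * B)\<^sup>2" by (rule power_mono[OF elim]) simp
      then show ?case by (simp add: power_mult_distrib mult_right_mono)
    qed
    show "AE x in M. (\<lambda>n. (norm ((k n x - k' x) *\<^sub>R h x))\<^sup>2) \<longlonglongrightarrow> 0"
      using lim
    proof eventually_elim
      case (elim x)
      have "(\<lambda>n. (norm ((k n x - k' x) *\<^sub>R h x))\<^sup>2) \<longlonglongrightarrow> (norm ((k' x - k' x) *\<^sub>R h x))\<^sup>2"
        by (intro tendsto_intros elim)
      then show ?case by simp
    qed
  qed auto
  then show ?thesis unfolding L2n_def using tendsto_real_sqrt by fastforce
qed

subsection \<open>Gradients and smooth functions\<close>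

lemma GDERIV_imp_grad: "GDERIV f x :> d \<Longrightarrow> grad f x = d"
  unfolding grad_def
proof (rule the_equality)
  fix e assume "GDERIV f x :> d" "GDERIV f x :> e"
  then have "(\<lambda>h. h \<bullet> d) = (\<lambda>h. h \<bullet> e)" unfolding gderiv_def by (rule has_derivative_unique)
  then have "\<forall>h. h \<bullet> (e - d) = 0" by (simp add: inner_diff_right fun_eq_iff)
  then have "(e - d) \<bullet> (e - d) = 0" by blast
  then show "e = d" by simp
qed

lemma GDERIV_grad:
  fixes f :: "'a::euclidean_space \<Rightarrow> real"
  assumes "f differentiable (at x)" shows "GDERIV f x :> grad f x"
proof -
  obtain f' where f': "(f has_derivative f') (at x)" using assms unfolding differentiable_def by blast
  then have l: "linear f'" using has_derivative_linear by blast
  define d where "d = (\<Sum>b\<in>Basis. f' b *\<^sub>R b)"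
  have "f' h = h \<bullet> d" for h
  proof -
    have "f' h = f' (\<Sum>b\<in>Basis. (h \<bullet> b) *\<^sub>R b)" by (simp add: euclidean_representation)
    also have "\<dots> = (\<Sum>b\<in>Basis. (h \<bullet> b) *\<^sub>R f' b)" by (simp add: linear_sum[OF l] linear_scale[OF l])
    finally show ?thesis by (simp add: d_def inner_sum_right mult.commute)
  qed
  then have "f' = (\<lambda>h. h \<bullet> d)" by blast
  then have "GDERIV f x :> d" using f' by (simp add: gderiv_def)
  then show ?thesis using GDERIV_imp_grad by metis
qed

lemma GDERIV_imp_differentiable: "GDERIV f x :> d \<Longrightarrow> f differentiable (at x)"
  unfolding gderiv_def differentiable_def by blast

lemma grad_has_derivative:
  fixes f :: "'a::euclidean_space \<Rightarrow> real"
  shows "f differentiable (at x) \<Longrightarrow> (f has_derivative (\<lambda>h. h \<bullet> grad f x)) (at x)"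
  using GDERIV_grad gderiv_def by blast

text \<open>Compositions of smooth functions with the level functions constructed below are only
  continuously differentiable, so the inequalities that such compositions must satisfy are proved in
  this class.\<close>

definition C1 :: "('a::euclidean_space \<Rightarrow> real) \<Rightarrow> bool" where
  "C1 f \<longleftrightarrow> (\<forall>x. f differentiable (at x)) \<and> continuous_on UNIV (grad f)"

lemma C1_I: "(\<And>x. GDERIV f x :> g x) \<Longrightarrow> continuous_on UNIV g \<Longrightarrow> C1 f \<and> grad f = g"
  unfolding C1_def using GDERIV_imp_grad GDERIV_imp_differentiable by (metis ext)

lemma C1_GDERIV: "C1 f \<Longrightarrow> GDERIV f x :> grad f x"
  unfolding C1_def using GDERIV_grad by blast

lemma C1_continuous_grad: "C1 f \<Longrightarrow> continuous_on S (grad f)"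
  unfolding C1_def using continuous_on_subset by blast

lemma C1_continuous: "C1 f \<Longrightarrow> continuous_on S f"
  unfolding C1_def by (meson continuous_at_imp_continuous_on differentiable_imp_continuous_within)

lemma C_k_Suc_imp: "C_k (Suc k) f \<Longrightarrow> C_k k f"
proof (induction k arbitrary: f)
  case 0
  then show ?case by (auto intro!: continuous_at_imp_continuous_on differentiable_imp_continuous_within)
next
  case (Suc k)
  show ?case unfolding C_k.simps(2)[of k]
    using Suc.prems Suc.IH unfolding C_k.simps(2)[of "Suc k"] by blast
qed

text \<open>A class of differentiable functions closed under partial derivatives lies in every
  \<open>C_k\<close>, by induction on k for all members at once. Smoothness can thus be shown by
  exhibiting an invariant class.\<close>

lemma smooth_coinduct:
  assumes "X f" and "\<And>f x. X f \<Longrightarrow> f differentiable (at x)"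
    and "\<And>f b. X f \<Longrightarrow> b \<in> Basis \<Longrightarrow> X (\<lambda>x. grad f x \<bullet> b)"
  shows "smooth f"
proof -
  have "C_k k f" if "X f" for k f
    using that by (induction k arbitrary: f) (auto intro!: continuous_at_imp_continuous_on differentiable_imp_continuous_within assms)
  then show ?thesis using assms(1) smooth_def by blast
qed

lemma smooth_imp: assumes "smooth f"
  shows smooth_differentiable: "f differentiable (at x)" and smooth_partial: "b \<in> Basis \<Longrightarrow> smooth (\<lambda>x. grad f x \<bullet> b)"
  using assms unfolding smooth_def by (metis C_k.simps(2))+

lemma smooth_continuous: "smooth f \<Longrightarrow> continuous_on S f"
  using C_k.simps(1) continuous_on_subset unfolding smooth_def by blast

lemma smooth_C1: "smooth f \<Longrightarrow> C1 f"
proof -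
  assume f: "smooth f"
  have "continuous_on UNIV (\<lambda>x. \<Sum>b\<in>Basis. (grad f x \<bullet> b) *\<^sub>R b)"
    by (intro continuous_intros smooth_continuous smooth_partial[OF f])
  then show "C1 f" unfolding C1_def using smooth_differentiable[OF f] by (simp add: euclidean_representation)
qed

lemma smooth_const: "smooth (\<lambda>x. c)"
proof (rule smooth_coinduct[of "\<lambda>f. \<exists>c. f = (\<lambda>x. c)"])
  show "\<exists>ca. (\<lambda>x. grad f x \<bullet> b) = (\<lambda>x. ca)" if "\<exists>c. f = (\<lambda>x. c)" for f :: "'a \<Rightarrow> real" and b
    using that GDERIV_imp_grad[OF GDERIV_const] by (metis)
qed auto

lemma grad_const [simp]: "grad (\<lambda>x. c) = (\<lambda>x. 0)"
  using GDERIV_imp_grad[OF GDERIV_const] by blast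

lemma smooth_add: "smooth f \<Longrightarrow> smooth g \<Longrightarrow> smooth (\<lambda>x. f x + g x)"
proof (rule smooth_coinduct[of "\<lambda>h. \<exists>f g. smooth f \<and> smooth g \<and> h = (\<lambda>x. f x + g x)"])
  fix h :: "'a \<Rightarrow> real" and b :: 'a assume "\<exists>f g. smooth f \<and> smooth g \<and> h = (\<lambda>x. f x + g x)" and b: "b \<in> Basis"
  then obtain f g where fg: "smooth f" "smooth g" and h: "h = (\<lambda>x. f x + g x)" by blast
  have "grad h x = grad f x + grad g x" for x
    unfolding h by (intro GDERIV_imp_grad GDERIV_add GDERIV_grad smooth_differentiable fg)
  then show "\<exists>f g. smooth f \<and> smooth g \<and> (\<lambda>x. grad h x \<bullet> b) = (\<lambda>x. f x + g x)"
    using smooth_partial[OF fg(1) b] smooth_partial[OF fg(2) b] by (auto simp: inner_add_left)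
qed (auto intro: smooth_differentiable differentiable_add)

text \<open>Partial derivatives of a product are sums of products, so the class of products is not
  invariant; induction on k, with sums treated alongside, replaces the coinduction.\<close>

lemma smooth_mult: "smooth f \<Longrightarrow> smooth g \<Longrightarrow> smooth (\<lambda>x. f x * g x)"
proof -
  have "C_k k (\<lambda>x. f x * g x)" if "C_k k f" "C_k k g" for k and f g :: "'a \<Rightarrow> real"
    using that
  proof (induction k arbitrary: f g)
    case 0 then show ?case by (auto intro: continuous_intros)
  next
    case (Suc k)
    have d: "f differentiable (at x)" "g differentiable (at x)" for x using Suc.prems by auto
    have gr: "grad (\<lambda>x. f x * g x) x = f x *\<^sub>R grad g x + g x *\<^sub>R grad f x" for x
      by (intro GDERIV_imp_grad GDERIV_mult GDERIV_grad d)
    have add: "C_k k (\<lambda>x. f x + g x)" if "C_k k f" "C_k k g" for k and f g :: "'a \<Rightarrow> real"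
      using that
    proof (induction k arbitrary: f g)
      case 0 then show ?case by (auto intro: continuous_intros)
    next
      case (Suc k)
      have "grad (\<lambda>x. f x + g x) x = grad f x + grad g x" for x
        using Suc.prems by (intro GDERIV_imp_grad GDERIV_add GDERIV_grad) auto
      then show ?case using Suc by (auto simp: inner_add_left)
    qed
    have "C_k k (\<lambda>x. f x * (grad g x \<bullet> b) + g x * (grad f x \<bullet> b))" if "b \<in> Basis" for b
      by (intro add Suc.IH C_k_Suc_imp[OF Suc.prems(1)] C_k_Suc_imp[OF Suc.prems(2)]) (use Suc.prems that in auto)
    then show ?case using d by (simp add: gr inner_add_left)
  qed
  then show "smooth f \<Longrightarrow> smooth g \<Longrightarrow> smooth (\<lambda>x. f x * g x)" by (simp add: smooth_def)
qed

lemma smooth_scale: "smooth f \<Longrightarrow> smooth (\<lambda>x. c * f x)"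
  by (intro smooth_mult smooth_const)

lemma smooth_diff: "smooth f \<Longrightarrow> smooth g \<Longrightarrow> smooth (\<lambda>x. f x - g x)"
  using smooth_add[of f, OF _ smooth_scale[of g "-1"]] by simp

lemma grad_simps:
  assumes "C1 f" "C1 g"
  shows grad_add: "grad (\<lambda>x. f x + g x) = (\<lambda>x. grad f x + grad g x)"
    and grad_diff: "grad (\<lambda>x. f x - g x) = (\<lambda>x. grad f x - grad g x)"
    and grad_mult: "grad (\<lambda>x. f x * g x) = (\<lambda>x. f x *\<^sub>R grad g x + g x *\<^sub>R grad f x)"
  using assms by (auto intro!: GDERIV_imp_grad GDERIV_add GDERIV_diff GDERIV_mult C1_GDERIV)

lemma grad_scale: "C1 f \<Longrightarrow> grad (\<lambda>x. c * f x) = (\<lambda>x. c *\<^sub>R grad f x)"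
  using GDERIV_mult[OF GDERIV_const C1_GDERIV] GDERIV_imp_grad by fastforce

lemma test_function_smooth: "test_function \<Omega> \<psi> \<Longrightarrow> smooth \<psi>"
  by (simp add: test_function_def)

lemma test_function_I:
  assumes "smooth \<psi>" "compact K" "K \<subseteq> \<Omega>" "\<And>x. x \<notin> K \<Longrightarrow> \<psi> x = 0"
  shows "test_function \<Omega> \<psi>"
proof -
  have "closure {x. \<psi> x \<noteq> 0} \<subseteq> K" using assms by (intro closure_minimal) (auto intro: compact_imp_closed)
  moreover have "compact (closure {x. \<psi> x \<noteq> 0})"
    using compact_Int_closed[OF assms(2) closed_closure[of "{x. \<psi> x \<noteq> 0}"]] calculation by (simp add: inf.absorb2)
  ultimately show ?thesis unfolding test_function_def using assms by blast
qed

lemma grad_zero_outside: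
  assumes "closed K" "\<And>x. x \<notin> K \<Longrightarrow> f x = 0" "x \<notin> K"
  shows "grad f x = 0"
proof (rule GDERIV_imp_grad, unfold gderiv_def, rule has_derivative_transform_within_open[where s = "- K" and f = "\<lambda>x. 0"])
  show "((\<lambda>x. 0) has_derivative (\<lambda>h. h \<bullet> 0)) (at x)" by simp
qed (use assms in auto)

lemma test_function_supp:
  assumes "test_function \<Omega> \<psi>"
  obtains K where "compact K" "K \<subseteq> \<Omega>" "\<And>x. x \<notin> K \<Longrightarrow> \<psi> x = 0" "\<And>x. x \<notin> K \<Longrightarrow> grad \<psi> x = 0"
proof -
  define K where "K = closure {x. \<psi> x \<noteq> 0}"
  have K: "compact K" "K \<subseteq> \<Omega>" "\<And>x. x \<notin> K \<Longrightarrow> \<psi> x = 0"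
    using assms closure_subset[of "{x. \<psi> x \<noteq> 0}"] unfolding K_def test_function_def by auto
  moreover have "grad \<psi> x = 0" if "x \<notin> K" for x using grad_zero_outside[OF compact_imp_closed[OF K(1)] K(3) that] .
  ultimately show thesis using that by blast
qed

lemma test_function_closure:
  assumes "test_function \<Omega> f" "test_function \<Omega> g"
  shows test_function_add: "test_function \<Omega> (\<lambda>x. f x + g x)"
    and test_function_diff: "test_function \<Omega> (\<lambda>x. f x - g x)"
proof -
  obtain K where K: "compact K" "K \<subseteq> \<Omega>" "\<And>x. x \<notin> K \<Longrightarrow> f x = 0" using test_function_supp[OF assms(1)] by metis
  obtain L where L: "compact L" "L \<subseteq> \<Omega>" "\<And>x. x \<notin> L \<Longrightarrow> g x = 0" using test_function_supp[OF assms(2)] by metis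
  note s = test_function_smooth[OF assms(1)] test_function_smooth[OF assms(2)]
  show "test_function \<Omega> (\<lambda>x. f x + g x)"
    by (rule test_function_I[of _ "K \<union> L", OF smooth_add[OF s]]) (use K L in auto)
  show "test_function \<Omega> (\<lambda>x. f x - g x)"
    by (rule test_function_I[of _ "K \<union> L", OF smooth_diff[OF s]]) (use K L in auto)
qed

lemma test_function_mult: "test_function \<Omega> f \<Longrightarrow> smooth g \<Longrightarrow> test_function \<Omega> (\<lambda>x. g x * f x)"
proof -
  assume f: "test_function \<Omega> f" and g: "smooth g"
  obtain K where K: "compact K" "K \<subseteq> \<Omega>" "\<And>x. x \<notin> K \<Longrightarrow> f x = 0" using test_function_supp[OF f] by metis
  show "test_function \<Omega> (\<lambda>x. g x * f x)"
    by (rule test_function_I[OF smooth_mult[OF g test_function_smooth[OF f]] K(1,2)]) (use K in auto)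
qed

lemma test_function_scale: "test_function \<Omega> f \<Longrightarrow> test_function \<Omega> (\<lambda>x. c * f x)"
  using test_function_mult smooth_const by blast

lemma test_function_zero: "test_function \<Omega> (\<lambda>x. 0)"
  by (rule test_function_I[of _ "{}"]) (auto intro: smooth_const)

lemma test_function_sum:
  "(\<And>i. i < n \<Longrightarrow> test_function \<Omega> (d i)) \<Longrightarrow> test_function \<Omega> (\<lambda>x. \<Sum>i<(n::nat). c i * d i x)"
  by (induction n) (auto intro!: test_function_add test_function_scale test_function_zero)

lemma grad_sum:
  "(\<And>i. i < n \<Longrightarrow> C1 (d i)) \<Longrightarrow> grad (\<lambda>x. \<Sum>i<(n::nat). c i * d i x) = (\<lambda>x. \<Sum>i<n. c i *\<^sub>R grad (d i) x)"
proof -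
  assume d: "\<And>i. i < n \<Longrightarrow> C1 (d i)"
  have "GDERIV (\<lambda>x. \<Sum>i<m. c i * d i x) x :> (\<Sum>i<m. c i *\<^sub>R grad (d i) x)" if "m \<le> n" for m x
    using that
  proof (induction m)
    case (Suc m)
    have "GDERIV (\<lambda>x. c m * d m x) x :> c m *\<^sub>R grad (d m) x"
      using GDERIV_mult[OF GDERIV_const C1_GDERIV[OF d], of m "c m" x] Suc by simp
    from GDERIV_add[OF Suc.IH this] Suc.prems show ?case by simp
  qed (simp add: GDERIV_const)
  then show ?thesis by (intro ext GDERIV_imp_grad) auto
qed

subsection \<open>Mollification\<close>

text \<open>The usual flat function is the case n = 0. The powers in the denominator make the family
  closed under differentiation up to linear combinations.\<close>

definition bump :: "nat \<Rightarrow> real \<Rightarrow> real" where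
  "bump n t = (if t > 0 then exp (- (1 / t)) / t ^ n else 0)"

text \<open>Quadratic decay makes the difference quotient at 0 vanish. It comes from
  \<open>1 + s \<le> exp s\<close> at \<open>s = 1 / (m * t)\<close> raised to the power
  \<open>m = n + 2\<close>: dividing by \<open>t ^ n\<close> leaves two powers of t.\<close>

lemma bump_bound: "\<exists>C. \<forall>t. \<bar>bump n t\<bar> \<le> C * t\<^sup>2"
proof (intro exI allI)
  fix t :: real
  define m where "m = n + 2"
  show "\<bar>bump n t\<bar> \<le> real m ^ m * t\<^sup>2"
  proof (cases "t > 0")
    case True
    have "(1 / (real m * t)) ^ m \<le> exp (1 / (real m * t)) ^ m"
      using exp_ge_add_one_self[of "1 / (real m * t)"] True by (intro power_mono) (auto simp del: exp_ge_add_one_self)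
    also have "\<dots> = exp (real m * (1 / (real m * t)))" by (rule exp_of_nat_mult[symmetric])
    also have "real m * (1 / (real m * t)) = 1 / t" by (simp add: m_def)
    finally have "1 / (real m * t) ^ m \<le> exp (1 / t)" by (simp add: power_one_over)
    then have "exp (- (1 / t)) \<le> (real m * t) ^ m"
      using True le_imp_inverse_le[of "1 / (real m * t) ^ m" "exp (1 / t)"] by (simp add: exp_minus m_def)
    then have "exp (- (1 / t)) / t ^ n \<le> (real m * t) ^ m / t ^ n" using True by (intro divide_right_mono) auto
    also have "\<dots> = real m ^ m * t\<^sup>2" using True by (simp add: m_def power_mult_distrib power_add power2_eq_square)
    finally show ?thesis using True by (simp add: bump_def)
  qed (simp add: bump_def)
qed

lemma bump_DERIV: "(bump n has_real_derivative (bump (n + 2) t - real n * bump (n + 1) t)) (at t)"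
proof (cases "t > 0")
  case True
  have "((\<lambda>t. exp (- (1 / t)) / t ^ n) has_real_derivative
      (exp (- (1 / t)) * (1 / t\<^sup>2) * t ^ n - exp (- (1 / t)) * (real n * t ^ (n - 1))) / (t ^ n * t ^ n)) (at t)"
    using True by (auto intro!: derivative_eq_intros simp: power2_eq_square)
  moreover have "(exp (- (1 / t)) * (1 / t\<^sup>2) * t ^ n - exp (- (1 / t)) * (real n * t ^ (n - 1))) / (t ^ n * t ^ n)
      = bump (n + 2) t - real n * bump (n + 1) t"
    using True by (cases n) (auto simp: bump_def field_simps power2_eq_square)
  ultimately have "((\<lambda>t. exp (- (1 / t)) / t ^ n) has_real_derivative bump (n + 2) t - real n * bump (n + 1) t) (at t)" by simp
  then show ?thesis
    by (rule has_field_derivative_transform_within_open[where S = "{0<..}"]) (use True in \<open>auto simp: bump_def\<close>)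
next
  case False
  show ?thesis
  proof (cases "t = 0")
    case True
    obtain C where C: "\<And>t. \<bar>bump n t\<bar> \<le> C * t\<^sup>2" using bump_bound by blast
    have "((\<lambda>h. (bump n (0 + h) - bump n 0) / h) \<longlongrightarrow> 0) (at 0)"
    proof (rule Lim_null_comparison)
      have "norm ((bump n (0 + h) - bump n 0) / h) \<le> C * \<bar>h\<bar>" if "h \<noteq> 0" for h
        using C[of h] that by (simp add: bump_def[of n 0] field_simps power2_eq_square abs_mult)
      then show "\<forall>\<^sub>F h in at 0. norm ((bump n (0 + h) - bump n 0) / h) \<le> C * \<bar>h\<bar>"
        by (auto simp: eventually_at intro: exI[of _ 1])
      show "((\<lambda>h. C * \<bar>h\<bar>) \<longlongrightarrow> 0) (at 0)" by (auto intro!: tendsto_eq_intros)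
    qed
    then show ?thesis using True by (simp add: DERIV_def bump_def[of _ 0])
  next
    case False
    then have "t < 0" using \<open>\<not> t > 0\<close> by simp
    have "((\<lambda>t. 0) has_real_derivative 0) (at t)" by simp
    then have "(bump n has_real_derivative 0) (at t)"
      by (rule has_field_derivative_transform_within_open[where S = "{..<0}"]) (use \<open>t < 0\<close> in \<open>auto simp: bump_def\<close>)
    then show ?thesis using \<open>t < 0\<close> by (simp add: bump_def)
  qed
qed

text \<open>The algebra generated by linear forms and radial bumps. The gradient of a radial bump is
  a combination of bumps times the coordinates, so the algebra is invariant under partial
  derivatives and \<open>smooth_coinduct\<close> applies.\<close>

inductive bump_poly :: "real \<Rightarrow> ('a::euclidean_space \<Rightarrow> real) \<Rightarrow> bool" for r where
  "bump_poly r (\<lambda>x. c)"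
| "bump_poly r (\<lambda>x. x \<bullet> b)"
| "bump_poly r (\<lambda>x. bump n (r - x \<bullet> x))"
| "bump_poly r f \<Longrightarrow> bump_poly r g \<Longrightarrow> bump_poly r (\<lambda>x. f x + g x)"
| "bump_poly r f \<Longrightarrow> bump_poly r g \<Longrightarrow> bump_poly r (\<lambda>x. f x * g x)"

lemma bump_poly_smooth: "bump_poly r f \<Longrightarrow> smooth f"
proof (rule smooth_coinduct[of "bump_poly r"])
  have *: "\<exists>g. (\<forall>x. GDERIV f x :> g x) \<and> (\<forall>b. bump_poly r (\<lambda>x. g x \<bullet> b))" if "bump_poly r f" for f :: "'a \<Rightarrow> real"
    using that
  proof induction
    case (1 c)
    show ?case by (rule exI[of _ "\<lambda>x. 0"]) (auto simp: GDERIV_const intro: bump_poly.intros)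
  next
    case (2 b)
    have "GDERIV (\<lambda>x. x \<bullet> b) x :> b" for x unfolding gderiv_def by (auto intro!: derivative_eq_intros)
    then show ?case by (intro exI[of _ "\<lambda>x. b"]) (auto intro: bump_poly.intros)
  next
    case (3 n)
    have "GDERIV (\<lambda>x. r - x \<bullet> x) x :> - 2 *\<^sub>R x" for x :: 'a
      unfolding gderiv_def by (auto intro!: derivative_eq_intros simp: inner_commute)
    from GDERIV_DERIV_compose[OF this bump_DERIV]
    have "GDERIV (\<lambda>x. bump n (r - x \<bullet> x)) x :> (bump (n + 2) (r - x \<bullet> x) - real n * bump (n + 1) (r - x \<bullet> x)) *\<^sub>R (- 2 *\<^sub>R x)" for x :: 'a .
    moreover have "bump_poly r (\<lambda>x. ((bump (n + 2) (r - x \<bullet> x) - real n * bump (n + 1) (r - x \<bullet> x)) *\<^sub>R (- 2 *\<^sub>R x)) \<bullet> b)" for b :: 'a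
    proof -
      have "bump_poly r (\<lambda>x. ((bump (n + 2) (r - x \<bullet> x) + (- real n) * bump (n + 1) (r - x \<bullet> x))) * (- 2 * (x \<bullet> b)))"
        by (intro bump_poly.intros)
      moreover have "(\<lambda>x. ((bump (n + 2) (r - x \<bullet> x) + (- real n) * bump (n + 1) (r - x \<bullet> x))) * (- 2 * (x \<bullet> b)))
        = (\<lambda>x. ((bump (n + 2) (r - x \<bullet> x) - real n * bump (n + 1) (r - x \<bullet> x)) *\<^sub>R (- 2 *\<^sub>R x)) \<bullet> b)"
        by (rule ext) simp
      ultimately show ?thesis by (simp only:)
    qed
    ultimately show ?case by (intro exI conjI allI)
  next
    case (4 f g)
    then obtain f' g' where "\<And>x. GDERIV f x :> f' x" "\<And>x. GDERIV g x :> g' x" "\<And>b. bump_poly r (\<lambda>x. f' x \<bullet> b)" "\<And>b. bump_poly r (\<lambda>x. g' x \<bullet> b)" by blast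
    then show ?case by (intro exI[of _ "\<lambda>x. f' x + g' x"]) (auto simp: inner_add_left intro: GDERIV_add bump_poly.intros)
  next
    case (5 f g)
    then obtain f' g' where *: "\<And>x. GDERIV f x :> f' x" "\<And>x. GDERIV g x :> g' x" "\<And>b. bump_poly r (\<lambda>x. f' x \<bullet> b)" "\<And>b. bump_poly r (\<lambda>x. g' x \<bullet> b)" by blast
    show ?case
      by (intro exI[of _ "\<lambda>x. f x *\<^sub>R g' x + g x *\<^sub>R f' x"] conjI allI GDERIV_mult *)
         (simp add: inner_add_left, intro bump_poly.intros 5 *)
  qed
  show "f differentiable (at x)" if "bump_poly r f" for f :: "'a \<Rightarrow> real" and x
    using *[OF that] GDERIV_imp_differentiable by blast
  show "bump_poly r (\<lambda>x. grad f x \<bullet> b)" if "bump_poly r f" for f :: "'a \<Rightarrow> real" and b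
    using *[OF that] GDERIV_imp_grad by (metis ext)
qed

lemma exists_mollifier:
  assumes "\<epsilon> > 0"
  obtains \<eta> :: "'a::euclidean_space \<Rightarrow> real" where "smooth \<eta>" "\<And>x. 0 \<le> \<eta> x" "\<And>x. norm x \<ge> \<epsilon> \<Longrightarrow> \<eta> x = 0"
    "integrable lborel \<eta>" "(\<integral>x. \<eta> x \<partial>lborel) = 1"
proof -
  define f where "f x = bump 0 (\<epsilon>\<^sup>2 - x \<bullet> x)" for x :: 'a
  have sm: "smooth f" unfolding f_def by (intro bump_poly_smooth[of "\<epsilon>\<^sup>2"] bump_poly.intros)
  have nn: "0 \<le> f x" for x by (simp add: f_def bump_def)
  have z: "f x = 0" if "norm x \<ge> \<epsilon>" for x
    using power_mono[OF that, of 2] assms by (simp add: f_def bump_def power2_norm_eq_inner)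
  have pos: "f x > 0" if "norm x < \<epsilon>" for x
    using power_strict_mono[OF that, of 2] assms by (simp add: f_def bump_def power2_norm_eq_inner)
  have eq: "(\<lambda>x. indicator (cball 0 \<epsilon>) x *\<^sub>R f x) = f"
  proof
    fix x show "indicator (cball 0 \<epsilon>) x *\<^sub>R f x = f x" using z[of x] by (cases "norm x \<le> \<epsilon>") auto
  qed
  have I: "integrable lborel f"
    using borel_integrable_compact[OF compact_cball smooth_continuous[OF sm], of 0 \<epsilon>] by (simp only: eq)
  have "(\<integral>x. f x \<partial>lborel) \<noteq> 0"
  proof
    assume "(\<integral>x. f x \<partial>lborel) = 0"
    then have "AE x in lborel. f x = 0" using integral_nonneg_eq_0_iff_AE[OF I] nn by fast
    then have "AE x in lborel. x \<notin> ball (0::'a) \<epsilon>" by eventually_elim (use pos in force)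
    then have "ball (0::'a) \<epsilon> \<in> null_sets lborel" using AE_iff_null_sets[of "ball (0::'a) \<epsilon>" lborel] by (simp del: mem_ball)
    then have "negligible (ball (0::'a) \<epsilon>)" by (simp add: negligible_iff_null_sets null_sets_completionI)
    then show False using assms open_not_negligible[of "ball (0::'a) \<epsilon>"] by simp
  qed
  moreover have "(\<integral>x. f x \<partial>lborel) \<ge> 0" by (rule integral_nonneg_AE) (use nn in auto)
  ultimately have c: "(\<integral>x. f x \<partial>lborel) > 0" by simp
  show thesis
  proof (rule that[of "\<lambda>x. (1 / (\<integral>x. f x \<partial>lborel)) * f x"])
    show "smooth (\<lambda>x. (1 / (\<integral>x. f x \<partial>lborel)) * f x)" by (rule smooth_scale[OF sm])
  qed (use c nn z I in auto)
qed

text \<open>Differentiation under the integral moves the derivative to \<eta>, so for fixed f the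
  class of all such convolutions with smooth \<eta> is invariant under partial derivatives.
  Integrating over a fixed box makes the Leibniz rule applicable.\<close>

lemma smooth_convolution:
  fixes f :: "'a::euclidean_space \<Rightarrow> real"
  assumes f: "continuous_on UNIV f" and "smooth \<eta>"
  shows "smooth (\<lambda>x. integral (cbox a b) (\<lambda>y. f y * \<eta> (x - y)))" (is "smooth (?F \<eta>)")
proof (rule smooth_coinduct[of "\<lambda>h. \<exists>\<eta>. smooth \<eta> \<and> h = ?F \<eta>"])
  have *: "GDERIV (?F \<eta>) x :> integral (cbox a b) (\<lambda>y. f y *\<^sub>R grad \<eta> (x - y))"
    if \<eta>: "smooth \<eta>" for \<eta> x
  proof -
    note c = C1_continuous_grad[OF smooth_C1[OF \<eta>], of UNIV]
    have cg: "continuous_on S (\<lambda>z. grad \<eta> (h z))" if "continuous_on S h" for S and h :: "_ \<Rightarrow> 'a"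
      using continuous_on_compose2[OF c that] by simp
    have cf: "continuous_on S (\<lambda>z. f (h z))" if "continuous_on S h" for S and h :: "_ \<Rightarrow> 'a"
      using continuous_on_compose2[OF f that] by simp
    let ?fx = "\<lambda>x y. blinfun_inner_left (f y *\<^sub>R grad \<eta> (x - y))"
    have "((?F \<eta>) has_derivative integral (cbox a b) (?fx x)) (at x within UNIV)"
    proof (rule leibniz_rule)
      show "((\<lambda>x. f t * \<eta> (x - t)) has_derivative blinfun_apply (?fx x t)) (at x within UNIV)" for x t
      proof -
        have "((\<lambda>x. \<eta> (x - t)) has_derivative (\<lambda>h. h \<bullet> grad \<eta> (x - t))) (at x)"
        proof (rule has_derivative_compose[OF _ grad_has_derivative[OF smooth_differentiable[OF \<eta>]], of "\<lambda>x. x - t" "\<lambda>h. h" x UNIV])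
          show "((\<lambda>x. x - t) has_derivative (\<lambda>h. h)) (at x)" by (auto intro!: derivative_eq_intros)
        qed
        from has_derivative_mult_right[OF this, of "f t"] show ?thesis by simp
      qed
      show "(\<lambda>y. f y * \<eta> (x - y)) integrable_on cbox a b" for x
        by (intro integrable_continuous continuous_intros cf continuous_on_compose2[OF smooth_continuous[OF \<eta>, of UNIV]]) auto
      show "continuous_on (UNIV \<times> cbox a b) (\<lambda>(x, t). ?fx x t)"
        unfolding split_def by (intro bounded_linear.continuous_on[OF bounded_linear_blinfun_inner_left] continuous_intros cg cf)
    qed auto
    moreover have "blinfun_apply (integral (cbox a b) (?fx x)) h = h \<bullet> integral (cbox a b) (\<lambda>y. f y *\<^sub>R grad \<eta> (x - y))" for h
    proof -
      have i: "(\<lambda>y. f y *\<^sub>R grad \<eta> (x - y)) integrable_on cbox a b"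
        by (intro integrable_continuous continuous_intros cg cf)
      have "?fx x integrable_on cbox a b"
        by (intro integrable_continuous bounded_linear.continuous_on[OF bounded_linear_blinfun_inner_left] continuous_intros cg cf)
      then have "blinfun_apply (integral (cbox a b) (?fx x)) h = integral (cbox a b) (\<lambda>y. h \<bullet> (f y *\<^sub>R grad \<eta> (x - y)))"
        using blinfun_apply_integral[of "?fx x" "cbox a b" h] by simp
      also have "\<dots> = h \<bullet> integral (cbox a b) (\<lambda>y. f y *\<^sub>R grad \<eta> (x - y))"
        using integral_linear[OF i bounded_linear_inner_right[of h]] by (simp add: o_def)
      finally show ?thesis .
    qed
    ultimately show ?thesis unfolding gderiv_def by (metis (no_types, lifting) ext)
  qed
  show "h differentiable (at x)" if "\<exists>\<eta>. smooth \<eta> \<and> h = ?F \<eta>" for h x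
    using that * GDERIV_imp_differentiable by blast
  show "\<exists>\<eta>. smooth \<eta> \<and> (\<lambda>x. grad h x \<bullet> e) = (?F \<eta>)"
    if ex: "\<exists>\<eta>. smooth \<eta> \<and> h = ?F \<eta>" and e: "e \<in> Basis" for h e
  proof -
    obtain \<eta> where \<eta>: "smooth \<eta>" and h: "h = ?F \<eta>" using ex by blast
    have "(\<lambda>x. grad h x \<bullet> e) = (\<lambda>x. integral (cbox a b) (\<lambda>y. f y * (grad \<eta> (x - y) \<bullet> e)))"
    proof
      fix x
      have i: "(\<lambda>y. f y *\<^sub>R grad \<eta> (x - y)) integrable_on cbox a b"
        by (intro integrable_continuous continuous_intros continuous_on_compose2[OF C1_continuous_grad[OF smooth_C1[OF \<eta>], of UNIV]]
            continuous_on_subset[OF f]) auto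
      show "grad h x \<bullet> e = integral (cbox a b) (\<lambda>y. f y * (grad \<eta> (x - y) \<bullet> e))"
        using integral_linear[OF i bounded_linear_inner_left[of e]] GDERIV_imp_grad[OF *[OF \<eta>, of x]] h by (simp add: o_def)
    qed
    then show ?thesis using smooth_partial[OF \<eta> e] by blast
  qed
qed (use assms in blast)

lemma lborel_integral_reflect:
  fixes g :: "'a::euclidean_space \<Rightarrow> real" assumes [measurable]: "g \<in> borel_measurable borel"
  shows "(\<integral>y. g (x - y) \<partial>lborel) = (\<integral>y. g y \<partial>lborel)" "integrable lborel g \<Longrightarrow> integrable lborel (\<lambda>y. g (x - y))"
proof -
  have eq: "lborel = distr lborel borel (\<lambda>y. x - y :: 'a)"
    using lborel_affine[of "-1" x] by (simp add: density_1)
  have "(\<integral>y. g y \<partial>distr lborel borel (\<lambda>y. x - y)) = (\<integral>y. g (x - y) \<partial>lborel)" by (rule integral_distr) auto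
  then show "(\<integral>y. g (x - y) \<partial>lborel) = (\<integral>y. g y \<partial>lborel)" using eq by simp
  have "integrable (distr lborel borel (\<lambda>y. x - y)) g \<longleftrightarrow> integrable lborel (\<lambda>y. g (x - y))" by (rule integrable_distr_eq) auto
  then show "integrable lborel g \<Longrightarrow> integrable lborel (\<lambda>y. g (x - y))" using eq by simp
qed

text \<open>The third property, applied to increments, transports Lipschitz bounds and derivatives.\<close>

lemma exists_mollification:
  fixes f :: "'a::euclidean_space \<Rightarrow> real"
  assumes f: "continuous_on UNIV f" and K: "compact K" "\<And>x. x \<notin> K \<Longrightarrow> f x = 0" and e: "\<epsilon> > 0"
  obtains \<zeta> where "smooth \<zeta>"
    "\<And>x c B. (\<And>y. dist x y < \<epsilon> \<Longrightarrow> \<bar>f y - c\<bar> \<le> B) \<Longrightarrow> \<bar>\<zeta> x - c\<bar> \<le> B"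
    "\<And>x z c B. (\<And>y. norm y < \<epsilon> \<Longrightarrow> \<bar>f (x - y) - f (z - y) - c\<bar> \<le> B) \<Longrightarrow> \<bar>\<zeta> x - \<zeta> z - c\<bar> \<le> B"
proof -
  obtain \<eta> :: "'a \<Rightarrow> real" where \<eta>: "smooth \<eta>" "\<And>x. 0 \<le> \<eta> x" "\<And>x. norm x \<ge> \<epsilon> \<Longrightarrow> \<eta> x = 0"
    "integrable lborel \<eta>" "(\<integral>x. \<eta> x \<partial>lborel) = 1" using exists_mollifier[OF e] by blast
  obtain a where a: "K \<subseteq> cbox (-a) a" using bounded_subset_cbox_symmetric[OF compact_imp_bounded[OF K(1)]] by blast
  define \<zeta> where "\<zeta> x = integral (cbox (-a) a) (\<lambda>y. f y * \<eta> (x - y))" for x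
  have [measurable]: "f \<in> borel_measurable borel" "\<eta> \<in> borel_measurable borel"
    using f smooth_continuous[OF \<eta>(1)] borel_measurable_continuous_onI by blast+
  have I: "integrable lborel (\<lambda>y. f (x - y) * \<eta> y)" and eq: "\<zeta> x = (\<integral>y. f (x - y) * \<eta> y \<partial>lborel)" for x
  proof -
    have c: "continuous_on S (\<lambda>y. f y * \<eta> (x - y))" for S
      by (intro continuous_intros continuous_on_compose2[OF smooth_continuous[OF \<eta>(1), of UNIV]] continuous_on_subset[OF f]) auto
    have e: "(\<lambda>y. indicator (cbox (-a) a) y *\<^sub>R (f y * \<eta> (x - y))) = (\<lambda>y. f y * \<eta> (x - y))"
      using K(2) a by (auto simp: indicator_def fun_eq_iff)
    have i: "integrable lborel (\<lambda>y. f y * \<eta> (x - y))"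
      using borel_integrable_compact[OF compact_cbox c, of "-a" a] by (simp only: e)
    from lborel_integral_reflect(2)[OF _ i, of x] show "integrable lborel (\<lambda>y. f (x - y) * \<eta> y)" by simp
    have "\<zeta> x = integral UNIV (\<lambda>y. f y * \<eta> (x - y))" unfolding \<zeta>_def
      using a K(2) integral_restrict_UNIV[of "cbox (-a) a" "\<lambda>y. f y * \<eta> (x - y)"] by (smt (verit, best) integral_cong mult_eq_0_iff subsetD)
    also have "\<dots> = (\<integral>y. f y * \<eta> (x - y) \<partial>lborel)" using integral_lborel[OF i] by simp
    also have "\<dots> = (\<integral>y. f (x - y) * \<eta> y \<partial>lborel)"
      using lborel_integral_reflect(1)[of "\<lambda>y. f y * \<eta> (x - y)" x] by simp
    finally show "\<zeta> x = (\<integral>y. f (x - y) * \<eta> y \<partial>lborel)" .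
  qed
  \<comment> \<open>An average against a probability density inherits every bound valid near the
    point. With h a reflected translate of f this is the second property of the mollification, with
    h an increment of f the third.\<close>
  have key: "\<bar>(\<integral>y. h y * \<eta> y \<partial>lborel) - c\<bar> \<le> B"
    if i: "integrable lborel (\<lambda>y. h y * \<eta> y)" and b: "\<And>y. norm y < \<epsilon> \<Longrightarrow> \<bar>h y - c\<bar> \<le> B" for h c B
  proof -
    have "(\<integral>y. h y * \<eta> y \<partial>lborel) - c = (\<integral>y. h y * \<eta> y - c * \<eta> y \<partial>lborel)"
      using i \<eta>(4,5) by simp
    also have "\<bar>\<dots>\<bar> \<le> (\<integral>y. B * \<eta> y \<partial>lborel)"
      unfolding real_norm_def[symmetric]
    proof (rule Bochner_Integration.integral_norm_bound_integral)
      show "integrable lborel (\<lambda>y. h y * \<eta> y - c * \<eta> y)" "integrable lborel (\<lambda>y. B * \<eta> y)" using i \<eta>(4) by auto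
      show "norm (h y * \<eta> y - c * \<eta> y) \<le> B * \<eta> y" for y
      proof (cases "norm y < \<epsilon>")
        case True
        have "\<bar>h y * \<eta> y - c * \<eta> y\<bar> = \<bar>h y - c\<bar> * \<eta> y" using \<eta>(2)[of y] by (simp add: abs_mult flip: left_diff_distrib)
        also have "\<dots> \<le> B * \<eta> y" by (rule mult_right_mono[OF b[OF True] \<eta>(2)])
        finally show ?thesis by simp
      qed (use \<eta>(3)[of y] in simp)
    qed
    finally show ?thesis using \<eta>(5) by simp
  qed
  show thesis
  proof (rule that[of \<zeta>])
    show "smooth \<zeta>" unfolding \<zeta>_def by (rule smooth_convolution[OF f \<eta>(1)])
    show "\<bar>\<zeta> x - c\<bar> \<le> B" if "\<And>y. dist x y < \<epsilon> \<Longrightarrow> \<bar>f y - c\<bar> \<le> B" for x c B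
      unfolding eq by (rule key[OF I]) (use that in \<open>auto simp: dist_norm\<close>)
    show "\<bar>\<zeta> x - \<zeta> z - c\<bar> \<le> B" if "\<And>y. norm y < \<epsilon> \<Longrightarrow> \<bar>f (x - y) - f (z - y) - c\<bar> \<le> B" for x z c B
    proof -
      have "\<zeta> x - \<zeta> z = (\<integral>y. (f (x - y) - f (z - y)) * \<eta> y \<partial>lborel)"
        unfolding eq using I by (simp add: left_diff_distrib)
      moreover have "integrable lborel (\<lambda>y. (f (x - y) - f (z - y)) * \<eta> y)"
        using I by (simp add: left_diff_distrib)
      ultimately show ?thesis using key[of "\<lambda>y. f (x - y) - f (z - y)"] that by simp
    qed
  qed
qed

subsection \<open>The Gagliardo-Nirenberg inequality in the plane\<close>

definition perp :: "real^2 \<Rightarrow> real^2" where "perp e = vector [- e$2, e$1]"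

lemma perp_simps: "norm e = 1 \<Longrightarrow> norm (perp e) = 1" "perp e \<bullet> e = 0" "e \<bullet> perp e = 0"
  by (simp_all add: perp_def norm_eq_sqrt_inner inner_vec_def sum_2 algebra_simps)

lemma perp_decomp: "norm e = 1 \<Longrightarrow> x = (x \<bullet> perp e) *\<^sub>R perp e + (x \<bullet> e) *\<^sub>R (e :: real^2)"
proof -
  assume "norm e = 1"
  then have u: "e$1 * e$1 + e$2 * e$2 = 1" by (simp add: norm_eq_sqrt_inner inner_vec_def sum_2)
  have "x$1 = x$1 * (e$1 * e$1 + e$2 * e$2)" "x$2 = x$2 * (e$1 * e$1 + e$2 * e$2)" using u by simp_all
  then show ?thesis by (simp add: vec_eq_iff forall_2 perp_def inner_vec_def sum_2 algebra_simps)
qed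

lemma axes_measurable [measurable]: "(\<lambda>p. vector [fst p, snd p] :: real^2) \<in> lborel \<Otimes>\<^sub>M lborel \<rightarrow>\<^sub>M borel"
proof -
  have "continuous_on UNIV (\<lambda>p. vector [fst p, snd p] :: real^2)"
    by (subst continuous_on_componentwise) (auto simp: Basis_vec_def inner_axis vector_2 forall_2 exhaust_2 intro!: continuous_intros)
  then show ?thesis unfolding lborel_prod using borel_measurable_continuous_onI by simp
qed

lemma lborel_axes:
  "(lborel :: (real^2) measure) = distr (lborel \<Otimes>\<^sub>M lborel) borel (\<lambda>p. vector [fst p, snd p])"
proof (rule lborel_eqI)
  fix l u :: "real^2" assume le: "\<And>b. b \<in> Basis \<Longrightarrow> l \<bullet> b \<le> u \<bullet> b"
  then have le': "l$i \<le> u$i" for i using le[of "axis i 1"] by (simp add: inner_axis axis_in_Basis_iff)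
  have "emeasure (distr (lborel \<Otimes>\<^sub>M lborel) borel (\<lambda>p. vector [fst p, snd p])) (box l u)
      = emeasure (lborel \<Otimes>\<^sub>M lborel) ({l$1<..<u$1} \<times> {l$2<..<u$2})"
    by (subst emeasure_distr) (auto simp: space_pair_measure mem_box_cart forall_2 intro!: arg_cong[of _ _ "emeasure (lborel \<Otimes>\<^sub>M lborel)"])
  also have "\<dots> = emeasure lborel {l$1<..<u$1} * emeasure lborel {l$2<..<u$2}"
    by (rule lborel.emeasure_pair_measure_Times) auto
  also have "\<dots> = ennreal ((u$1 - l$1) * (u$2 - l$2))" using le' by (simp add: ennreal_mult)
  also have "(u$1 - l$1) * (u$2 - l$2) = (\<Prod>i\<in>UNIV. u$i - l$i)" by (simp add: UNIV_2)
  also have "\<dots> = (\<Prod>b\<in>Basis. (u - l) \<bullet> b)"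
    using content_cbox_cart[of l u] content_cbox[of l u] le le' by (simp add: interval_ne_empty_cart(1) less_eq_vec_def)
  finally show "emeasure (distr (lborel \<Otimes>\<^sub>M lborel) borel (\<lambda>p. vector [fst p, snd p])) (box l u) = (\<Prod>b\<in>Basis. (u - l) \<bullet> b)" .
qed simp

lemma lborel_orthogonal:
  fixes T :: "real^'n::{finite,wellorder} \<Rightarrow> real^'n::{finite,wellorder}" assumes T: "orthogonal_transformation T"
  shows "lborel = distr lborel borel T"
proof (rule lborel_eqI)
  have lin: "linear T" using T orthogonal_transformation_def by blast
  then have "continuous_on UNIV T" by (simp add: linear_continuous_on linear_conv_bounded_linear)
  then have [measurable]: "T \<in> borel \<rightarrow>\<^sub>M borel" by (rule borel_measurable_continuous_onI)
  fix l u :: "real^'n::{finite,wellorder}" assume le: "\<And>b. b \<in> Basis \<Longrightarrow> l \<bullet> b \<le> u \<bullet> b"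
  have b: "bij T" using T orthogonal_transformation_bij by blast
  have iT: "orthogonal_transformation (inv T)" using T orthogonal_transformation_inv by blast
  have eq: "T -` box l u = inv T ` box l u" using b by (simp add: bij_vimage_eq_inv_image)
  have "emeasure (distr lborel borel T) (box l u) = emeasure lborel (inv T ` box l u)"
    by (subst emeasure_distr) (auto simp: eq)
  also have "\<dots> = emeasure lebesgue (inv T ` box l u)"
  proof -
    have "T -` box l u \<inter> space borel \<in> sets borel" by measurable
    then show ?thesis by (simp add: eq)
  qed
  also have "\<dots> = ennreal (measure lebesgue (inv T ` box l u))"
    using measurable_orthogonal_image[OF iT lmeasurable_box] by (simp add: fmeasurable_def emeasure_eq_ennreal_measure less_top[symmetric])
  also have "\<dots> = ennreal (measure lebesgue (box l u))" using measure_orthogonal_image[OF iT lmeasurable_box] by simp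
  also have "\<dots> = (\<Prod>b\<in>Basis. (u - l) \<bullet> b)" using le by (simp add: measure_completion)
  finally show "emeasure (distr lborel borel T) (box l u) = (\<Prod>b\<in>Basis. (u - l) \<bullet> b)" .
qed simp

lemma frame_continuous: "continuous_on UNIV (\<lambda>p. fst p *\<^sub>R a + snd p *\<^sub>R (b :: 'a::real_normed_vector))"
  by (intro continuous_intros)

lemma frame_measurable [measurable]:
  "(\<lambda>p. fst p *\<^sub>R a + snd p *\<^sub>R (b::'a::euclidean_space)) \<in> borel_measurable (lborel \<Otimes>\<^sub>M lborel)"
  unfolding lborel_prod using borel_measurable_continuous_onI[OF frame_continuous[of a b]] by simp

text \<open>Fubini's theorem is needed along arbitrary orthonormal frames, since a boundary chart
  comes with its own direction e.\<close>

lemma lborel_frame: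
  fixes e :: "real^2" assumes e: "norm e = 1"
  shows "lborel = distr (lborel \<Otimes>\<^sub>M lborel) borel (\<lambda>p. fst p *\<^sub>R perp e + snd p *\<^sub>R e)"
proof -
  let ?T = "\<lambda>x::real^2. x$1 *\<^sub>R perp e + x$2 *\<^sub>R e" and ?A = "\<lambda>p. vector [fst p, snd p] :: real^2"
  have u: "e$1 * e$1 + e$2 * e$2 = 1" using e by (simp add: norm_eq_sqrt_inner inner_vec_def sum_2)
  have lin: "linear ?T" by (rule linearI) (auto simp: algebra_simps)
  have "?T x \<bullet> ?T y = x \<bullet> y" for x y
  proof -
    have "perp e \<bullet> perp e = 1" "e \<bullet> e = 1" using perp_simps(1)[OF e] e by (simp_all add: norm_eq_1)
    then show ?thesis by (simp add: inner_add_left inner_add_right perp_simps inner_vec_def[of x y] sum_2)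
  qed
  then have o: "orthogonal_transformation ?T" using lin by (simp add: orthogonal_transformation_def)
  have [measurable]: "?T \<in> borel \<rightarrow>\<^sub>M borel" using lin by (intro borel_measurable_continuous_onI linear_continuous_on) (simp add: linear_conv_bounded_linear)
  have "lborel = distr lborel borel ?T" by (rule lborel_orthogonal[OF o])
  also have "\<dots> = distr (distr (lborel \<Otimes>\<^sub>M lborel) borel ?A) borel ?T" by (subst lborel_axes) simp
  also have "\<dots> = distr (lborel \<Otimes>\<^sub>M lborel) borel (?T \<circ> ?A)" by (rule distr_distr) auto
  finally show ?thesis by (simp add: o_def)
qed

lemma nn_integral_frame:
  fixes e :: "real^2" assumes e: "norm e = 1" and [measurable]: "f \<in> borel_measurable borel"
  shows "(\<integral>\<^sup>+x. f x \<partial>lborel) = (\<integral>\<^sup>+s. \<integral>\<^sup>+t. f (s *\<^sub>R perp e + t *\<^sub>R e) \<partial>lborel \<partial>lborel)"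
proof -
  have "(\<integral>\<^sup>+x. f x \<partial>lborel) = (\<integral>\<^sup>+p. f (fst p *\<^sub>R perp e + snd p *\<^sub>R e) \<partial>(lborel \<Otimes>\<^sub>M lborel))"
    by (subst lborel_frame[OF e], subst nn_integral_distr) auto
  also have "\<dots> = (\<integral>\<^sup>+s. \<integral>\<^sup>+t. f (s *\<^sub>R perp e + t *\<^sub>R e) \<partial>lborel \<partial>lborel)"
    by (subst lborel.nn_integral_fst[symmetric]) auto
  finally show ?thesis .
qed

lemma nn_integral_frame_swap:
  fixes e :: "real^2" assumes e: "norm e = 1" and [measurable]: "f \<in> borel_measurable borel"
  shows "(\<integral>\<^sup>+x. f x \<partial>lborel) = (\<integral>\<^sup>+t. \<integral>\<^sup>+s. f (s *\<^sub>R perp e + t *\<^sub>R e) \<partial>lborel \<partial>lborel)"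
proof -
  have m: "(\<lambda>p. f (fst p *\<^sub>R perp e + snd p *\<^sub>R e)) \<in> borel_measurable (lborel \<Otimes>\<^sub>M lborel)" by measurable
  show ?thesis using nn_integral_frame[OF assms] lborel_pair.Fubini'[of "\<lambda>t s. f (s *\<^sub>R perp e + t *\<^sub>R e)"] m
    by (simp add: split_def)
qed

lemma GDERIV_line:
  assumes "GDERIV f (x + \<tau> *\<^sub>R e) :> d"
  shows "((\<lambda>t. f (x + t *\<^sub>R e)) has_real_derivative d \<bullet> e) (at \<tau>)"
proof -
  have "((\<lambda>t. x + t *\<^sub>R e) has_derivative (\<lambda>h. h *\<^sub>R e)) (at \<tau>)" by (auto intro!: derivative_eq_intros)
  from has_derivative_compose[OF this, of f "\<lambda>h. h \<bullet> d"] assms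
  show ?thesis unfolding has_field_derivative_def gderiv_def by (simp add: inner_commute mult.commute[of _ "_ \<bullet> _"])
qed

lemma C1_increment:
  fixes f :: "'a::euclidean_space \<Rightarrow> real"
  assumes f: "C1 f" and e: "norm e = 1" and ab: "a \<le> b"
  shows "ennreal \<bar>f (x + b *\<^sub>R e) - f (x + a *\<^sub>R e)\<bar> \<le> (\<integral>\<^sup>+\<tau>. ennreal (norm (grad f (x + \<tau> *\<^sub>R e))) * indicator {a..b} \<tau> \<partial>lborel)"
proof -
  let ?g = "\<lambda>\<tau>. grad f (x + \<tau> *\<^sub>R e) \<bullet> e"
  have c: "continuous_on {a..b} ?g"
    by (intro continuous_intros continuous_on_compose2[OF C1_continuous_grad[OF f, of UNIV]]) auto
  have d: "((\<lambda>\<tau>. f (x + \<tau> *\<^sub>R e)) has_vector_derivative ?g \<tau>) (at \<tau> within {a..b})" for \<tau>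
    using has_field_derivative_at_within[OF GDERIV_line[OF C1_GDERIV[OF f]]] by (simp add: has_real_derivative_iff_has_vector_derivative)
  have i: "integrable lborel (\<lambda>\<tau>. indicator {a..b} \<tau> *\<^sub>R ?g \<tau>)"
    by (rule borel_integrable_compact[OF compact_Icc c])
  have "f (x + b *\<^sub>R e) - f (x + a *\<^sub>R e) = (\<integral>\<tau>. indicator {a..b} \<tau> *\<^sub>R ?g \<tau> \<partial>lborel)"
    using integral_FTC_atLeastAtMost[OF ab d c] by simp
  then have "ennreal \<bar>f (x + b *\<^sub>R e) - f (x + a *\<^sub>R e)\<bar> \<le> (\<integral>\<^sup>+\<tau>. norm (indicator {a..b} \<tau> *\<^sub>R ?g \<tau>) \<partial>lborel)"
    using integral_norm_bound_ennreal[OF i] by simp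
  also have "\<dots> \<le> (\<integral>\<^sup>+\<tau>. ennreal (norm (grad f (x + \<tau> *\<^sub>R e))) * indicator {a..b} \<tau> \<partial>lborel)"
  proof (rule nn_integral_mono)
    fix \<tau>
    have "\<bar>?g \<tau>\<bar> \<le> norm (grad f (x + \<tau> *\<^sub>R e))" using Cauchy_Schwarz_ineq2[of "grad f (x + \<tau> *\<^sub>R e)" e] e by simp
    then show "ennreal (norm (indicator {a..b} \<tau> *\<^sub>R ?g \<tau>)) \<le> ennreal (norm (grad f (x + \<tau> *\<^sub>R e))) * indicator {a..b} \<tau>"
      by (auto simp: indicator_def ennreal_leI)
  qed
  finally show ?thesis .
qed

lemma C1_measurable: assumes "C1 f"
  shows C1_borel: "f \<in> borel_measurable borel" and grad_borel: "grad f \<in> borel_measurable borel"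
  using C1_continuous[OF assms] C1_continuous_grad[OF assms] borel_measurable_continuous_onI by blast+

lemma C1_compact_support_bound:
  fixes f :: "'a::euclidean_space \<Rightarrow> real"
  assumes f: "C1 f" and e: "norm e = 1" and K: "bounded K" "\<And>x. x \<notin> K \<Longrightarrow> f x = 0"
  shows "ennreal \<bar>f (x + t *\<^sub>R e)\<bar> \<le> (\<integral>\<^sup>+\<tau>. ennreal (norm (grad f (x + \<tau> *\<^sub>R e))) \<partial>lborel)"
proof -
  obtain B where B: "\<And>y. y \<in> K \<Longrightarrow> norm y \<le> B" using K(1) bounded_iff by blast
  \<comment> \<open>So far out that the point leaves every ball containing K; f vanishes there and
    the increment from \<open>a\<close> to \<open>t\<close> is the full value.\<close>
  define a where "a = - (\<bar>B\<bar> + norm x + \<bar>t\<bar> + 1)"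
  have "norm (a *\<^sub>R e) - norm x \<le> norm (x + a *\<^sub>R e)" using norm_diff_ineq[of "a *\<^sub>R e" x] by (simp add: add.commute)
  then have "norm (x + a *\<^sub>R e) > B" using e by (simp add: a_def)
  then have z: "f (x + a *\<^sub>R e) = 0" using B K(2) by force
  have at: "a \<le> t" unfolding a_def using abs_ge_minus_self[of t] abs_ge_zero[of B] norm_ge_zero[of x] by linarith
  have "ennreal \<bar>f (x + t *\<^sub>R e) - f (x + a *\<^sub>R e)\<bar> \<le> (\<integral>\<^sup>+\<tau>. ennreal (norm (grad f (x + \<tau> *\<^sub>R e))) * indicator {a..t} \<tau> \<partial>lborel)"
    by (rule C1_increment[OF f e at])
  also have "\<dots> \<le> (\<integral>\<^sup>+\<tau>. ennreal (norm (grad f (x + \<tau> *\<^sub>R e))) \<partial>lborel)"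
    by (rule nn_integral_mono) (auto simp: indicator_def)
  finally show ?thesis using z by simp
qed

text \<open>Bounding \<open>f\<close> along both coordinate lines and integrating the product of the two bounds
  gives the Gagliardo-Nirenberg inequality.\<close>

lemma gagliardo_nirenberg_plane:
  fixes f :: "real^2 \<Rightarrow> real"
  assumes f: "C1 f" and K: "bounded K" "\<And>x. x \<notin> K \<Longrightarrow> f x = 0"
  shows "(\<integral>\<^sup>+x. ennreal ((f x)\<^sup>2) \<partial>lborel) \<le> (\<integral>\<^sup>+x. ennreal (norm (grad f x)) \<partial>lborel)\<^sup>2"
    and "norm e = 1 \<Longrightarrow> (\<integral>\<^sup>+t. ennreal \<bar>f (x + t *\<^sub>R e)\<bar> \<partial>lborel) \<le> (\<integral>\<^sup>+x. ennreal (norm (grad f x)) \<partial>lborel)"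
proof -
  have [measurable]: "f \<in> borel_measurable borel" "grad f \<in> borel_measurable borel" by (rule C1_borel[OF f] grad_borel[OF f])+
  let ?N = "\<integral>\<^sup>+x. ennreal (norm (grad f x)) \<partial>lborel"
  { fix e :: "real^2" assume e: "norm e = 1"
    define A where "A s = (\<integral>\<^sup>+t. ennreal (norm (grad f (s *\<^sub>R perp e + t *\<^sub>R e))) \<partial>lborel)" for s
    define B where "B t = (\<integral>\<^sup>+s. ennreal (norm (grad f (s *\<^sub>R perp e + t *\<^sub>R e))) \<partial>lborel)" for t
    have m: "(\<lambda>p. ennreal (norm (grad f (fst p *\<^sub>R perp e + snd p *\<^sub>R e)))) \<in> borel_measurable (lborel \<Otimes>\<^sub>M lborel)" by measurable
    have mA [measurable]: "A \<in> borel_measurable lborel" unfolding A_def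
      using lborel.borel_measurable_nn_integral_fst[OF m] by simp
    have mB [measurable]: "B \<in> borel_measurable lborel" unfolding B_def
      using lborel.borel_measurable_nn_integral_fst[of "\<lambda>p. ennreal (norm (grad f (snd p *\<^sub>R perp e + fst p *\<^sub>R e)))" lborel] m
      by (simp add: add.commute)
    have iA: "(\<integral>\<^sup>+s. A s \<partial>lborel) = ?N" unfolding A_def by (rule nn_integral_frame[OF e, symmetric]) measurable
    have iB: "(\<integral>\<^sup>+t. B t \<partial>lborel) = ?N" unfolding B_def by (rule nn_integral_frame_swap[OF e, symmetric]) measurable
    have leA: "ennreal \<bar>f (s *\<^sub>R perp e + t *\<^sub>R e)\<bar> \<le> A s" for s t
      unfolding A_def by (rule C1_compact_support_bound[OF f e K])
    have leB: "ennreal \<bar>f (s *\<^sub>R perp e + t *\<^sub>R e)\<bar> \<le> B t" for s t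
      unfolding B_def using C1_compact_support_bound[OF f perp_simps(1)[OF e] K, of "t *\<^sub>R e" s] by (simp add: add.commute)
    have "(\<integral>\<^sup>+x. ennreal ((f x)\<^sup>2) \<partial>lborel) = (\<integral>\<^sup>+s. \<integral>\<^sup>+t. ennreal ((f (s *\<^sub>R perp e + t *\<^sub>R e))\<^sup>2) \<partial>lborel \<partial>lborel)"
      by (rule nn_integral_frame[OF e]) measurable
    also have "\<dots> \<le> (\<integral>\<^sup>+s. \<integral>\<^sup>+t. A s * B t \<partial>lborel \<partial>lborel)"
    proof (intro nn_integral_mono)
      fix s t
      have "ennreal ((f (s *\<^sub>R perp e + t *\<^sub>R e))\<^sup>2) = ennreal \<bar>f (s *\<^sub>R perp e + t *\<^sub>R e)\<bar> * ennreal \<bar>f (s *\<^sub>R perp e + t *\<^sub>R e)\<bar>"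
        by (simp add: power2_eq_square flip: ennreal_mult)
      also have "\<dots> \<le> A s * B t" by (intro mult_mono leA leB) auto
      finally show "ennreal ((f (s *\<^sub>R perp e + t *\<^sub>R e))\<^sup>2) \<le> A s * B t" .
    qed
    also have "\<dots> = ?N\<^sup>2" by (simp add: nn_integral_cmult nn_integral_multc iA iB power2_eq_square)
    finally have 1: "(\<integral>\<^sup>+x. ennreal ((f x)\<^sup>2) \<partial>lborel) \<le> ?N\<^sup>2" .
    \<comment> \<open>Each value on the line is bounded by the integral of the gradient along the
      perpendicular line through that point, and these perpendicular lines sweep out the
      plane.\<close>
    have 2: "(\<integral>\<^sup>+t. ennreal \<bar>f (x + t *\<^sub>R e)\<bar> \<partial>lborel) \<le> ?N" for x
    proof -
      have xe: "x + t *\<^sub>R e = (x \<bullet> perp e) *\<^sub>R perp e + (x \<bullet> e + t) *\<^sub>R e" for t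
        using perp_decomp[OF e, of x] by (simp add: scaleR_add_left add.assoc)
      have "(\<integral>\<^sup>+t. ennreal \<bar>f (x + t *\<^sub>R e)\<bar> \<partial>lborel) \<le> (\<integral>\<^sup>+t. B (x \<bullet> e + t) \<partial>lborel)"
        unfolding xe by (intro nn_integral_mono leB)
      also have "\<dots> = (\<integral>\<^sup>+t. B t \<partial>lborel)" using nn_integral_real_affine[of B 1 "x \<bullet> e"] mB by simp
      finally show ?thesis using iB by simp
    qed
    note 1 2 }
  note * = this
  have "norm (axis 1 1 :: real^2) = 1" by simp
  from *(1)[OF this] show "(\<integral>\<^sup>+x. ennreal ((f x)\<^sup>2) \<partial>lborel) \<le> ?N\<^sup>2" .
  show "norm e = 1 \<Longrightarrow> (\<integral>\<^sup>+t. ennreal \<bar>f (x + t *\<^sub>R e)\<bar> \<partial>lborel) \<le> ?N" by (rule *(2))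
qed

lemma nn_integral_lebesgue_on_eq:
  fixes f :: "'a::euclidean_space \<Rightarrow> ennreal"
  assumes [measurable]: "\<Omega> \<in> sets borel" "f \<in> borel_measurable borel" and z: "\<And>x. x \<notin> \<Omega> \<Longrightarrow> f x = 0"
  shows "(\<integral>\<^sup>+x. f x \<partial>lebesgue_on \<Omega>) = (\<integral>\<^sup>+x. f x \<partial>lborel)"
proof -
  have "(\<integral>\<^sup>+x. f x \<partial>lebesgue_on \<Omega>) = (\<integral>\<^sup>+x. f x * indicator \<Omega> x \<partial>lebesgue)"
    by (rule nn_integral_restrict_space) auto
  also have "(\<lambda>x. f x * indicator \<Omega> x) = f" using z by (auto simp: indicator_def)
  also have "(\<integral>\<^sup>+x. f x \<partial>lebesgue) = (\<integral>\<^sup>+x. f x \<partial>lborel)" by (rule nn_integral_completion)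
  finally show ?thesis .
qed

section \<open>Poincare and Sobolev inequalities for test functions on a bounded plane
  domain\<close>

locale bounded_domain =
  fixes \<Omega> :: "(real^2) set"
  assumes open_domain: "open \<Omega>" and bounded_domain: "bounded \<Omega>"
begin

abbreviation M :: "(real^2) measure" where "M \<equiv> lebesgue_on \<Omega>"
abbreviation tf :: "(real^2 \<Rightarrow> real) \<Rightarrow> bool" where "tf \<equiv> test_function \<Omega>"

lemma domain_borel [measurable]: "\<Omega> \<in> sets borel"
  using open_domain by simp

lemma domain_lebesgue: "\<Omega> \<in> sets lebesgue"
  using open_domain by simp

sublocale finite_measure M
  by (rule finite_measure_lebesgue_on) (use bounded_domain domain_lebesgue bounded_set_imp_lmeasurable in blast)

lemma borel_measurable_M: "f \<in> borel_measurable borel \<Longrightarrow> f \<in> borel_measurable M"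
  by (intro measurable_restrict_space1 measurable_completion) simp

lemma continuous_bounded_on_domain:
  fixes f :: "real^2 \<Rightarrow> 'b::euclidean_space"
  assumes "continuous_on UNIV f" shows "\<exists>B. \<forall>x\<in>\<Omega>. norm (f x) \<le> B"
proof -
  have "compact (closure \<Omega>)" using bounded_domain by simp
  then have "bounded (f ` closure \<Omega>)" using compact_continuous_image[of "closure \<Omega>" f] assms continuous_on_subset compact_imp_bounded by blast
  then show ?thesis unfolding bounded_iff using closure_subset by blast
qed

lemma continuous_Lp2:
  fixes f :: "real^2 \<Rightarrow> 'b::euclidean_space"
  assumes "continuous_on UNIV f" shows "Lp M 2 f" "integrable M f"
proof -
  obtain B where B: "\<And>x. x \<in> \<Omega> \<Longrightarrow> norm (f x) \<le> B" using continuous_bounded_on_domain[OF assms] by blast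
  have [measurable]: "f \<in> borel_measurable M" by (rule borel_measurable_M[OF borel_measurable_continuous_onI[OF assms]])
  have "integrable M (\<lambda>x. (norm (f x))\<^sup>2)"
    by (rule integrable_const_bound[where B = "B\<^sup>2"]) (use B in \<open>auto simp: space_restrict_space power_mono\<close>)
  then show "Lp M 2 f" by (simp add: Lp2_iff)
  then show "integrable M f" by (rule L2_norm_integrable)
qed

lemma C1_Lp2: assumes "C1 f" shows "Lp M 2 f" "Lp M 2 (grad f)"
  using continuous_Lp2 C1_continuous[OF assms] C1_continuous_grad[OF assms] by blast+

lemma test_C1: "tf \<psi> \<Longrightarrow> C1 \<psi>"
  by (simp add: test_function_smooth smooth_C1)

lemma test_grad_nn:
  assumes "tf \<psi>"
  shows "(\<integral>\<^sup>+x. ennreal (norm (grad \<psi> x)) \<partial>lborel) = ennreal (LINT x|M. norm (grad \<psi> x))"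
proof -
  obtain K where K: "K \<subseteq> \<Omega>" "\<And>x. x \<notin> K \<Longrightarrow> grad \<psi> x = 0" using test_function_supp[OF assms] by metis
  have [measurable]: "grad \<psi> \<in> borel_measurable borel" by (rule grad_borel[OF test_C1[OF assms]])
  have "(\<integral>\<^sup>+x. ennreal (norm (grad \<psi> x)) \<partial>lborel) = (\<integral>\<^sup>+x. ennreal (norm (grad \<psi> x)) \<partial>M)"
    by (rule nn_integral_lebesgue_on_eq[symmetric]) (use K in auto)
  also have "\<dots> = ennreal (LINT x|M. norm (grad \<psi> x))"
    by (rule nn_integral_eq_integral) (use continuous_Lp2(2)[OF continuous_on_norm[OF C1_continuous_grad[OF test_C1[OF assms]]]] in auto)
  finally show ?thesis .
qed

lemma test_gagliardo_nirenberg: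
  assumes "tf \<psi>"
  shows "(LINT x|M. (\<psi> x)\<^sup>2) \<le> (LINT x|M. norm (grad \<psi> x))\<^sup>2"
proof -
  obtain K where K: "compact K" "K \<subseteq> \<Omega>" "\<And>x. x \<notin> K \<Longrightarrow> \<psi> x = 0" using test_function_supp[OF assms] by metis
  have [measurable]: "\<psi> \<in> borel_measurable borel" by (rule C1_borel[OF test_C1[OF assms]])
  have "ennreal (LINT x|M. (\<psi> x)\<^sup>2) = (\<integral>\<^sup>+x. ennreal ((\<psi> x)\<^sup>2) \<partial>M)"
    by (rule nn_integral_eq_integral[symmetric]) (use Lp2_integrable[OF C1_Lp2(1)[OF test_C1[OF assms]]] in auto)
  also have "\<dots> = (\<integral>\<^sup>+x. ennreal ((\<psi> x)\<^sup>2) \<partial>lborel)"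
    by (rule nn_integral_lebesgue_on_eq) (use K in auto)
  also have "\<dots> \<le> (\<integral>\<^sup>+x. ennreal (norm (grad \<psi> x)) \<partial>lborel)\<^sup>2"
    by (rule gagliardo_nirenberg_plane(1)[OF test_C1[OF assms] compact_imp_bounded[OF K(1)] K(3)])
  also have "\<dots> = ennreal ((LINT x|M. norm (grad \<psi> x))\<^sup>2)"
    by (simp add: test_grad_nn[OF assms] ennreal_power)
  finally show ?thesis by simp
qed

lemma test_poincare:
  assumes "tf \<psi>"
  shows "L2n M \<psi> \<le> sqrt (measure M \<Omega>) * L2n M (grad \<psi>)"
proof -
  have "(L2n M \<psi>)\<^sup>2 \<le> (LINT x|M. norm (grad \<psi> x))\<^sup>2" using test_gagliardo_nirenberg[OF assms] by (simp add: L2n_sq)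
  then have "L2n M \<psi> \<le> (LINT x|M. norm (grad \<psi> x))" by (rule power2_le_imp_le) simp
  also have "\<dots> \<le> sqrt (measure M \<Omega>) * L2n M (grad \<psi>)"
    using L2_norm_integrable(3)[OF C1_Lp2(2)[OF test_C1[OF assms]]] by (simp add: space_restrict_space)
  finally show ?thesis .
qed

lemma test_function_power:
  assumes "tf \<psi>"
  shows "tf (\<lambda>x. \<psi> x ^ Suc n) \<and> grad (\<lambda>x. \<psi> x ^ Suc n) = (\<lambda>x. (real (Suc n) * \<psi> x ^ n) *\<^sub>R grad \<psi> x)"
proof (induction n)
  case (Suc n)
  have t: "tf (\<lambda>x. \<psi> x ^ Suc (Suc n))"
    using test_function_mult[OF conjunct1[OF Suc] test_function_smooth[OF assms]] by simp
  have "grad (\<lambda>x. \<psi> x * \<psi> x ^ Suc n) = (\<lambda>x. \<psi> x *\<^sub>R grad (\<lambda>x. \<psi> x ^ Suc n) x + (\<psi> x ^ Suc n) *\<^sub>R grad \<psi> x)"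
    by (rule grad_mult) (use Suc assms test_C1 in auto)
  moreover have "grad (\<lambda>x. \<psi> x ^ Suc (Suc n)) = (\<lambda>x. (real (Suc (Suc n)) * \<psi> x ^ Suc n) *\<^sub>R grad \<psi> x)"
  proof -
    have "\<psi> x *\<^sub>R ((real (Suc n) * \<psi> x ^ n) *\<^sub>R grad \<psi> x) + \<psi> x ^ Suc n *\<^sub>R grad \<psi> x = (real (Suc (Suc n)) * \<psi> x ^ Suc n) *\<^sub>R grad \<psi> x" for x
      unfolding scaleR_scaleR scaleR_left_distrib[symmetric] by (simp add: algebra_simps)
    then show ?thesis using \<open>grad (\<lambda>x. \<psi> x * \<psi> x ^ Suc n) = _\<close> unfolding conjunct2[OF Suc] by simp
  qed
  ultimately show ?case using t by blast
qed (use assms in simp)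

text \<open>Gagliardo-Nirenberg for the power n + 1 of \<psi> brings out the factor n + 1 and the
  power n, which Cauchy-Schwarz splits off the gradient. Iterating raises the exponent by 2 each
  time and accumulates the factorial.\<close>

lemma test_sobolev_power:
  assumes "tf \<psi>"
  shows "(LINT x|M. \<psi> x ^ (2 * n)) \<le> (fact n)\<^sup>2 * measure M \<Omega> * L2n M (grad \<psi>) ^ (2 * n)"
proof (induction n)
  case 0
  then show ?case by (simp add: space_restrict_space)
next
  case (Suc n)
  have c: "C1 \<psi>" by (rule test_C1[OF assms])
  have L: "Lp M 2 (\<lambda>x. real (Suc n) * \<psi> x ^ n)" by (rule continuous_Lp2) (intro continuous_intros C1_continuous c)
  have "(LINT x|M. \<psi> x ^ (2 * Suc n)) = (LINT x|M. (\<psi> x ^ Suc n)\<^sup>2)" by (simp only: mult.commute[of 2] power_mult)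
  also have "\<dots> \<le> (LINT x|M. norm (real (Suc n) * \<psi> x ^ n) * norm (grad \<psi> x))\<^sup>2"
    using test_gagliardo_nirenberg[OF conjunct1[OF test_function_power[OF assms]], of n] conjunct2[OF test_function_power[OF assms], of n]
    by simp
  also have "\<dots> \<le> (L2n M (\<lambda>x. real (Suc n) * \<psi> x ^ n) * L2n M (grad \<psi>))\<^sup>2"
    by (intro power_mono L2_product(2) L C1_Lp2 c) simp
  also have "\<dots> = (real (Suc n))\<^sup>2 * (LINT x|M. \<psi> x ^ (2 * n)) * (L2n M (grad \<psi>))\<^sup>2"
    unfolding power_mult_distrib L2n_sq[of M "\<lambda>x. real (Suc n) * \<psi> x ^ n"] by (simp add: power_mult_distrib power_even_eq)
  also have "\<dots> \<le> (real (Suc n))\<^sup>2 * ((fact n)\<^sup>2 * measure M \<Omega> * L2n M (grad \<psi>) ^ (2 * n)) * (L2n M (grad \<psi>))\<^sup>2"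
    by (intro mult_right_mono mult_left_mono Suc) auto
  also have "\<dots> = (fact (Suc n))\<^sup>2 * measure M \<Omega> * L2n M (grad \<psi>) ^ (2 * Suc n)"
    by (simp add: power_mult_distrib power2_eq_square algebra_simps)
  finally show ?case .
qed

text \<open>A form of Young's inequality with an even integer exponent in place of the conjugate
  exponent \<open>p / (p - 1)\<close>: compare b with \<open>a powr (p - 1)\<close>. The summand 1
  covers \<open>b \<le> 1\<close>, where raising the exponent goes the wrong way.\<close>

lemma young_power:
  fixes a b p :: real and s :: nat
  assumes ab: "a \<ge> 0" "b \<ge> 0" and p: "p > 1" and s: "2 * real s \<ge> p / (p - 1)"
  shows "a * b \<le> a powr p + 1 + b ^ (2 * s)"
proof (cases "b \<le> a powr (p - 1)")
  case True
  show ?thesis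
  proof (cases "a = 0")
    case False
    then have "a * b \<le> a * a powr (p - 1)" using True ab by (intro mult_left_mono) auto
    also have "\<dots> = a powr p" using False ab by (simp add: powr_diff)
    finally show ?thesis using ab by (smt (verit) zero_le_power)
  qed (use ab in auto)
next
  case False
  have bpos: "b > 0" using False powr_ge_zero[of a "p - 1"] by linarith
  have "a \<le> b powr (1 / (p - 1))"
  proof (cases "a = 0")
    case False
    have "a = (a powr (p - 1)) powr (1 / (p - 1))" using p ab False by (simp add: powr_powr)
    also have "\<dots> \<le> b powr (1 / (p - 1))" using \<open>\<not> b \<le> a powr (p - 1)\<close> p by (intro powr_mono2) auto
    finally show ?thesis .
  qed simp
  then have "a * b \<le> b powr (1 / (p - 1)) * b" using ab by (intro mult_right_mono)
  also have "\<dots> = b powr (1 / (p - 1) + 1)" using bpos by (simp add: powr_add)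
  also have "1 / (p - 1) + 1 = p / (p - 1)" using p by (simp add: field_simps)
  also have "b powr (p / (p - 1)) \<le> 1 + b ^ (2 * s)"
  proof (cases "b \<le> 1")
    case True
    then have "b powr (p / (p - 1)) \<le> 1" using p bpos by (intro powr_le1) auto
    then show ?thesis using bpos by (smt (verit) zero_le_power)
  next
    case False
    then have "b powr (p / (p - 1)) \<le> b powr (real (2 * s))" using s by (intro powr_mono) auto
    then show ?thesis using bpos by (simp only: powr_realpow)
  qed
  finally show ?thesis using powr_ge_zero[of a p] by linarith
qed

text \<open>In the plane every exponent above 1 suffices, because test functions are bounded in all
  even powers by the gradient norm. Young's inequality is not homogeneous, so it is used for \<psi>
  normalised to gradient norm 1 and the result is scaled back; a vanishing gradient norm forces
  \<psi> = 0 almost everywhere by the Poincare inequality.\<close>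

lemma test_dual_bound:
  fixes f :: "real^2 \<Rightarrow> real"
  assumes f: "Lp M p f" and p: "p > 1"
  shows "\<exists>C\<ge>0. \<forall>\<psi>. tf \<psi> \<longrightarrow> integrable M (\<lambda>x. f x * \<psi> x) \<and> (LINT x|M. \<bar>f x * \<psi> x\<bar>) \<le> C * L2n M (grad \<psi>)"
proof -
  obtain s :: nat where s: "2 * real s \<ge> p / (p - 1)" using real_arch_simple[of "p / (p - 1)"] by (metis (no_types, opaque_lifting) mult_2 of_nat_0_le_iff order_trans le_add_same_cancel1)
  have [measurable]: "f \<in> borel_measurable M" and fi: "integrable M (\<lambda>x. \<bar>f x\<bar> powr p)" using f by (auto simp: Lp_def)
  define C where "C = (LINT x|M. \<bar>f x\<bar> powr p) + measure M \<Omega> + (fact s)\<^sup>2 * measure M \<Omega>"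
  have C: "C \<ge> 0" unfolding C_def by (intro add_nonneg_nonneg integral_nonneg_AE) auto
  have I: "integrable M (\<lambda>x. \<bar>f x * \<psi> x\<bar>) \<and> (LINT x|M. \<bar>f x * \<psi> x\<bar>) \<le> (LINT x|M. \<bar>f x\<bar> powr p) + measure M \<Omega> + (LINT x|M. \<psi> x ^ (2 * s))"
    if t: "tf \<psi>" for \<psi>
  proof -
    have [measurable]: "\<psi> \<in> borel_measurable M" by (rule borel_measurable_M[OF C1_borel[OF test_C1[OF t]]])
    have pi: "integrable M (\<lambda>x. \<psi> x ^ (2 * s))" by (rule continuous_Lp2) (intro continuous_intros C1_continuous test_C1[OF t])
    have le: "\<bar>f x * \<psi> x\<bar> \<le> \<bar>f x\<bar> powr p + 1 + \<psi> x ^ (2 * s)" for x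
      using young_power[OF abs_ge_zero abs_ge_zero p s, of "f x" "\<psi> x"] by (simp add: abs_mult power_even_abs)
    have b: "integrable M (\<lambda>x. \<bar>f x\<bar> powr p + 1 + \<psi> x ^ (2 * s))" using fi pi by simp
    have i: "integrable M (\<lambda>x. \<bar>f x * \<psi> x\<bar>)"
      by (rule Bochner_Integration.integrable_bound[OF b]) (auto intro!: AE_I2 order_trans[OF le])
    have "(LINT x|M. \<bar>f x * \<psi> x\<bar>) \<le> (LINT x|M. \<bar>f x\<bar> powr p + 1 + \<psi> x ^ (2 * s))"
      by (intro integral_mono i b le)
    also have "\<dots> = (LINT x|M. \<bar>f x\<bar> powr p) + measure M \<Omega> + (LINT x|M. \<psi> x ^ (2 * s))"
      using fi pi by (simp add: space_restrict_space)
    finally show ?thesis using i by blast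
  qed
  have "integrable M (\<lambda>x. f x * \<psi> x) \<and> (LINT x|M. \<bar>f x * \<psi> x\<bar>) \<le> C * L2n M (grad \<psi>)" if t: "tf \<psi>" for \<psi>
  proof
    have [measurable]: "\<psi> \<in> borel_measurable M" by (rule borel_measurable_M[OF C1_borel[OF test_C1[OF t]]])
    show "integrable M (\<lambda>x. f x * \<psi> x)" using I[OF t] by (subst integrable_abs_iff[symmetric]) auto
    define l where "l = L2n M (grad \<psi>)"
    show "(LINT x|M. \<bar>f x * \<psi> x\<bar>) \<le> C * L2n M (grad \<psi>)"
    proof (cases "l = 0")
      case True
      then have "L2n M \<psi> = 0" using test_poincare[OF t] L2n_nonneg[of M \<psi>] by (simp add: l_def)
      then have "AE x in M. \<psi> x = 0" using L2n_zero_imp_AE C1_Lp2(1)[OF test_C1[OF t]] by blast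
      then have "(LINT x|M. \<bar>f x * \<psi> x\<bar>) = (LINT x|M. 0)" by (intro integral_cong_AE) auto
      then show ?thesis using True by (simp add: l_def)
    next
      case False
      then have l: "l > 0" using L2n_nonneg[of M "grad \<psi>"] unfolding l_def by linarith
      let ?c = "\<lambda>x. (1 / l) * \<psi> x"
      have tc: "tf ?c" by (rule test_function_scale[OF t])
      have "grad ?c = (\<lambda>x. (1 / l) *\<^sub>R grad \<psi> x)" by (rule grad_scale[OF test_C1[OF t]])
      then have n1: "L2n M (grad ?c) = 1" using L2_scaleR(2)[OF C1_Lp2(2)[OF test_C1[OF t]], of "1 / l"] l by (simp add: l_def)
      have "(LINT x|M. \<bar>f x * ?c x\<bar>) \<le> C" using I[OF tc] test_sobolev_power[OF tc, of s] unfolding n1 C_def by simp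
      moreover have "(\<lambda>x. \<bar>f x * ?c x\<bar>) = (\<lambda>x. (1 / l) * \<bar>f x * \<psi> x\<bar>)" using l by (simp add: abs_mult fun_eq_iff)
      ultimately have "(1 / l) * (LINT x|M. \<bar>f x * \<psi> x\<bar>) \<le> C" by (simp only: integral_mult_right_zero)
      then show ?thesis using l by (simp add: field_simps l_def)
    qed
  qed
  with C show ?thesis by blast
qed

end

text \<open>Uniform limits of convergent sequences converge. This passes convergence from a dense
  set of functionals to all of them.\<close>

lemma convergent_approx:
  fixes a :: "nat \<Rightarrow> real"
  assumes "\<And>\<eta>. \<eta> > 0 \<Longrightarrow> \<exists>b. convergent b \<and> (\<forall>n. \<bar>a n - b n\<bar> \<le> \<eta>)"
  shows "convergent a"
proof -
  have "Cauchy a"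
  proof (rule metric_CauchyI)
    fix e :: real assume "e > 0"
    then obtain b where b: "convergent b" "\<And>n. \<bar>a n - b n\<bar> \<le> e/4" using assms[of "e/4"] by auto
    obtain N where N: "\<And>m n. m \<ge> N \<Longrightarrow> n \<ge> N \<Longrightarrow> dist (b m) (b n) < e/4"
      using metric_CauchyD[OF convergent_Cauchy[OF b(1)], of "e/4"] \<open>e > 0\<close> by auto
    have "dist (a m) (a n) < e" if "m \<ge> N" "n \<ge> N" for m n
      using N[OF that] b(2)[of m] b(2)[of n] unfolding dist_real_def by linarith
    then show "\<exists>N. \<forall>m\<ge>N. \<forall>n\<ge>N. dist (a m) (a n) < e" by blast
  qed
  then show ?thesis by (simp add: Cauchy_convergent_iff)
qed

context bounded_domain begin

subsection \<open>Weak and strong compactness\<close>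

definition ip :: "(real^2 \<Rightarrow> real) \<Rightarrow> (real^2 \<Rightarrow> real) \<Rightarrow> real" where
  "ip v w = (LINT x|M. grad v x \<bullet> grad w x)"

definition nrm :: "(real^2 \<Rightarrow> real) \<Rightarrow> real" where "nrm v = L2n M (grad v)"

text \<open>The bounded linear functionals for the gradient norm. They stand for the dual of the
  closure of the test functions.\<close>

definition bfun :: "((real^2 \<Rightarrow> real) \<Rightarrow> real) \<Rightarrow> bool" where
  "bfun l \<longleftrightarrow> (\<forall>v w. tf v \<longrightarrow> tf w \<longrightarrow> l (\<lambda>x. v x + w x) = l v + l w) \<and>
     (\<forall>c v. tf v \<longrightarrow> l (\<lambda>x. c * v x) = c * l v) \<and> (\<exists>C\<ge>0. \<forall>v. tf v \<longrightarrow> \<bar>l v\<bar> \<le> C * nrm v)"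

lemma test_Lp2: "tf v \<Longrightarrow> Lp M 2 v" and test_grad_Lp2: "tf v \<Longrightarrow> Lp M 2 (grad v)"
  using C1_Lp2 test_C1 by blast+

lemma test_measurable: "tf v \<Longrightarrow> v \<in> borel_measurable M" and test_grad_measurable: "tf v \<Longrightarrow> grad v \<in> borel_measurable M"
  using test_Lp2 test_grad_Lp2 Lp2_measurable by blast+

lemma nrm_nonneg [simp]: "0 \<le> nrm v" by (simp add: nrm_def)

lemma ip_self: "ip v v = (nrm v)\<^sup>2"
  by (simp add: ip_def nrm_def L2n_sq power2_norm_eq_inner)

lemma ip_commute: "ip v w = ip w v"
  by (simp add: ip_def inner_commute)

lemma ip_bound: "tf v \<Longrightarrow> tf w \<Longrightarrow> \<bar>ip v w\<bar> \<le> nrm v * nrm w"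
  unfolding ip_def nrm_def by (intro L2_inner(2) test_grad_Lp2)

lemma grad_test_simps:
  assumes "tf v" "tf w"
  shows "grad (\<lambda>x. v x + w x) = (\<lambda>x. grad v x + grad w x)" "grad (\<lambda>x. v x - w x) = (\<lambda>x. grad v x - grad w x)"
    "grad (\<lambda>x. c * v x) = (\<lambda>x. c *\<^sub>R grad v x)"
  using grad_add grad_diff grad_scale test_C1 assms by blast+

lemma bfun_add: "bfun l \<Longrightarrow> tf v \<Longrightarrow> tf w \<Longrightarrow> l (\<lambda>x. v x + w x) = l v + l w"
  and bfun_scale: "bfun l \<Longrightarrow> tf v \<Longrightarrow> l (\<lambda>x. c * v x) = c * l v"
  and bfun_bound: "bfun l \<Longrightarrow> \<exists>C\<ge>0. \<forall>v. tf v \<longrightarrow> \<bar>l v\<bar> \<le> C * nrm v"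
  unfolding bfun_def by blast+

lemma bfun_diff: "bfun l \<Longrightarrow> tf v \<Longrightarrow> tf w \<Longrightarrow> l (\<lambda>x. v x - w x) = l v - l w"
  using bfun_add[of l v "\<lambda>x. -1 * w x"] bfun_scale[of l w "-1"] test_function_scale[of \<Omega> w "-1"] by simp

lemma bfun_inner_grad: assumes G: "Lp M 2 G" shows "bfun (\<lambda>v. (LINT x|M. G x \<bullet> grad v x))"
  unfolding bfun_def
proof (intro conjI allI impI)
  fix v w assume v: "tf v" and w: "tf w"
  show "(LINT x|M. G x \<bullet> grad (\<lambda>x. v x + w x) x) = (LINT x|M. G x \<bullet> grad v x) + (LINT x|M. G x \<bullet> grad w x)"
    unfolding grad_test_simps[OF v w] inner_add_right
    by (intro Bochner_Integration.integral_add L2_inner(1) G test_grad_Lp2 v w)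
next
  fix v c assume v: "tf v"
  show "(LINT x|M. G x \<bullet> grad (\<lambda>x. c * v x) x) = c * (LINT x|M. G x \<bullet> grad v x)"
    unfolding grad_test_simps(3)[OF v v] by simp
next
  show "\<exists>C\<ge>0. \<forall>v. tf v \<longrightarrow> \<bar>(LINT x|M. G x \<bullet> grad v x)\<bar> \<le> C * nrm v"
    by (rule exI[of _ "L2n M G"]) (use L2_inner(2)[OF G test_grad_Lp2] in \<open>auto simp: nrm_def\<close>)
qed

lemma bfun_ip: "tf w \<Longrightarrow> bfun (ip w)"
  using bfun_inner_grad[OF test_grad_Lp2, of w] unfolding ip_def .

lemma bfun_mult:
  assumes f: "Lp M p f" "p > 1" shows "bfun (\<lambda>v. (LINT x|M. f x * v x))"
proof -
  obtain C where C: "C \<ge> 0" "\<And>v. tf v \<Longrightarrow> integrable M (\<lambda>x. f x * v x)" "\<And>v. tf v \<Longrightarrow> (LINT x|M. \<bar>f x * v x\<bar>) \<le> C * nrm v"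
    using test_dual_bound[OF f] unfolding nrm_def by blast
  have "\<bar>(LINT x|M. f x * v x)\<bar> \<le> C * nrm v" if "tf v" for v
    using order_trans[OF integral_abs_bound C(3)[OF that]] .
  with C show ?thesis unfolding bfun_def
    by (auto simp: distrib_left mult.left_commute)
qed

text \<open>Without completeness the energy Q need not have a minimiser among test functions, hence
  only an approximate Riesz representation. If Q at w is within
  \<open>\<epsilon>\<^sup>2 / 2\<close> of its infimum, no direction v can lower it by more, and the
  possible gain along v is the square of \<open>l v - ip w v\<close> divided by twice the square of
  \<open>nrm v\<close>.\<close>

lemma approx_riesz:
  assumes l: "bfun l" and e: "\<epsilon> > 0"
  shows "\<exists>w. tf w \<and> (\<forall>v. tf v \<longrightarrow> \<bar>l v - ip w v\<bar> \<le> \<epsilon> * nrm v)"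
proof -
  obtain C where C: "C \<ge> 0" "\<And>v. tf v \<Longrightarrow> \<bar>l v\<bar> \<le> C * nrm v" using bfun_bound[OF l] by blast
  define Q where "Q v = (nrm v)\<^sup>2 / 2 - l v" for v
  have low: "Q v \<ge> - (C\<^sup>2 / 2)" if "tf v" for v
  proof -
    have "2 * (C * nrm v) \<le> C\<^sup>2 + (nrm v)\<^sup>2" using sum_squares_bound[of C "nrm v"] by (simp add: mult.assoc)
    then show ?thesis using C(2)[OF that] unfolding Q_def by linarith
  qed
  define m where "m = Inf (Q ` Collect tf)"
  have bdd: "bdd_below (Q ` Collect tf)" using low by (auto intro!: bdd_belowI)
  have mle: "m \<le> Q v" if "tf v" for v unfolding m_def using bdd that by (intro cInf_lower) auto
  have "\<exists>w\<in>Collect tf. Q w < m + \<epsilon>\<^sup>2 / 2"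
    using cInf_lessD[of "Q ` Collect tf" "m + \<epsilon>\<^sup>2 / 2"] test_function_zero e unfolding m_def by auto
  then obtain w where w: "tf w" "Q w < m + \<epsilon>\<^sup>2 / 2" by auto
  have "\<bar>l v - ip w v\<bar> \<le> \<epsilon> * nrm v" if v: "tf v" for v
  proof (cases "nrm v = 0")
    case True
    then show ?thesis using C(2)[OF v] ip_bound[OF w(1) v] by simp
  next
    case False
    then have n: "nrm v > 0" using nrm_nonneg[of v] by linarith
    define a where "a = ip w v - l v"
    \<comment> \<open>The minimiser of the quadratic polynomial t \<mapsto> Q(w + t v).\<close>
    define t where "t = - a / (nrm v)\<^sup>2"
    have tv: "tf (\<lambda>x. t * v x)" by (rule test_function_scale[OF v])
    have wtv: "tf (\<lambda>x. w x + t * v x)" by (rule test_function_add[OF w(1) tv])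
    have i: "integrable M (\<lambda>x. grad w x \<bullet> grad w x)" "integrable M (\<lambda>x. grad w x \<bullet> grad v x)" "integrable M (\<lambda>x. grad v x \<bullet> grad v x)"
      by (intro L2_inner(1) test_grad_Lp2 w v)+
    have "(nrm (\<lambda>x. w x + t * v x))\<^sup>2 = (LINT x|M. grad w x \<bullet> grad w x + (2 * t) * (grad w x \<bullet> grad v x) + t\<^sup>2 * (grad v x \<bullet> grad v x))"
      unfolding ip_self[symmetric] ip_def grad_test_simps(1)[OF w(1) tv] grad_test_simps(3)[OF v v]
      by (rule Bochner_Integration.integral_cong)
         (auto simp: inner_add_left inner_add_right power2_eq_square inner_commute algebra_simps)
    also have "\<dots> = (nrm w)\<^sup>2 + 2 * t * ip w v + t\<^sup>2 * (nrm v)\<^sup>2"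
      using i unfolding ip_self[symmetric] ip_def by simp
    finally have Qv: "Q (\<lambda>x. w x + t * v x) = Q w + t * a + t\<^sup>2 * (nrm v)\<^sup>2 / 2"
      unfolding Q_def bfun_add[OF l w(1) tv] bfun_scale[OF l v] a_def by (simp add: algebra_simps)
    have tq: "t * a + t\<^sup>2 * (nrm v)\<^sup>2 / 2 = - (a\<^sup>2 / (2 * (nrm v)\<^sup>2))"
      using n unfolding t_def by (simp add: field_simps power2_eq_square)
    have "a\<^sup>2 / (2 * (nrm v)\<^sup>2) < \<epsilon>\<^sup>2 / 2" using mle[OF wtv] w(2) Qv tq by linarith
    then have "a\<^sup>2 \<le> (\<epsilon> * nrm v)\<^sup>2" using n by (simp add: field_simps power_mult_distrib)
    then have "\<bar>a\<bar> \<le> \<bar>\<epsilon> * nrm v\<bar>" by (simp only: abs_le_square_iff)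
    then show ?thesis using e n unfolding a_def by (simp add: abs_minus_commute)
  qed
  then show ?thesis using w(1) by blast
qed

lemma L2n_uniform:
  fixes f g :: "real^2 \<Rightarrow> 'b::euclidean_space"
  assumes "f \<in> borel_measurable M" "g \<in> borel_measurable M" "\<And>x. x \<in> \<Omega> \<Longrightarrow> norm (f x - g x) \<le> c" "c \<ge> 0"
  shows "L2n M (\<lambda>x. f x - g x) \<le> c * sqrt (measure M \<Omega>)"
proof -
  have "Lp M 2 (\<lambda>x. c)" by (rule continuous_Lp2) (rule continuous_on_const)
  then have "L2n M (\<lambda>x. f x - g x) \<le> L2n M (\<lambda>x. c)"
    by (rule Lp2_mono(2)) (use assms in \<open>auto simp: space_restrict_space\<close>)
  also have "\<dots> = c * sqrt (measure M \<Omega>)" using assms(4) by (simp add: L2n_def space_restrict_space real_sqrt_mult)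
  finally show ?thesis .
qed

text \<open>Separability: test functions whose gradients have a common modulus of continuity are close in
  \<open>C\<^sup>1\<close> as soon as the gradients are close on a finite net, and the product space of the values on
  a countable dense set is separable.\<close>

lemma countable_dense_tests:
  "\<exists>d :: nat \<Rightarrow> real^2 \<Rightarrow> real. (\<forall>j. tf (d j)) \<and> (\<forall>\<psi> \<epsilon>. tf \<psi> \<longrightarrow> \<epsilon> > 0 \<longrightarrow> (\<exists>j. nrm (\<lambda>x. \<psi> x - d j x) < \<epsilon>))"
proof -
  define Z where "Z = insert 0 (closure \<Omega>)"
  have Z: "compact Z" "Z \<noteq> {}" "\<Omega> \<subseteq> Z" using bounded_domain closure_subset by (auto simp: Z_def)
  obtain Q where Q: "countable Q" "Q \<subseteq> Z" "Z \<subseteq> closure Q" using separable by blast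
  have Q0: "Q \<noteq> {}" using Q(3) Z(2) by auto
  define q where "q = from_nat_into Q"
  have q: "range q = Q" unfolding q_def by (rule range_from_nat_into[OF Q0 Q(1)])
  \<comment> \<open>Test functions sharing one modulus of continuity of the gradient at the scale n.
    For each n every test function lies in \<open>T n m\<close> for some m, since its gradient is
    uniformly continuous on the compact set Z.\<close>
  define T where "T n m = {\<psi>. tf \<psi> \<and> (\<forall>x\<in>Z. \<forall>y\<in>Z. dist x y < 1 / real (Suc m) \<longrightarrow> norm (grad \<psi> x - grad \<psi> y) \<le> 1 / real (Suc n))}" for n m
  have "\<exists>E. countable E \<and> E \<subseteq> T n m \<and> (\<forall>\<psi>\<in>T n m. \<forall>I. finite I \<longrightarrow> (\<exists>w\<in>E. \<forall>i\<in>I. norm (grad w (q i) - grad \<psi> (q i)) < 1 / real (Suc n)))" for n m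
  proof -
    let ?v = "\<lambda>\<psi> i. grad \<psi> (q i)"
    obtain V where V: "countable V" "V \<subseteq> ?v ` T n m" "?v ` T n m \<subseteq> closure V" using separable by blast
    then obtain E where E: "countable E" "E \<subseteq> T n m" "V = ?v ` E" using countable_subset_image[of V ?v "T n m"] by blast
    have "\<exists>w\<in>E. \<forall>i\<in>I. norm (grad w (q i) - grad \<psi> (q i)) < 1 / real (Suc n)" if "\<psi> \<in> T n m" "finite I" for \<psi> I
    proof -
      let ?U = "\<Inter>i\<in>I. {f. norm (f i - grad \<psi> (q i)) < 1 / real (Suc n)}"
      have "open ?U" using that(2)
        by (intro open_INT ballI open_Collect_less continuous_intros continuous_on_product_coordinates)
      moreover have "?v \<psi> \<in> ?U" by simp
      moreover have "?v \<psi> \<in> closure V" using V(3) that(1) by blast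
      ultimately have "V \<inter> ?U \<noteq> {}" using open_Int_closure_eq_empty[of ?U V] by blast
      then show ?thesis using E(3) by auto
    qed
    then show ?thesis using E by blast
  qed
  then obtain E where E: "\<And>n m. countable (E n m)" "\<And>n m. E n m \<subseteq> T n m"
    "\<And>n m \<psi> I. \<psi> \<in> T n m \<Longrightarrow> finite I \<Longrightarrow> \<exists>w\<in>E n m. \<forall>i\<in>I. norm (grad w (q i) - grad \<psi> (q i)) < 1 / real (Suc n)" by metis
  define D where "D = insert (\<lambda>x. 0) (\<Union>n m. E n m)"
  have tD: "tf d" if "d \<in> D" for d using that E(2) test_function_zero unfolding D_def T_def by blast
  have dense: "\<exists>w\<in>D. nrm (\<lambda>x. \<psi> x - w x) < \<epsilon>" if t: "tf \<psi>" and e: "\<epsilon> > 0" for \<psi> \<epsilon>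
  proof -
    define s where "s = sqrt (measure M \<Omega>) + 1"
    have s: "s > 0" unfolding s_def by (simp add: add_nonneg_pos)
    \<comment> \<open>The factor 3 pays for three errors of size \<open>1 / real (Suc n)\<close>:
      moving from x to a net point in either of the two gradients, and their difference at the net
      point.\<close>
    obtain n where n: "inverse (real (Suc n)) < \<epsilon> / s / 3" using reals_Archimedean[of "\<epsilon> / s / 3"] e s by auto
    let ?e = "1 / real (Suc n)"
    have "uniformly_continuous_on Z (grad \<psi>)" by (intro compact_uniformly_continuous C1_continuous_grad test_C1 t Z(1))
    then obtain d where d: "d > 0" "\<And>x y. x \<in> Z \<Longrightarrow> y \<in> Z \<Longrightarrow> dist y x < d \<Longrightarrow> dist (grad \<psi> y) (grad \<psi> x) < ?e"
      unfolding uniformly_continuous_on_def by (metis of_nat_0_less_iff zero_less_Suc zero_less_divide_1_iff)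
    obtain m where "inverse (real (Suc m)) < d" using reals_Archimedean[OF d(1)] by blast
    then have pT: "\<psi> \<in> T n m" unfolding T_def using t d(2) by (force simp: dist_norm inverse_eq_divide)
    let ?b = "\<lambda>i. ball (q i) (1 / real (Suc m))"
    have "Z \<subseteq> (\<Union>i. ?b i)"
    proof
      fix x assume "x \<in> Z"
      then obtain y where "y \<in> Q" "dist y x < 1 / real (Suc m)" using Q(3) closure_approachable[of x Q] by (metis of_nat_0_less_iff subsetD zero_less_Suc zero_less_divide_1_iff)
      then show "x \<in> (\<Union>i. ?b i)" using q by auto
    qed
    then obtain I where I: "finite I" "Z \<subseteq> (\<Union>i\<in>I. ?b i)" using compactE_image[OF Z(1), of UNIV ?b] by auto
    obtain w where w: "w \<in> E n m" "\<And>i. i \<in> I \<Longrightarrow> norm (grad w (q i) - grad \<psi> (q i)) < ?e" using E(3)[OF pT I(1)] by blast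
    have wT: "w \<in> T n m" using w(1) E(2) by blast
    then have tw: "tf w" by (simp add: T_def)
    have "norm (grad \<psi> x - grad w x) \<le> 3 * ?e" if x: "x \<in> \<Omega>" for x
    proof -
      obtain i where i: "i \<in> I" "dist x (q i) < 1 / real (Suc m)" using I(2) Z(3) x by (auto simp: dist_commute)
      have "x \<in> Z" "q i \<in> Z" using x Z(3) Q(2) q by auto
      then have "dist (grad \<psi> x) (grad \<psi> (q i)) \<le> ?e" "dist (grad w x) (grad w (q i)) \<le> ?e"
        using pT wT i(2) unfolding T_def by (auto simp: dist_norm)
      moreover have "dist (grad w (q i)) (grad \<psi> (q i)) < ?e" using w(2)[OF i(1)] by (simp add: dist_norm)
      ultimately show ?thesis
        using dist_triangle[of "grad \<psi> x" "grad w x" "grad \<psi> (q i)"] dist_triangle[of "grad \<psi> (q i)" "grad w x" "grad w (q i)"]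
        unfolding dist_norm[symmetric] by (simp add: dist_commute)
    qed
    then have "nrm (\<lambda>x. \<psi> x - w x) \<le> 3 * ?e * sqrt (measure M \<Omega>)"
      unfolding nrm_def grad_test_simps(2)[OF t tw] by (intro L2n_uniform test_grad_measurable t tw) auto
    also have "\<dots> \<le> 3 * ?e * s" unfolding s_def by (intro mult_left_mono) auto
    also have "\<dots> < \<epsilon>" using n s by (simp add: field_simps)
    finally show ?thesis using w(1) unfolding D_def by blast
  qed
  have "countable D" unfolding D_def using E(1) by auto
  then have r: "range (from_nat_into D) = D" by (intro range_from_nat_into) (auto simp: D_def)
  have "\<exists>j. nrm (\<lambda>x. \<psi> x - from_nat_into D j x) < \<epsilon>" if "tf \<psi>" "\<epsilon> > 0" for \<psi> \<epsilon>
  proof -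
    obtain w where w: "w \<in> D" "nrm (\<lambda>x. \<psi> x - w x) < \<epsilon>" using dense[OF \<open>tf \<psi>\<close> \<open>\<epsilon> > 0\<close>] by blast
    then obtain j where "w = from_nat_into D j" using r by blast
    with w(2) show ?thesis by blast
  qed
  moreover have "tf (from_nat_into D j)" for j using tD r by blast
  ultimately show ?thesis by (intro exI[of _ "from_nat_into D"]) simp
qed

text \<open>Weak sequential compactness without a space in which the limit could live. A diagonal
  argument makes the inner products with a dense sequence converge, \<open>approx_riesz\<close>
  extends this to all bounded functionals, and applied to the limit functional itself it produces a
  sequence w that is Cauchy in the gradient norm and on which every bounded functional has the same
  limit.\<close>

lemma weak_compactness:
  assumes v: "\<And>n. tf (v n)" and C: "\<And>n::nat. nrm (v n) \<le> C"
  shows "\<exists>r w. strict_mono r \<and> (\<forall>k. tf (w k)) \<and> (\<forall>e>0. \<exists>N. \<forall>i\<ge>N. \<forall>j\<ge>N. nrm (\<lambda>x. w i x - w j x) < e) \<and>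
     (\<forall>l. bfun l \<longrightarrow> (\<exists>L. (\<lambda>n. l (v (r n))) \<longlonglongrightarrow> L \<and> (\<lambda>k. l (w k)) \<longlonglongrightarrow> L))"
proof -
  have C0: "C \<ge> 0" using nrm_nonneg[of "v 0"] C[of 0] by linarith
  obtain d :: "nat \<Rightarrow> real^2 \<Rightarrow> real" where d: "\<And>j. tf (d j)" "\<And>\<psi> \<epsilon>. tf \<psi> \<Longrightarrow> \<epsilon> > 0 \<Longrightarrow> \<exists>j. nrm (\<lambda>x. \<psi> x - d j x) < \<epsilon>"
    using countable_dense_tests by blast
  \<comment> \<open>The denominator makes all coordinates bounded by C, as the diagonal argument
    requires, and stays positive when \<open>nrm (d j)\<close> vanishes.\<close>
  define f where "f n j = ip (v n) (d j) / (nrm (d j) + 1)" for n j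
  have "norm (f n j) \<le> C" for n j
  proof -
    have "\<bar>ip (v n) (d j)\<bar> \<le> C * (nrm (d j) + 1)"
      using order_trans[OF ip_bound[OF v d(1)] mult_mono[OF C[of n], of "nrm (d j)" "nrm (d j) + 1"]] C0 by simp
    moreover have "0 < nrm (d j) + 1" using nrm_nonneg[of "d j"] by linarith
    ultimately show ?thesis unfolding f_def by (simp add: abs_divide field_simps)
  qed
  then obtain r where r: "strict_mono r" and lim: "\<And>j. \<exists>l. (\<lambda>n. f (r n) j) \<longlonglongrightarrow> l"
    using function_convergent_subsequence[of "UNIV :: nat set" f C] by (metis UNIV_I countableI_type)
  have conv_d: "convergent (\<lambda>n. ip (v (r n)) (d j))" for j
  proof -
    have "nrm (d j) + 1 \<noteq> 0" using nrm_nonneg[of "d j"] by linarith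
    then have eq: "(\<lambda>n. ip (v (r n)) (d j)) = (\<lambda>n. (nrm (d j) + 1) * f (r n) j)" unfolding f_def by auto
    show ?thesis unfolding eq using lim[of j] by (auto simp: convergent_def intro: tendsto_mult_left)
  qed
  have conv_t: "convergent (\<lambda>n. ip (v (r n)) \<psi>)" if t: "tf \<psi>" for \<psi>
  proof (rule convergent_approx)
    fix \<eta> :: real assume "\<eta> > 0"
    then obtain j where j: "nrm (\<lambda>x. \<psi> x - d j x) < \<eta> / (C + 1)" using d(2)[OF t, of "\<eta> / (C + 1)"] C0 by auto
    have "\<bar>ip (v (r n)) \<psi> - ip (v (r n)) (d j)\<bar> \<le> \<eta>" for n
    proof -
      have "ip (v (r n)) \<psi> - ip (v (r n)) (d j) = ip (v (r n)) (\<lambda>x. \<psi> x - d j x)"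
        using bfun_diff[OF bfun_ip[OF v] t d(1)] by simp
      also have "\<bar>\<dots>\<bar> \<le> nrm (v (r n)) * nrm (\<lambda>x. \<psi> x - d j x)" by (rule ip_bound[OF v test_function_diff[OF t d(1)]])
      also have "\<dots> \<le> C * (\<eta> / (C + 1))" using j C C0 by (intro mult_mono) auto
      also have "\<dots> \<le> \<eta>" using C0 \<open>\<eta> > 0\<close> by (simp add: field_simps)
      finally show ?thesis .
    qed
    then show "\<exists>b. convergent b \<and> (\<forall>n. \<bar>ip (v (r n)) \<psi> - b n\<bar> \<le> \<eta>)" using conv_d by blast
  qed
  have conv_l: "convergent (\<lambda>n. l (v (r n)))" if l: "bfun l" for l
  proof (rule convergent_approx)
    fix \<eta> :: real assume "\<eta> > 0"
    then obtain z where z: "tf z" "\<And>u. tf u \<Longrightarrow> \<bar>l u - ip z u\<bar> \<le> \<eta> / (C + 1) * nrm u" using approx_riesz[OF l, of "\<eta> / (C + 1)"] C0 by auto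
    have "\<bar>l (v (r n)) - ip (v (r n)) z\<bar> \<le> \<eta>" for n
    proof -
      have "\<bar>l (v (r n)) - ip (v (r n)) z\<bar> \<le> \<eta> / (C + 1) * nrm (v (r n))" using z(2)[OF v] by (simp add: ip_commute)
      also have "\<dots> \<le> \<eta> / (C + 1) * C" using C C0 \<open>\<eta> > 0\<close> by (intro mult_left_mono) auto
      also have "\<dots> \<le> \<eta>" using C0 \<open>\<eta> > 0\<close> by (simp add: field_simps)
      finally show ?thesis .
    qed
    then show "\<exists>b. convergent b \<and> (\<forall>n. \<bar>l (v (r n)) - b n\<bar> \<le> \<eta>)" using conv_t[OF z(1)] by blast
  qed
  define L where "L \<psi> = lim (\<lambda>n. ip (v (r n)) \<psi>)" for \<psi>
  have L: "(\<lambda>n. ip (v (r n)) \<psi>) \<longlonglongrightarrow> L \<psi>" if "tf \<psi>" for \<psi>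
    using conv_t[OF that] by (simp add: L_def convergent_LIMSEQ_iff)
  have Lb: "\<bar>L \<psi>\<bar> \<le> C * nrm \<psi>" if t: "tf \<psi>" for \<psi>
  proof (rule LIMSEQ_le_const2[OF tendsto_rabs[OF L[OF t]]], intro exI allI impI)
    fix n show "\<bar>ip (v (r n)) \<psi>\<bar> \<le> C * nrm \<psi>" using ip_bound[OF v t, of "r n"] C[of "r n"] mult_right_mono[OF C[of "r n"] nrm_nonneg[of \<psi>]] by linarith
  qed
  have bL: "bfun L"
    unfolding bfun_def
  proof (intro conjI allI impI)
    fix a b assume a: "tf a" and b: "tf b"
    show "L (\<lambda>x. a x + b x) = L a + L b"
      by (rule LIMSEQ_unique[OF L[OF test_function_add[OF a b]]])
         (use tendsto_add[OF L[OF a] L[OF b]] bfun_add[OF bfun_ip[OF v] a b] in simp)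
  next
    fix c a assume a: "tf a"
    show "L (\<lambda>x. c * a x) = c * L a"
      by (rule LIMSEQ_unique[OF L[OF test_function_scale[OF a]]])
         (use tendsto_mult_left[OF L[OF a], of c] bfun_scale[OF bfun_ip[OF v] a] in simp)
  qed (use Lb C0 in blast)
  have "\<exists>w. tf w \<and> (\<forall>u. tf u \<longrightarrow> \<bar>L u - ip w u\<bar> \<le> 1 / real (Suc k) * nrm u)" for k
    by (rule approx_riesz[OF bL]) simp
  then obtain w where w: "\<And>k. tf (w k)" "\<And>k u. tf u \<Longrightarrow> \<bar>L u - ip (w k) u\<bar> \<le> 1 / real (Suc k) * nrm u" by metis
  have wC: "nrm (w k) \<le> C + 1" for k
  proof -
    have "(nrm (w k))\<^sup>2 \<le> \<bar>L (w k)\<bar> + 1 / real (Suc k) * nrm (w k)" using w(2)[OF w(1), of k k] unfolding ip_self by linarith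
    also have "\<dots> \<le> C * nrm (w k) + 1 * nrm (w k)" by (intro add_mono Lb w mult_right_mono) auto
    finally have "nrm (w k) * nrm (w k) \<le> (C + 1) * nrm (w k)" by (simp add: power2_eq_square algebra_simps)
    then show ?thesis using nrm_nonneg[of "w k"] C0 by (cases "nrm (w k) = 0") auto
  qed
  have wd: "nrm (\<lambda>x. w i x - w j x) \<le> 1 / real (Suc i) + 1 / real (Suc j)" for i j
  proof -
    let ?z = "\<lambda>x. w i x - w j x"
    have tz: "tf ?z" by (rule test_function_diff[OF w(1) w(1)])
    have "(nrm ?z)\<^sup>2 = ip (w i) ?z - ip (w j) ?z"
      unfolding ip_self[symmetric] using bfun_diff[OF bfun_ip[OF tz] w(1)[of i] w(1)[of j]] by (simp add: ip_commute)
    also have "\<dots> \<le> (1 / real (Suc i) + 1 / real (Suc j)) * nrm ?z"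
      using w(2)[OF tz, of i] w(2)[OF tz, of j] unfolding distrib_right by linarith
    finally have "nrm ?z * nrm ?z \<le> (1 / real (Suc i) + 1 / real (Suc j)) * nrm ?z" by (simp add: power2_eq_square)
    then show ?thesis using nrm_nonneg[of ?z] by (cases "nrm ?z = 0") auto
  qed
  have cau: "\<exists>N. \<forall>i\<ge>N. \<forall>j\<ge>N. nrm (\<lambda>x. w i x - w j x) < e" if e: "e > 0" for e
  proof -
    obtain N where N: "inverse (real (Suc N)) < e / 2" using reals_Archimedean[of "e / 2"] e by auto
    have *: "1 / real (Suc i) < e / 2" if "i \<ge> N" for i
      using N that by (smt (verit) frac_le inverse_eq_divide of_nat_0_less_iff of_nat_mono Suc_le_mono zero_less_Suc)
    then have "nrm (\<lambda>x. w i x - w j x) < e" if "i \<ge> N" "j \<ge> N" for i j using wd[of i j] *[OF that(1)] *[OF that(2)] by linarith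
    then show ?thesis by blast
  qed
  have inv0: "(\<lambda>k. 1 / real (Suc k)) \<longlonglongrightarrow> 0" using LIMSEQ_inverse_real_of_nat by (simp add: inverse_eq_divide)
  have Lw: "(\<lambda>k. ip (w k) u) \<longlonglongrightarrow> L u" if u: "tf u" for u
  proof -
    have "(\<lambda>k. 1 / real (Suc k) * nrm u) \<longlonglongrightarrow> 0" using tendsto_mult_left_zero[OF inv0] by blast
    then have "(\<lambda>k. L u - ip (w k) u) \<longlonglongrightarrow> 0" by (rule Lim_null_comparison[rotated]) (use w(2)[OF u] in auto)
    from tendsto_diff[OF tendsto_const[of "L u"] this] show ?thesis by simp
  qed
  have "\<exists>l'. (\<lambda>n. l (v (r n))) \<longlonglongrightarrow> l' \<and> (\<lambda>k. l (w k)) \<longlonglongrightarrow> l'" if l: "bfun l" for l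
  proof -
    define a where "a = lim (\<lambda>n. l (v (r n)))"
    have a: "(\<lambda>n. l (v (r n))) \<longlonglongrightarrow> a" using conv_l[OF l] by (simp add: a_def convergent_LIMSEQ_iff)
    have "(\<lambda>k. l (w k)) \<longlonglongrightarrow> a"
    proof (rule LIMSEQ_I)
      fix e :: real assume e: "e > 0"
      define \<eta> where "\<eta> = (e / 4) / (C + 1)"
      have \<eta>: "\<eta> > 0" using e C0 by (simp add: \<eta>_def)
      obtain z where z: "tf z" "\<And>u. tf u \<Longrightarrow> \<bar>l u - ip z u\<bar> \<le> \<eta> * nrm u" using approx_riesz[OF l \<eta>] by auto
      have s: "\<eta> * t \<le> e / 4" if "t \<le> C + 1" for t
      proof -
        have "\<eta> * (C + 1) = e / 4" using nonzero_eq_divide_eq[of "C + 1" \<eta> "e / 4"] C0 \<eta>_def by simp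
        then show ?thesis using mult_left_mono[OF that, of \<eta>] \<eta> by linarith
      qed
      have 1: "\<bar>a - L z\<bar> \<le> e / 4"
      proof (rule LIMSEQ_le_const2[OF tendsto_rabs[OF tendsto_diff[OF a L[OF z(1)]]]], intro exI allI impI)
        fix n show "\<bar>l (v (r n)) - ip (v (r n)) z\<bar> \<le> e / 4"
          using z(2)[OF v, of "r n"] s[of "nrm (v (r n))"] C[of "r n"] by (simp add: ip_commute)
      qed
      obtain N where N: "\<And>k. k \<ge> N \<Longrightarrow> \<bar>ip (w k) z - L z\<bar> < e / 4"
        using LIMSEQ_D[OF Lw[OF z(1)], of "e/4"] e by auto
      have "\<bar>l (w k) - a\<bar> < e" if "k \<ge> N" for k
        using z(2)[OF w(1)[of k]] s[OF wC[of k]] 1 N[OF that] ip_commute[of z "w k"] e by linarith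
      then show "\<exists>no. \<forall>n\<ge>no. norm (l (w n) - a) < e" by (intro exI[of _ N]) simp
    qed
    with a show ?thesis by blast
  qed
  with r w(1) cau show ?thesis by blast
qed

end

section \<open>Segment averages, Rellich compactness and the closure of the test functions\<close>

context bounded_domain begin

text \<open>Averages over segments in one coordinate direction: their values at a point are bounded
  functionals on the test functions, which makes them converge pointwise along weakly
  convergent sequences.\<close>

definition seg_avg :: "real \<Rightarrow> (real^2 \<Rightarrow> real) \<Rightarrow> real^2 \<Rightarrow> real" where
  "seg_avg h v p = (1 / h) * (\<integral>\<tau>. indicator {0..h} \<tau> *\<^sub>R v (p + \<tau> *\<^sub>R axis 2 1) \<partial>lborel)"

lemma seg_integrable:
  assumes "C1 v" shows "integrable lborel (\<lambda>\<tau>. indicator {0..h} \<tau> *\<^sub>R v (p + \<tau> *\<^sub>R axis 2 1))"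
  by (rule borel_integrable_compact[OF compact_Icc])
     (intro continuous_on_compose2[OF C1_continuous[OF assms, of UNIV]] continuous_intros, auto)

text \<open>Point values of a function are not controlled by the gradient norm in the plane, but
  integrals over a segment are: this is the second form of the Gagliardo-Nirenberg
  inequality.\<close>

lemma seg_avg_bound:
  assumes v: "tf v" and h: "h > 0"
  shows "\<bar>seg_avg h v p\<bar> \<le> (1 / h) * sqrt (measure M \<Omega>) * nrm v"
proof -
  let ?e = "axis 2 1 :: real^2"
  obtain K where K: "compact K" "\<And>x. x \<notin> K \<Longrightarrow> v x = 0" using test_function_supp[OF v] by metis
  have "ennreal \<bar>\<integral>\<tau>. indicator {0..h} \<tau> *\<^sub>R v (p + \<tau> *\<^sub>R ?e) \<partial>lborel\<bar>
      \<le> (\<integral>\<^sup>+\<tau>. norm (indicator {0..h} \<tau> *\<^sub>R v (p + \<tau> *\<^sub>R ?e)) \<partial>lborel)"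
    using integral_norm_bound_ennreal[OF seg_integrable[OF test_C1[OF v]]] by simp
  also have "\<dots> \<le> (\<integral>\<^sup>+\<tau>. ennreal \<bar>v (p + \<tau> *\<^sub>R ?e)\<bar> \<partial>lborel)"
    by (rule nn_integral_mono) (auto simp: indicator_def)
  also have "\<dots> \<le> (\<integral>\<^sup>+x. ennreal (norm (grad v x)) \<partial>lborel)"
    by (rule gagliardo_nirenberg_plane(2)[OF test_C1[OF v] compact_imp_bounded[OF K(1)] K(2)]) simp_all
  also have "\<dots> = ennreal (LINT x|M. norm (grad v x))" by (rule test_grad_nn[OF v])
  also have "\<dots> \<le> ennreal (sqrt (measure M \<Omega>) * nrm v)"
    using L2_norm_integrable(3)[OF test_grad_Lp2[OF v]] by (intro ennreal_leI) (simp add: nrm_def space_restrict_space)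
  finally have "\<bar>\<integral>\<tau>. indicator {0..h} \<tau> *\<^sub>R v (p + \<tau> *\<^sub>R ?e) \<partial>lborel\<bar> \<le> sqrt (measure M \<Omega>) * nrm v" by simp
  then have "(1 / h) * \<bar>\<integral>\<tau>. indicator {0..h} \<tau> *\<^sub>R v (p + \<tau> *\<^sub>R ?e) \<partial>lborel\<bar> \<le> (1 / h) * (sqrt (measure M \<Omega>) * nrm v)"
    using h by (intro mult_left_mono) auto
  then show ?thesis using h unfolding seg_avg_def abs_mult by (simp add: mult.assoc)
qed

lemma bfun_seg_avg: assumes h: "h > 0" shows "bfun (\<lambda>v. seg_avg h v p)"
  unfolding bfun_def
proof (intro conjI allI impI)
  fix v w assume v: "tf v" and w: "tf w"
  show "seg_avg h (\<lambda>x. v x + w x) p = seg_avg h v p + seg_avg h w p"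
    unfolding seg_avg_def scaleR_add_right
    using seg_integrable[OF test_C1[OF v], of h p] seg_integrable[OF test_C1[OF w], of h p]
    by (subst Bochner_Integration.integral_add) (auto simp: distrib_left)
next
  fix c v assume v: "tf v"
  show "seg_avg h (\<lambda>x. c * v x) p = c * seg_avg h v p"
    unfolding seg_avg_def using Bochner_Integration.integral_mult_right_zero[of lborel c "\<lambda>\<tau>. indicator {0..h} \<tau> *\<^sub>R v (p + \<tau> *\<^sub>R axis 2 1)"]
    by (simp add: mult.left_commute)
next
  show "\<exists>C\<ge>0. \<forall>v. tf v \<longrightarrow> \<bar>seg_avg h v p\<bar> \<le> C * nrm v"
    using seg_avg_bound[OF _ h] h by (intro exI[of _ "(1 / h) * sqrt (measure M \<Omega>)"]) auto
qed

lemma seg_avg_measurable: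
  assumes "tf v" shows "seg_avg h v \<in> borel_measurable borel"
proof -
  have [measurable]: "v \<in> borel_measurable borel" by (rule C1_borel[OF test_C1[OF assms]])
  have "(\<lambda>q. fst q + snd q *\<^sub>R (axis 2 1 :: real^2)) \<in> borel_measurable (borel \<Otimes>\<^sub>M lborel)" by measurable
  then have [measurable]: "(\<lambda>q. v (fst q + snd q *\<^sub>R axis 2 1)) \<in> borel_measurable (borel \<Otimes>\<^sub>M lborel)" by measurable
  have "(\<lambda>p. \<integral>\<tau>. indicator {0..h} \<tau> *\<^sub>R v (p + \<tau> *\<^sub>R axis 2 1) \<partial>lborel) \<in> borel_measurable borel"
    by (rule lborel.borel_measurable_lebesgue_integral) (simp add: split_def)
  then show ?thesis unfolding seg_avg_def[abs_def] by measurable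
qed

text \<open>The deviation at p is at most the integral of the gradient over the segment.
  Cauchy-Schwarz gains one factor h, integrating over the segment a second one, since translations
  preserve the integral over the plane.\<close>

lemma seg_avg_error:
  assumes v: "tf v" and h: "h > 0"
  shows "L2n M (\<lambda>p. v p - seg_avg h v p) \<le> h * nrm v"
proof -
  let ?e = "axis 2 1 :: real^2"
  have c: "C1 v" by (rule test_C1[OF v])
  have [measurable]: "v \<in> borel_measurable borel" "grad v \<in> borel_measurable borel" by (rule C1_borel[OF c] grad_borel[OF c])+
  define g where "g p \<tau> = ennreal (norm (grad v (p + \<tau> *\<^sub>R ?e))) * indicator {0..h} \<tau>" for p \<tau>
  have [measurable]: "(\<lambda>q. fst q + snd q *\<^sub>R ?e) \<in> borel_measurable (lborel \<Otimes>\<^sub>M lborel)"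
  proof -
    have "continuous_on UNIV (\<lambda>q :: (real^2) \<times> real. fst q + snd q *\<^sub>R ?e)" by (intro continuous_intros)
    then show ?thesis unfolding lborel_prod using borel_measurable_continuous_onI by simp
  qed
  have gm [measurable]: "g p \<in> borel_measurable lborel" for p unfolding g_def by measurable
  let ?G = "\<lambda>p. \<integral>\<^sup>+\<sigma>. g p \<sigma> \<partial>lborel"
  have inc: "ennreal \<bar>v p - v (p + \<tau> *\<^sub>R ?e)\<bar> \<le> ?G p" if "0 \<le> \<tau>" "\<tau> \<le> h" for p \<tau>
  proof -
    have "ennreal \<bar>v (p + \<tau> *\<^sub>R ?e) - v (p + 0 *\<^sub>R ?e)\<bar> \<le> (\<integral>\<^sup>+\<sigma>. ennreal (norm (grad v (p + \<sigma> *\<^sub>R ?e))) * indicator {0..\<tau>} \<sigma> \<partial>lborel)"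
      by (rule C1_increment[OF c]) (use that in auto)
    also have "\<dots> \<le> ?G p" unfolding g_def by (rule nn_integral_mono) (use that in \<open>auto simp: indicator_def\<close>)
    finally show ?thesis by (simp add: abs_minus_commute)
  qed
  have err: "ennreal \<bar>v p - seg_avg h v p\<bar> \<le> ?G p" for p
  proof -
    have i1: "integrable lborel (\<lambda>\<tau>. indicator {0..h} \<tau> *\<^sub>R v p)" using h by (intro integrable_real_indicator integrable_scaleR_left) auto
    note i2 = seg_integrable[OF c, of h p]
    let ?d = "\<lambda>\<tau>. indicator {0..h} \<tau> *\<^sub>R (v p - v (p + \<tau> *\<^sub>R ?e))"
    have dist: "?d = (\<lambda>\<tau>. indicator {0..h} \<tau> *\<^sub>R v p - indicator {0..h} \<tau> *\<^sub>R v (p + \<tau> *\<^sub>R ?e))"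
      by (simp only: scaleR_diff_right)
    have "(\<integral>\<tau>. indicator {0..h} \<tau> *\<^sub>R v p \<partial>lborel) = h * v p" using h by simp
    then have "v p = (1 / h) * (\<integral>\<tau>. indicator {0..h} \<tau> *\<^sub>R v p \<partial>lborel)" using h by (metis less_irrefl mult.assoc mult_1 nonzero_eq_divide_eq times_divide_eq_left)
    then have "v p - seg_avg h v p = (1 / h) * ((\<integral>\<tau>. indicator {0..h} \<tau> *\<^sub>R v p \<partial>lborel) - (\<integral>\<tau>. indicator {0..h} \<tau> *\<^sub>R v (p + \<tau> *\<^sub>R ?e) \<partial>lborel))"
      unfolding seg_avg_def by (simp only: right_diff_distrib)
    also have "\<dots> = (1 / h) * (\<integral>\<tau>. ?d \<tau> \<partial>lborel)"
      unfolding dist using Bochner_Integration.integral_diff[OF i1 i2] by (simp only:)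
    finally have eq: "v p - seg_avg h v p = (1 / h) * (\<integral>\<tau>. ?d \<tau> \<partial>lborel)" .
    have i3: "integrable lborel ?d"
      unfolding dist by (rule Bochner_Integration.integrable_diff[OF i1 i2])
    have "ennreal \<bar>\<integral>\<tau>. ?d \<tau> \<partial>lborel\<bar> \<le> (\<integral>\<^sup>+\<tau>. norm (?d \<tau>) \<partial>lborel)"
      using integral_norm_bound_ennreal[OF i3] by simp
    also have "\<dots> \<le> (\<integral>\<^sup>+\<tau>. ?G p * indicator {0..h} \<tau> \<partial>lborel)"
      by (rule nn_integral_mono) (use inc[of _ p] in \<open>auto simp: indicator_def\<close>)
    also have "\<dots> = ?G p * ennreal h" using h by (simp add: nn_integral_cmult_indicator)
    finally have "ennreal (1 / h) * ennreal \<bar>\<integral>\<tau>. ?d \<tau> \<partial>lborel\<bar> \<le> ennreal (1 / h) * (?G p * ennreal h)"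
      by (rule mult_left_mono) simp
    also have "\<dots> = ?G p * (ennreal h * ennreal (1 / h))" by (simp only: mult.assoc mult.commute mult.left_commute)
    also have "ennreal h * ennreal (1 / h) = 1" using h by (simp flip: ennreal_mult)
    finally show ?thesis unfolding eq abs_mult using h by (subst ennreal_mult) auto
  qed
  have sq: "(?G p)\<^sup>2 \<le> ennreal h * (\<integral>\<^sup>+\<sigma>. (g p \<sigma>)\<^sup>2 \<partial>lborel)" for p
  proof -
    have "g p \<sigma> * indicator {0..h} \<sigma> = g p \<sigma>" for \<sigma> by (simp add: g_def indicator_def)
    moreover have "(indicator {0..h} \<sigma> :: ennreal)\<^sup>2 = indicator {0..h} \<sigma>" for \<sigma> by (simp add: indicator_def)
    ultimately show ?thesis using Cauchy_Schwarz_nn_integral[of "g p" lborel "indicator {0..h}"] h by (simp add: mult.commute)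
  qed
  have gsq: "(g p \<sigma>)\<^sup>2 = ennreal ((norm (grad v (p + \<sigma> *\<^sub>R ?e)))\<^sup>2) * indicator {0..h} \<sigma>" for p \<sigma>
    by (simp add: g_def indicator_def ennreal_power)
  have [measurable]: "seg_avg h v \<in> borel_measurable borel" by (rule seg_avg_measurable[OF v])
  obtain K where K: "K \<subseteq> \<Omega>" "\<And>x. x \<notin> K \<Longrightarrow> grad v x = 0" using test_function_supp[OF v] by metis
  have "(\<integral>\<^sup>+p. ennreal ((norm (v p - seg_avg h v p))\<^sup>2) \<partial>M) \<le> (\<integral>\<^sup>+p. ennreal ((norm (v p - seg_avg h v p))\<^sup>2) \<partial>lborel)"
    by (subst nn_integral_restrict_space) (auto simp: nn_integral_completion indicator_def intro!: nn_integral_mono)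
  also have "\<dots> \<le> (\<integral>\<^sup>+p. ennreal h * (\<integral>\<^sup>+\<sigma>. (g p \<sigma>)\<^sup>2 \<partial>lborel) \<partial>lborel)"
  proof (rule nn_integral_mono)
    fix p
    have "ennreal ((norm (v p - seg_avg h v p))\<^sup>2) = (ennreal \<bar>v p - seg_avg h v p\<bar>)\<^sup>2" by (simp add: ennreal_power)
    also have "\<dots> \<le> (?G p)\<^sup>2" by (rule power_mono[OF err]) simp
    also note sq
    finally show "ennreal ((norm (v p - seg_avg h v p))\<^sup>2) \<le> ennreal h * (\<integral>\<^sup>+\<sigma>. (g p \<sigma>)\<^sup>2 \<partial>lborel)" .
  qed
  also have "\<dots> = ennreal h * (\<integral>\<^sup>+p. \<integral>\<^sup>+\<sigma>. (g p \<sigma>)\<^sup>2 \<partial>lborel \<partial>lborel)"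
    unfolding gsq by (rule nn_integral_cmult) measurable
  also have "(\<integral>\<^sup>+p. \<integral>\<^sup>+\<sigma>. (g p \<sigma>)\<^sup>2 \<partial>lborel \<partial>lborel) = (\<integral>\<^sup>+\<sigma>. \<integral>\<^sup>+p. (g p \<sigma>)\<^sup>2 \<partial>lborel \<partial>lborel)"
    unfolding gsq by (rule lborel_pair.Fubini'[symmetric]) (unfold split_def, measurable)
  also have "\<dots> = (\<integral>\<^sup>+\<sigma>. ennreal ((nrm v)\<^sup>2) * indicator {0..h} \<sigma> \<partial>lborel)"
  proof (rule nn_integral_cong)
    fix \<sigma> :: real
    have "(\<integral>\<^sup>+p. ennreal ((norm (grad v (p + \<sigma> *\<^sub>R ?e)))\<^sup>2) \<partial>lborel) = (\<integral>\<^sup>+p. ennreal ((norm (grad v p))\<^sup>2) \<partial>distr lborel borel ((+) (\<sigma> *\<^sub>R ?e)))"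
      by (subst nn_integral_distr) (auto simp: add.commute)
    also have "\<dots> = (\<integral>\<^sup>+p. ennreal ((norm (grad v p))\<^sup>2) \<partial>M)"
      unfolding lborel_distr_plus by (rule nn_integral_lebesgue_on_eq[symmetric]) (use K in auto)
    also have "\<dots> = ennreal ((nrm v)\<^sup>2)" unfolding nrm_def by (rule nn_integral_L2n[OF test_grad_Lp2[OF v]])
    finally have "(\<integral>\<^sup>+p. ennreal ((norm (grad v (p + \<sigma> *\<^sub>R ?e)))\<^sup>2) \<partial>lborel) = ennreal ((nrm v)\<^sup>2)" .
    then show "(\<integral>\<^sup>+p. (g p \<sigma>)\<^sup>2 \<partial>lborel) = ennreal ((nrm v)\<^sup>2) * indicator {0..h} \<sigma>"
      unfolding gsq by (subst nn_integral_multc) auto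
  qed
  also have "\<dots> = ennreal ((nrm v)\<^sup>2) * ennreal h" using h by (simp add: nn_integral_cmult_indicator)
  also have "ennreal h * (ennreal ((nrm v)\<^sup>2) * ennreal h) = ennreal ((h * nrm v)\<^sup>2)"
    using h by (simp add: power_mult_distrib power2_eq_square mult.commute mult.left_commute flip: ennreal_mult)
  finally show ?thesis
    by (intro L2n_le_nn(2) borel_measurable_M) (use h in auto)
qed

text \<open>For fixed h the averages converge at every point and are uniformly bounded, hence
  converge in L2 on the bounded domain. They are within \<open>h * C\<close> of the functions
  themselves, uniformly in n, so the functions form a Cauchy sequence. With this h the approximation
  error stays below a quarter of e.\<close>

lemma rellich:
  assumes v: "\<And>n. tf (v n)" and C: "\<And>n::nat. nrm (v n) \<le> C" and conv: "\<And>l. bfun l \<Longrightarrow> convergent (\<lambda>n. l (v n))"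
    and e: "e > 0"
  shows "\<exists>N. \<forall>i\<ge>N. \<forall>j\<ge>N. L2n M (\<lambda>x. v i x - v j x) < e"
proof -
  have C0: "C \<ge> 0" using nrm_nonneg[of "v 0"] C[of 0] by linarith
  define h where "h = e / (4 * (C + 1))"
  have h: "h > 0" using e C0 by (simp add: h_def)
  have hC: "h * nrm (v n) < e / 4" for n
  proof -
    have "h * nrm (v n) < h * (C + 1)" using C[of n] h by (intro mult_strict_left_mono) auto
    also have "\<dots> = e / 4"
    proof -
      have "C + 1 > 0" using C0 by simp
      then have "4 * (C + 1) > 0" by simp
      then have "4 * (C + 1) \<noteq> 0" by (rule less_imp_neq[symmetric])
      then have "h * (4 * (C + 1)) = e" using nonzero_eq_divide_eq h_def by blast
      then show ?thesis by (simp add: algebra_simps)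
    qed
    finally show ?thesis .
  qed
  define A where "A p = lim (\<lambda>n. seg_avg h (v n) p)" for p
  have lim: "(\<lambda>n. seg_avg h (v n) p) \<longlonglongrightarrow> A p" for p
    using conv[OF bfun_seg_avg[OF h, of p]] by (simp add: A_def convergent_LIMSEQ_iff)
  have m: "seg_avg h (v n) \<in> borel_measurable M" for n by (rule borel_measurable_M[OF seg_avg_measurable[OF v]])
  have mA: "A \<in> borel_measurable M" by (rule borel_measurable_LIMSEQ_real[OF lim m])
  define B where "B = (1 / h) * sqrt (measure M \<Omega>) * C"
  have bd: "\<bar>seg_avg h (v n) p\<bar> \<le> B" for n p
    unfolding B_def using order_trans[OF seg_avg_bound[OF v h] mult_left_mono[OF C]] h by simp
  have one: "Lp M 2 (\<lambda>x. 1 :: real)" by (rule continuous_Lp2) (rule continuous_on_const)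
  have "(\<lambda>n. L2n M (\<lambda>x. (seg_avg h (v n) x - A x) *\<^sub>R (1::real))) \<longlonglongrightarrow> 0"
    by (rule L2_dominated_convergence[OF one m mA]) (use bd lim in auto)
  then have "(\<lambda>n. L2n M (\<lambda>x. seg_avg h (v n) x - A x)) \<longlonglongrightarrow> 0" by simp
  then obtain N where N: "\<And>n. n \<ge> N \<Longrightarrow> L2n M (\<lambda>x. seg_avg h (v n) x - A x) < e / 4"
    using LIMSEQ_D[of _ 0 "e/4"] e by fastforce
  have LA: "Lp M 2 (seg_avg h (v n))" for n
    by (rule Lp2_mono(1)[OF L2_mult_left(1)[OF one, of B] m]) (use order_trans[OF bd[of n] abs_ge_self] in \<open>auto intro!: AE_I2\<close>)
  have LA': "Lp M 2 A"
  proof (rule Lp2_mono(1)[OF L2_mult_left(1)[OF one, of B] mA])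
    have "\<bar>A p\<bar> \<le> B" for p by (rule LIMSEQ_le_const2[OF tendsto_rabs[OF lim]]) (use bd in auto)
    then show "AE x in M. norm (A x) \<le> norm (B * 1)" using order_trans[OF _ abs_ge_self] by (auto intro!: AE_I2)
  qed
  have "L2n M (\<lambda>x. v i x - v j x) < e" if "i \<ge> N" "j \<ge> N" for i j
  proof -
    have Lv: "Lp M 2 (v k)" for k by (rule test_Lp2[OF v])
    have d: "L2n M (\<lambda>x. v k x - A x) < e / 2" if "k \<ge> N" for k
    proof -
      have "L2n M (\<lambda>x. v k x - A x) \<le> L2n M (\<lambda>x. v k x - seg_avg h (v k) x) + L2n M (\<lambda>x. seg_avg h (v k) x - A x)"
        by (rule L2_diff_triangle[OF Lv LA LA'])
      also have "\<dots> < e/4 + e/4" using seg_avg_error[OF v h, of k] hC[of k] N[OF that] by linarith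
      finally show ?thesis by simp
    qed
    have "L2n M (\<lambda>x. v i x - v j x) \<le> L2n M (\<lambda>x. v i x - A x) + L2n M (\<lambda>x. A x - v j x)"
      by (rule L2_diff_triangle[OF Lv LA' Lv])
    then show ?thesis using d[OF that(1)] d[OF that(2)] L2n_minus_commute[of M A "v j"] by linarith
  qed
  then show ?thesis by blast
qed

text \<open>The space usually written with a subscript 0, as the closure of the pairs of a test
  function and its gradient. Carrying the gradient as an argument spares every use a choice of weak
  gradient.\<close>

definition H0 :: "(real^2 \<Rightarrow> real) \<Rightarrow> (real^2 \<Rightarrow> real^2) \<Rightarrow> bool" where
  "H0 f g \<longleftrightarrow> Lp M 2 f \<and> Lp M 2 g \<and> (\<exists>v. (\<forall>k. tf (v k)) \<and>
     L2lim M v f \<and> L2lim M (\<lambda>k. grad (v k)) g)"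

abbreviation weak_lim :: "(nat \<Rightarrow> real^2 \<Rightarrow> real^2) \<Rightarrow> (real^2 \<Rightarrow> real^2) \<Rightarrow> bool" where
  "weak_lim F g \<equiv> \<forall>G. Lp M 2 G \<longrightarrow> (\<lambda>n. (LINT x|M. G x \<bullet> F n x)) \<longlonglongrightarrow> (LINT x|M. G x \<bullet> g x)"

theorem H0_compactness:
  assumes v: "\<And>n. tf (v n)" and C: "\<And>n::nat. nrm (v n) \<le> C"
  shows "\<exists>r f g. strict_mono r \<and> H0 f g \<and> L2lim M (\<lambda>n. v (r n)) f \<and> weak_lim (\<lambda>n. grad (v (r n))) g"
proof -
  obtain r w where r: "strict_mono r" and w: "\<And>k. tf (w k)"
    and cau: "\<And>e. e > 0 \<Longrightarrow> \<exists>N. \<forall>i\<ge>N. \<forall>j\<ge>N. nrm (\<lambda>x. w i x - w j x) < e"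
    and lim: "\<And>l. bfun l \<Longrightarrow> \<exists>L. (\<lambda>n. l (v (r n))) \<longlonglongrightarrow> L \<and> (\<lambda>k. l (w k)) \<longlonglongrightarrow> L"
    using weak_compactness[of v C, OF v C] by blast
  have wd: "tf (\<lambda>x. w i x - w j x)" for i j by (rule test_function_diff[OF w w])
  have "\<exists>g. Lp M 2 g \<and> L2lim M (\<lambda>k. grad (w k)) g"
    by (rule L2_complete[OF test_grad_Lp2[OF w]]) (use cau in \<open>simp add: nrm_def grad_test_simps(2)[OF w w]\<close>)
  then obtain g where g: "Lp M 2 g" "L2lim M (\<lambda>k. grad (w k)) g" by blast
  have "\<exists>f. Lp M 2 f \<and> L2lim M w f"
  proof (rule L2_complete[OF test_Lp2[OF w]])
    fix e :: real assume "e > 0"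
    define s where "s = sqrt (measure M \<Omega>) + 1"
    have s: "s > 0" unfolding s_def by (simp add: add_nonneg_pos)
    obtain N where N: "\<And>i j. i \<ge> N \<Longrightarrow> j \<ge> N \<Longrightarrow> nrm (\<lambda>x. w i x - w j x) < e / s" using cau[of "e / s"] s \<open>e > 0\<close> by auto
    have "L2n M (\<lambda>x. w i x - w j x) < e" if "i \<ge> N" "j \<ge> N" for i j
    proof -
      have "L2n M (\<lambda>x. w i x - w j x) \<le> s * nrm (\<lambda>x. w i x - w j x)"
        using test_poincare[OF wd, of i j] unfolding nrm_def[symmetric] s_def by (rule order_trans[OF _ mult_right_mono]) auto
      also have "\<dots> < e" using N[OF that] s by (simp add: field_simps)
      finally show ?thesis .
    qed
    then show "\<exists>N. \<forall>i\<ge>N. \<forall>j\<ge>N. L2n M (\<lambda>x. w i x - w j x) < e" by blast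
  qed
  then obtain f where f: "Lp M 2 f" "L2lim M w f" by blast
  have H: "H0 f g" unfolding H0_def using f g w by blast
  have "\<exists>f'. Lp M 2 f' \<and> L2lim M (\<lambda>n. v (r n)) f'"
    by (rule L2_complete[OF test_Lp2[OF v]], rule rellich[OF v C]) (use lim in \<open>auto simp: convergent_def\<close>)
  then obtain f' where f': "Lp M 2 f'" "L2lim M (\<lambda>n. v (r n)) f'" by blast
  \<comment> \<open>The strong limit f' of the subsequence and the limit f of the representing
    sequence must be identified. Pairing with \<zeta> = f' - f is itself a bounded functional, so
    both sequences give the same limit and the norm of \<zeta> is 0.\<close>
  define \<zeta> where "\<zeta> x = f' x - f x" for x
  have Z: "Lp M 2 \<zeta>" unfolding \<zeta>_def by (rule L2_diff(1)[OF f'(1) f(1)])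
  have "bfun (\<lambda>u. (LINT x|M. \<zeta> x * u x))" by (rule bfun_mult[OF Z]) simp
  then obtain L where L: "(\<lambda>n. (LINT x|M. \<zeta> x * v (r n) x)) \<longlonglongrightarrow> L" "(\<lambda>k. (LINT x|M. \<zeta> x * w k x)) \<longlonglongrightarrow> L" using lim by blast
  have "L = (LINT x|M. \<zeta> x * f' x)" using LIMSEQ_unique[OF L(1)] L2_inner_tendsto[OF test_Lp2[OF v] f'(1) Z f'(2)] by simp
  moreover have "L = (LINT x|M. \<zeta> x * f x)" using LIMSEQ_unique[OF L(2)] L2_inner_tendsto[OF test_Lp2[OF w] f(1) Z f(2)] by simp
  ultimately have "(LINT x|M. \<zeta> x * f' x - \<zeta> x * f x) = 0"
    using L2_inner(1)[OF Z f(1)] L2_inner(1)[OF Z f'(1)] by (subst Bochner_Integration.integral_diff) auto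
  then have "(L2n M \<zeta>)\<^sup>2 = 0" unfolding L2n_sq by (simp add: \<zeta>_def power2_eq_square algebra_simps)
  then have "AE x in M. \<zeta> x = 0" using L2n_zero_imp_AE[OF Z] by simp
  then have ae: "AE x in M. f' x = f x" by (simp add: \<zeta>_def)
  have eq: "L2n M (\<lambda>x. v (r n) x - f' x) = L2n M (\<lambda>x. v (r n) x - f x)" for n
    by (rule L2n_cong_AE) (use ae f(1) f'(1) test_measurable[OF v] in \<open>auto simp: Lp2_measurable\<close>)
  have "(\<lambda>n. (LINT x|M. G x \<bullet> grad (v (r n)) x)) \<longlonglongrightarrow> (LINT x|M. G x \<bullet> g x)" if G: "Lp M 2 G" for G
  proof -
    obtain L where L: "(\<lambda>n. (LINT x|M. G x \<bullet> grad (v (r n)) x)) \<longlonglongrightarrow> L" "(\<lambda>k. (LINT x|M. G x \<bullet> grad (w k) x)) \<longlonglongrightarrow> L"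
      using lim[OF bfun_inner_grad[OF G]] by blast
    have "L = (LINT x|M. G x \<bullet> g x)" using LIMSEQ_unique[OF L(2)] L2_inner_tendsto[OF test_grad_Lp2[OF w] g(1) G g(2)] by simp
    then show ?thesis using L(1) by simp
  qed
  then show ?thesis using r H f'(2) unfolding eq by blast
qed

end

subsection \<open>Solution of the truncated system\<close>

text \<open>The pointwise inequality behind the product of L3 and L2: both factors are powers of the
  larger summand m, and 1/3 + 1/2 is the reciprocal of 6/5.\<close>

lemma powr_product_bound:
  fixes x y :: real assumes "x \<ge> 0" "y \<ge> 0"
  shows "(x * y) powr (6/5) \<le> x powr 3 + y\<^sup>2"
proof -
  define m where "m = max (x powr 3) (y\<^sup>2)"
  have x: "x \<le> m powr (1/3)"
  proof -
    have "x = (x powr 3) powr (1/3)" using assms by (simp only: powr_powr) simp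
    also have "\<dots> \<le> m powr (1/3)" by (intro powr_mono2) (auto simp: m_def)
    finally show ?thesis .
  qed
  have y: "y \<le> m powr (1/2)"
  proof -
    have "y = (y powr 2) powr (1/2)" using assms by (simp only: powr_powr) simp
    also have "\<dots> \<le> m powr (1/2)" using norm_powr_2[of y] assms by (intro powr_mono2) (auto simp: m_def)
    finally show ?thesis .
  qed
  have m0: "m \<ge> 0" unfolding m_def by (simp add: le_max_iff_disj)
  have "(x * y) powr (6/5) \<le> (m powr (1/3) * m powr (1/2)) powr (6/5)"
    using x y assms by (intro powr_mono2 mult_mono) auto
  also have "\<dots> = m" using m0 by (simp add: powr_powr flip: powr_add)
  also have "\<dots> \<le> x powr 3 + y\<^sup>2" unfolding m_def by simp
  finally show ?thesis .
qed

lemma sum_lessThan_split: "(\<Sum>j<(n::nat)+m. F j) = (\<Sum>j<n. F j) + (\<Sum>j<m. F (n + j) :: 'a::comm_monoid_add)"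
  by (induction m) (auto simp: add.assoc)

context bounded_domain begin

text \<open>This is why a drift in L3 is enough: applied to a square integrable gradient it gives
  exponent 6/5, and any exponent above 1 defines a bounded functional on test functions.\<close>

lemma Lp3_product:
  assumes b: "Lp M 3 b" and g: "Lp M 2 g"
  shows "Lp M (6/5) (\<lambda>x. b x \<bullet> g x)"
proof -
  have [measurable]: "b \<in> borel_measurable M" "g \<in> borel_measurable M" using b g by (auto simp: Lp_def)
  have i: "integrable M (\<lambda>x. norm (b x) powr 3 + (norm (g x))\<^sup>2)" using b g by (auto simp: Lp_def Lp2_iff)
  have "norm (b x \<bullet> g x) powr (6/5) \<le> norm (b x) powr 3 + (norm (g x))\<^sup>2" for x
  proof -
    have "norm (b x \<bullet> g x) powr (6/5) \<le> (norm (b x) * norm (g x)) powr (6/5)"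
      by (rule powr_mono2) (auto simp: Cauchy_Schwarz_ineq2)
    then show ?thesis using powr_product_bound[OF norm_ge_zero norm_ge_zero, of "b x" "g x"] by linarith
  qed
  then have "integrable M (\<lambda>x. norm (b x \<bullet> g x) powr (6/5))"
    by (intro Bochner_Integration.integrable_bound[OF i]) (auto intro!: AE_I2 order_trans[OF _ abs_ge_self])
  then show ?thesis by (simp add: Lp_def)
qed

lemma Lp3_imp_Lp2: assumes b: "Lp M 3 b" shows "Lp M 2 b"
proof -
  have [measurable]: "b \<in> borel_measurable M" using b by (simp add: Lp_def)
  have i: "integrable M (\<lambda>x. 1 + norm (b x) powr 3)" using b by (simp add: Lp_def)
  have "(norm (b x))\<^sup>2 \<le> 1 + norm (b x) powr 3" for x
  proof (cases "norm (b x) \<le> 1")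
    case True then show ?thesis using power_le_one[OF norm_ge_zero True, of 2] powr_ge_zero[of "norm (b x)" 3] by linarith
  next
    case False
    then have "norm (b x) powr 2 \<le> norm (b x) powr 3" by (intro powr_mono) auto
    then show ?thesis by (simp add: norm_powr_2)
  qed
  then show ?thesis unfolding Lp2_iff
    by (intro conjI Bochner_Integration.integrable_bound[OF i]) (auto intro!: AE_I2 order_trans[OF _ abs_ge_self])
qed

lemma test_bounded: assumes "tf \<psi>" shows "\<exists>B\<ge>0. \<forall>x\<in>\<Omega>. \<bar>\<psi> x\<bar> \<le> B"
proof -
  obtain B where "\<And>x. x \<in> \<Omega> \<Longrightarrow> norm (\<psi> x) \<le> B" using continuous_bounded_on_domain[OF C1_continuous[OF test_C1[OF assms]]] by blast
  then show ?thesis by (intro exI[of _ "max B 0"]) (auto simp: le_max_iff_disj)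
qed

lemma test_scaleR_Lp2: assumes "tf \<psi>" "Lp M 2 b" shows "Lp M 2 (\<lambda>x. \<psi> x *\<^sub>R b x)"
proof -
  obtain B where "\<forall>x\<in>\<Omega>. \<bar>\<psi> x\<bar> \<le> B" using test_bounded[OF assms(1)] by blast
  then show ?thesis by (intro L2_bounded_scaleR(1)[OF assms(2) test_measurable[OF assms(1)], of B]) (auto simp: space_restrict_space)
qed

lemma bfun_plus: "bfun l \<Longrightarrow> bfun l' \<Longrightarrow> bfun (\<lambda>v. l v + l' v)"
proof -
  assume l: "bfun l" and l': "bfun l'"
  obtain C C' where C: "C \<ge> 0" "\<And>v. tf v \<Longrightarrow> \<bar>l v\<bar> \<le> C * nrm v" "C' \<ge> 0" "\<And>v. tf v \<Longrightarrow> \<bar>l' v\<bar> \<le> C' * nrm v"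
    using bfun_bound[OF l] bfun_bound[OF l'] by blast
  have "\<bar>l v + l' v\<bar> \<le> (C + C') * nrm v" if "tf v" for v
    using C(2)[OF that] C(4)[OF that] unfolding distrib_right by linarith
  then have "\<exists>C\<ge>0. \<forall>v. tf v \<longrightarrow> \<bar>l v + l' v\<bar> \<le> C * nrm v" using C(1,3) by (intro exI[of _ "C + C'"]) auto
  then show ?thesis unfolding bfun_def using bfun_add[OF l] bfun_add[OF l'] bfun_scale[OF l] bfun_scale[OF l']
    by (simp add: distrib_left)
qed

lemma bfun_minus: "bfun l \<Longrightarrow> bfun (\<lambda>v. - l v)"
  unfolding bfun_def by simp

lemma bfun_sum:
  assumes l: "bfun l" and d: "\<And>i. tf (d i)"
  shows "l (\<lambda>x. \<Sum>i<(n::nat). c i * d i x) = (\<Sum>i<n. c i * l (d i))"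
proof (induction n)
  case 0
  show ?case using bfun_scale[OF l test_function_zero, of 0] by simp
next
  case (Suc n)
  show ?case using bfun_add[OF l test_function_sum[of n \<Omega> d c] test_function_scale[of \<Omega> "d n" "c n"]] bfun_scale[OF l d] d Suc by simp
qed

lemma bfun_zero_dense:
  assumes l: "bfun l" and d: "\<And>j. tf (d j)" "\<And>\<psi> \<epsilon>. tf \<psi> \<Longrightarrow> \<epsilon> > 0 \<Longrightarrow> \<exists>j. nrm (\<lambda>x. \<psi> x - d j x) < \<epsilon>"
    and z: "\<And>j. l (d j) = 0" and t: "tf \<psi>"
  shows "l \<psi> = 0"
proof -
  obtain C where C: "C \<ge> 0" "\<And>v. tf v \<Longrightarrow> \<bar>l v\<bar> \<le> C * nrm v" using bfun_bound[OF l] by blast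
  have "\<bar>l \<psi>\<bar> \<le> e" if e: "e > 0" for e
  proof -
    obtain j where j: "nrm (\<lambda>x. \<psi> x - d j x) < e / (C + 1)" using d(2)[OF t, of "e / (C + 1)"] e C(1) by auto
    have "\<bar>l \<psi>\<bar> = \<bar>l (\<lambda>x. \<psi> x - d j x)\<bar>" using bfun_diff[OF l t d(1)] z by simp
    also have "\<dots> \<le> C * nrm (\<lambda>x. \<psi> x - d j x)" by (rule C(2)[OF test_function_diff[OF t d(1)]])
    also have "\<dots> \<le> C * (e / (C + 1))" using j C(1) by (intro mult_left_mono) auto
    also have "\<dots> \<le> e" using C(1) e by (simp add: field_simps)
    finally show ?thesis .
  qed
  then have "\<bar>l \<psi>\<bar> \<le> 0" using field_le_epsilon[of "\<bar>l \<psi>\<bar>" 0] by simp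
  then show ?thesis by simp
qed

end

text \<open>One equation of the truncated system. The field g is the gradient of an extension of the
  boundary data, so the gradient of the unknown is g + w with w the gradient of a correction in the
  closure of the test functions. The two scalar arguments of k and H take both unknowns of the
  system.\<close>

locale equation = bounded_domain +
  fixes b :: "real^2 \<Rightarrow> real^2" and k H :: "real^2 \<Rightarrow> real \<Rightarrow> real \<Rightarrow> real" and g :: "real^2 \<Rightarrow> real^2"
    and kmin kmax s :: real and Hb :: "real^2 \<Rightarrow> real"
  assumes b3: "Lp M 3 b" and b_div: "\<And>\<psi>. tf \<psi> \<Longrightarrow> (LINT x|M. b x \<bullet> grad \<psi> x) = 0"
    and k_meas: "\<And>p q. p \<in> borel_measurable M \<Longrightarrow> q \<in> borel_measurable M \<Longrightarrow> (\<lambda>x. k x (p x) (q x)) \<in> borel_measurable M"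
    and k_cont: "AE x in M. continuous_on UNIV (\<lambda>(v, w). k x v w)"
    and k_bound: "AE x in M. \<forall>v w. kmin \<le> k x v w \<and> k x v w \<le> kmax" and kmin: "kmin > 0"
    and H_meas: "\<And>p q. p \<in> borel_measurable M \<Longrightarrow> q \<in> borel_measurable M \<Longrightarrow> (\<lambda>x. H x (p x) (q x)) \<in> borel_measurable M"
    and H_cont: "AE x in M. continuous_on UNIV (\<lambda>(v, w). H x v w)"
    and H_bound: "AE x in M. \<forall>v w. \<bar>H x v w\<bar> \<le> Hb x"
    and Hb: "Lp M s Hb" and s: "s > 1"
    and g: "Lp M 2 g"
begin

definition Res :: "(real^2 \<Rightarrow> real) \<Rightarrow> (real^2 \<Rightarrow> real) \<Rightarrow> (real^2 \<Rightarrow> real^2) \<Rightarrow> (real^2 \<Rightarrow> real) \<Rightarrow> real" where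
  "Res p q w \<psi> = (LINT x|M. (b x \<bullet> (g x + w x)) * \<psi> x) + (LINT x|M. (k x (p x) (q x) *\<^sub>R (g x + w x)) \<bullet> grad \<psi> x)
     - (LINT x|M. H x (p x) (q x) * \<psi> x)"

lemma b2: "Lp M 2 b" by (rule Lp3_imp_Lp2[OF b3])

lemma kabs: "p \<in> borel_measurable M \<Longrightarrow> q \<in> borel_measurable M \<Longrightarrow> AE x in M. \<bar>k x (p x) (q x)\<bar> \<le> kmax"
  using k_bound
proof eventually_elim
  case (elim x)
  have "kmin \<le> k x (p x) (q x)" "k x (p x) (q x) \<le> kmax" using elim(3) by blast+
  then show ?case using kmin by linarith
qed

lemma H_Lp: assumes [measurable]: "p \<in> borel_measurable M" "q \<in> borel_measurable M" shows "Lp M s (\<lambda>x. H x (p x) (q x))"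
proof -
  have i: "integrable M (\<lambda>x. norm (Hb x) powr s)" using Hb by (simp add: Lp_def)
  have [measurable]: "(\<lambda>x. H x (p x) (q x)) \<in> borel_measurable M" by (rule H_meas) measurable
  have "AE x in M. norm (H x (p x) (q x)) powr s \<le> norm (Hb x) powr s"
    using H_bound
  proof eventually_elim
    case (elim x)
    have "\<bar>H x (p x) (q x)\<bar> \<le> Hb x" using elim by blast
    then show ?case using s by (intro powr_mono2) auto
  qed
  then have "integrable M (\<lambda>x. norm (H x (p x) (q x)) powr s)"
    by (intro Bochner_Integration.integrable_bound[OF i]) auto
  then show ?thesis by (simp add: Lp_def)
qed

lemma bfun_Res:
  assumes p: "p \<in> borel_measurable M" "q \<in> borel_measurable M" and w: "Lp M 2 w"
  shows "bfun (Res p q w)"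
proof -
  have gw: "Lp M 2 (\<lambda>x. g x + w x)" by (rule L2_add(1)[OF g w])
  have 1: "bfun (\<lambda>\<psi>. (LINT x|M. (b x \<bullet> (g x + w x)) * \<psi> x))" by (rule bfun_mult[OF Lp3_product[OF b3 gw]]) simp
  have 2: "bfun (\<lambda>\<psi>. (LINT x|M. (k x (p x) (q x) *\<^sub>R (g x + w x)) \<bullet> grad \<psi> x))"
    by (rule bfun_inner_grad[OF L2_bounded_scaleR(1)[OF gw k_meas[OF p] kabs[OF p]]])
  have 3: "bfun (\<lambda>\<psi>. (LINT x|M. H x (p x) (q x) * \<psi> x))" by (rule bfun_mult[OF H_Lp[OF p] s])
  show ?thesis using bfun_plus[OF bfun_plus[OF 1 2] bfun_minus[OF 3]] unfolding Res_def[abs_def] by simp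
qed

text \<open>The integrand is half of b applied to the gradient of the square of v, and that square
  is again a test function.\<close>

lemma drift_self_zero:
  assumes v: "tf v" shows "(LINT x|M. (b x \<bullet> grad v x) * v x) = 0"
proof -
  have "(LINT x|M. b x \<bullet> grad (\<lambda>x. v x * v x) x) = 0"
    by (rule b_div[OF test_function_mult[OF v test_function_smooth[OF v]]])
  also have "grad (\<lambda>x. v x * v x) = (\<lambda>x. v x *\<^sub>R grad v x + v x *\<^sub>R grad v x)" by (rule grad_mult[OF test_C1[OF v] test_C1[OF v]])
  also have "(\<lambda>x. b x \<bullet> (v x *\<^sub>R grad v x + v x *\<^sub>R grad v x)) = (\<lambda>x. 2 * ((b x \<bullet> grad v x) * v x))"
    by (rule ext, simp only: inner_add_right inner_scaleR_right) simp
  finally have "(LINT x|M. 2 * ((b x \<bullet> grad v x) * v x)) = 0" .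
  then show ?thesis by simp
qed

text \<open>The constant C does not depend on p and q, because k and H are dominated uniformly in
  their scalar arguments. So the Galerkin solutions are bounded without any knowledge of the
  arguments of the coefficients.\<close>

lemma coercive:
  "\<exists>C\<ge>0. \<forall>p q v. p \<in> borel_measurable M \<longrightarrow> q \<in> borel_measurable M \<longrightarrow> tf v \<longrightarrow>
     Res p q (grad v) v \<ge> kmin * (nrm v)\<^sup>2 - C * nrm v"
proof -
  obtain C1 where C1: "C1 \<ge> 0" "\<And>v. tf v \<Longrightarrow> \<bar>(LINT x|M. (b x \<bullet> g x) * v x)\<bar> \<le> C1 * nrm v"
    using bfun_bound[OF bfun_mult[OF Lp3_product[OF b3 g]]] by auto
  obtain C2 where C2: "C2 \<ge> 0" "\<And>v. tf v \<Longrightarrow> integrable M (\<lambda>x. Hb x * v x)" "\<And>v. tf v \<Longrightarrow> (LINT x|M. \<bar>Hb x * v x\<bar>) \<le> C2 * nrm v"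
    using test_dual_bound[OF Hb s] unfolding nrm_def by blast
  define C where "C = C1 + C2 + \<bar>kmax\<bar> * L2n M g"
  have "Res p q (grad v) v \<ge> kmin * (nrm v)\<^sup>2 - C * nrm v"
    if p: "p \<in> borel_measurable M" "q \<in> borel_measurable M" and v: "tf v" for p q v
  proof -
    note [measurable] = k_meas[OF p] H_meas[OF p] test_measurable[OF v] test_grad_measurable[OF v]
    have dv: "Lp M 2 (grad v)" by (rule test_grad_Lp2[OF v])
    let ?k = "\<lambda>x. k x (p x) (q x)"
    have kb: "AE x in M. \<bar>?k x\<bar> \<le> \<bar>kmax\<bar>" using kabs[OF p] by eventually_elim simp
    have kg: "Lp M 2 (\<lambda>x. ?k x *\<^sub>R g x)" and kgn: "L2n M (\<lambda>x. ?k x *\<^sub>R g x) \<le> \<bar>kmax\<bar> * L2n M g"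
      using L2_bounded_scaleR[OF g k_meas[OF p] kb] by auto
    have kv: "Lp M 2 (\<lambda>x. ?k x *\<^sub>R grad v x)" by (rule L2_bounded_scaleR(1)[OF dv k_meas[OF p] kb])
    have i1: "integrable M (\<lambda>x. (b x \<bullet> g x) * v x)" "integrable M (\<lambda>x. (b x \<bullet> grad v x) * v x)"
      using test_dual_bound[OF Lp3_product[OF b3 g]] test_dual_bound[OF Lp3_product[OF b3 dv]] v by auto
    have e1: "(LINT x|M. (b x \<bullet> (g x + grad v x)) * v x) = (LINT x|M. (b x \<bullet> g x) * v x)"
      using i1 drift_self_zero[OF v] by (simp add: inner_add_right distrib_right)
    have e2: "(LINT x|M. (?k x *\<^sub>R (g x + grad v x)) \<bullet> grad v x)
        = (LINT x|M. (?k x *\<^sub>R g x) \<bullet> grad v x) + (LINT x|M. (?k x *\<^sub>R grad v x) \<bullet> grad v x)"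
      unfolding scaleR_add_right inner_add_left
      by (rule Bochner_Integration.integral_add[OF L2_inner(1)[OF kg dv] L2_inner(1)[OF kv dv]])
    have b1: "\<bar>(LINT x|M. (?k x *\<^sub>R g x) \<bullet> grad v x)\<bar> \<le> \<bar>kmax\<bar> * L2n M g * nrm v"
      using order_trans[OF L2_inner(2)[OF kg dv] mult_right_mono[OF kgn L2n_nonneg]] by (simp add: nrm_def)
    have b2: "kmin * (nrm v)\<^sup>2 \<le> (LINT x|M. (?k x *\<^sub>R grad v x) \<bullet> grad v x)"
    proof -
      have "kmin * (nrm v)\<^sup>2 = (LINT x|M. kmin * (norm (grad v x))\<^sup>2)" by (simp add: nrm_def L2n_sq)
      also have "\<dots> \<le> (LINT x|M. (?k x *\<^sub>R grad v x) \<bullet> grad v x)"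
      proof (rule integral_mono_AE)
        show "integrable M (\<lambda>x. kmin * (norm (grad v x))\<^sup>2)" using Lp2_integrable[OF dv] by simp
        show "integrable M (\<lambda>x. (?k x *\<^sub>R grad v x) \<bullet> grad v x)" by (rule L2_inner(1)[OF kv dv])
        show "AE x in M. kmin * (norm (grad v x))\<^sup>2 \<le> (?k x *\<^sub>R grad v x) \<bullet> grad v x"
          using k_bound by eventually_elim (simp add: power2_norm_eq_inner mult_right_mono)
      qed
      finally show ?thesis .
    qed
    have b3': "\<bar>(LINT x|M. H x (p x) (q x) * v x)\<bar> \<le> C2 * nrm v"
    proof -
      have "\<bar>(LINT x|M. H x (p x) (q x) * v x)\<bar> \<le> (LINT x|M. \<bar>H x (p x) (q x) * v x\<bar>)" by (rule integral_abs_bound)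
      also have "\<dots> \<le> (LINT x|M. \<bar>Hb x * v x\<bar>)"
      proof (rule integral_mono_AE)
        show "integrable M (\<lambda>x. \<bar>H x (p x) (q x) * v x\<bar>)" using test_dual_bound[OF H_Lp[OF p] s] v by auto
        show "integrable M (\<lambda>x. \<bar>Hb x * v x\<bar>)" using C2(2)[OF v] by simp
        show "AE x in M. \<bar>H x (p x) (q x) * v x\<bar> \<le> \<bar>Hb x * v x\<bar>"
          using H_bound
        proof eventually_elim
          case (elim x)
          have "\<bar>H x (p x) (q x)\<bar> \<le> \<bar>Hb x\<bar>" using elim abs_ge_self order_trans by blast
          then show ?case by (simp add: abs_mult mult_right_mono)
        qed
      qed
      finally show ?thesis using C2(3)[OF v] by linarith
    qed
    show ?thesis unfolding Res_def e1 e2 C_def distrib_right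
      using b1 b2 b3' C1(2)[OF v] by linarith
  qed
  moreover have "C \<ge> 0" unfolding C_def using C1(1) C2(1) by simp
  ultimately show ?thesis by blast
qed

text \<open>Only the gradients \<open>wn\<close> converge weakly. The nonlinear coefficient is moved
  to the fixed gradient of \<psi>, where it converges strongly by dominated convergence; a strongly
  and a weakly convergent factor may be paired.\<close>

lemma Res_tendsto:
  assumes pm: "\<And>n. pn n \<in> borel_measurable M" "\<And>n. qn n \<in> borel_measurable M" "p \<in> borel_measurable M" "q \<in> borel_measurable M"
    and pc: "AE x in M. (\<lambda>n. pn n x) \<longlonglongrightarrow> p x" and qc: "AE x in M. (\<lambda>n. qn n x) \<longlonglongrightarrow> q x"
    and w: "\<And>n. Lp M 2 (wn n)" "Lp M 2 w" and wb: "\<And>n. L2n M (wn n) \<le> C"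
    and wc: "\<And>G. Lp M 2 G \<Longrightarrow> (\<lambda>n. (LINT x|M. G x \<bullet> wn n x)) \<longlonglongrightarrow> (LINT x|M. G x \<bullet> w x)"
    and t: "tf \<psi>"
  shows "(\<lambda>n. Res (pn n) (qn n) (wn n) \<psi>) \<longlonglongrightarrow> Res p q w \<psi>"
proof -
  note [measurable] = k_meas[OF pm(1,2)] k_meas[OF pm(3,4)] H_meas[OF pm(1,2)] H_meas[OF pm(3,4)] test_measurable[OF t] test_grad_measurable[OF t]
  have gw: "Lp M 2 (\<lambda>x. g x + w x)" "Lp M 2 (\<lambda>x. g x + wn n x)" for n using L2_add(1)[OF g] w by blast+
  have gwc: "(\<lambda>n. (LINT x|M. G x \<bullet> (g x + wn n x))) \<longlonglongrightarrow> (LINT x|M. G x \<bullet> (g x + w x))" if G: "Lp M 2 G" for G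
  proof -
    have "(LINT x|M. G x \<bullet> (g x + w' x)) = (LINT x|M. G x \<bullet> g x) + (LINT x|M. G x \<bullet> w' x)" if "Lp M 2 w'" for w'
      unfolding inner_add_right by (rule Bochner_Integration.integral_add[OF L2_inner(1)[OF G g] L2_inner(1)[OF G that]])
    then show ?thesis using tendsto_add[OF tendsto_const wc[OF G]] w by simp
  qed
  have gwb: "L2n M (\<lambda>x. g x + wn n x) \<le> L2n M g + C" for n using L2_add(2)[OF g w(1)[of n]] wb[of n] by linarith
  have lim: "AE x in M. (\<lambda>n. f x (pn n x) (qn n x)) \<longlonglongrightarrow> f x (p x) (q x)"
    if "AE x in M. continuous_on UNIV (\<lambda>(v, w). f x v w)" for f :: "real^2 \<Rightarrow> real \<Rightarrow> real \<Rightarrow> real"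
    using that pc qc
  proof eventually_elim
    case (elim x)
    have "isCont (\<lambda>(v, w). f x v w) (p x, q x)" using elim(1) by (simp add: continuous_on_eq_continuous_at)
    from isCont_tendsto_compose[OF this tendsto_Pair[OF elim(2,3)]] show ?case by simp
  qed
  have 1: "(\<lambda>n. (LINT x|M. (b x \<bullet> (g x + wn n x)) * \<psi> x)) \<longlonglongrightarrow> (LINT x|M. (b x \<bullet> (g x + w x)) * \<psi> x)"
    using gwc[OF test_scaleR_Lp2[OF t b2]] by (simp add: mult.commute)
  have dpsi: "Lp M 2 (grad \<psi>)" by (rule test_grad_Lp2[OF t])
  let ?k = "\<lambda>x. k x (p x) (q x)" and ?kn = "\<lambda>n x. k x (pn n x) (qn n x)"
  define K where "K n x = (?kn n x - ?k x) *\<^sub>R grad \<psi> x" for n x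
  have kLp: "Lp M 2 (\<lambda>x. ?k x *\<^sub>R grad \<psi> x)" "Lp M 2 (\<lambda>x. ?kn n x *\<^sub>R grad \<psi> x)" for n
    using L2_bounded_scaleR(1)[OF dpsi k_meas[OF pm(3,4)] kabs[OF pm(3,4)]]
      L2_bounded_scaleR(1)[OF dpsi k_meas[OF pm(1,2)] kabs[OF pm(1,2)]] by auto
  have KLp: "Lp M 2 (K n)" for n unfolding K_def scaleR_diff_left by (rule L2_diff(1)[OF kLp(2) kLp(1)])
  have K0: "(\<lambda>n. L2n M (K n)) \<longlonglongrightarrow> 0"
    unfolding K_def by (rule L2_dominated_convergence[OF dpsi k_meas[OF pm(1,2)] k_meas[OF pm(3,4)] kabs[OF pm(1,2)] lim[OF k_cont]])
  have 2: "(\<lambda>n. (LINT x|M. (?kn n x *\<^sub>R (g x + wn n x)) \<bullet> grad \<psi> x)) \<longlonglongrightarrow> (LINT x|M. (?k x *\<^sub>R (g x + w x)) \<bullet> grad \<psi> x)"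
  proof -
    have "(\<lambda>n. (LINT x|M. K n x \<bullet> (g x + wn n x))) \<longlonglongrightarrow> 0"
    proof (rule Lim_null_comparison)
      show "\<forall>\<^sub>F n in sequentially. norm (LINT x|M. K n x \<bullet> (g x + wn n x)) \<le> L2n M (K n) * (L2n M g + C)"
        using order_trans[OF L2_inner(2)[OF KLp gw(2)] mult_left_mono[OF gwb L2n_nonneg]] by simp
      show "(\<lambda>n. L2n M (K n) * (L2n M g + C)) \<longlonglongrightarrow> 0" using tendsto_mult_left_zero[OF K0] by blast
    qed
    from tendsto_add[OF this gwc[OF kLp(1)]]
    have "(\<lambda>n. (LINT x|M. K n x \<bullet> (g x + wn n x)) + (LINT x|M. (?k x *\<^sub>R grad \<psi> x) \<bullet> (g x + wn n x)))
      \<longlonglongrightarrow> (LINT x|M. (?k x *\<^sub>R grad \<psi> x) \<bullet> (g x + w x))" by simp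
    moreover have "(LINT x|M. K n x \<bullet> (g x + wn n x)) + (LINT x|M. (?k x *\<^sub>R grad \<psi> x) \<bullet> (g x + wn n x))
      = (LINT x|M. (?kn n x *\<^sub>R (g x + wn n x)) \<bullet> grad \<psi> x)" for n
      by (subst Bochner_Integration.integral_add[OF L2_inner(1)[OF KLp gw(2)] L2_inner(1)[OF kLp(1) gw(2)], symmetric])
         (rule Bochner_Integration.integral_cong, auto simp: K_def inner_commute algebra_simps)
    ultimately show ?thesis by (simp add: inner_commute)
  qed
  have Hpsi: "integrable M (\<lambda>x. \<bar>Hb x * \<psi> x\<bar>)" using test_dual_bound[OF Hb s] t by auto
  have 3: "(\<lambda>n. (LINT x|M. H x (pn n x) (qn n x) * \<psi> x)) \<longlonglongrightarrow> (LINT x|M. H x (p x) (q x) * \<psi> x)"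
  proof (rule integral_dominated_convergence[OF _ _ Hpsi])
    show "AE x in M. (\<lambda>n. H x (pn n x) (qn n x) * \<psi> x) \<longlonglongrightarrow> H x (p x) (q x) * \<psi> x"
      using lim[OF H_cont] by eventually_elim (rule tendsto_mult_right)
    show "AE x in M. norm (H x (pn n x) (qn n x) * \<psi> x) \<le> \<bar>Hb x * \<psi> x\<bar>" for n
      using H_bound
    proof eventually_elim
      case (elim x)
      have "\<bar>H x (pn n x) (qn n x)\<bar> \<le> \<bar>Hb x\<bar>" using elim abs_ge_self order_trans by blast
      then show ?case by (simp add: abs_mult mult_right_mono)
    qed
  qed measurable
  show ?thesis unfolding Res_def by (intro tendsto_add tendsto_diff 1 2 3)
qed

end

lemma (in bounded_domain) H0_compactness_AE:
  assumes v: "\<And>n. tf (v n)" and C: "\<And>n::nat. nrm (v n) \<le> C"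
  shows "\<exists>r f g. strict_mono r \<and> H0 f g \<and> (AE x in M. (\<lambda>n. v (r n) x) \<longlonglongrightarrow> f x) \<and> weak_lim (\<lambda>n. grad (v (r n))) g"
proof -
  obtain r f g where r: "strict_mono r" and H: "H0 f g" and l: "L2lim M (\<lambda>n. v (r n)) f"
    and w: "\<And>G. Lp M 2 G \<Longrightarrow> (\<lambda>n. (LINT x|M. G x \<bullet> grad (v (r n)) x)) \<longlonglongrightarrow> (LINT x|M. G x \<bullet> g x)"
    using H0_compactness[of v C, OF v C] by blast
  obtain r' where r': "strict_mono r'" and ae: "AE x in M. (\<lambda>n. v (r (r' n)) x) \<longlonglongrightarrow> f x"
    using L2_tendsto_AE_subseq[OF test_Lp2[OF v] _ l] H unfolding H0_def by blast
  have "(\<lambda>n. (LINT x|M. G x \<bullet> grad (v (r (r' n))) x)) \<longlonglongrightarrow> (LINT x|M. G x \<bullet> g x)" if "Lp M 2 G" for G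
    using LIMSEQ_subseq_LIMSEQ[OF w[OF that] r'] by (simp add: o_def)
  then show ?thesis using strict_mono_o[OF r r'] H ae by (intro exI[of _ "r \<circ> r'"] exI[of _ f] exI[of _ g]) (simp add: o_def)
qed

text \<open>The term \<open>c\<^sub>j / (n + 1)\<close> makes the finite-dimensional field coercive in
  the coefficients although the approximating functions need not be linearly independent; it
  vanishes in the limit.\<close>

theorem (in bounded_domain) quasilinear_system_solvable:
  fixes f1 f2 :: "real^2 \<Rightarrow> real"
  assumes "equation \<Omega> b k1 h1 g1 m1 M1 s1 Hb1" and "equation \<Omega> b k2 h2 g2 m2 M2 s2 Hb2"
    and f: "f1 \<in> borel_measurable M" "f2 \<in> borel_measurable M"
  shows "\<exists>v1 w1 v2 w2. H0 v1 w1 \<and> H0 v2 w2 \<and> (\<forall>\<psi>. tf \<psi> \<longrightarrow>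
     equation.Res \<Omega> b k1 h1 g1 (\<lambda>x. f1 x + v1 x) (\<lambda>x. f2 x + v2 x) w1 \<psi> = 0 \<and>
     equation.Res \<Omega> b k2 h2 g2 (\<lambda>x. f1 x + v1 x) (\<lambda>x. f2 x + v2 x) w2 \<psi> = 0)"
proof -
  interpret E1: equation \<Omega> b k1 h1 g1 m1 M1 s1 Hb1 by fact
  interpret E2: equation \<Omega> b k2 h2 g2 m2 M2 s2 Hb2 by fact
  obtain d :: "nat \<Rightarrow> real^2 \<Rightarrow> real" where d: "\<And>j. tf (d j)" and dense: "\<And>\<psi> \<epsilon>. tf \<psi> \<Longrightarrow> \<epsilon> > 0 \<Longrightarrow> \<exists>j. nrm (\<lambda>x. \<psi> x - d j x) < \<epsilon>"
    using countable_dense_tests by blast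
  obtain C1 where C1: "C1 \<ge> 0" "\<And>p q v. p \<in> borel_measurable M \<Longrightarrow> q \<in> borel_measurable M \<Longrightarrow> tf v \<Longrightarrow> E1.Res p q (grad v) v \<ge> m1 * (nrm v)\<^sup>2 - C1 * nrm v"
    using E1.coercive by blast
  obtain C2 where C2: "C2 \<ge> 0" "\<And>p q v. p \<in> borel_measurable M \<Longrightarrow> q \<in> borel_measurable M \<Longrightarrow> tf v \<Longrightarrow> E2.Res p q (grad v) v \<ge> m2 * (nrm v)\<^sup>2 - C2 * nrm v"
    using E2.coercive by blast
  \<comment> \<open>The cost of completing the square in both equations while half of each quadratic
    term is kept for the a priori bound.\<close>
  define K where "K = C1\<^sup>2 / (2 * m1) + C2\<^sup>2 / (2 * m2)"
  have K0: "K \<ge> 0" unfolding K_def using E1.kmin E2.kmin by simp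
  have nn: "0 \<le> m1 / 2 * t\<^sup>2" "0 \<le> m2 / 2 * t\<^sup>2" for t using E1.kmin E2.kmin by simp_all
  define V where "V n c = (\<lambda>x. \<Sum>i<n. c i * d i x)" for n :: nat and c :: "nat \<Rightarrow> real"
  have tV: "tf (V n c)" for n c unfolding V_def by (rule test_function_sum[OF d])
  have gV: "grad (V n c) = (\<lambda>x. \<Sum>i<n. c i *\<^sub>R grad (d i) x)" for n c unfolding V_def by (rule grad_sum[OF test_C1[OF d]])
  \<comment> \<open>Both components are coded in one coefficient sequence: entries below n belong to
    the first, and \<open>sh\<close> reads off the next n for the second.\<close>
  define sh where "sh n c = (\<lambda>i. c (n + i))" for n and c :: "nat \<Rightarrow> real"
  define p where "p n c = (\<lambda>x. f1 x + V n c x)" for n c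
  define q where "q n c = (\<lambda>x. f2 x + V n (sh n c) x)" for n c
  have pm: "p n c \<in> borel_measurable M" "q n c \<in> borel_measurable M" for n c
    unfolding p_def q_def using f test_measurable[OF tV] by auto
  define R1 where "R1 n c = E1.Res (p n c) (q n c) (grad (V n c))" for n c
  define R2 where "R2 n c = E2.Res (p n c) (q n c) (grad (V n (sh n c)))" for n c
  have bR: "bfun (R1 n c)" "bfun (R2 n c)" for n c
    unfolding R1_def R2_def by (intro E1.bfun_Res E2.bfun_Res pm test_grad_Lp2 tV)+
  let ?S = "\<lambda>n (c :: nat \<Rightarrow> real). \<Sum>j<n+n. (c j)\<^sup>2"
  define P where "P n c j = (if j < n then R1 n c (d j) else R2 n c (d (j - n))) + c j / real (Suc n)" for n c j
  have sumP: "(\<Sum>j<n+n. P n c j * c j) = R1 n c (V n c) + R2 n c (V n (sh n c)) + ?S n c / real (Suc n)" for n c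
  proof -
    have "R1 n c (V n c) = (\<Sum>i<n. c i * R1 n c (d i))" "R2 n c (V n (sh n c)) = (\<Sum>i<n. c (n + i) * R2 n c (d i))"
      using bfun_sum[where d = d and n = n and c = c, OF bR(1) d] bfun_sum[where d = d and n = n and c = "sh n c", OF bR(2) d]
      unfolding V_def by (simp_all add: sh_def)
    moreover have "(\<Sum>j<n+n. P n c j * c j) = (\<Sum>j<n+n. (if j < n then R1 n c (d j) else R2 n c (d (j - n))) * c j) + ?S n c / real (Suc n)"
      unfolding P_def by (simp add: distrib_right sum.distrib sum_divide_distrib power2_eq_square)
    ultimately show ?thesis by (simp add: sum_lessThan_split mult.commute)
  qed
  have lower: "R1 n c (V n c) + R2 n c (V n (sh n c)) \<ge> m1 / 2 * (nrm (V n c))\<^sup>2 + m2 / 2 * (nrm (V n (sh n c)))\<^sup>2 - K" for n c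
  proof -
    have quad: "m * t\<^sup>2 - C * t \<ge> m / 2 * t\<^sup>2 - C\<^sup>2 / (2 * m)" if "m > 0" for m C t :: real
    proof -
      have "0 \<le> m / 2 * (t - C / m)\<^sup>2" using that by simp
      also have "\<dots> = m / 2 * t\<^sup>2 - C * t + C\<^sup>2 / (2 * m)" using that by (simp add: power2_diff field_simps power2_eq_square)
      finally show ?thesis by linarith
    qed
    have "R1 n c (V n c) \<ge> m1 * (nrm (V n c))\<^sup>2 - C1 * nrm (V n c)" "R2 n c (V n (sh n c)) \<ge> m2 * (nrm (V n (sh n c)))\<^sup>2 - C2 * nrm (V n (sh n c))"
      unfolding R1_def R2_def by (intro C1 C2 pm tV)+
    then show ?thesis using quad[OF E1.kmin, where C = C1 and t = "nrm (V n c)"] quad[OF E2.kmin, where C = C2 and t = "nrm (V n (sh n c))"] unfolding K_def by linarith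
  qed
  have "\<exists>c. \<forall>i<n+n. P n c i = 0" for n
  proof -
    \<comment> \<open>On the faces of the cube the penalty is at least
      \<open>R\<^sup>2 / real (Suc n) = K + 1\<close>, which beats the loss K in the lower
      bound.\<close>
    define R where "R = sqrt (real (Suc n) * (K + 1))"
    have R: "R > 0" unfolding R_def using K0 by simp
    have R2: "R\<^sup>2 = real (Suc n) * (K + 1)" unfolding R_def using K0 by simp
    have "\<exists>c. (\<forall>j. \<bar>c j\<bar> \<le> R) \<and> (\<forall>i<n+n. P n c i = 0)"
    proof (rule coercive_field_has_zero_nat[OF R])
      fix x :: "nat \<Rightarrow> nat \<Rightarrow> real" and y i assume x: "\<And>j. (\<lambda>k. x k j) \<longlonglongrightarrow> y j" "\<And>k j. \<bar>x k j\<bar> \<le> R" and i: "i < n + n"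
      have Vx: "(\<lambda>k. V n (sh' (x k)) z) \<longlonglongrightarrow> V n (sh' y) z" if "\<And>c i. sh' c i = c (a + i)" for sh' a z
        unfolding V_def that by (intro tendsto_sum tendsto_mult_right x)
      have Vg: "(\<lambda>k. (LINT z|M. G z \<bullet> grad (V n (sh' (x k))) z)) \<longlonglongrightarrow> (LINT z|M. G z \<bullet> grad (V n (sh' y)) z)" if sh: "\<And>c i. sh' c i = c (a + i)" and G: "Lp M 2 G" for sh' a G
      proof -
        have e: "(LINT z|M. G z \<bullet> grad (V n c) z) = (\<Sum>i<n. c i * (LINT z|M. G z \<bullet> grad (d i) z))" for c
          using bfun_sum[OF bfun_inner_grad[OF G] d, where n = n and c = c] unfolding V_def .
        show ?thesis unfolding e sh by (intro tendsto_sum tendsto_mult_right x)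
      qed
      have Vb: "L2n M (grad (V n (sh' (x k)))) \<le> (\<Sum>i<n. R * nrm (d i))" if sh: "\<And>c i. sh' c i = c (a + i)" for sh' a k
      proof -
        have "nrm (V n c) \<le> (\<Sum>i<n. R * nrm (d i))" if "\<And>j. \<bar>c j\<bar> \<le> R" for c
        proof (induction n)
          case 0 then show ?case by (simp add: V_def nrm_def L2n_def)
        next
          case (Suc n)
          have t1: "tf (\<lambda>x. c n * d n x)" by (rule test_function_scale[OF d])
          have "nrm (V (Suc n) c) \<le> nrm (V n c) + nrm (\<lambda>x. c n * d n x)"
            using L2_add(2)[OF test_grad_Lp2[OF tV] test_grad_Lp2[OF t1], of n c] grad_test_simps(1)[OF tV t1, of n c]
            unfolding nrm_def by (simp add: V_def)
          also have "nrm (\<lambda>x. c n * d n x) = \<bar>c n\<bar> * nrm (d n)"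
            unfolding nrm_def grad_test_simps(3)[OF d d] by (rule L2_scaleR(2)[OF test_grad_Lp2[OF d]])
          also have "\<dots> \<le> R * nrm (d n)" by (rule mult_right_mono[OF that]) simp
          finally show ?case using Suc by simp
        qed
        from this[of "sh' (x k)"] show ?thesis unfolding nrm_def[symmetric] sh using x(2) by blast
      qed
      have s0: "\<And>c i. (\<lambda>c. c) c i = c (0 + i :: nat)" for c :: "nat \<Rightarrow> real" by simp
      have s1: "\<And>c i. sh n c i = c (n + i)" by (simp add: sh_def)
      have pc: "(\<lambda>k. p n (x k) z) \<longlonglongrightarrow> p n y z" "(\<lambda>k. q n (x k) z) \<longlonglongrightarrow> q n y z" for z
        unfolding p_def q_def by (intro tendsto_add tendsto_const Vx[of "\<lambda>c. c" 0] Vx[of "sh n" n] s1; simp)+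
      have r1: "(\<lambda>k. R1 n (x k) (d j)) \<longlonglongrightarrow> R1 n y (d j)" for j
        unfolding R1_def
        by (rule E1.Res_tendsto[where wn = "\<lambda>k. grad (V n (x k))" and C = "\<Sum>i<n. R * nrm (d i)"])
           (use pc pm d Vb[of "\<lambda>c. c" 0] Vg[of "\<lambda>c. c" 0] in \<open>auto intro: test_grad_Lp2 tV\<close>)
      have r2: "(\<lambda>k. R2 n (x k) (d j)) \<longlonglongrightarrow> R2 n y (d j)" for j
        unfolding R2_def
        by (rule E2.Res_tendsto[where wn = "\<lambda>k. grad (V n (sh n (x k)))" and C = "\<Sum>i<n. R * nrm (d i)"])
           (use pc pm d Vb[of "sh n" n, OF s1] Vg[of "sh n" n, OF s1] in \<open>auto intro: test_grad_Lp2 tV\<close>)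
      show "(\<lambda>k. P n (x k) i) \<longlonglongrightarrow> P n y i"
        unfolding P_def using r1 r2 by (auto intro!: tendsto_add tendsto_divide x)
    next
      fix c :: "nat \<Rightarrow> real" and i assume i: "i < n + n" "\<bar>c i\<bar> = R"
      have "(c i)\<^sup>2 \<le> ?S n c" by (rule member_le_sum) (use i in auto)
      moreover have "(c i)\<^sup>2 = real (Suc n) * (K + 1)" using i(2) R2 by (metis power2_abs)
      ultimately have "K + 1 \<le> ?S n c / real (Suc n)" by (simp add: pos_le_divide_eq mult.commute del: of_nat_Suc)
      then show "0 < (\<Sum>j<n+n. P n c j * c j)"
        unfolding sumP using lower[of n c] nn(1)[of "nrm (V n c)"] nn(2)[of "nrm (V n (sh n c))"] by linarith
    qed
    then show ?thesis by blast
  qed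
  then obtain c where c: "\<And>n i. i < n + n \<Longrightarrow> P n (c n) i = 0" by metis
  define v where "v n = V n (c n)" for n
  define w where "w n = V n (sh n (c n))" for n
  have tv: "tf (v n)" "tf (w n)" for n unfolding v_def w_def by (rule tV)+
  have zero: "R1 n (c n) (v n) + R2 n (c n) (w n) + ?S n (c n) / real (Suc n) = 0" for n
  proof -
    have "(\<Sum>j<n+n. P n (c n) j * c n j) = 0" using c by (intro sum.neutral) auto
    then show ?thesis unfolding sumP v_def w_def .
  qed
  have est: "m1 / 2 * (nrm (v n))\<^sup>2 + m2 / 2 * (nrm (w n))\<^sup>2 + ?S n (c n) / real (Suc n) \<le> K" for n
    using zero[of n] lower[of n "c n"] unfolding v_def w_def by linarith
  have S0: "?S n (c n) / real (Suc n) \<ge> 0" for n by (intro divide_nonneg_nonneg sum_nonneg) auto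
  have cK: "?S n (c n) / real (Suc n) \<le> K" for n using est[of n] nn(1)[of "nrm (v n)"] nn(2)[of "nrm (w n)"] by linarith
  have bnd: "t \<le> sqrt (2 * K / m)" if "m / 2 * t\<^sup>2 \<le> K" "m > 0" for m t :: real
    by (rule real_le_rsqrt) (use that in \<open>simp add: field_simps\<close>)
  define B where "B = max (sqrt (2 * K / m1)) (sqrt (2 * K / m2))"
  have vB: "nrm (v n) \<le> B" and wB: "nrm (w n) \<le> B" for n
    using bnd[OF _ E1.kmin, of "nrm (v n)"] bnd[OF _ E2.kmin, of "nrm (w n)"] est[of n] S0[of n] nn(1)[of "nrm (v n)"] nn(2)[of "nrm (w n)"]
    unfolding B_def by linarith+
  obtain r v1 w1 where r: "strict_mono r" and H1': "H0 v1 w1" and ae1: "AE x in M. (\<lambda>n. v (r n) x) \<longlonglongrightarrow> v1 x"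
    and wk1: "\<And>G. Lp M 2 G \<Longrightarrow> (\<lambda>n. (LINT x|M. G x \<bullet> grad (v (r n)) x)) \<longlonglongrightarrow> (LINT x|M. G x \<bullet> w1 x)"
    using H0_compactness_AE[of v B, OF tv(1) vB] by blast
  obtain r' v2 w2 where r': "strict_mono r'" and H2': "H0 v2 w2" and ae2: "AE x in M. (\<lambda>n. w (r (r' n)) x) \<longlonglongrightarrow> v2 x"
    and wk2: "\<And>G. Lp M 2 G \<Longrightarrow> (\<lambda>n. (LINT x|M. G x \<bullet> grad (w (r (r' n))) x)) \<longlonglongrightarrow> (LINT x|M. G x \<bullet> w2 x)"
    using H0_compactness_AE[of "\<lambda>n. w (r n)" B, OF tv(2) wB] by blast
  define u where "u n = r (r' n)" for n
  have u: "strict_mono u" using strict_mono_o[OF r r'] by (simp add: u_def[abs_def] o_def)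
  have ae1': "AE x in M. (\<lambda>n. v (u n) x) \<longlonglongrightarrow> v1 x"
    using ae1 by eventually_elim (use LIMSEQ_subseq_LIMSEQ[OF _ r'] in \<open>auto simp: o_def u_def\<close>)
  have wk1': "(\<lambda>n. (LINT x|M. G x \<bullet> grad (v (u n)) x)) \<longlonglongrightarrow> (LINT x|M. G x \<bullet> w1 x)" if "Lp M 2 G" for G
    using LIMSEQ_subseq_LIMSEQ[OF wk1[OF that] r'] by (simp add: o_def u_def)
  have Lp: "Lp M 2 v1" "Lp M 2 w1" "Lp M 2 v2" "Lp M 2 w2" using H1' H2' unfolding H0_def by auto
  let ?p = "\<lambda>x. f1 x + v1 x" and ?q = "\<lambda>x. f2 x + v2 x"
  have P1m: "?p \<in> borel_measurable M" "?q \<in> borel_measurable M"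
    using f Lp by (auto simp: Lp2_measurable)
  have pe: "p n (c n) = (\<lambda>x. f1 x + v n x)" "q n (c n) = (\<lambda>x. f2 x + w n x)" for n by (simp_all add: p_def q_def v_def w_def)
  have aep: "AE x in M. (\<lambda>n. p (u n) (c (u n)) x) \<longlonglongrightarrow> ?p x" "AE x in M. (\<lambda>n. q (u n) (c (u n)) x) \<longlonglongrightarrow> ?q x"
    unfolding pe using ae1' ae2[folded u_def] by (eventually_elim, elim tendsto_add[OF tendsto_const])+
  have lim1: "(\<lambda>n. R1 (u n) (c (u n)) (d j)) \<longlonglongrightarrow> E1.Res ?p ?q w1 (d j)" for j
    unfolding R1_def v_def[symmetric]
    by (rule E1.Res_tendsto[OF pm(1) pm(2) P1m aep test_grad_Lp2[OF tv(1)] Lp(2) vB[unfolded nrm_def] wk1' d])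
  have lim2: "(\<lambda>n. R2 (u n) (c (u n)) (d j)) \<longlonglongrightarrow> E2.Res ?p ?q w2 (d j)" for j
    unfolding R2_def w_def[symmetric]
    by (rule E2.Res_tendsto[OF pm(1) pm(2) P1m aep test_grad_Lp2[OF tv(2)] Lp(4) wB[unfolded nrm_def] wk2[folded u_def] d])
  \<comment> \<open>The penalty enters the energy estimate with the sum of all squares over n + 1,
    which is bounded by K; dividing a single square once more by n + 1 makes its contribution to
    each equation tend to 0.\<close>
  have csmall: "\<bar>c n j / real (Suc n)\<bar> \<le> sqrt (K / real (Suc n))" if "j < n + n" for n j
  proof (rule real_le_rsqrt)
    have "(c n j)\<^sup>2 \<le> ?S n (c n)" by (rule member_le_sum) (use that in auto)
    then have "(c n j)\<^sup>2 / real (Suc n) \<le> K" using cK[of n] divide_right_mono[of "(c n j)\<^sup>2" "?S n (c n)" "real (Suc n)"] by linarith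
    then have "(c n j)\<^sup>2 / real (Suc n) / real (Suc n) \<le> K / real (Suc n)" by (rule divide_right_mono) simp
    then show "\<bar>c n j / real (Suc n)\<bar>\<^sup>2 \<le> K / real (Suc n)" by (simp add: power_divide power2_eq_square)
  qed
  have sq0: "(\<lambda>n. sqrt (K / real (Suc (u n)))) \<longlonglongrightarrow> 0"
  proof -
    have "(\<lambda>n. K * inverse (real (Suc n))) \<longlonglongrightarrow> 0" using tendsto_mult_right_zero[OF LIMSEQ_inverse_real_of_nat] by blast
    then have "(\<lambda>n. sqrt (K / real (Suc n))) \<longlonglongrightarrow> 0" using tendsto_real_sqrt[of _ 0] by (fastforce simp: divide_inverse)
    from LIMSEQ_subseq_LIMSEQ[OF this u] show ?thesis by (simp add: o_def)
  qed
  have z1: "(\<lambda>n. R1 (u n) (c (u n)) (d j)) \<longlonglongrightarrow> 0" and z2: "(\<lambda>n. R2 (u n) (c (u n)) (d j)) \<longlonglongrightarrow> 0" for j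
  proof -
    have "\<forall>\<^sub>F n in sequentially. n > j" by (rule eventually_gt_at_top)
    then have ev: "\<forall>\<^sub>F n in sequentially. u n > j" by eventually_elim (use seq_suble[OF u] in \<open>meson less_le_trans\<close>)
    have r1: "\<bar>R1 n (c n) (d j)\<bar> \<le> sqrt (K / real (Suc n))" if "j < n" for n
      using c[of j n] csmall[of j n] that unfolding P_def by (auto simp: abs_if split: if_splits)
    have r2: "\<bar>R2 n (c n) (d j)\<bar> \<le> sqrt (K / real (Suc n))" if "j < n" for n
      using c[of "n + j" n] csmall[of "n + j" n] that unfolding P_def by (auto simp: abs_if split: if_splits)
    show "(\<lambda>n. R1 (u n) (c (u n)) (d j)) \<longlonglongrightarrow> 0"
      by (rule Lim_null_comparison[OF _ sq0], use ev in eventually_elim) (use r1 in simp)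
    show "(\<lambda>n. R2 (u n) (c (u n)) (d j)) \<longlonglongrightarrow> 0"
      by (rule Lim_null_comparison[OF _ sq0], use ev in eventually_elim) (use r2 in simp)
  qed
  have "E1.Res ?p ?q w1 \<psi> = 0 \<and> E2.Res ?p ?q w2 \<psi> = 0" if "tf \<psi>" for \<psi>
    using bfun_zero_dense[OF E1.bfun_Res[OF P1m Lp(2)] d dense LIMSEQ_unique[OF lim1 z1] that]
      bfun_zero_dense[OF E2.bfun_Res[OF P1m Lp(4)] d dense LIMSEQ_unique[OF lim2 z2] that] by blast
  then show ?thesis using H1' H2' by blast
qed

subsection \<open>Hausdorff measure of graphs\<close>

definition hausdorff1_pre :: "real \<Rightarrow> 'a::euclidean_space set \<Rightarrow> ennreal" where
  "hausdorff1_pre \<delta> A = (INF U\<in>{U. A \<subseteq> (\<Union>i::nat. U i) \<and> (\<forall>i. bounded (U i) \<and> diameter (U i) \<le> \<delta>)}.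
        \<Sum>i. ennreal (diameter (U i)))"

lemma hausdorff1_outer_eq: "hausdorff1_outer A = (SUP \<delta>\<in>{0<..}. hausdorff1_pre \<delta> A)"
  unfolding hausdorff1_outer_def hausdorff1_pre_def ..

lemma hausdorff1_pre_le:
  "A \<subseteq> (\<Union>i::nat. U i) \<Longrightarrow> (\<And>i. bounded (U i)) \<Longrightarrow> (\<And>i. diameter (U i) \<le> \<delta>) \<Longrightarrow> hausdorff1_pre \<delta> A \<le> (\<Sum>i. ennreal (diameter (U i)))"
  unfolding hausdorff1_pre_def by (rule INF_lower) auto

lemma hausdorff1_pre_mono: "A \<subseteq> B \<Longrightarrow> hausdorff1_pre \<delta> A \<le> hausdorff1_pre \<delta> B"
  unfolding hausdorff1_pre_def by (rule INF_superset_mono) auto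

lemma hausdorff1_pre_antimono: "\<delta> \<le> \<delta>' \<Longrightarrow> hausdorff1_pre \<delta>' A \<le> hausdorff1_pre \<delta> A"
  unfolding hausdorff1_pre_def by (rule INF_superset_mono) (auto intro: order_trans)

lemma hausdorff1_pre_le_outer: "\<delta> > 0 \<Longrightarrow> hausdorff1_pre \<delta> A \<le> hausdorff1_outer A"
  unfolding hausdorff1_outer_eq by (rule SUP_upper) simp

lemma hausdorff1_outer_mono: "A \<subseteq> B \<Longrightarrow> hausdorff1_outer A \<le> hausdorff1_outer B"
  unfolding hausdorff1_outer_eq by (intro SUP_mono) (auto intro: hausdorff1_pre_mono)

lemma hausdorff1_outer_empty: "hausdorff1_outer {} = 0"
proof -
  have "hausdorff1_pre \<delta> ({} :: 'a set) \<le> (\<Sum>i::nat. ennreal (diameter ({} :: 'a set)))" if "\<delta> > 0" for \<delta>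
    by (rule hausdorff1_pre_le[of _ "\<lambda>_. {}"]) (use that in \<open>auto simp: diameter_empty\<close>)
  then have "hausdorff1_pre \<delta> ({} :: 'a set) = 0" if "\<delta> > 0" for \<delta> using that by (simp add: diameter_empty)
  then show ?thesis unfolding hausdorff1_outer_eq by (simp add: SUP_eq_const)
qed

lemma hausdorff1_outer_UN: "hausdorff1_outer (\<Union>i::nat. A i) \<le> (\<Sum>i. hausdorff1_outer (A i))"
proof -
  have "hausdorff1_pre \<delta> (\<Union>i. A i) \<le> (\<Sum>i. hausdorff1_outer (A i))" if \<delta>: "\<delta> > 0" for \<delta>
  proof (rule ennreal_le_epsilon)
    fix e :: real assume fin: "(\<Sum>i. hausdorff1_outer (A i)) < top" and e: "e > 0"
    have "\<exists>U. A i \<subseteq> (\<Union>j::nat. U j) \<and> (\<forall>j. bounded (U j) \<and> diameter (U j) \<le> \<delta>) \<and>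
        (\<Sum>j. ennreal (diameter (U j))) \<le> hausdorff1_outer (A i) + ennreal (e * (1/2) ^ Suc i)" for i
    proof -
      have "hausdorff1_outer (A i) < top" using ennreal_suminf_lessD[OF fin] .
      then have "hausdorff1_pre \<delta> (A i) < top" using hausdorff1_pre_le_outer[OF \<delta>, of "A i"] by (rule le_less_trans[rotated])
      then have "hausdorff1_pre \<delta> (A i) < hausdorff1_pre \<delta> (A i) + ennreal (e * (1/2) ^ Suc i)"
        using e by (cases "hausdorff1_pre \<delta> (A i)" rule: ennreal_cases) (auto simp: ennreal_less_iff simp flip: ennreal_plus)
      then obtain U where "A i \<subseteq> (\<Union>j::nat. U j)" "\<forall>j. bounded (U j) \<and> diameter (U j) \<le> \<delta>"
        "(\<Sum>j. ennreal (diameter (U j))) < hausdorff1_pre \<delta> (A i) + ennreal (e * (1/2) ^ Suc i)"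
        unfolding hausdorff1_pre_def[of \<delta> "A i"] INF_less_iff by auto
      then show ?thesis using add_right_mono[OF hausdorff1_pre_le_outer[OF \<delta>, of "A i"], of "ennreal (e * (1/2) ^ Suc i)"]
        by (intro exI[of _ U]) (auto intro: order_trans[OF less_imp_le])
    qed
    then obtain U where U: "\<And>i. A i \<subseteq> (\<Union>j::nat. U i j)" "\<And>i j. bounded (U i j)" "\<And>i j. diameter (U i j) \<le> \<delta>"
      "\<And>i. (\<Sum>j. ennreal (diameter (U i j))) \<le> hausdorff1_outer (A i) + ennreal (e * (1/2) ^ Suc i)" by metis
    define V where "V n = case_prod U (prod_decode n)" for n
    have "(\<Union>i. A i) \<subseteq> (\<Union>n. V n)"
    proof
      fix x assume "x \<in> (\<Union>i. A i)"
      then obtain i j where "x \<in> U i j" using U(1) by blast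
      then have "x \<in> V (prod_encode (i, j))" by (simp add: V_def)
      then show "x \<in> (\<Union>n. V n)" by blast
    qed
    then have "hausdorff1_pre \<delta> (\<Union>i. A i) \<le> (\<Sum>n. ennreal (diameter (V n)))"
      by (rule hausdorff1_pre_le) (auto simp: V_def split_beta U)
    also have "\<dots> = (\<Sum>n. (\<lambda>p. ennreal (diameter (case_prod U p))) (prod_decode n))" by (simp add: V_def)
    also have "\<dots> = (\<Sum>i. \<Sum>j. ennreal (diameter (U i j)))" by (rule suminf_ennreal_2dimen) simp
    also have "\<dots> \<le> (\<Sum>i. hausdorff1_outer (A i) + ennreal (e * (1/2) ^ Suc i))" by (intro suminf_le U) auto
    also have "\<dots> = (\<Sum>i. hausdorff1_outer (A i)) + (\<Sum>i. ennreal (e * (1/2) ^ Suc i))"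
      by (rule suminf_add[symmetric]) auto
    also have "(\<Sum>i. ennreal (e * (1/2) ^ Suc i)) = ennreal e"
    proof -
      have "(\<lambda>i. e * (1/2) ^ Suc i) sums (e * 1)" by (intro sums_mult power_half_series)
      then have "(\<lambda>i. ennreal (e * (1/2) ^ Suc i)) sums ennreal (e * 1)" using e by (subst sums_ennreal) auto
      then show ?thesis using sums_unique by fastforce
    qed
    finally show "hausdorff1_pre \<delta> (\<Union>i. A i) \<le> (\<Sum>i. hausdorff1_outer (A i)) + ennreal e" .
  qed
  then show ?thesis unfolding hausdorff1_outer_eq[of "\<Union>i. A i"] by (intro SUP_least) auto
qed

lemma hausdorff1_outer_Un: "hausdorff1_outer (A \<union> B) \<le> hausdorff1_outer A + hausdorff1_outer B"
proof -
  define U where "U i = (if i = 0 then A else if i = 1 then B else {})" for i :: nat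
  have "A \<union> B \<subseteq> (\<Union>i. U i)" unfolding U_def by (auto intro: exI[of _ "0::nat"] exI[of _ "1::nat"])
  then have "hausdorff1_outer (A \<union> B) \<le> hausdorff1_outer (\<Union>i. U i)" by (rule hausdorff1_outer_mono)
  also have "\<dots> \<le> (\<Sum>i. hausdorff1_outer (U i))" by (rule hausdorff1_outer_UN)
  also have "\<dots> = (\<Sum>i\<in>{0,1}. hausdorff1_outer (U i))"
    by (rule suminf_finite) (auto simp: U_def hausdorff1_outer_empty)
  also have "\<dots> = hausdorff1_outer A + hausdorff1_outer B" by (simp add: U_def)
  finally show ?thesis .
qed

lemma hausdorff1_outer_seq: "hausdorff1_outer A = (SUP n. hausdorff1_pre (1 / real (Suc n)) A)"
proof (rule antisym)
  show "(SUP n. hausdorff1_pre (1 / real (Suc n)) A) \<le> hausdorff1_outer A"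
    by (intro SUP_least hausdorff1_pre_le_outer) simp
  show "hausdorff1_outer A \<le> (SUP n. hausdorff1_pre (1 / real (Suc n)) A)"
    unfolding hausdorff1_outer_eq
  proof (rule SUP_mono)
    fix \<delta> :: real assume "\<delta> \<in> {0<..}"
    then obtain n where "inverse (real (Suc n)) < \<delta>" using reals_Archimedean by auto
    then have "hausdorff1_pre \<delta> A \<le> hausdorff1_pre (1 / real (Suc n)) A"
      by (intro hausdorff1_pre_antimono) (simp add: inverse_eq_divide)
    then show "\<exists>m\<in>UNIV. hausdorff1_pre \<delta> A \<le> hausdorff1_pre (1 / real (Suc m)) A" by blast
  qed
qed

text \<open>A set of diameter below d cannot meet both A and B, so a fine cover of the union splits
  into disjointly used covers of the two parts.\<close>

lemma hausdorff1_outer_separated: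
  assumes d: "d > 0" "\<And>x y. x \<in> A \<Longrightarrow> y \<in> B \<Longrightarrow> d \<le> dist x y"
  shows "hausdorff1_outer A + hausdorff1_outer B \<le> hausdorff1_outer (A \<union> B)"
proof -
  have pre: "hausdorff1_pre \<delta> A + hausdorff1_pre \<delta> B \<le> hausdorff1_outer (A \<union> B)" if \<delta>: "0 < \<delta>" "\<delta> < d" for \<delta>
  proof -
    have "hausdorff1_pre \<delta> A + hausdorff1_pre \<delta> B \<le> (\<Sum>i. ennreal (diameter (U i)))"
      if U: "A \<union> B \<subseteq> (\<Union>i::nat. U i)" "\<And>i. bounded (U i)" "\<And>i. diameter (U i) \<le> \<delta>" for U
    proof -
      define V where "V i = (if U i \<inter> A \<noteq> {} then U i else {})" for i
      define W where "W i = (if U i \<inter> B \<noteq> {} then U i else {})" for i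
      have sep: "U i \<inter> A = {} \<or> U i \<inter> B = {}" for i
      proof (rule ccontr)
        assume "\<not> ?thesis"
        then obtain x y where "x \<in> U i" "x \<in> A" "y \<in> U i" "y \<in> B" by blast
        then have "dist x y \<le> \<delta>" "d \<le> dist x y" using diameter_bounded_bound[OF U(2)[of i]] U(3)[of i] d(2) by fastforce+
        then show False using \<delta> by linarith
      qed
      have "A \<subseteq> (\<Union>i. V i)" "B \<subseteq> (\<Union>i. W i)" using U(1) unfolding V_def W_def by fastforce+
      then have "hausdorff1_pre \<delta> A \<le> (\<Sum>i. ennreal (diameter (V i)))"
        by (intro hausdorff1_pre_le) (use U \<delta> in \<open>auto simp: V_def diameter_empty\<close>)
      moreover have "hausdorff1_pre \<delta> B \<le> (\<Sum>i. ennreal (diameter (W i)))"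
        using \<open>B \<subseteq> _\<close> by (rule hausdorff1_pre_le) (use U \<delta> in \<open>auto simp: W_def diameter_empty\<close>)
      ultimately have "hausdorff1_pre \<delta> A + hausdorff1_pre \<delta> B \<le> (\<Sum>i. ennreal (diameter (V i))) + (\<Sum>i. ennreal (diameter (W i)))"
        by (rule add_mono)
      also have "\<dots> = (\<Sum>i. ennreal (diameter (V i)) + ennreal (diameter (W i)))" by (rule suminf_add) auto
      also have "\<dots> \<le> (\<Sum>i. ennreal (diameter (U i)))"
        by (rule suminf_le) (use sep in \<open>auto simp: V_def W_def diameter_empty\<close>)
      finally show ?thesis .
    qed
    then have "hausdorff1_pre \<delta> A + hausdorff1_pre \<delta> B \<le> hausdorff1_pre \<delta> (A \<union> B)"
      unfolding hausdorff1_pre_def[of \<delta> "A \<union> B"] by (intro INF_greatest) auto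
    then show ?thesis using hausdorff1_pre_le_outer[OF \<delta>(1), of "A \<union> B"] by (rule order_trans)
  qed
  have inc: "incseq (\<lambda>n. hausdorff1_pre (1 / real (Suc n)) X)" for X :: "'a set"
    by (rule monoI, rule hausdorff1_pre_antimono) (simp add: frac_le)
  have "hausdorff1_outer A + hausdorff1_outer B = (SUP n. hausdorff1_pre (1 / real (Suc n)) A + hausdorff1_pre (1 / real (Suc n)) B)"
    unfolding hausdorff1_outer_seq by (rule ennreal_SUP_add[OF inc inc, symmetric])
  also have "\<dots> \<le> hausdorff1_outer (A \<union> B)"
  proof (rule SUP_least)
    fix n :: nat
    define \<delta> where "\<delta> = min (1 / real (Suc n)) (d / 2)"
    have "\<delta> > 0" "\<delta> < d" "\<delta> \<le> 1 / real (Suc n)" using d(1) by (auto simp: \<delta>_def min_def)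
    then show "hausdorff1_pre (1 / real (Suc n)) A + hausdorff1_pre (1 / real (Suc n)) B \<le> hausdorff1_outer (A \<union> B)"
      using order_trans[OF add_mono[OF hausdorff1_pre_antimono hausdorff1_pre_antimono] pre] by blast
  qed
  finally show ?thesis .
qed

text \<open>Caratheodory's criterion. The layers of \<open>X - F\<close> with indices of equal parity are positively
  separated, so the series of their measures converges.\<close>

lemma hausdorff1_closed_split:
  assumes F: "closed (F :: 'a::euclidean_space set)"
  shows "hausdorff1_outer (X \<inter> F) + hausdorff1_outer (X - F) \<le> hausdorff1_outer X"
proof (cases "hausdorff1_outer X = top \<or> F = {}")
  case True
  then show ?thesis by (auto simp: hausdorff1_outer_empty)
next
  case False
  then have fin: "hausdorff1_outer X < top" and ne: "F \<noteq> {}" by (auto simp: less_top)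
  let ?H = "hausdorff1_outer :: 'a set \<Rightarrow> ennreal"
  define XX where "XX n = {x \<in> X. infdist x F \<ge> 1 / real (Suc n)}" for n
  define R where "R n = XX (Suc n) - XX n" for n
  have infd: "infdist x F \<le> dist x y + infdist y F" for x y :: 'a using infdist_triangle[of x F y] by (simp add: add.commute)
  have sepF: "?H (X \<inter> F) + ?H (XX n) \<le> ?H X" for n
  proof -
    have "?H (X \<inter> F) + ?H (XX n) \<le> ?H (X \<inter> F \<union> XX n)"
    proof (rule hausdorff1_outer_separated)
      show "0 < 1 / real (Suc n)" by simp
      show "1 / real (Suc n) \<le> dist x y" if "x \<in> X \<inter> F" "y \<in> XX n" for x y
        using that infdist_le[of x F y] unfolding XX_def by (auto simp: dist_commute)
    qed
    also have "\<dots> \<le> ?H X" by (rule hausdorff1_outer_mono) (auto simp: XX_def)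
    finally show ?thesis .
  qed
  have Rsep: "1 / real (Suc (Suc n)) - 1 / real (Suc (Suc (Suc n))) \<le> dist x y" if "x \<in> R n" "y \<in> R m" "m \<ge> n + 2" for x y n m
  proof -
    have 1: "infdist x F \<ge> 1 / real (Suc (Suc n))" using that(1) unfolding R_def XX_def by auto
    have "infdist y F < 1 / real (Suc m)" using that(2) unfolding R_def XX_def by auto
    also have "\<dots> \<le> 1 / real (Suc (Suc (Suc n)))" using that(3) by (intro frac_le) auto
    finally show ?thesis using 1 infd[of x y] by linarith
  qed
  have par: "(\<Sum>i<m. ?H (R (2 * i + a))) \<le> ?H (\<Union>i<m. R (2 * i + a))" for m a
  proof (induction m)
    case (Suc m)
    let ?n = "2 * m + a"
    have "(\<Sum>i<Suc m. ?H (R (2 * i + a))) \<le> ?H (\<Union>i<m. R (2 * i + a)) + ?H (R ?n)" using Suc by (simp add: add_right_mono)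
    also have "\<dots> \<le> ?H ((\<Union>i<m. R (2 * i + a)) \<union> R ?n)"
    proof (cases "m = 0")
      case False
      show ?thesis
      proof (rule hausdorff1_outer_separated)
        let ?d = "\<lambda>i. 1 / real (Suc (Suc (2 * i + a))) - 1 / real (Suc (Suc (Suc (2 * i + a))))"
        have pos: "?d i > 0" for i by (simp add: frac_less2)
        show "0 < Min (?d ` {..<m})" using False pos by (subst Min_gr_iff) auto
        show "Min (?d ` {..<m}) \<le> dist x y" if x: "x \<in> (\<Union>i<m. R (2 * i + a))" and y: "y \<in> R ?n" for x y
        proof -
          obtain i where i: "i < m" "x \<in> R (2 * i + a)" using x by blast
          have "Min (?d ` {..<m}) \<le> ?d i" using i by (intro Min_le) auto
          also have "\<dots> \<le> dist x y" using Rsep[OF i(2) y] i(1) by simp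
          finally show ?thesis .
        qed
      qed
    qed (simp add: hausdorff1_outer_empty)
    also have "(\<Union>i<m. R (2 * i + a)) \<union> R ?n = (\<Union>i<Suc m. R (2 * i + a))" by (auto simp: less_Suc_eq)
    finally show ?case .
  qed (simp add: hausdorff1_outer_empty)
  have parX: "(\<Sum>i<m. ?H (R (2 * i + a))) \<le> ?H X" for m a
    by (rule order_trans[OF par hausdorff1_outer_mono]) (auto simp: R_def XX_def)
  have sum2: "(\<Sum>i<m. ?H (R i)) \<le> 2 * ?H X" for m
  proof -
    have "(\<Sum>i<m. ?H (R i)) \<le> (\<Sum>i<2*m. ?H (R i))" by (rule sum_mono2) auto
    also have "\<dots> = (\<Sum>i<m. ?H (R (2 * i + 0))) + (\<Sum>i<m. ?H (R (2 * i + 1)))"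
      by (induction m) (auto simp: algebra_simps)
    also have "\<dots> \<le> ?H X + ?H X" by (intro add_mono parX)
    finally show ?thesis by (simp add: mult_2)
  qed
  have HR: "?H (R i) < top" for i
    using hausdorff1_outer_mono[of "R i" X] fin by (auto simp: R_def XX_def intro: le_less_trans)
  define \<rho> where "\<rho> i = enn2real (?H (R i))" for i
  have \<rho>: "?H (R i) = ennreal (\<rho> i)" "\<rho> i \<ge> 0" for i using HR[of i] by (auto simp: \<rho>_def ennreal_enn2real_if less_top)
  have "summable \<rho>"
  proof (rule summableI_nonneg_bounded)
    show "(\<Sum>i<m. \<rho> i) \<le> enn2real (2 * ?H X)" for m
    proof -
      have "ennreal (\<Sum>i<m. \<rho> i) \<le> 2 * ?H X" using sum2[of m] \<rho> by (simp add: sum_ennreal)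
      then have "enn2real (ennreal (\<Sum>i<m. \<rho> i)) \<le> enn2real (2 * ?H X)"
        using fin by (intro enn2real_mono) (auto simp: ennreal_mult_less_top)
      then show ?thesis using \<rho>(2) by (simp add: sum_nonneg)
    qed
  qed (rule \<rho>)
  show ?thesis
  proof (rule ennreal_le_epsilon)
    fix e :: real assume "e > 0"
    then obtain N where N: "norm (\<Sum>i. \<rho> (i + N)) < e" using suminf_exist_split[OF _ \<open>summable \<rho>\<close>, of e] by blast
    have "X - F \<subseteq> XX N \<union> (\<Union>i. R (i + N))"
    proof
      fix x assume x: "x \<in> X - F"
      have "infdist x F > 0" using x F ne in_closed_iff_infdist_zero[OF F ne, of x] infdist_nonneg[of x F] by force
      then obtain m where "inverse (real (Suc m)) < infdist x F" using reals_Archimedean by blast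
      then have m: "x \<in> XX m" using x by (auto simp: XX_def inverse_eq_divide)
      define k where "k = (LEAST k. x \<in> XX k)"
      have k: "x \<in> XX k" unfolding k_def by (rule LeastI[of _ m]) (rule m)
      show "x \<in> XX N \<union> (\<Union>i. R (i + N))"
      proof (cases "k \<le> N")
        case True
        have "1 / real (Suc N) \<le> 1 / real (Suc k)" using True by (intro frac_le) auto
        then have "x \<in> XX N" using k unfolding XX_def by auto
        then show ?thesis by blast
      next
        case False
        then have "x \<notin> XX (k - 1)" using not_less_Least[of "k - 1" "\<lambda>k. x \<in> XX k"] unfolding k_def[symmetric] by simp
        then have "x \<in> R (k - 1)" using k False unfolding R_def by simp
        then have "x \<in> R ((k - 1 - N) + N)" using False by simp
        then show ?thesis by blast
      qed
    qed
    then have "?H (X - F) \<le> ?H (XX N \<union> (\<Union>i. R (i + N)))" by (rule hausdorff1_outer_mono)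
    also have "\<dots> \<le> ?H (XX N) + ?H (\<Union>i. R (i + N))" by (rule hausdorff1_outer_Un)
    also have "\<dots> \<le> ?H (XX N) + (\<Sum>i. ?H (R (i + N)))" by (intro add_left_mono hausdorff1_outer_UN)
    also have "(\<Sum>i. ?H (R (i + N))) = ennreal (\<Sum>i. \<rho> (i + N))"
      unfolding \<rho>(1) using \<rho>(2) \<open>summable \<rho>\<close> by (intro suminf_ennreal2) auto
    also have "\<dots> \<le> ennreal e" using N by (intro ennreal_leI) auto
    finally have "?H (X - F) \<le> ?H (XX N) + ennreal e" by (simp add: add_left_mono)
    then have "?H (X \<inter> F) + ?H (X - F) \<le> ?H (X \<inter> F) + ?H (XX N) + ennreal e" by (simp add: add_left_mono add.assoc)
    also have "\<dots> \<le> ?H X + ennreal e" by (intro add_right_mono sepF)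
    finally show "?H (X \<inter> F) + ?H (X - F) \<le> ?H X + ennreal e" .
  qed
qed

lemma hausdorff1_measure:
  shows sets_hausdorff1: "sets borel \<subseteq> sets (hausdorff1 :: 'a::euclidean_space measure)"
    and emeasure_hausdorff1: "A \<in> sets borel \<Longrightarrow> emeasure (hausdorff1 :: 'a measure) A = hausdorff1_outer A"
    and space_hausdorff1: "space (hausdorff1 :: 'a measure) = UNIV"
proof -
  interpret P: sigma_algebra "UNIV :: 'a set" "Pow UNIV" by (rule sigma_algebra_Pow)
  define L where "L = lambda_system (UNIV :: 'a set) (Pow UNIV) hausdorff1_outer"
  have "outer_measure_space (Pow (UNIV :: 'a set)) hausdorff1_outer"
    unfolding outer_measure_space_def positive_def increasing_def countably_subadditive_def
    by (auto simp: hausdorff1_outer_empty hausdorff1_outer_mono hausdorff1_outer_UN)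
  then have ms: "measure_space UNIV L hausdorff1_outer" unfolding L_def by (rule P.caratheodory_lemma)
  then interpret L: sigma_algebra UNIV L unfolding measure_space_def by blast
  have "F \<in> L" if "closed F" for F
    unfolding L_def P.lambda_system_eq
  proof (safe intro!: antisym)
    fix X :: "'a set"
    show "hausdorff1_outer (X \<inter> F) + hausdorff1_outer (X - F) \<le> hausdorff1_outer X" by (rule hausdorff1_closed_split[OF that])
    have "hausdorff1_outer ((X \<inter> F) \<union> (X - F)) \<le> hausdorff1_outer (X \<inter> F) + hausdorff1_outer (X - F)" by (rule hausdorff1_outer_Un)
    then show "hausdorff1_outer X \<le> hausdorff1_outer (X \<inter> F) + hausdorff1_outer (X - F)" by (simp add: Int_Diff_Un)
  qed auto
  then have "sigma_sets UNIV (Collect closed) \<subseteq> L" by (intro L.sigma_sets_subset) auto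
  then have bL: "sets borel \<subseteq> L" unfolding borel_eq_closed by (subst sets_measure_of) auto
  have sets: "sets (hausdorff1 :: 'a measure) = L"
    unfolding hausdorff1_def L_def[symmetric] by (subst sets_measure_of) (auto simp: L.sigma_sets_eq)
  then show "sets borel \<subseteq> sets (hausdorff1 :: 'a measure)" using bL by simp
  show "space (hausdorff1 :: 'a measure) = UNIV" unfolding hausdorff1_def by (simp add: space_measure_of_conv)
  show "emeasure (hausdorff1 :: 'a measure) A = hausdorff1_outer A" if "A \<in> sets borel"
    unfolding hausdorff1_def L_def[symmetric]
    by (rule emeasure_measure_of_sigma) (use ms that bL in \<open>auto simp: measure_space_def\<close>)
qed

text \<open>Orthogonal projection to the line spanned by e does not increase diameters, so a cover
  of E projects to a cover of S by intervals that are no longer than the covering sets.\<close>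

lemma graph_projection_le:
  fixes e :: "real^2" and \<Gamma> :: "real \<Rightarrow> real^2"
  assumes e: "norm e = 1" and E: "\<And>s. s \<in> S \<Longrightarrow> \<Gamma> s \<in> E \<and> \<Gamma> s \<bullet> e = s"
  assumes S: "S \<in> sets borel"
  shows "emeasure lborel S \<le> hausdorff1_outer E"
proof -
  have "emeasure lborel S \<le> (\<Sum>i. ennreal (diameter (U i)))"
    if U: "E \<subseteq> (\<Union>i::nat. U i)" "\<And>i. bounded (U i)" for U
  proof -
    define P where "P i = (\<lambda>x. x \<bullet> e) ` U i" for i
    have dP: "\<bar>s - t\<bar> \<le> diameter (U i)" if st: "s \<in> P i" "t \<in> P i" for s t i
    proof -
      obtain x y where x: "x \<in> U i" "y \<in> U i" "s = x \<bullet> e" "t = y \<bullet> e" using st unfolding P_def by blast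
      have "\<bar>s - t\<bar> \<le> norm (x - y)" using Cauchy_Schwarz_ineq2[of "x - y" e] e by (simp add: x inner_diff_left)
      also have "\<dots> \<le> diameter (U i)" using diameter_bounded_bound[OF U(2) x(1,2)] by (simp add: dist_norm)
      finally show ?thesis .
    qed
    have bP: "bounded (P i)" for i unfolding P_def by (rule bounded_linear_image[OF U(2) bounded_linear_inner_left])
    define I where "I i = (if P i = {} then {} else {Inf (P i) .. Sup (P i)})" for i
    have PI: "P i \<subseteq> I i" for i
      using bP[of i] unfolding I_def by (auto intro!: cInf_lower cSup_upper dest: bounded_imp_bdd_above bounded_imp_bdd_below)
    have mI: "emeasure lborel (I i) \<le> ennreal (diameter (U i))" for i
    proof (cases "P i = {}")
      case False
      then obtain t0 where t0: "t0 \<in> P i" by blast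
      have "Sup (P i) \<le> diameter (U i) + t" if "t \<in> P i" for t
        using False by (rule cSup_least) (use dP[OF _ that] in \<open>fastforce simp: abs_le_iff\<close>)
      then have "Sup (P i) - diameter (U i) \<le> Inf (P i)" using False by (intro cInf_greatest) (auto simp: algebra_simps)
      moreover have "Inf (P i) \<le> Sup (P i)" using PI[of i] t0 False unfolding I_def by auto
      ultimately show ?thesis using False by (simp add: I_def ennreal_leI)
    qed (simp add: I_def)
    have "S \<subseteq> (\<Union>i. I i)"
    proof
      fix s assume "s \<in> S"
      then have "\<Gamma> s \<in> E" and s: "\<Gamma> s \<bullet> e = s" using E by blast+
      then obtain i where "\<Gamma> s \<in> U i" using U(1) by blast
      then have "s \<in> P i" using s unfolding P_def by force
      then show "s \<in> (\<Union>i. I i)" using PI by blast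
    qed
    then have "emeasure lborel S \<le> emeasure lborel (\<Union>i. I i)" by (intro emeasure_mono) (auto simp: I_def)
    also have "\<dots> \<le> (\<Sum>i. emeasure lborel (I i))" by (intro emeasure_subadditive_countably) (auto simp: I_def)
    also have "\<dots> \<le> (\<Sum>i. ennreal (diameter (U i)))" by (intro suminf_le mI) auto
    finally show ?thesis .
  qed
  then have "emeasure lborel S \<le> hausdorff1_pre 1 E" unfolding hausdorff1_pre_def by (intro INF_greatest) auto
  also have "\<dots> \<le> hausdorff1_outer E" by (rule hausdorff1_pre_le_outer) simp
  finally show ?thesis .
qed

text \<open>The comparison of measures passes to integrals through image measures on the plane. This
  direction of the inequality carries smallness of boundary values, measured on the frontier, into a
  chart.\<close>

lemma graph_integral_le:
  fixes e :: "real^2" and \<Gamma> :: "real \<Rightarrow> real^2" and h :: "real^2 \<Rightarrow> ennreal"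
  assumes e: "norm e = 1" and I: "I \<in> sets borel" and \<Gamma>: "\<And>s. s \<in> I \<Longrightarrow> \<Gamma> s \<in> frontier \<Omega> \<and> \<Gamma> s \<bullet> e = s"
    and [measurable]: "\<Gamma> \<in> borel_measurable borel" "h \<in> borel_measurable borel"
  shows "(\<integral>\<^sup>+s. h (\<Gamma> s) * indicator I s \<partial>lborel) \<le> (\<integral>\<^sup>+x. h x \<partial>boundary_measure \<Omega>)"
proof -
  note [measurable] = I
  have F: "frontier \<Omega> \<in> sets borel" by (simp add: frontier_closed borel_closed)
  then have Fh: "frontier \<Omega> \<inter> space hausdorff1 \<in> sets hausdorff1" using sets_hausdorff1 by (auto simp: space_hausdorff1)
  have id [measurable]: "(\<lambda>x. x) \<in> boundary_measure \<Omega> \<rightarrow>\<^sub>M borel"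
    unfolding boundary_measure_def using sets_hausdorff1
    by (intro measurable_restrict_space1) (auto simp: measurable_def space_hausdorff1)
  have g: "\<Gamma> \<in> restrict_space lborel I \<rightarrow>\<^sub>M borel" by (intro measurable_restrict_space1) simp
  define N1 where "N1 = distr (restrict_space lborel I) borel \<Gamma>"
  define N2 where "N2 = distr (boundary_measure \<Omega>) borel (\<lambda>x. x)"
  have "emeasure N1 E \<le> emeasure N2 E" for E
  proof (cases "E \<in> sets borel")
    case True
    have [measurable]: "\<Gamma> -` E \<in> sets borel"
      using measurable_sets[OF \<open>\<Gamma> \<in> borel_measurable borel\<close> True] by simp
    have "emeasure N1 E = emeasure (restrict_space lborel I) (\<Gamma> -` E \<inter> I)"
      unfolding N1_def by (subst emeasure_distr[OF g True]) (simp add: space_restrict_space)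
    also have "\<dots> = emeasure lborel (\<Gamma> -` E \<inter> I)" by (rule emeasure_restrict_space) (use I in auto)
    also have "\<dots> \<le> hausdorff1_outer (E \<inter> frontier \<Omega>)"
      by (rule graph_projection_le[OF e, of _ \<Gamma>]) (use \<Gamma> in auto)
    also have "\<dots> = emeasure hausdorff1 (E \<inter> frontier \<Omega>)" using True F by (intro emeasure_hausdorff1[symmetric]) auto
    also have "\<dots> = emeasure (boundary_measure \<Omega>) (E \<inter> frontier \<Omega>)"
      unfolding boundary_measure_def by (rule emeasure_restrict_space[OF Fh, symmetric]) simp
    also have "\<dots> = emeasure N2 E"
      unfolding N2_def by (subst emeasure_distr[OF id True]) (simp add: boundary_measure_def space_restrict_space space_hausdorff1)
    finally show ?thesis .
  next
    case False
    then show ?thesis by (simp add: emeasure_notin_sets N1_def N2_def)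
  qed
  then have "N1 \<le> N2" by (auto simp: le_measure_iff N1_def N2_def le_fun_def)
  then have "(\<integral>\<^sup>+x. h x \<partial>N1) \<le> (\<integral>\<^sup>+x. h x \<partial>N2)" by (intro nn_integral_mono_measure) (auto simp: N1_def N2_def)
  moreover have "(\<integral>\<^sup>+x. h x \<partial>N1) = (\<integral>\<^sup>+s. h (\<Gamma> s) * indicator I s \<partial>lborel)"
    unfolding N1_def by (subst nn_integral_distr[OF g]) (auto intro!: nn_integral_restrict_space)
  moreover have "(\<integral>\<^sup>+x. h x \<partial>N2) = (\<integral>\<^sup>+x. h x \<partial>boundary_measure \<Omega>)"
    unfolding N2_def by (subst nn_integral_distr[OF id]) auto
  ultimately show ?thesis by simp
qed

subsection \<open>Functions with zero trace\<close>

lemma power2_add_le_ennreal: "(a + b :: ennreal)\<^sup>2 \<le> 2 * a\<^sup>2 + 2 * b\<^sup>2"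
proof (cases a rule: ennreal_cases)
  case (real x)
  note a = this
  show ?thesis
  proof (cases b rule: ennreal_cases)
    case (real y)
    have "(x + y)\<^sup>2 \<le> 2 * x\<^sup>2 + 2 * y\<^sup>2" using sum_squares_bound[of x y] by (simp add: power2_sum)
    then have "ennreal ((x + y)\<^sup>2) \<le> ennreal (2 * x\<^sup>2 + 2 * y\<^sup>2)" by (rule ennreal_leI)
    also have "ennreal (2 * x\<^sup>2 + 2 * y\<^sup>2) = 2 * ennreal (x\<^sup>2) + 2 * ennreal (y\<^sup>2)" by (simp add: ennreal_plus ennreal_mult)
    finally show ?thesis using a real by (simp add: ennreal_power flip: ennreal_plus)
  qed (simp add: ennreal_mult_top)
qed (simp add: ennreal_mult_top)

context bounded_domain begin

abbreviation D :: "real^2 \<Rightarrow> real" where "D x \<equiv> infdist x (- \<Omega>)"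

lemma compl_nonempty: "- \<Omega> \<noteq> {}"
proof -
  have "\<Omega> \<noteq> UNIV" using bounded_domain not_bounded_UNIV by metis
  then show ?thesis by auto
qed

lemma D_pos: "x \<in> \<Omega> \<Longrightarrow> D x > 0"
  using in_closed_iff_infdist_zero[of "- \<Omega>" x] compl_nonempty open_domain infdist_nonneg[of x "- \<Omega>"]
  by (force simp: closed_Compl)

lemma D_lip: "\<bar>D x - D y\<bar> \<le> dist x y"
  using infdist_triangle_abs .

lemma D_near: assumes "D x < s" shows "\<exists>y. y \<notin> \<Omega> \<and> dist x y < s"
proof -
  have "Inf (dist x ` (- \<Omega>)) < s" using assms compl_nonempty unfolding infdist_def by simp
  then obtain z where "z \<in> dist x ` (- \<Omega>)" "z < s" using cInf_lessD[of "dist x ` (- \<Omega>)" s] compl_nonempty by blast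
  then show ?thesis by blast
qed

lemma compact_D_lower: assumes "compact K" "K \<subseteq> \<Omega>" shows "\<exists>d>0. \<forall>x\<in>K. d \<le> D x"
proof (cases "K = {}")
  case False
  have "continuous_on K D" by (intro continuous_intros)
  then obtain x0 where x0: "x0 \<in> K" "\<And>x. x \<in> K \<Longrightarrow> D x0 \<le> D x" using continuous_attains_inf[OF assms(1) False] by blast
  then show ?thesis using D_pos[of x0] assms(2) by blast
qed (auto intro: exI[of _ 1])

lemma D_borel [measurable]: "D \<in> borel_measurable borel"
  by (intro borel_measurable_continuous_onI continuous_intros)

definition strip :: "real \<Rightarrow> (real^2) set" where "strip s = {x \<in> \<Omega>. D x < s}"

lemma strip_borel [measurable]: "strip s \<in> sets borel"
proof -
  have "strip s = \<Omega> \<inter> {x \<in> space borel. D x < s}" by (auto simp: strip_def)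
  then show ?thesis by simp
qed

definition int2 :: "(real^2) set \<Rightarrow> (real^2 \<Rightarrow> 'b::euclidean_space) \<Rightarrow> ennreal" where
  "int2 S f = (\<integral>\<^sup>+x. ennreal ((norm (f x))\<^sup>2) * indicator S x \<partial>lborel)"

abbreviation boundary_sq :: "(real^2 \<Rightarrow> real) \<Rightarrow> ennreal" where
  "boundary_sq f \<equiv> \<integral>\<^sup>+x. ennreal ((f x)\<^sup>2) \<partial>boundary_measure \<Omega>"

text \<open>The powers of s are what the cutoff argument needs: a cutoff adapted to the strip has
  gradient of order 1 / s, whose square the factor \<open>s\<^sup>2\<close> compensates, and the
  boundary term vanishes with the boundary values before s is sent to 0.\<close>

definition strip_bound :: "(real^2) set \<Rightarrow> real \<Rightarrow> real \<Rightarrow> bool" where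
  "strip_bound S C s0 \<longleftrightarrow> C \<ge> 1 \<and> s0 > 0 \<and> (\<forall>s h. 0 < s \<longrightarrow> s < s0 \<longrightarrow> C1 h \<longrightarrow>
     int2 (strip s \<inter> S) h \<le> ennreal (C * s) * boundary_sq h
       + ennreal (C * s\<^sup>2) * int2 (strip (C * s)) (grad h))"

text \<open>In the chart, h at a point is its value at the foot on the graph plus the integral of
  the gradient along the vertical segment between them. Squaring and integrating over heights below
  T, and then over the base, gives the two terms; the base integral of the squared values on the
  graph is at most the boundary integral.\<close>

lemma strip_local:
  assumes "p \<in> frontier \<Omega>" and e: "norm e = 1" and \<epsilon>: "\<epsilon> > 0" and lip: "L-lipschitz_on {y. y \<bullet> e = 0} \<gamma>"
    and chart: "\<And>x. x \<in> ball p \<epsilon> \<Longrightarrow> x \<in> \<Omega> \<longleftrightarrow> \<gamma> (x - (x \<bullet> e) *\<^sub>R e) < x \<bullet> e"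
  shows "\<exists>r>0. \<exists>C s0. strip_bound (ball p r) C s0"
proof -
  let ?f = "perp e"
  note pe = perp_simps(1)[OF e] perp_simps(2,3)[of e]
  have L0: "L \<ge> 0" by (rule lipschitz_on_nonneg[OF lip])
  define \<gamma>' where "\<gamma>' \<sigma> = \<gamma> (\<sigma> *\<^sub>R ?f)" for \<sigma>
  have lip': "\<bar>\<gamma>' \<sigma> - \<gamma>' \<tau>\<bar> \<le> L * \<bar>\<sigma> - \<tau>\<bar>" for \<sigma> \<tau>
  proof -
    have "dist (\<gamma> (\<sigma> *\<^sub>R ?f)) (\<gamma> (\<tau> *\<^sub>R ?f)) \<le> L * dist (\<sigma> *\<^sub>R ?f) (\<tau> *\<^sub>R ?f)"
      by (rule lipschitz_onD[OF lip]) (auto simp: pe)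
    then show ?thesis using pe by (simp add: \<gamma>'_def dist_real_def dist_norm flip: scaleR_diff_left)
  qed
  have cont': "continuous_on UNIV \<gamma>'"
  proof -
    have "L-lipschitz_on UNIV \<gamma>'" by (rule lipschitz_onI) (use lip' L0 in \<open>auto simp: dist_real_def\<close>)
    then show ?thesis by (rule lipschitz_on_continuous_on)
  qed
  have [measurable]: "\<gamma>' \<in> borel_measurable borel" by (rule borel_measurable_continuous_onI[OF cont'])
  have proj: "x - (x \<bullet> e) *\<^sub>R e = (x \<bullet> ?f) *\<^sub>R ?f" for x using perp_decomp[OF e, of x] by (metis add_diff_cancel_right')
  have chart': "x \<in> \<Omega> \<longleftrightarrow> \<gamma>' (x \<bullet> ?f) < x \<bullet> e" if "x \<in> ball p \<epsilon>" for x
    using chart[OF that] unfolding proj \<gamma>'_def .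
  have pn: "p \<notin> \<Omega>" using assms(1) open_domain by (simp add: frontier_def interior_open)
  have p2: "p \<bullet> e = \<gamma>' (p \<bullet> ?f)"
  proof (rule antisym)
    show "p \<bullet> e \<le> \<gamma>' (p \<bullet> ?f)" using chart'[of p] pn \<epsilon> by simp
    show "\<gamma>' (p \<bullet> ?f) \<le> p \<bullet> e"
    proof (rule ccontr)
      assume "\<not> ?thesis"
      then have "p \<in> {x. x \<bullet> e < \<gamma>' (x \<bullet> ?f)} \<inter> ball p \<epsilon>" using \<epsilon> by simp
      moreover have "open ({x. x \<bullet> e < \<gamma>' (x \<bullet> ?f)} \<inter> ball p \<epsilon>)"
        by (intro open_Int open_ball open_Collect_less continuous_intros continuous_on_compose2[OF cont']) auto
      moreover have "p \<in> closure \<Omega>" using assms(1) by (simp add: frontier_def)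
      ultimately obtain x where "x \<in> \<Omega>" "x \<bullet> e < \<gamma>' (x \<bullet> ?f)" "x \<in> ball p \<epsilon>"
        using open_Int_closure_eq_empty[of "{x. x \<bullet> e < \<gamma>' (x \<bullet> ?f)} \<inter> ball p \<epsilon>" \<Omega>] by blast
      then show False using chart' by force
    qed
  qed
  define \<Gamma> where "\<Gamma> \<sigma> = \<sigma> *\<^sub>R ?f + \<gamma>' \<sigma> *\<^sub>R e" for \<sigma>
  have \<Gamma>c: "\<Gamma> \<sigma> \<bullet> ?f = \<sigma>" "\<Gamma> \<sigma> \<bullet> e = \<gamma>' \<sigma>" for \<sigma> using pe e by (simp_all add: \<Gamma>_def inner_add_left norm_eq_1)
  have [measurable]: "\<Gamma> \<in> borel_measurable borel" unfolding \<Gamma>_def by measurable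
  \<comment> \<open>Over the base interval of half width r the graph stays within
    \<open>\<epsilon> / 4\<close> of p, so vertical segments of length below
    \<open>\<epsilon> / 2\<close> starting on it remain in the chart.\<close>
  define r where "r = \<epsilon> / (4 * (1 + L))"
  have r: "r > 0" "(1 + L) * r = \<epsilon> / 4" "r \<le> \<epsilon> / 4"
    using \<epsilon> L0 by (auto simp: r_def field_simps add_nonneg_pos)
  have \<Gamma>p: "dist (\<Gamma> \<sigma> + \<tau> *\<^sub>R e) p \<le> \<epsilon> / 4 + \<bar>\<tau>\<bar>" if "\<bar>\<sigma> - p \<bullet> ?f\<bar> < r" for \<sigma> \<tau>
  proof -
    have "\<Gamma> \<sigma> + \<tau> *\<^sub>R e - p = (\<sigma> - p \<bullet> ?f) *\<^sub>R ?f + ((\<gamma>' \<sigma> - \<gamma>' (p \<bullet> ?f)) + \<tau>) *\<^sub>R e"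
      using perp_decomp[OF e, of p] p2 by (simp add: \<Gamma>_def algebra_simps)
    then have "norm (\<Gamma> \<sigma> + \<tau> *\<^sub>R e - p) \<le> \<bar>\<sigma> - p \<bullet> ?f\<bar> + \<bar>(\<gamma>' \<sigma> - \<gamma>' (p \<bullet> ?f)) + \<tau>\<bar>"
      using norm_triangle_ineq[of "(\<sigma> - p \<bullet> ?f) *\<^sub>R ?f" "((\<gamma>' \<sigma> - \<gamma>' (p \<bullet> ?f)) + \<tau>) *\<^sub>R e"] pe e by simp
    also have "\<dots> \<le> \<bar>\<sigma> - p \<bullet> ?f\<bar> + (L * \<bar>\<sigma> - p \<bullet> ?f\<bar> + \<bar>\<tau>\<bar>)" using lip'[of \<sigma> "p \<bullet> ?f"] by linarith
    also have "\<dots> = (1 + L) * \<bar>\<sigma> - p \<bullet> ?f\<bar> + \<bar>\<tau>\<bar>" by (simp add: algebra_simps)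
    also have "\<dots> \<le> (1 + L) * r + \<bar>\<tau>\<bar>" using that L0 by (intro add_right_mono mult_left_mono) auto
    finally show ?thesis using r by (simp add: dist_norm)
  qed
  define I where "I = {p \<bullet> ?f - r <..< p \<bullet> ?f + r}"
  have Iab: "\<sigma> \<in> I \<longleftrightarrow> \<bar>\<sigma> - p \<bullet> ?f\<bar> < r" for \<sigma> unfolding I_def by auto
  have above: "\<Gamma> \<sigma> + \<tau> *\<^sub>R e \<in> \<Omega>" if "\<sigma> \<in> I" "0 < \<tau>" "\<tau> < \<epsilon> / 2" for \<sigma> \<tau>
  proof -
    have "\<Gamma> \<sigma> + \<tau> *\<^sub>R e \<in> ball p \<epsilon>" using \<Gamma>p[of \<sigma> \<tau>] that Iab \<epsilon> by (simp add: dist_commute)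
    then show ?thesis using chart'[of "\<Gamma> \<sigma> + \<tau> *\<^sub>R e"] that pe e by (simp add: inner_add_left \<Gamma>c norm_eq_1)
  qed
  have on: "\<Gamma> \<sigma> \<notin> \<Omega>" "\<Gamma> \<sigma> \<in> frontier \<Omega>" if "\<sigma> \<in> I" for \<sigma>
  proof -
    have b: "\<Gamma> \<sigma> \<in> ball p \<epsilon>" using \<Gamma>p[of \<sigma> 0] that Iab \<epsilon> by (simp add: dist_commute)
    then show n: "\<Gamma> \<sigma> \<notin> \<Omega>" using chart'[OF b] by (simp add: \<Gamma>c)
    have "\<Gamma> \<sigma> \<in> closure \<Omega>"
      unfolding closure_approachable
    proof (intro allI impI)
      fix d :: real assume "d > 0"
      define \<tau> where "\<tau> = min (d / 2) (\<epsilon> / 4)"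
      have "0 < \<tau>" "\<tau> < \<epsilon> / 2" "\<tau> < d" using \<open>d > 0\<close> \<epsilon> by (auto simp: \<tau>_def min_def)
      then show "\<exists>y\<in>\<Omega>. dist y (\<Gamma> \<sigma>) < d" using above[OF that, of \<tau>] e by (intro bexI[of _ "\<Gamma> \<sigma> + \<tau> *\<^sub>R e"]) (auto simp: dist_norm)
    qed
    then show "\<Gamma> \<sigma> \<in> frontier \<Omega>" using n open_domain by (simp add: frontier_def interior_open)
  qed
  \<comment> \<open>Chosen so that \<open>2 * T * T = C * s\<^sup>2\<close> for the height
    \<open>T = (1 + L) * s\<close>.\<close>
  define C where "C = 2 * (1 + L)\<^sup>2"
  have C: "C \<ge> 1" "2 * (1 + L) \<le> C" "1 + L \<le> C"
  proof -
    define q where "q = (1 + L)\<^sup>2"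
    have "1 + L \<le> q" using L0 by (simp add: q_def power2_eq_square algebra_simps)
    then show "C \<ge> 1" "2 * (1 + L) \<le> C" "1 + L \<le> C" using L0 unfolding C_def q_def[symmetric] by simp_all
  qed
  define s0 where "s0 = r"
  have main: "int2 (strip s \<inter> ball p r) h \<le> ennreal (C * s) * boundary_sq h
       + ennreal (C * s\<^sup>2) * int2 (strip (C * s)) (grad h)" if s: "0 < s" "s < s0" and h: "C1 h" for s h
  proof -
    have [measurable]: "h \<in> borel_measurable borel" "grad h \<in> borel_measurable borel" by (rule C1_borel[OF h] grad_borel[OF h])+
    define T where "T = (1 + L) * s"
    have T: "0 < T" "T < \<epsilon> / 2" "T \<le> C * s"
    proof -
      show "0 < T" using s L0 by (simp add: T_def)
      have "T < (1 + L) * r" unfolding T_def using s L0 by (intro mult_strict_left_mono) (auto simp: s0_def)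
      then show "T < \<epsilon> / 2" using r \<epsilon> by linarith
      show "T \<le> C * s" unfolding T_def using C s by (intro mult_right_mono) auto
    qed
    \<comment> \<open>A point of the strip has a complement point y within distance s. As y lies in
      the chart it is on or below the graph, and passing from y to x changes the height over the
      graph by less than \<open>(1 + L) * s\<close>.\<close>
    have sub: "x \<bullet> ?f \<in> I \<and> 0 < x \<bullet> e - \<gamma>' (x \<bullet> ?f) \<and> x \<bullet> e - \<gamma>' (x \<bullet> ?f) < T" if x: "x \<in> strip s \<inter> ball p r" for x
    proof -
      have xb: "x \<in> ball p \<epsilon>" "x \<in> \<Omega>" "D x < s" "dist p x < r" using x r \<epsilon> by (auto simp: strip_def)
      have "\<bar>x \<bullet> ?f - p \<bullet> ?f\<bar> \<le> norm (x - p)" using Cauchy_Schwarz_ineq2[of "x - p" ?f] pe by (simp add: inner_diff_left)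
      then have 1: "x \<bullet> ?f \<in> I" using xb(4) unfolding Iab by (simp add: dist_norm norm_minus_commute)
      have 2: "0 < x \<bullet> e - \<gamma>' (x \<bullet> ?f)" using chart'[OF xb(1)] xb(2) by simp
      obtain y where y: "y \<notin> \<Omega>" "dist x y < s" using D_near[OF xb(3)] by blast
      have "dist p y < \<epsilon>" using dist_triangle[of p y x] y(2) xb(4) s r \<epsilon> by (simp add: s0_def)
      then have y2: "y \<bullet> e \<le> \<gamma>' (y \<bullet> ?f)" using chart'[of y] y(1) by simp
      have "\<bar>x \<bullet> e - y \<bullet> e\<bar> < s" using Cauchy_Schwarz_ineq2[of "x - y" e] e y(2) by (simp add: inner_diff_left dist_norm)
      moreover have "\<bar>x \<bullet> ?f - y \<bullet> ?f\<bar> < s" using Cauchy_Schwarz_ineq2[of "x - y" ?f] pe y(2) by (simp add: inner_diff_left dist_norm)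
      then have "L * \<bar>y \<bullet> ?f - x \<bullet> ?f\<bar> \<le> L * s" using L0 by (intro mult_left_mono) auto
      then have "\<bar>\<gamma>' (y \<bullet> ?f) - \<gamma>' (x \<bullet> ?f)\<bar> \<le> L * s" using lip'[of "y \<bullet> ?f" "x \<bullet> ?f"] by linarith
      ultimately have "x \<bullet> e - \<gamma>' (x \<bullet> ?f) < s + L * s" using y2 by linarith
      then show ?thesis using 1 2 by (simp add: T_def distrib_right)
    qed
    define G where "G \<sigma> = (\<integral>\<^sup>+\<zeta>. ennreal ((norm (grad h (\<Gamma> \<sigma> + \<zeta> *\<^sub>R e)))\<^sup>2) * indicator {0<..<T} \<zeta> \<partial>lborel)" for \<sigma>
    have mG: "(\<lambda>q. ennreal ((norm (grad h (\<Gamma> (fst q) + snd q *\<^sub>R e)))\<^sup>2) * indicator {0<..<T} (snd q)) \<in> borel_measurable (lborel \<Otimes>\<^sub>M lborel)"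
      by measurable
    have [measurable]: "G \<in> borel_measurable lborel" unfolding G_def
      using lborel.borel_measurable_nn_integral_fst[OF mG] by simp
    let ?q = "\<lambda>\<sigma>. 2 * ennreal ((h (\<Gamma> \<sigma>))\<^sup>2) + 2 * (ennreal T * G \<sigma>)" and ?T = "indicator {0<..<T}"
    have line: "ennreal ((h (\<Gamma> \<sigma> + \<tau> *\<^sub>R e))\<^sup>2) \<le> ?q \<sigma>" if \<tau>: "0 < \<tau>" "\<tau> < T" for \<sigma> \<tau>
    proof -
      let ?n = "\<lambda>\<zeta>. ennreal (norm (grad h (\<Gamma> \<sigma> + \<zeta> *\<^sub>R e)))"
      define J where "J = (\<integral>\<^sup>+\<zeta>. ?n \<zeta> * ?T \<zeta> \<partial>lborel)"
      have "ennreal \<bar>h (\<Gamma> \<sigma> + \<tau> *\<^sub>R e) - h (\<Gamma> \<sigma> + 0 *\<^sub>R e)\<bar> \<le> (\<integral>\<^sup>+\<zeta>. ?n \<zeta> * indicator {0..\<tau>} \<zeta> \<partial>lborel)"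
        by (rule C1_increment[OF h e]) (use \<tau> in simp)
      also have "\<dots> \<le> J" unfolding J_def
      proof (rule nn_integral_mono_AE)
        show "AE \<zeta> in lborel. ?n \<zeta> * indicator {0..\<tau>} \<zeta> \<le> ?n \<zeta> * ?T \<zeta>"
          using AE_lborel_singleton[of 0] by eventually_elim (use \<tau> in \<open>auto simp: indicator_def\<close>)
      qed
      finally have inc: "ennreal \<bar>h (\<Gamma> \<sigma> + \<tau> *\<^sub>R e) - h (\<Gamma> \<sigma>)\<bar> \<le> J" by simp
      have "J\<^sup>2 \<le> ennreal T * G \<sigma>"
      proof -
        have "J = (\<integral>\<^sup>+\<zeta>. (?n \<zeta> * ?T \<zeta>) * ?T \<zeta> \<partial>lborel)"
          unfolding J_def by (rule nn_integral_cong) (simp add: indicator_def)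
        also have "\<dots>\<^sup>2 \<le> (\<integral>\<^sup>+\<zeta>. (?n \<zeta> * ?T \<zeta>)\<^sup>2 \<partial>lborel) * (\<integral>\<^sup>+\<zeta>. (?T \<zeta>)\<^sup>2 \<partial>lborel)"
          by (rule Cauchy_Schwarz_nn_integral) measurable
        also have "(\<integral>\<^sup>+\<zeta>. (?n \<zeta> * ?T \<zeta>)\<^sup>2 \<partial>lborel) = G \<sigma>"
          unfolding G_def by (rule nn_integral_cong) (simp add: indicator_def ennreal_power)
        also have "(\<integral>\<^sup>+\<zeta>. (?T \<zeta>)\<^sup>2 \<partial>lborel) = (\<integral>\<^sup>+\<zeta>. ?T \<zeta> \<partial>lborel)"
          by (rule nn_integral_cong) (simp add: indicator_def)
        also have "\<dots> = ennreal T" using T by simp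
        finally show ?thesis by (simp add: mult.commute)
      qed
      have "ennreal \<bar>h (\<Gamma> \<sigma> + \<tau> *\<^sub>R e)\<bar> \<le> ennreal (\<bar>h (\<Gamma> \<sigma>)\<bar> + \<bar>h (\<Gamma> \<sigma> + \<tau> *\<^sub>R e) - h (\<Gamma> \<sigma>)\<bar>)" by (rule ennreal_leI) linarith
      also have "\<dots> \<le> ennreal \<bar>h (\<Gamma> \<sigma>)\<bar> + J" using inc by (simp add: add_left_mono)
      finally have "(ennreal \<bar>h (\<Gamma> \<sigma> + \<tau> *\<^sub>R e)\<bar>)\<^sup>2 \<le> (ennreal \<bar>h (\<Gamma> \<sigma>)\<bar> + J)\<^sup>2" by (rule power_mono) simp
      also have "\<dots> \<le> 2 * (ennreal \<bar>h (\<Gamma> \<sigma>)\<bar>)\<^sup>2 + 2 * J\<^sup>2" by (rule power2_add_le_ennreal)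
      also have "\<dots> \<le> 2 * (ennreal \<bar>h (\<Gamma> \<sigma>)\<bar>)\<^sup>2 + 2 * (ennreal T * G \<sigma>)" using \<open>J\<^sup>2 \<le> _\<close> by (intro add_left_mono mult_left_mono) auto
      finally show ?thesis by (simp add: ennreal_power)
    qed
    have "int2 (strip s \<inter> ball p r) h \<le> (\<integral>\<^sup>+x. ennreal ((h x)\<^sup>2) * indicator I (x \<bullet> ?f) * ?T (x \<bullet> e - \<gamma>' (x \<bullet> ?f)) \<partial>lborel)"
      unfolding int2_def by (rule nn_integral_mono) (use sub in \<open>auto simp: indicator_def\<close>)
    also have "\<dots> = (\<integral>\<^sup>+\<sigma>. \<integral>\<^sup>+t. ennreal ((h (\<sigma> *\<^sub>R ?f + t *\<^sub>R e))\<^sup>2) * indicator I \<sigma> * ?T (t - \<gamma>' \<sigma>) \<partial>lborel \<partial>lborel)"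
      by (subst nn_integral_frame[OF e]) (auto simp: inner_add_left pe e norm_eq_1[symmetric] I_def dot_square_norm)
    also have "\<dots> \<le> (\<integral>\<^sup>+\<sigma>. indicator I \<sigma> * (ennreal T * ?q \<sigma>) \<partial>lborel)"
    proof (rule nn_integral_mono)
      fix \<sigma> :: real
      define X where "X t = ennreal ((h (\<sigma> *\<^sub>R ?f + t *\<^sub>R e))\<^sup>2) * indicator I \<sigma> * ?T (t - \<gamma>' \<sigma>)" for t
      have [measurable]: "X \<in> borel_measurable borel" unfolding X_def by measurable
      have "(\<integral>\<^sup>+t. X t \<partial>lborel) = (\<integral>\<^sup>+\<tau>. X (\<gamma>' \<sigma> + 1 * \<tau>) \<partial>lborel)"
        using nn_integral_real_affine[of X 1 "\<gamma>' \<sigma>"] by simp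
      also have "\<dots> \<le> (\<integral>\<^sup>+\<tau>. (indicator I \<sigma> * ?q \<sigma>) * ?T \<tau> \<partial>lborel)"
        by (rule nn_integral_mono) (use line[of _ \<sigma>] in \<open>auto simp: X_def indicator_def \<Gamma>_def scaleR_add_left add.assoc\<close>)
      also have "\<dots> = (indicator I \<sigma> * ?q \<sigma>) * ennreal T"
        using T by (subst nn_integral_cmult_indicator) auto
      finally show "(\<integral>\<^sup>+t. ennreal ((h (\<sigma> *\<^sub>R ?f + t *\<^sub>R e))\<^sup>2) * indicator I \<sigma> * ?T (t - \<gamma>' \<sigma>) \<partial>lborel)
        \<le> indicator I \<sigma> * (ennreal T * ?q \<sigma>)"
        unfolding X_def by (simp only: mult.assoc mult.commute mult.left_commute)
    qed
    also have "\<dots> = (\<integral>\<^sup>+\<sigma>. (2 * ennreal T) * (ennreal ((h (\<Gamma> \<sigma>))\<^sup>2) * indicator I \<sigma>) + (2 * ennreal T * ennreal T) * (G \<sigma> * indicator I \<sigma>) \<partial>lborel)"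
      by (rule nn_integral_cong) (simp only: distrib_left mult.assoc mult.commute mult.left_commute)
    also have "\<dots> = (2 * ennreal T) * (\<integral>\<^sup>+\<sigma>. ennreal ((h (\<Gamma> \<sigma>))\<^sup>2) * indicator I \<sigma> \<partial>lborel) + (2 * ennreal T * ennreal T) * (\<integral>\<^sup>+\<sigma>. G \<sigma> * indicator I \<sigma> \<partial>lborel)"
      by (subst nn_integral_add) (auto simp: nn_integral_cmult I_def)
    also have "\<dots> \<le> ennreal (C * s) * boundary_sq h + ennreal (C * s\<^sup>2) * int2 (strip (C * s)) (grad h)"
    proof (rule add_mono; rule mult_mono)
      have "2 * T \<le> C * s" unfolding T_def using C(2) s by (simp add: mult_right_mono flip: mult.assoc)
      moreover have "2 * ennreal T = ennreal (2 * T)" using T by (simp add: ennreal_mult)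
      ultimately show "2 * ennreal T \<le> ennreal (C * s)" by (simp add: ennreal_leI)
      have "2 * ennreal T * ennreal T = ennreal (2 * T * T)" using T by (simp add: ennreal_mult)
      also have "2 * T * T = C * s\<^sup>2" unfolding T_def C_def by (simp add: power2_eq_square)
      finally show "2 * ennreal T * ennreal T \<le> ennreal (C * s\<^sup>2)" by simp
      show "(\<integral>\<^sup>+\<sigma>. ennreal ((h (\<Gamma> \<sigma>))\<^sup>2) * indicator I \<sigma> \<partial>lborel) \<le> boundary_sq h"
        by (rule graph_integral_le[OF pe(1), where h = "\<lambda>x. ennreal ((h x)\<^sup>2)"]) (use on \<Gamma>c in \<open>auto simp: I_def\<close>)
      have "(\<integral>\<^sup>+\<sigma>. G \<sigma> * indicator I \<sigma> \<partial>lborel) \<le> (\<integral>\<^sup>+\<sigma>. \<integral>\<^sup>+t. ennreal ((norm (grad h (\<sigma> *\<^sub>R ?f + t *\<^sub>R e)))\<^sup>2) * indicator (strip (C * s)) (\<sigma> *\<^sub>R ?f + t *\<^sub>R e) \<partial>lborel \<partial>lborel)"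
      proof (rule nn_integral_mono)
        fix \<sigma> :: real
        define X where "X t = ennreal ((norm (grad h (\<sigma> *\<^sub>R ?f + t *\<^sub>R e)))\<^sup>2) * indicator (strip (C * s)) (\<sigma> *\<^sub>R ?f + t *\<^sub>R e)" for t
        have [measurable]: "X \<in> borel_measurable borel" unfolding X_def by measurable
        have st: "\<Gamma> \<sigma> + \<zeta> *\<^sub>R e \<in> strip (C * s)" if "\<sigma> \<in> I" "0 < \<zeta>" "\<zeta> < T" for \<zeta>
        proof -
          have "D (\<Gamma> \<sigma> + \<zeta> *\<^sub>R e) \<le> dist (\<Gamma> \<sigma> + \<zeta> *\<^sub>R e) (\<Gamma> \<sigma>)" using on(1)[OF that(1)] by (intro infdist_le) simp
          also have "\<dots> = \<zeta>" using that e by (simp add: dist_norm)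
          finally show ?thesis using above[OF that(1,2)] that T by (auto simp: strip_def)
        qed
        have "G \<sigma> * indicator I \<sigma> = (\<integral>\<^sup>+\<zeta>. ennreal ((norm (grad h (\<Gamma> \<sigma> + \<zeta> *\<^sub>R e)))\<^sup>2) * ?T \<zeta> * indicator I \<sigma> \<partial>lborel)"
          unfolding G_def by (rule nn_integral_multc[symmetric]) measurable
        also have "\<dots> \<le> (\<integral>\<^sup>+\<zeta>. X (\<gamma>' \<sigma> + 1 * \<zeta>) \<partial>lborel)"
          by (rule nn_integral_mono) (use st in \<open>auto simp: X_def indicator_def \<Gamma>_def scaleR_add_left add.assoc\<close>)
        also have "\<dots> = (\<integral>\<^sup>+t. X t \<partial>lborel)" using nn_integral_real_affine[of X 1 "\<gamma>' \<sigma>"] by simp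
        finally show "G \<sigma> * indicator I \<sigma> \<le> (\<integral>\<^sup>+t. ennreal ((norm (grad h (\<sigma> *\<^sub>R ?f + t *\<^sub>R e)))\<^sup>2) * indicator (strip (C * s)) (\<sigma> *\<^sub>R ?f + t *\<^sub>R e) \<partial>lborel)"
          unfolding X_def .
      qed
      also have "\<dots> = int2 (strip (C * s)) (grad h)" unfolding int2_def by (rule nn_integral_frame[OF e, symmetric]) measurable
      finally show "(\<integral>\<^sup>+\<sigma>. G \<sigma> * indicator I \<sigma> \<partial>lborel) \<le> int2 (strip (C * s)) (grad h)" .
    qed simp_all
    finally show ?thesis .
  qed
  have "s0 > 0" using r by (simp add: s0_def)
  then have "strip_bound (ball p r) C s0" unfolding strip_bound_def using main C(1) by blast
  then show ?thesis using r(1) by blast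
qed

lemma int2_mono: "S \<subseteq> S' \<Longrightarrow> int2 S f \<le> int2 S' f"
  unfolding int2_def by (rule nn_integral_mono) (auto simp: indicator_def)

text \<open>Finitely many chart balls cover the frontier. What they leave of the closure is compact
  and inside the domain, so it keeps a positive distance d from the complement and misses all strips
  thinner than d. The constants of the charts are added.\<close>

lemma strip_estimate:
  assumes lb: "lipschitz_boundary \<Omega>"
  shows "\<exists>C s0. strip_bound UNIV C s0"
proof -
  have "\<forall>p\<in>frontier \<Omega>. \<exists>r C s0. r > 0 \<and> strip_bound (ball p r) C s0"
  proof
    fix p assume p: "p \<in> frontier \<Omega>"
    then obtain e \<epsilon> L \<gamma> where "norm e = 1" "\<epsilon> > 0" "L-lipschitz_on {y. y \<bullet> e = 0} \<gamma>"
      "\<And>x. x \<in> ball p \<epsilon> \<Longrightarrow> x \<in> \<Omega> \<longleftrightarrow> \<gamma> (x - (x \<bullet> e) *\<^sub>R e) < x \<bullet> e" using lb unfolding lipschitz_boundary_def by metis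
    from strip_local[OF p this] show "\<exists>r C s0. r > 0 \<and> strip_bound (ball p r) C s0" by blast
  qed
  then obtain r C s0 where r: "\<And>p. p \<in> frontier \<Omega> \<Longrightarrow> r p > 0" and Q: "\<And>p. p \<in> frontier \<Omega> \<Longrightarrow> strip_bound (ball p (r p)) (C p) (s0 p)" by metis
  then have C: "\<And>p. p \<in> frontier \<Omega> \<Longrightarrow> C p \<ge> 1" and s0: "\<And>p. p \<in> frontier \<Omega> \<Longrightarrow> s0 p > 0" unfolding strip_bound_def by blast+
  have "compact (frontier \<Omega>)" using bounded_domain by (rule compact_frontier_bounded)
  then obtain P where P: "P \<subseteq> frontier \<Omega>" "finite P" "frontier \<Omega> \<subseteq> (\<Union>p\<in>P. ball p (r p))"
    by (rule compactE_image[where f = "\<lambda>p. ball p (r p)" and C = "frontier \<Omega>"]) (use r in auto)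
  define K where "K = closure \<Omega> - (\<Union>p\<in>P. ball p (r p))"
  have cK: "compact K" unfolding K_def using bounded_domain by (intro compact_diff) auto
  have KO: "K \<subseteq> \<Omega>" unfolding K_def using P(3) open_domain by (auto simp: frontier_def interior_open)
  obtain d where d: "d > 0" "\<And>x. x \<in> K \<Longrightarrow> d \<le> D x" using compact_D_lower[OF cK KO] by blast
  define C' where "C' = 1 + (\<Sum>p\<in>P. C p)"
  define s' where "s' = Min (insert d (s0 ` P))"
  have CP: "1 \<le> C p" if "p \<in> P" for p using C P(1) that by blast
  have "C' \<ge> 1" unfolding C'_def using CP by (simp add: sum_nonneg order_trans[OF zero_le_one])
  have CC': "C p \<le> C'" if "p \<in> P" for p
  proof -
    have "C p \<le> (\<Sum>p\<in>P. C p)" by (rule member_le_sum[OF that]) (use CP P(2) in \<open>auto intro: order_trans[OF zero_le_one]\<close>)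
    then show ?thesis unfolding C'_def by linarith
  qed
  have s': "s' > 0" "s' \<le> d" "\<And>p. p \<in> P \<Longrightarrow> s' \<le> s0 p" unfolding s'_def using d(1) s0 P by auto
  have "int2 (strip s \<inter> UNIV) h \<le> ennreal (C' * s) * boundary_sq h
       + ennreal (C' * s\<^sup>2) * int2 (strip (C' * s)) (grad h)" if s: "0 < s" "s < s'" and h: "C1 h" for s h
  proof -
    have [measurable]: "h \<in> borel_measurable borel" "grad h \<in> borel_measurable borel" by (rule C1_borel[OF h] grad_borel[OF h])+
    let ?b = "boundary_sq h" and ?e = "\<lambda>x. ennreal ((norm (h x))\<^sup>2)" and ?g = "int2 (strip (C' * s)) (grad h)"
    have cov: "\<exists>p\<in>P. x \<in> ball p (r p)" if "x \<in> strip s" for x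
    proof (rule ccontr)
      assume "\<not> ?thesis"
      then have "x \<in> K" using that closure_subset[of \<Omega>] unfolding K_def strip_def by blast
      then show False using d(2)[of x] that s s'(2) unfolding strip_def by force
    qed
    have "int2 (strip s \<inter> UNIV) h \<le> (\<integral>\<^sup>+x. (\<Sum>p\<in>P. ?e x * indicator (strip s \<inter> ball p (r p)) x) \<partial>lborel)"
      unfolding int2_def
    proof (rule nn_integral_mono)
      fix x
      show "?e x * indicator (strip s \<inter> UNIV) x \<le> (\<Sum>p\<in>P. ?e x * indicator (strip s \<inter> ball p (r p)) x)"
      proof (cases "x \<in> strip s")
        case True
        then obtain p where p: "p \<in> P" "x \<in> ball p (r p)" using cov by blast
        have "?e x * indicator (strip s \<inter> UNIV) x = ?e x * indicator (strip s \<inter> ball p (r p)) x" using True p by simp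
        also have "\<dots> \<le> (\<Sum>p\<in>P. ?e x * indicator (strip s \<inter> ball p (r p)) x)"
          by (rule member_le_sum[OF p(1)]) (use P(2) in auto)
        finally show ?thesis .
      qed simp
    qed
    also have "\<dots> = (\<Sum>p\<in>P. int2 (strip s \<inter> ball p (r p)) h)"
    proof -
      have [measurable]: "strip s \<inter> ball p (r p) \<in> sets borel" for p by (intro sets.Int strip_borel) simp
      show ?thesis unfolding int2_def by (rule nn_integral_sum) measurable
    qed
    also have "\<dots> \<le> (\<Sum>p\<in>P. ennreal (C p) * (ennreal s * ?b + ennreal (s\<^sup>2) * ?g))"
    proof (rule sum_mono)
      fix p assume p: "p \<in> P"
      have "int2 (strip s \<inter> ball p (r p)) h \<le> ennreal (C p * s) * ?b + ennreal (C p * s\<^sup>2) * int2 (strip (C p * s)) (grad h)"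
        using Q[of p] p P s s'(3)[OF p] h unfolding strip_bound_def by auto
      also have "\<dots> \<le> ennreal (C p * s) * ?b + ennreal (C p * s\<^sup>2) * ?g"
      proof -
        have "C p * s \<le> C' * s" using CC'[OF p] s by (intro mult_right_mono) auto
        then have "strip (C p * s) \<subseteq> strip (C' * s)" by (auto simp: strip_def)
        then show ?thesis by (intro add_left_mono mult_left_mono int2_mono) auto
      qed
      also have "\<dots> = ennreal (C p) * (ennreal s * ?b + ennreal (s\<^sup>2) * ?g)"
        using CP[OF p] s by (simp add: ennreal_mult distrib_left mult.assoc)
      finally show "int2 (strip s \<inter> ball p (r p)) h \<le> ennreal (C p) * (ennreal s * ?b + ennreal (s\<^sup>2) * ?g)" .
    qed
    also have "\<dots> = ennreal (\<Sum>p\<in>P. C p) * (ennreal s * ?b + ennreal (s\<^sup>2) * ?g)"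
    proof -
      have "(\<Sum>p\<in>P. ennreal (C p)) = ennreal (\<Sum>p\<in>P. C p)" using CP by (intro sum_ennreal) (auto intro: order_trans[OF zero_le_one])
      then show ?thesis by (simp flip: sum_distrib_right)
    qed
    also have "\<dots> \<le> ennreal C' * (ennreal s * ?b + ennreal (s\<^sup>2) * ?g)" unfolding C'_def by (intro mult_right_mono ennreal_leI) auto
    also have "\<dots> = ennreal (C' * s) * ?b + ennreal (C' * s\<^sup>2) * ?g"
      using \<open>C' \<ge> 1\<close> s by (simp add: ennreal_mult distrib_left mult.assoc)
    finally show ?thesis .
  qed
  with \<open>C' \<ge> 1\<close> s'(1) have "strip_bound UNIV C' s'" unfolding strip_bound_def by blast
  then show ?thesis by blast
qed

end

section \<open>Mollification and cutoff functions inside the domain\<close>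

lemma C1_mult: assumes "C1 f" "C1 g" shows "C1 (\<lambda>x. f x * g x)"
proof -
  have "C1 (\<lambda>x. f x * g x) \<and> grad (\<lambda>x. f x * g x) = (\<lambda>x. f x *\<^sub>R grad g x + g x *\<^sub>R grad f x)"
    by (rule C1_I) (use assms in \<open>auto intro!: GDERIV_mult C1_GDERIV continuous_intros C1_continuous C1_continuous_grad\<close>)
  then show ?thesis by blast
qed

lemma C1_compose:
  assumes f: "C1 f" and G: "\<And>t. (G has_real_derivative G' t) (at t)" and c: "continuous_on UNIV G'"
  shows "C1 (\<lambda>x. G (f x))" "grad (\<lambda>x. G (f x)) = (\<lambda>x. G' (f x) *\<^sub>R grad f x)"
proof -
  have "C1 (\<lambda>x. G (f x)) \<and> grad (\<lambda>x. G (f x)) = (\<lambda>x. G' (f x) *\<^sub>R grad f x)"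
    by (rule C1_I[OF GDERIV_DERIV_compose[OF C1_GDERIV[OF f] G]])
       (auto intro!: continuous_intros C1_continuous_grad[OF f] continuous_on_compose2[OF c C1_continuous[OF f]])
  then show "C1 (\<lambda>x. G (f x))" "grad (\<lambda>x. G (f x)) = (\<lambda>x. G' (f x) *\<^sub>R grad f x)" by auto
qed

lemma GDERIV_norm_le:
  fixes f :: "'a::euclidean_space \<Rightarrow> real"
  assumes d: "GDERIV f x :> d" and "\<epsilon> > 0" and b: "\<And>z. dist z x < \<epsilon> \<Longrightarrow> \<bar>f z - f x\<bar> \<le> B * dist z x"
  shows "norm d \<le> B"
proof (cases "d = 0")
  case True
  obtain v :: 'a where "v \<in> Basis" using nonempty_Basis by blast
  then have eq: "dist (x + (\<epsilon> / 2) *\<^sub>R v) x = \<epsilon> / 2" using \<open>\<epsilon> > 0\<close> by (simp add: dist_norm)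
  have "0 \<le> B * (\<epsilon> / 2)" using b[of "x + (\<epsilon> / 2) *\<^sub>R v"] \<open>\<epsilon> > 0\<close> unfolding eq by linarith
  then show ?thesis using \<open>d = 0\<close> \<open>\<epsilon> > 0\<close> by (simp add: zero_le_mult_iff)
next
  case False
  have lim: "((\<lambda>h. (f (x + h *\<^sub>R d) - f x) / h) \<longlongrightarrow> d \<bullet> d) (at 0)"
    using GDERIV_line[of f x 0 d d] d by (simp add: DERIV_def)
  have "\<forall>\<^sub>F h in at 0. (f (x + h *\<^sub>R d) - f x) / h \<le> B * norm d"
    unfolding eventually_at
  proof (intro exI conjI ballI impI)
    show "\<epsilon> / norm d > 0" using False \<open>\<epsilon> > 0\<close> by simp
    fix h :: real assume h: "h \<noteq> 0 \<and> dist h 0 < \<epsilon> / norm d"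
    then have "dist (x + h *\<^sub>R d) x < \<epsilon>" using False by (simp add: dist_norm field_simps)
    from b[OF this] have "\<bar>f (x + h *\<^sub>R d) - f x\<bar> \<le> B * norm d * \<bar>h\<bar>" by (simp add: dist_norm mult.commute mult.left_commute)
    then have "\<bar>(f (x + h *\<^sub>R d) - f x) / h\<bar> \<le> B * norm d" using h by (simp add: abs_divide pos_divide_le_eq)
    then show "(f (x + h *\<^sub>R d) - f x) / h \<le> B * norm d" by linarith
  qed
  from tendsto_upperbound[OF lim this] have "norm d * norm d \<le> B * norm d" by (simp add: dot_square_norm power2_eq_square)
  then show ?thesis using False by simp
qed

lemma compact_support_uniformly_continuous:
  fixes f :: "'a::euclidean_space \<Rightarrow> 'b::real_normed_vector"
  assumes f: "continuous_on UNIV f" and K: "bounded K" "\<And>x. x \<notin> K \<Longrightarrow> f x = 0" and e: "e > 0"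
  shows "\<exists>d>0. \<forall>x y. dist x y < d \<longrightarrow> dist (f x) (f y) < e"
proof -
  obtain B where B: "\<And>x. x \<in> K \<Longrightarrow> norm x \<le> B" using K(1) bounded_iff by blast
  have "uniformly_continuous_on (cball 0 (B + 1)) f"
    by (rule compact_uniformly_continuous[OF continuous_on_subset[OF f]]) auto
  then obtain d where d: "d > 0" "\<And>x y. x \<in> cball 0 (B + 1) \<Longrightarrow> y \<in> cball 0 (B + 1) \<Longrightarrow> dist y x < d \<Longrightarrow> dist (f y) (f x) < e"
    unfolding uniformly_continuous_on_def using e by metis
  have "dist (f x) (f y) < e" if "dist x y < min d 1" for x y
  proof (cases "x \<in> K \<or> y \<in> K")
    case True
    have "norm y \<le> norm x + dist x y" "norm x \<le> norm y + dist x y"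
      using norm_triangle_sub[of y x] norm_triangle_sub[of x y] by (auto simp: dist_norm norm_minus_commute)
    then have "norm x \<le> B + 1 \<and> norm y \<le> B + 1" using True B[of x] B[of y] that by linarith
    then show ?thesis using d(2)[of y x] that by simp
  qed (use K(2) e in simp)
  then show ?thesis using d(1) by (intro exI[of _ "min d 1"]) simp
qed

context bounded_domain begin

lemma D_ge_compact: assumes "d > 0" shows "compact {x. D x \<ge> d}" "{x. D x \<ge> d} \<subseteq> \<Omega>"
proof -
  show sub: "{x. D x \<ge> d} \<subseteq> \<Omega>"
  proof
    fix x assume "x \<in> {x. D x \<ge> d}"
    then show "x \<in> \<Omega>" using assms infdist_zero[of x "- \<Omega>"] by (cases "x \<in> \<Omega>") auto
  qed
  have "closed {x. D x \<ge> d}" by (intro closed_Collect_le continuous_intros)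
  then show "compact {x. D x \<ge> d}" using sub bounded_domain bounded_subset compact_eq_bounded_closed by blast
qed

text \<open>The gradient of the mollification is not computed. Near x the increments of h differ
  from those of the linear map given by \<open>grad h x\<close> by at most e times the distance;
  mollification preserves such bounds, and \<open>GDERIV_norm_le\<close> reads off the
  gradients.\<close>

lemma mollify_C1:
  assumes h: "C1 h" and K: "compact K" "K \<subseteq> \<Omega>" "\<And>x. x \<notin> K \<Longrightarrow> h x = 0" and e: "e > 0"
  shows "\<exists>w. tf w \<and> (\<forall>x. \<bar>w x - h x\<bar> \<le> e \<and> norm (grad w x - grad h x) \<le> e)"
proof -
  have g0: "grad h x = 0" if "x \<notin> K" for x using grad_zero_outside[OF compact_imp_closed[OF K(1)] K(3) that] .
  obtain d where d: "d > 0" "\<And>x. x \<in> K \<Longrightarrow> d \<le> D x" using compact_D_lower[OF K(1,2)] by blast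
  obtain d1 where d1: "d1 > 0" "\<And>x y. dist x y < d1 \<Longrightarrow> dist (h x) (h y) < e"
    using compact_support_uniformly_continuous[OF C1_continuous[OF h] compact_imp_bounded[OF K(1)] K(3) e] by blast
  obtain d2 where d2: "d2 > 0" "\<And>x y. dist x y < d2 \<Longrightarrow> dist (grad h x) (grad h y) < e"
    using compact_support_uniformly_continuous[OF C1_continuous_grad[OF h] compact_imp_bounded[OF K(1)] g0 e] by blast
  \<comment> \<open>Half of d keeps the support inside the domain; half of d2 because the shifted
    points \<open>z - y\<close> are up to twice \<epsilon> away from x.\<close>
  define \<epsilon> where "\<epsilon> = min (d / 2) (min d1 (d2 / 2))"
  have \<epsilon>: "\<epsilon> > 0" "\<epsilon> \<le> d / 2" "\<epsilon> \<le> d1" "2 * \<epsilon> \<le> d2" using d(1) d1(1) d2(1) by (auto simp: \<epsilon>_def min_def)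
  obtain w where w: "smooth w"
    "\<And>x c B. (\<And>y. dist x y < \<epsilon> \<Longrightarrow> \<bar>h y - c\<bar> \<le> B) \<Longrightarrow> \<bar>w x - c\<bar> \<le> B"
    "\<And>x z c B. (\<And>y. norm y < \<epsilon> \<Longrightarrow> \<bar>h (x - y) - h (z - y) - c\<bar> \<le> B) \<Longrightarrow> \<bar>w x - w z - c\<bar> \<le> B"
    by (rule exists_mollification[OF C1_continuous[OF h] K(1,3) \<epsilon>(1)]) blast+
  have "w x = 0" if "x \<notin> {x. D x \<ge> d / 2}" for x
  proof -
    have "\<bar>w x - 0\<bar> \<le> 0"
    proof (rule w(2))
      fix y assume y: "dist x y < \<epsilon>"
      have "y \<notin> K"
      proof
        assume "y \<in> K"
        then show False using d(2)[of y] D_lip[of x y] y \<epsilon>(2) that by simp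
      qed
      then show "\<bar>h y - 0\<bar> \<le> 0" using K(3) by simp
    qed
    then show ?thesis by simp
  qed
  then have tw: "tf w" using D_ge_compact[of "d / 2"] d(1) by (intro test_function_I[OF w(1), of "{x. D x \<ge> d / 2}"]) auto
  have "\<bar>w x - h x\<bar> \<le> e" for x
  proof (rule w(2))
    fix y assume "dist x y < \<epsilon>"
    then have "dist (h y) (h x) < e" using d1(2)[of y x] \<epsilon> by (simp add: dist_commute)
    then show "\<bar>h y - h x\<bar> \<le> e" by (simp add: dist_real_def)
  qed
  moreover have "norm (grad w x - grad h x) \<le> e" for x
  proof (rule GDERIV_norm_le[OF _ \<epsilon>(1), where f = "\<lambda>z. w z - z \<bullet> grad h x"])
    have "GDERIV (\<lambda>z. z \<bullet> grad h x) x :> grad h x" unfolding gderiv_def by (auto intro!: derivative_eq_intros)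
    from GDERIV_diff[OF C1_GDERIV[OF smooth_C1[OF w(1)]] this]
    show "GDERIV (\<lambda>z. w z - z \<bullet> grad h x) x :> grad w x - grad h x" .
    fix z assume z: "dist z x < \<epsilon>"
    have "\<bar>w z - w x - (z - x) \<bullet> grad h x\<bar> \<le> e * dist z x"
    proof (rule w(3))
      fix y :: "real^2" assume y: "norm y < \<epsilon>"
      let ?k = "\<lambda>u. h u - u \<bullet> grad h x"
      have "norm (?k (z - y) - ?k (x - y)) \<le> e * norm ((z - y) - (x - y))"
      proof (rule differentiable_bound[where S = "ball x (2 * \<epsilon>)" and f' = "\<lambda>u v. v \<bullet> (grad h u - grad h x)"])
        show "(?k has_derivative (\<lambda>v. v \<bullet> (grad h u - grad h x))) (at u within ball x (2 * \<epsilon>))" for u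
        proof -
          have "GDERIV (\<lambda>z. z \<bullet> grad h x) u :> grad h x" unfolding gderiv_def by (auto intro!: derivative_eq_intros)
          from GDERIV_diff[OF C1_GDERIV[OF h] this] show ?thesis unfolding gderiv_def by (rule has_derivative_at_withinI)
        qed
        show "onorm (\<lambda>v. v \<bullet> (grad h u - grad h x)) \<le> e" if "u \<in> ball x (2 * \<epsilon>)" for u
        proof (rule onorm_bound)
          fix v :: "real^2"
          have "dist (grad h u) (grad h x) < e" using d2(2)[of u x] that \<epsilon>(4) by (simp add: dist_commute)
          then have "norm v * norm (grad h u - grad h x) \<le> norm v * e" by (intro mult_left_mono) (auto simp: dist_norm)
          then show "norm (v \<bullet> (grad h u - grad h x)) \<le> e * norm v"
            using Cauchy_Schwarz_ineq2[of v "grad h u - grad h x"] by (simp add: mult.commute)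
        qed (use e in simp)
        have "dist x (z - y) \<le> dist x z + norm y" using norm_triangle_ineq[of "x - z" y] by (simp add: dist_norm diff_diff_eq2 add_diff_eq diff_add_eq)
        then show "z - y \<in> ball x (2 * \<epsilon>)" using z y by (simp add: dist_commute)
        show "x - y \<in> ball x (2 * \<epsilon>)" using y \<epsilon>(1) by (simp add: dist_norm)
      qed auto
      then show "\<bar>h (z - y) - h (x - y) - (z - x) \<bullet> grad h x\<bar> \<le> e * dist z x"
        by (simp add: dist_norm inner_diff_left algebra_simps)
    qed
    then show "\<bar>w z - z \<bullet> grad h x - (w x - x \<bullet> grad h x)\<bar> \<le> e * dist z x" by (simp add: inner_diff_left algebra_simps)
  qed
  ultimately show ?thesis using tw by blast
qed

text \<open>A ramp in the distance D that rises from 0 at \<open>s / 4\<close> to 1 at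
  \<open>s / 2\<close> with slope \<open>4 / s\<close>, mollified at scale \<open>s / 8\<close>.
  Mollification keeps the Lipschitz constant, hence the bound on the gradient.\<close>

lemma cutoff_exists:
  assumes s: "s > 0"
  shows "\<exists>z. tf z \<and> (\<forall>x. 0 \<le> z x \<and> z x \<le> 1) \<and> (\<forall>x. D x \<ge> s \<longrightarrow> z x = 1) \<and> (\<forall>x. norm (grad z x) \<le> 4 / s)"
proof -
  define f where "f x = min 1 (max 0 ((4 / s) * D x - 1))" for x
  have fc: "continuous_on UNIV f" unfolding f_def by (intro continuous_intros)
  have f0: "f x = 0" if "D x \<le> s / 4" for x using that s by (simp add: f_def field_simps)
  have f1: "f x = 1" if "D x \<ge> s / 2" for x using that s by (simp add: f_def field_simps)
  have fb: "0 \<le> f x" "f x \<le> 1" for x by (auto simp: f_def)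
  have fl: "\<bar>f x - f y\<bar> \<le> (4 / s) * dist x y" for x y
  proof -
    have "\<bar>f x - f y\<bar> \<le> \<bar>(4 / s) * D x - (4 / s) * D y\<bar>" unfolding f_def by (simp add: min_def max_def)
    also have "(4 / s) * D x - (4 / s) * D y = (4 / s) * (D x - D y)" by (simp only: right_diff_distrib)
    also have "\<bar>(4 / s) * (D x - D y)\<bar> = (4 / s) * \<bar>D x - D y\<bar>" unfolding abs_mult using s by simp
    also have "\<dots> \<le> (4 / s) * dist x y" using s by (intro mult_left_mono D_lip) simp
    finally show ?thesis .
  qed
  have e8: "s / 8 > 0" using s by simp
  have K: "compact {x. D x \<ge> s / 4}" "\<And>x. x \<notin> {x. D x \<ge> s / 4} \<Longrightarrow> f x = 0" using D_ge_compact(1)[of "s / 4"] s f0 by auto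
  obtain w where w: "smooth w"
    "\<And>x c B. (\<And>y. dist x y < s / 8 \<Longrightarrow> \<bar>f y - c\<bar> \<le> B) \<Longrightarrow> \<bar>w x - c\<bar> \<le> B"
    "\<And>x z c B. (\<And>y. norm y < s / 8 \<Longrightarrow> \<bar>f (x - y) - f (z - y) - c\<bar> \<le> B) \<Longrightarrow> \<bar>w x - w z - c\<bar> \<le> B"
    by (rule exists_mollification[OF fc K e8]) blast+
  have "w x = 0" if "x \<notin> {x. D x \<ge> s / 8}" for x
  proof -
    have "\<bar>w x - 0\<bar> \<le> 0"
    proof (rule w(2))
      fix y assume y: "dist x y < s / 8"
      have "D y \<le> s / 4" using D_lip[of x y] y that by (simp add: abs_le_iff)
      then show "\<bar>f y - 0\<bar> \<le> 0" using f0 by simp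
    qed
    then show ?thesis by simp
  qed
  then have tw: "tf w" using D_ge_compact[of "s / 8"] s by (intro test_function_I[OF w(1), of "{x. D x \<ge> s / 8}"]) auto
  have "0 \<le> w x \<and> w x \<le> 1" for x
  proof -
    have "\<bar>w x - 1/2\<bar> \<le> 1/2"
    proof (rule w(2))
      fix y show "\<bar>f y - 1/2\<bar> \<le> 1/2" using fb[of y] by linarith
    qed
    then show ?thesis by (intro conjI) linarith+
  qed
  moreover have "w x = 1" if "D x \<ge> s" for x
  proof -
    have "\<bar>w x - 1\<bar> \<le> 0"
    proof (rule w(2))
      fix y assume y: "dist x y < s / 8"
      have "D y \<ge> s / 2" using D_lip[of x y] y that s by (simp add: abs_le_iff)
      then show "\<bar>f y - 1\<bar> \<le> 0" using f1 by simp
    qed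
    then show ?thesis by simp
  qed
  moreover have "norm (grad w x) \<le> 4 / s" for x
  proof (rule GDERIV_norm_le[OF C1_GDERIV[OF smooth_C1[OF w(1)]], of 1])
    fix z
    have "\<bar>w z - w x - 0\<bar> \<le> 4 / s * dist z x"
    proof (rule w(3))
      fix y show "\<bar>f (z - y) - f (x - y) - 0\<bar> \<le> 4 / s * dist z x" using fl[of "z - y" "x - y"] by (simp add: dist_norm)
    qed
    then show "\<bar>w z - w x\<bar> \<le> 4 / s * dist z x" by simp
  qed simp
  ultimately show ?thesis using tw by blast
qed

lemma H0_Lp2: "H0 f g \<Longrightarrow> Lp M 2 f" "H0 f g \<Longrightarrow> Lp M 2 g"
  unfolding H0_def by blast+

lemma H0_approx: "H0 f g \<Longrightarrow> e > 0 \<Longrightarrow> \<exists>v. tf v \<and> L2n M (\<lambda>x. v x - f x) < e \<and> L2n M (\<lambda>x. grad v x - g x) < e"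
proof -
  assume "H0 f g" and e: "e > 0"
  then obtain v where v: "\<And>k. tf (v k)" "L2lim M v f" "L2lim M (\<lambda>k. grad (v k)) g"
    unfolding H0_def by blast
  have "\<forall>\<^sub>F k in sequentially. L2n M (\<lambda>x. v k x - f x) < e \<and> L2n M (\<lambda>x. grad (v k) x - g x) < e"
    using order_tendstoD(2)[OF v(2) e] order_tendstoD(2)[OF v(3) e] by eventually_elim blast
  then obtain k where "L2n M (\<lambda>x. v k x - f x) < e \<and> L2n M (\<lambda>x. grad (v k) x - g x) < e"
    using eventually_happens'[OF sequentially_bot] by blast
  then show ?thesis using v(1) by blast
qed

lemma H0_I:
  assumes L: "Lp M 2 f" "Lp M 2 g" and a: "\<And>e. e > 0 \<Longrightarrow> \<exists>v. tf v \<and> L2n M (\<lambda>x. v x - f x) \<le> e \<and> L2n M (\<lambda>x. grad v x - g x) \<le> e"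
  shows "H0 f g"
proof -
  have "\<forall>k. \<exists>v. tf v \<and> L2n M (\<lambda>x. v x - f x) \<le> 1 / real (Suc k) \<and> L2n M (\<lambda>x. grad v x - g x) \<le> 1 / real (Suc k)"
    using a by simp
  then obtain v where v: "\<And>k. tf (v k)" "\<And>k. L2n M (\<lambda>x. v k x - f x) \<le> 1 / real (Suc k)" "\<And>k. L2n M (\<lambda>x. grad (v k) x - g x) \<le> 1 / real (Suc k)"
    using choice[of "\<lambda>k v. tf v \<and> L2n M (\<lambda>x. v x - f x) \<le> 1 / real (Suc k) \<and> L2n M (\<lambda>x. grad v x - g x) \<le> 1 / real (Suc k)"] by blast
  have inv0: "(\<lambda>k. 1 / real (Suc k)) \<longlonglongrightarrow> 0" using LIMSEQ_inverse_real_of_nat by (simp add: inverse_eq_divide)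
  have "L2lim M v f" "L2lim M (\<lambda>k. grad (v k)) g"
    by (rule Lim_null_comparison[OF _ inv0], use v in simp)+
  then show ?thesis unfolding H0_def using L v(1) by blast
qed

lemma H0_closed:
  assumes H: "\<And>k::nat. H0 (fs k) (gs k)" and L: "Lp M 2 f" "Lp M 2 g"
    and lim: "L2lim M fs f" "L2lim M gs g"
  shows "H0 f g"
proof (rule H0_I[OF L])
  fix e :: real assume e: "e > 0"
  have "\<forall>\<^sub>F k in sequentially. L2n M (\<lambda>x. fs k x - f x) < e / 2 \<and> L2n M (\<lambda>x. gs k x - g x) < e / 2"
    using order_tendstoD(2)[OF lim(1), of "e / 2"] order_tendstoD(2)[OF lim(2), of "e / 2"] e by (auto elim: eventually_elim2)
  then obtain k where k: "L2n M (\<lambda>x. fs k x - f x) < e / 2" "L2n M (\<lambda>x. gs k x - g x) < e / 2"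
    using eventually_happens'[OF sequentially_bot] by blast
  obtain v where v: "tf v" "L2n M (\<lambda>x. v x - fs k x) < e / 2" "L2n M (\<lambda>x. grad v x - gs k x) < e / 2"
    using H0_approx[OF H, of "e / 2" k] e by auto
  have "L2n M (\<lambda>x. v x - f x) \<le> e" using L2_diff_triangle[OF test_Lp2[OF v(1)] H0_Lp2(1)[OF H, of k] L(1)] v k by linarith
  moreover have "L2n M (\<lambda>x. grad v x - g x) \<le> e"
    using L2_diff_triangle[OF test_grad_Lp2[OF v(1)] H0_Lp2(2)[OF H, of k] L(2)] v k by linarith
  ultimately show "\<exists>v. tf v \<and> L2n M (\<lambda>x. v x - f x) \<le> e \<and> L2n M (\<lambda>x. grad v x - g x) \<le> e" using v(1) by blast
qed

lemma H0_C1_compact: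
  assumes h: "C1 h" and K: "compact K" "K \<subseteq> \<Omega>" "\<And>x. x \<notin> K \<Longrightarrow> h x = 0"
  shows "H0 h (grad h)"
proof (rule H0_I[OF C1_Lp2[OF h]])
  fix e :: real assume e: "e > 0"
  define s where "s = sqrt (measure M \<Omega>) + 1"
  have s: "s > 0" unfolding s_def by (simp add: add_nonneg_pos)
  obtain w where w: "tf w" "\<And>x. \<bar>w x - h x\<bar> \<le> e / s" "\<And>x. norm (grad w x - grad h x) \<le> e / s"
    using mollify_C1[OF h K, of "e / s"] e s by auto
  have "(e / s) * sqrt (measure M \<Omega>) \<le> (e / s) * s" using e s by (intro mult_left_mono) (auto simp: s_def)
  then have le: "(e / s) * sqrt (measure M \<Omega>) \<le> e" using s by simp
  have "L2n M (\<lambda>x. w x - h x) \<le> e"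
    using L2n_uniform[of w h "e / s"] w e s le Lp2_measurable[OF C1_Lp2(1)[OF h]] test_measurable[OF w(1)] by force
  moreover have "L2n M (\<lambda>x. grad w x - grad h x) \<le> e"
    using L2n_uniform[of "grad w" "grad h" "e / s"] w e s le Lp2_measurable[OF C1_Lp2(2)[OF h]] test_grad_measurable[OF w(1)] by force
  ultimately show "\<exists>v. tf v \<and> L2n M (\<lambda>x. v x - h x) \<le> e \<and> L2n M (\<lambda>x. grad v x - grad h x) \<le> e" using w(1) by blast
qed

end

section \<open>Vanishing boundary values put a function in the closure of the test functions\<close>

context bounded_domain begin

lemma int2_L2n:
  assumes f: "f \<in> borel_measurable borel" "Lp M 2 f" and S: "S \<in> sets borel" "S \<subseteq> \<Omega>"
  shows "int2 S f = ennreal ((L2n M (\<lambda>x. indicator S x *\<^sub>R f x))\<^sup>2)"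
proof -
  note [measurable] = f(1) S(1)
  have mi: "indicator S \<in> borel_measurable M" by (rule borel_measurable_M[OF borel_measurable_indicator[OF S(1)]])
  have L: "Lp M 2 (\<lambda>x. indicator S x *\<^sub>R f x)" by (rule L2_bounded_scaleR(1)[OF f(2) mi, of 1]) (auto simp: indicator_def)
  have "int2 S f = (\<integral>\<^sup>+x. ennreal ((norm (indicator S x *\<^sub>R f x))\<^sup>2) \<partial>lborel)"
    unfolding int2_def by (rule nn_integral_cong) (simp add: indicator_def)
  also have "\<dots> = (\<integral>\<^sup>+x. ennreal ((norm (indicator S x *\<^sub>R f x))\<^sup>2) \<partial>M)"
    by (rule nn_integral_lebesgue_on_eq[symmetric]) (use S in \<open>auto simp: indicator_def\<close>)
  also have "\<dots> = ennreal ((L2n M (\<lambda>x. indicator S x *\<^sub>R f x))\<^sup>2)" by (rule nn_integral_L2n[OF L])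
  finally show ?thesis .
qed

lemma L2n_tendsto:
  assumes "\<And>k. Lp M 2 (fs k)" "Lp M 2 f" "L2lim M fs f"
  shows "(\<lambda>k. L2n M (fs k)) \<longlonglongrightarrow> L2n M f"
proof -
  have z: "Lp M 2 (\<lambda>x. 0 :: 'a)" by (simp add: Lp2_iff)
  have "\<bar>L2n M (fs k) - L2n M f\<bar> \<le> L2n M (\<lambda>x. fs k x - f x)" for k
    using L2_diff_triangle[OF assms(1) assms(2) z, of k] L2_diff_triangle[OF assms(2) assms(1) z, of k]
      L2n_minus_commute[of M f "fs k"] by auto
  then have "(\<lambda>k. L2n M (fs k) - L2n M f) \<longlonglongrightarrow> 0" using assms(3) by (auto intro: Lim_null_comparison[rotated])
  then show ?thesis by (rule LIM_zero_cancel)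
qed

lemma L2_scaled_vector:
  assumes h: "Lp M 2 (h :: real^2 \<Rightarrow> real)" and v: "v \<in> borel_measurable M" "\<And>x. norm (v x :: real^2) \<le> B"
  shows "Lp M 2 (\<lambda>x. h x *\<^sub>R v x)" "L2n M (\<lambda>x. h x *\<^sub>R v x) \<le> B * L2n M h"
proof -
  have B: "B \<ge> 0" using v(2)[of 0] norm_ge_zero[of "v 0"] by linarith
  have m: "(\<lambda>x. h x *\<^sub>R v x) \<in> borel_measurable M" using h v(1) by (auto simp: Lp_def)
  have "norm (h x *\<^sub>R v x) \<le> norm (B * h x)" for x
    using mult_left_mono[OF v(2)[of x] abs_ge_zero[of "h x"]] B by (simp add: abs_mult mult.commute)
  then have ae: "AE x in M. norm (h x *\<^sub>R v x) \<le> norm (B * h x)" by simp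
  show "Lp M 2 (\<lambda>x. h x *\<^sub>R v x)" "L2n M (\<lambda>x. h x *\<^sub>R v x) \<le> B * L2n M h"
    using Lp2_mono[OF L2_mult_left(1)[OF h, of B] m ae] L2_mult_left(2)[OF h, of B] B by auto
qed

abbreviation restr :: "real \<Rightarrow> (real^2 \<Rightarrow> 'b::euclidean_space) \<Rightarrow> real^2 \<Rightarrow> 'b" where
  "restr s f \<equiv> \<lambda>x. indicator (strip s) x *\<^sub>R f x"

text \<open>Multiply h by cutoffs z that equal 1 off thin strips. The dangerous term is h times the
  gradient of z, of size 1 / s on a strip of width s; there h is bounded by s times the gradient on
  a wider strip, so the term is at most a constant times the norm of g on a shrinking strip.\<close>

theorem zero_trace_H0:
  assumes lb: "lipschitz_boundary \<Omega>"
    and hs: "\<And>k. C1 (hs k)" and L: "Lp M 2 h" "Lp M 2 g"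
    and lim: "L2lim M hs h" "L2lim M (\<lambda>k. grad (hs k)) g"
    and bd: "(\<lambda>k. boundary_sq (hs k)) \<longlonglongrightarrow> 0"
  shows "H0 h g"
proof -
  obtain C s0 where sb: "strip_bound UNIV C s0" using strip_estimate[OF lb] by blast
  then have C: "C \<ge> 1" and s0: "s0 > 0" unfolding strip_bound_def by blast+
  have mi: "indicator (strip s) \<in> borel_measurable M" for s by (rule borel_measurable_M[OF borel_measurable_indicator[OF strip_borel]])
  have Li: "Lp M 2 (restr s f)" "L2n M (restr s f) \<le> L2n M f"
    if "Lp M 2 f" for s and f :: "real^2 \<Rightarrow> 'b::euclidean_space"
    using L2_bounded_scaleR[OF that mi, of s 1] by (auto simp: indicator_def)
  have Lhs: "Lp M 2 (hs k)" "Lp M 2 (grad (hs k))" for k using C1_Lp2[OF hs] by auto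
  have limi: "(\<lambda>k. L2n M (restr s (fs k))) \<longlonglongrightarrow> L2n M (restr s f)"
    if "\<And>k. Lp M 2 (fs k)" "Lp M 2 f" "L2lim M fs f"
    for s and fs :: "nat \<Rightarrow> real^2 \<Rightarrow> 'b::euclidean_space" and f
  proof (rule L2n_tendsto)
    show "(\<lambda>k. L2n M (\<lambda>x. restr s (fs k) x - restr s f x)) \<longlonglongrightarrow> 0"
      by (rule L2n_LIMSEQ_0[OF that(3)]) (use Li(2)[OF L2_diff(1)[OF that(1) that(2)], of s] in \<open>simp add: scaleR_diff_right\<close>)
  qed (intro Li that)+
  \<comment> \<open>The boundary term of the strip bound disappears along the sequence, and a
    Poincare inequality on strips remains for the limit.\<close>
  have key: "L2n M (restr s h) \<le> C * s * L2n M (restr (C * s) g)"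
    if s: "0 < s" "s < s0" for s
  proof -
    let ?a = "\<lambda>k. L2n M (restr s (hs k))" and ?c = "\<lambda>k. L2n M (restr (C * s) (grad (hs k)))"
    let ?a' = "L2n M (restr s h)" and ?c' = "L2n M (restr (C * s) g)"
    have sO: "strip t \<subseteq> \<Omega>" for t by (auto simp: strip_def)
    have le: "ennreal ((?a k)\<^sup>2) \<le> ennreal (C * s) * boundary_sq (hs k) + ennreal (C * s\<^sup>2) * ennreal ((?c k)\<^sup>2)" for k
    proof -
      have "int2 (strip s) (hs k) \<le> ennreal (C * s) * boundary_sq (hs k) + ennreal (C * s\<^sup>2) * int2 (strip (C * s)) (grad (hs k))"
        using sb s hs[of k] unfolding strip_bound_def Int_UNIV_right by blast
      then show ?thesis unfolding int2_L2n[OF C1_borel[OF hs] Lhs(1) strip_borel sO] int2_L2n[OF grad_borel[OF hs] Lhs(2) strip_borel sO] .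
    qed
    have "ennreal (?a'\<^sup>2) \<le> ennreal (C * s) * 0 + ennreal (C * s\<^sup>2) * ennreal (?c'\<^sup>2)"
    proof (rule LIMSEQ_le)
      show "(\<lambda>k. ennreal ((?a k)\<^sup>2)) \<longlonglongrightarrow> ennreal (?a'\<^sup>2)"
        by (intro tendsto_ennrealI tendsto_power limi Lhs L lim)
      show "(\<lambda>k. ennreal (C * s) * boundary_sq (hs k) + ennreal (C * s\<^sup>2) * ennreal ((?c k)\<^sup>2))
        \<longlonglongrightarrow> ennreal (C * s) * 0 + ennreal (C * s\<^sup>2) * ennreal (?c'\<^sup>2)"
        by (intro tendsto_add ennreal_tendsto_cmult tendsto_ennrealI tendsto_power limi Lhs L lim bd) auto
    qed (use le in blast)
    then have "ennreal (?a'\<^sup>2) \<le> ennreal (C * s\<^sup>2 * ?c'\<^sup>2)" using C by (simp add: ennreal_mult)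
    then have "?a'\<^sup>2 \<le> C * s\<^sup>2 * ?c'\<^sup>2" using C by (simp add: ennreal_le_iff)
    also have "\<dots> \<le> C * C * s\<^sup>2 * ?c'\<^sup>2" using C by (intro mult_right_mono) auto
    also have "\<dots> = (C * s * ?c')\<^sup>2" by (simp add: power_mult_distrib power2_eq_square)
    finally have fin: "?a'\<^sup>2 \<le> (C * s * ?c')\<^sup>2" .
    show ?thesis by (rule power2_le_imp_le[OF fin]) (use C s in auto)
  qed
  \<comment> \<open>Adding 2 keeps already the first width strictly below s0.\<close>
  define sn where "sn n = s0 / real (n + 2)" for n
  have sn: "0 < sn n" "sn n < s0" for n using s0 mult_nonneg_nonneg[of s0 "real n"] by (auto simp: sn_def field_simps add_pos_nonneg)
  have sn0: "sn \<longlonglongrightarrow> 0"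
  proof -
    have "(\<lambda>n. s0 * inverse (real (Suc (n + 1)))) \<longlonglongrightarrow> s0 * 0"
      by (intro tendsto_mult tendsto_const LIMSEQ_ignore_initial_segment[OF LIMSEQ_inverse_real_of_nat])
    then show ?thesis by (simp add: sn_def[abs_def] divide_inverse)
  qed
  obtain z where z: "\<And>n. tf (z n)" "\<And>n x. 0 \<le> z n x \<and> z n x \<le> 1" "\<And>n x. D x \<ge> sn n \<Longrightarrow> z n x = 1" "\<And>n x. norm (grad (z n) x) \<le> 4 / sn n"
    using cutoff_exists[OF sn(1)] by metis
  have zb: "AE x in M. \<bar>z n x\<bar> \<le> 1" "AE x in M. \<bar>z n x - 1\<bar> \<le> 1" for n using z(2)[of n] by (auto simp: abs_le_iff)
  have zm: "z n \<in> borel_measurable M" "grad (z n) \<in> borel_measurable M" for n using test_measurable test_grad_measurable z(1) by blast+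
  note zh = L2_bounded_scaleR[OF _ zm(1) zb(1)] and zv = L2_scaled_vector[OF _ zm(2) z(4)]
  let ?g = "\<lambda>n x. z n x *\<^sub>R g x + h x *\<^sub>R grad (z n) x"
  have Hn: "H0 (\<lambda>x. z n x * h x) (?g n)" for n
  proof (rule H0_closed)
    fix k
    obtain K where K: "compact K" "K \<subseteq> \<Omega>" "\<And>x. x \<notin> K \<Longrightarrow> z n x = 0" using test_function_supp[OF z(1)] by metis
    have "H0 (\<lambda>x. z n x * hs k x) (grad (\<lambda>x. z n x * hs k x))"
      by (rule H0_C1_compact[OF C1_mult[OF test_C1[OF z(1)] hs] K(1,2)]) (use K(3) in simp)
    then show "H0 (\<lambda>x. z n x * hs k x) (\<lambda>x. z n x *\<^sub>R grad (hs k) x + hs k x *\<^sub>R grad (z n) x)"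
      unfolding grad_mult[OF test_C1[OF z(1)] hs] .
  next
    show "Lp M 2 (\<lambda>x. z n x * h x)" using zh(1)[OF L(1)] by simp
    show "Lp M 2 (?g n)" by (intro L2_add(1) zh(1) zv(1) L)
    show "(\<lambda>k. L2n M (\<lambda>x. z n x * hs k x - z n x * h x)) \<longlonglongrightarrow> 0"
      by (rule L2n_LIMSEQ_0[OF lim(1)]) (use zh(2)[OF L2_diff(1)[OF Lhs(1) L(1)], of n] in \<open>simp add: right_diff_distrib\<close>)
    show "(\<lambda>k. L2n M (\<lambda>x. (z n x *\<^sub>R grad (hs k) x + hs k x *\<^sub>R grad (z n) x) - ?g n x)) \<longlonglongrightarrow> 0"
    proof (rule L2n_LIMSEQ_0[OF tendsto_add_zero[OF lim(2) tendsto_mult_right_zero[OF lim(1), of "4 / sn n"]]])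
      fix k
      have dg: "Lp M 2 (\<lambda>x. grad (hs k) x - g x)" and dh: "Lp M 2 (\<lambda>x. hs k x - h x)" using L2_diff(1) Lhs L by blast+
      have "L2n M (\<lambda>x. z n x *\<^sub>R (grad (hs k) x - g x) + (hs k x - h x) *\<^sub>R grad (z n) x)
        \<le> L2n M (\<lambda>x. grad (hs k) x - g x) + 4 / sn n * L2n M (\<lambda>x. hs k x - h x)"
        using L2_add(2)[OF zh(1)[OF dg, of n] zv(1)[OF dh, of n]] zh(2)[OF dg, of n] zv(2)[OF dh, of n] by linarith
      then show "L2n M (\<lambda>x. (z n x *\<^sub>R grad (hs k) x + hs k x *\<^sub>R grad (z n) x) - ?g n x)
        \<le> L2n M (\<lambda>x. grad (hs k) x - g x) + 4 / sn n * L2n M (\<lambda>x. hs k x - h x)"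
        by (simp add: algebra_simps)
    qed
  qed
  have s1: "L2n M (\<lambda>x. (z n x - 1) *\<^sub>R f x) \<le> L2n M (restr (sn n) f)" if "Lp M 2 f" for n and f :: "real^2 \<Rightarrow> 'b::euclidean_space"
  proof (rule Lp2_mono(2)[OF Li(1)[OF that]])
    show "(\<lambda>x. (z n x - 1) *\<^sub>R f x) \<in> borel_measurable M" using zm(1) that by (auto simp: Lp_def)
    show "AE x in M. norm ((z n x - 1) *\<^sub>R f x) \<le> norm (indicator (strip (sn n)) x *\<^sub>R f x)"
    proof (rule AE_I2)
      fix x assume "x \<in> space M"
      then have "x \<in> \<Omega>" by (simp add: space_restrict_space)
      then show "norm ((z n x - 1) *\<^sub>R f x) \<le> norm (indicator (strip (sn n)) x *\<^sub>R f x)"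
        using z(2)[of n x] z(3)[of n x] by (cases "D x < sn n") (auto simp: strip_def abs_le_iff mult_left_le_one_le)
    qed
  qed
  have small: "(\<lambda>n. L2n M (restr (c * sn n) f)) \<longlonglongrightarrow> 0" if f: "Lp M 2 f" for c and f :: "real^2 \<Rightarrow> 'b::euclidean_space"
  proof -
    have c0: "(\<lambda>n. c * sn n) \<longlonglongrightarrow> 0" using tendsto_mult_right_zero[OF sn0] by blast
    have "(\<lambda>n. L2n M (\<lambda>x. (indicator (strip (c * sn n)) x - 0) *\<^sub>R f x)) \<longlonglongrightarrow> 0"
    proof (rule L2_dominated_convergence[OF f mi])
      show "AE x in M. (\<lambda>n. indicat_real (strip (c * sn n)) x) \<longlonglongrightarrow> 0"
      proof (rule AE_I2)
        fix x assume "x \<in> space M"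
        then have "D x > 0" using D_pos by (simp add: space_restrict_space)
        then have "\<forall>\<^sub>F n in sequentially. c * sn n < D x" using order_tendstoD(2)[OF c0] by blast
        then have "\<forall>\<^sub>F n in sequentially. indicat_real (strip (c * sn n)) x = 0" by eventually_elim (auto simp: strip_def)
        then show "(\<lambda>n. indicat_real (strip (c * sn n)) x) \<longlonglongrightarrow> 0" by (rule tendsto_eventually)
      qed
    qed (auto simp: indicator_def)
    then show ?thesis by simp
  qed
  show "H0 h g"
  proof (rule H0_closed[OF Hn L])
    show "(\<lambda>n. L2n M (\<lambda>x. z n x * h x - h x)) \<longlonglongrightarrow> 0"
      by (rule L2n_LIMSEQ_0[OF small[OF L(1), of 1]]) (use s1[OF L(1)] in \<open>simp add: left_diff_distrib\<close>)
    show "(\<lambda>n. L2n M (\<lambda>x. ?g n x - g x)) \<longlonglongrightarrow> 0"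
    proof (rule L2n_LIMSEQ_0[OF tendsto_add_zero[OF small[OF L(2), of 1] tendsto_mult_right_zero[OF small[OF L(2), of C], of "4 * C"]]])
      fix n
      let ?ih = "restr (sn n) h"
      have gz': "h x *\<^sub>R grad (z n) x = ?ih x *\<^sub>R grad (z n) x" if "x \<in> \<Omega>" for x
      proof (cases "D x < sn n")
        case False
        have "grad (z n) x = 0"
        proof -
          \<comment> \<open>D may equal \<open>sn n\<close> at x, so \<open>z n\<close> need not be
            constant near x; but it attains its maximum 1 there, and the gradient vanishes.\<close>
          have "z n y \<le> z n x" for y using z(2)[of n y] z(3)[of n x] False by simp
          then show ?thesis
            using DERIV_local_max[OF GDERIV_line[of "z n" x 0 "grad (z n) x" "grad (z n) x"], of 1] C1_GDERIV[OF test_C1[OF z(1)], of n x] by simp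
        qed
        then show ?thesis by simp
      qed (use that in \<open>simp add: strip_def\<close>)
      have t: "Lp M 2 (\<lambda>x. (z n x - 1) *\<^sub>R g x)" by (rule L2_bounded_scaleR(1)[OF L(2) _ zb(2)]) (use zm in simp)
      have "L2n M (\<lambda>x. ?g n x - g x) = L2n M (\<lambda>x. (z n x - 1) *\<^sub>R g x + h x *\<^sub>R grad (z n) x)"
        by (simp add: algebra_simps)
      also have "\<dots> \<le> L2n M (\<lambda>x. (z n x - 1) *\<^sub>R g x) + L2n M (\<lambda>x. h x *\<^sub>R grad (z n) x)"
        by (rule L2_add(2)[OF t zv(1)[OF L(1)]])
      also have "L2n M (\<lambda>x. h x *\<^sub>R grad (z n) x) = L2n M (\<lambda>x. ?ih x *\<^sub>R grad (z n) x)"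
        unfolding L2n_def by (intro arg_cong[of _ _ sqrt] Bochner_Integration.integral_cong refl, subst gz') (auto simp: space_restrict_space)
      also have "\<dots> \<le> 4 / sn n * L2n M ?ih" by (rule zv(2)[OF Li(1)[OF L(1)]])
      also have "\<dots> \<le> 4 / sn n * (C * sn n * L2n M (restr (C * sn n) g))"
        using key[OF sn] sn(1)[of n] by (intro mult_left_mono) auto
      also have "\<dots> = 4 * C * L2n M (restr (C * sn n) g)" using sn(1)[of n] by simp
      finally show "L2n M (\<lambda>x. ?g n x - g x) \<le> L2n M (restr (1 * sn n) g) + 4 * C * L2n M (restr (C * sn n) g)"
        using s1[OF L(2), of n] by simp
    qed
  qed
qed

end

section \<open>Stampacchia iteration and functions of the solution as test functions\<close>

lemma borel_measurable_boundary:
  assumes "f \<in> borel_measurable borel" shows "f \<in> borel_measurable (boundary_measure \<Omega>)"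
proof -
  have "(\<lambda>x. x) \<in> boundary_measure \<Omega> \<rightarrow>\<^sub>M borel"
    unfolding boundary_measure_def using sets_hausdorff1
    by (intro measurable_restrict_space1) (auto simp: measurable_def space_hausdorff1)
  from measurable_compose[OF this assms] show ?thesis .
qed

lemma antiderivative_exists:
  fixes f :: "real \<Rightarrow> real" assumes "continuous_on UNIV f"
  shows "\<exists>F. (\<forall>x. (F has_real_derivative f x) (at x)) \<and> F c = 0"
proof -
  have "isCont f x" for x using assms by (simp add: continuous_on_eq_continuous_at)
  then have "\<exists>F. \<forall>x::real. -\<infinity> < ereal x \<longrightarrow> ereal x < \<infinity> \<longrightarrow> (F has_vector_derivative f x) (at x)"
    by (intro einterval_antiderivative) auto
  then obtain F where F: "\<And>x. (F has_real_derivative f x) (at x)" by (auto simp: has_real_derivative_iff_has_vector_derivative)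
  have "((\<lambda>x. F x - F c) has_real_derivative f x) (at x)" for x using DERIV_diff[OF F DERIV_const] by simp
  then show ?thesis by (intro exI[of _ "\<lambda>x. F x - F c"]) simp
qed

lemma DERIV_zero_interval_const:
  fixes F :: "real \<Rightarrow> real"
  assumes F: "\<And>x. (F has_real_derivative f x) (at x)" and z: "\<And>x. a < x \<Longrightarrow> x < b \<Longrightarrow> f x = 0" and ab: "a \<le> b"
  shows "F b = F a"
proof (cases "a = b")
  case False
  then show ?thesis using ab z F
    by (intro DERIV_isconst_end) (auto intro!: DERIV_continuous_on DERIV_subset[OF F] simp flip: z)
qed simp

text \<open>Along the levels \<open>k0 + d * (1 - 1 / 2 ^ n)\<close> the function decays
  geometrically, because the power \<beta> > 1 overcomes the shrinking gaps. The number d serves all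
  \<phi> and k0 at once, as truncation levels must be fixed before there is a solution. The
  hypothesis concerns levels below \<open>k0 + d\<close> only, since a truncated logarithm carries
  no information beyond.\<close>

lemma stampacchia_iteration:
  fixes \<phi> :: "real \<Rightarrow> real"
  assumes C: "C \<ge> 0" and V: "V > 0" and \<beta>: "\<beta> > 1" and m: "m > 0"
  shows "\<exists>d>0. \<forall>\<phi> k0. (\<forall>k. 0 \<le> \<phi> k) \<longrightarrow> \<phi> k0 \<le> V \<longrightarrow> (\<forall>k l. k \<le> l \<longrightarrow> \<phi> l \<le> \<phi> k) \<longrightarrow>
     (\<forall>k l. k0 \<le> k \<longrightarrow> k < l \<longrightarrow> l < k0 + d \<longrightarrow> \<phi> l * (l - k) ^ m \<le> C * \<phi> k powr \<beta>) \<longrightarrow> \<phi> (k0 + d) = (0::real)"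
proof -
  \<comment> \<open>The ratio of decay for which \<open>q powr (\<beta> - 1)\<close> cancels the
    factor \<open>2 ^ m\<close> that every halving of the gap costs.\<close>
  define q where "q = 2 powr (- (real m / (\<beta> - 1)))"
  have q: "0 < q" "q < 1" using m \<beta> by (auto simp: q_def powr_less_one)
  have qb: "q powr (\<beta> - 1) = 1 / 2 ^ m"
  proof -
    have "q powr (\<beta> - 1) = 2 powr (- (real m / (\<beta> - 1)) * (\<beta> - 1))" by (simp only: q_def powr_powr)
    also have "- (real m / (\<beta> - 1)) * (\<beta> - 1) = - real m" using \<beta> by simp
    finally show ?thesis by (simp add: powr_minus powr_realpow inverse_eq_divide)
  qed
  \<comment> \<open>The summand 1 makes \<open>d \<le> d ^ m\<close>, so the condition on
    \<open>d ^ m\<close> that closes the induction follows from the one on d.\<close>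
  define d where "d = 1 + 2 ^ m * C * V powr (\<beta> - 1) / q"
  have d1: "d \<ge> 1" unfolding d_def using C q by simp
  have dm: "2 ^ m * C * V powr (\<beta> - 1) / q \<le> d ^ m"
  proof -
    have "2 ^ m * C * V powr (\<beta> - 1) / q \<le> d" unfolding d_def by simp
    also have "d \<le> d ^ m" using self_le_power[OF d1 m] .
    finally show ?thesis .
  qed
  have "\<phi> (k0 + d) = 0"
    if nn: "\<And>k. 0 \<le> \<phi> k" and V0: "\<phi> k0 \<le> V" and mono: "\<And>k l. k \<le> l \<Longrightarrow> \<phi> l \<le> \<phi> k"
      and step: "\<And>k l. k0 \<le> k \<Longrightarrow> k < l \<Longrightarrow> l < k0 + d \<Longrightarrow> \<phi> l * (l - k) ^ m \<le> C * \<phi> k powr \<beta>" for \<phi> :: "real \<Rightarrow> real" and k0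
  proof -
    define kn where "kn n = k0 + d * (1 - 1 / 2 ^ n)" for n :: nat
    have kd: "kn (Suc n) - kn n = d / 2 ^ Suc n" for n by (simp add: kn_def field_simps)
    have kk: "k0 \<le> kn n" "kn n < kn (Suc n)" "kn n < k0 + d" for n
    proof -
      show "k0 \<le> kn n" using d1 by (simp add: kn_def)
      show "kn n < kn (Suc n)" using kd[of n] d1 by (smt (verit) divide_pos_pos zero_less_power)
      show "kn n < k0 + d" using d1 by (simp add: kn_def)
    qed
    have dec: "\<phi> (kn n) \<le> V * q ^ n" for n
    proof (induction n)
      case 0 then show ?case using V0 by (simp add: kn_def)
    next
      case (Suc n)
      have "\<phi> (kn (Suc n)) * (d / 2 ^ Suc n) ^ m \<le> C * \<phi> (kn n) powr \<beta>"
        using step[OF kk(1) kk(2) kk(3), of n] unfolding kd .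
      also have "\<dots> \<le> C * (V * q ^ n) powr \<beta>" using Suc nn \<beta> C by (intro mult_left_mono powr_mono2) auto
      also have "(V * q ^ n) powr \<beta> = (V * q ^ n) * (V * q ^ n) powr (\<beta> - 1)"
        using V q by (simp add: powr_diff)
      also have "(V * q ^ n) powr (\<beta> - 1) = V powr (\<beta> - 1) * (1 / 2 ^ m) ^ n"
      proof -
        have "(q ^ n) powr (\<beta> - 1) = (q powr (\<beta> - 1)) ^ n"
          using q by (simp add: powr_powr mult.commute flip: powr_realpow)
        then show ?thesis using V q by (simp add: powr_mult qb)
      qed
      finally have 1: "\<phi> (kn (Suc n)) * (d / 2 ^ Suc n) ^ m \<le> C * ((V * q ^ n) * (V powr (\<beta> - 1) * (1 / 2 ^ m) ^ n))" .
      have e: "(d / 2 ^ Suc n) ^ m = d ^ m * (1 / 2 ^ m) ^ n / 2 ^ m"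
        by (simp add: power_divide power_mult_distrib mult.commute flip: power_mult)
      have "\<phi> (kn (Suc n)) * d ^ m * ((1 / 2 ^ m) ^ n / 2 ^ m) \<le> (V * q ^ n) * (2 ^ m * C * V powr (\<beta> - 1)) * ((1 / 2 ^ m) ^ n / 2 ^ m)"
        using 1 unfolding e by (simp add: mult.assoc mult.commute mult.left_commute)
      then have "\<phi> (kn (Suc n)) * d ^ m \<le> (V * q ^ n) * (2 ^ m * C * V powr (\<beta> - 1))"
        by (rule mult_right_le_imp_le) simp
      also have "\<dots> = (V * q ^ Suc n) * (2 ^ m * C * V powr (\<beta> - 1) / q)" using q by simp
      also have "\<dots> \<le> (V * q ^ Suc n) * d ^ m" using dm V q by (intro mult_left_mono) auto
      finally show ?case by (rule mult_right_le_imp_le) (use d1 in auto)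
    qed
    have "\<phi> (k0 + d) \<le> V * q ^ n" for n using mono[of "kn n" "k0 + d"] kk(3)[of n] dec[of n] by linarith
    moreover have "(\<lambda>n. V * q ^ n) \<longlonglongrightarrow> 0" using tendsto_mult_right_zero[OF LIMSEQ_power_zero[of q]] q by simp
    ultimately have "\<phi> (k0 + d) \<le> 0" by (intro LIMSEQ_le_const[of "\<lambda>n. V * q ^ n"]) auto
    then show ?thesis using nn[of "k0 + d"] by linarith
  qed
  then show ?thesis using d1 by (intro exI[of _ d]) (auto simp: less_le_trans[OF zero_less_one])
qed

context bounded_domain begin

text \<open>\<open>adm \<delta> B \<theta> g\<close>: functions of \<open>\<theta>\<close> that vanish on \<open>[\<delta>, B]\<close>, where the boundary values of
  \<open>\<theta>\<close> lie, are admissible test functions, and the chain rule holds for them.\<close>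

definition adm :: "real \<Rightarrow> real \<Rightarrow> (real^2 \<Rightarrow> real) \<Rightarrow> (real^2 \<Rightarrow> real^2) \<Rightarrow> bool" where
  "adm \<delta> B \<theta> g \<longleftrightarrow> Lp M 2 \<theta> \<and> Lp M 2 g \<and> \<delta> \<le> B \<and> (\<forall>G G' L. (\<forall>t. (G has_real_derivative G' t) (at t)) \<longrightarrow> continuous_on UNIV G' \<longrightarrow>
     (\<forall>t. \<bar>G' t\<bar> \<le> L) \<longrightarrow> (\<forall>t\<in>{\<delta>..B}. G t = 0) \<longrightarrow> H0 (\<lambda>x. G (\<theta> x)) (\<lambda>x. G' (\<theta> x) *\<^sub>R g x))"

text \<open>The content of \<open>has_trace\<close> with gradient and approximating sequence
  exposed, so that corrections can be added to the sequence and functions applied to it.\<close>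

definition approx_trace :: "(real^2 \<Rightarrow> real) \<Rightarrow> (real^2 \<Rightarrow> real^2) \<Rightarrow> (real^2 \<Rightarrow> real) \<Rightarrow> (nat \<Rightarrow> real^2 \<Rightarrow> real) \<Rightarrow> bool" where
  "approx_trace f g a \<psi> \<longleftrightarrow> Lp M 2 f \<and> Lp M 2 g \<and> Lp (boundary_measure \<Omega>) 2 a \<and> (\<forall>k. smooth (\<psi> k)) \<and>
     L2lim M \<psi> f \<and> L2lim M (\<lambda>k. grad (\<psi> k)) g \<and> L2_converges (boundary_measure \<Omega>) \<psi> a"

lemma approx_trace_exists:
  assumes "H_half_boundary \<Omega> a" shows "\<exists>f g \<psi>. approx_trace f g a \<psi>"
proof -
  obtain f g \<psi> where a: "Lp (boundary_measure \<Omega>) 2 a" and H: "H1 \<Omega> f g" and \<psi>: "\<And>k. smooth (\<psi> k)"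
    and l: "L2_converges M \<psi> f" "L2_converges M (\<lambda>k. grad (\<psi> k)) g" "L2_converges (boundary_measure \<Omega>) \<psi> a"
    using assms unfolding H_half_boundary_def has_trace_def by blast
  have L: "Lp M 2 f" "Lp M 2 g" using H unfolding H1_def by blast+
  then have "approx_trace f g a \<psi>" unfolding approx_trace_def
    using a \<psi> l L2_converges_iff[of M f \<psi>] L2_converges_iff[of M g "\<lambda>k. grad (\<psi> k)"] C1_Lp2[OF smooth_C1[OF \<psi>]] by blast
  then show ?thesis by blast
qed

text \<open>Test functions do not change the boundary values.\<close>

lemma approx_trace_add:
  assumes f: "approx_trace f g a \<psi>" and H: "H0 v w"
  shows "\<exists>t. approx_trace (\<lambda>x. f x + v x) (\<lambda>x. g x + w x) a t"
proof -
  have L: "Lp M 2 f" "Lp M 2 g" and a: "Lp (boundary_measure \<Omega>) 2 a" and \<psi>: "\<And>k. smooth (\<psi> k)"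
    and l: "L2lim M \<psi> f" "L2lim M (\<lambda>k. grad (\<psi> k)) g" and lb: "L2_converges (boundary_measure \<Omega>) \<psi> a"
    using f unfolding approx_trace_def by blast+
  obtain c where c: "\<And>k. tf (c k)" "L2lim M c v" "L2lim M (\<lambda>k. grad (c k)) w" using H unfolding H0_def by blast
  define t where "t k x = \<psi> k x + c k x" for k x
  have c1: "C1 (\<psi> k)" "C1 (c k)" for k using smooth_C1[OF \<psi>] test_C1[OF c(1)] by auto
  have tg: "grad (t k) x = grad (\<psi> k) x + grad (c k) x" for k x unfolding t_def grad_add[OF c1] ..
  have L1: "Lp M 2 (\<lambda>x. \<psi> k x - f x)" "Lp M 2 (\<lambda>x. c k x - v x)" "Lp M 2 (\<lambda>x. grad (\<psi> k) x - g x)" "Lp M 2 (\<lambda>x. grad (c k) x - w x)" for k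
    by (intro L2_diff(1) C1_Lp2 c1 L H0_Lp2[OF H])+
  have "L2lim M t (\<lambda>x. f x + v x)"
    by (rule L2n_LIMSEQ_0[OF tendsto_add_zero[OF l(1) c(2)]]) (use L2_add(2)[OF L1(1,2)] in \<open>simp add: t_def algebra_simps\<close>)
  moreover have "L2lim M (\<lambda>k. grad (t k)) (\<lambda>x. g x + w x)"
    by (rule L2n_LIMSEQ_0[OF tendsto_add_zero[OF l(2) c(3)]]) (use L2_add(2)[OF L1(3,4)] in \<open>simp add: tg algebra_simps\<close>)
  moreover have "(\<integral>\<^sup>+x. ennreal ((norm (t k x - a x))\<^sup>2) \<partial>boundary_measure \<Omega>) = (\<integral>\<^sup>+x. ennreal ((norm (\<psi> k x - a x))\<^sup>2) \<partial>boundary_measure \<Omega>)" for k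
  proof (rule nn_integral_cong)
    fix x assume "x \<in> space (boundary_measure \<Omega>)"
    then have "x \<in> frontier \<Omega>" by (simp add: boundary_measure_def space_restrict_space)
    then have "x \<notin> \<Omega>" using open_domain by (simp add: frontier_def interior_open)
    moreover obtain K where "K \<subseteq> \<Omega>" "\<And>x. x \<notin> K \<Longrightarrow> c k x = 0" using test_function_supp[OF c(1)] by metis
    ultimately have "t k x = \<psi> k x" by (auto simp: t_def)
    then show "ennreal ((norm (t k x - a x))\<^sup>2) = ennreal ((norm (\<psi> k x - a x))\<^sup>2)" by simp
  qed
  then have "L2_converges (boundary_measure \<Omega>) t a" using lb unfolding L2_converges_def by simp
  moreover have "smooth (t k)" for k unfolding t_def by (intro smooth_add \<psi> test_function_smooth[OF c(1)])
  ultimately have "approx_trace (\<lambda>x. f x + v x) (\<lambda>x. g x + w x) a t"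
    unfolding approx_trace_def using a L2_add(1)[OF L(1) H0_Lp2(1)[OF H]] L2_add(1)[OF L(2) H0_Lp2(2)[OF H]] by blast
  then show ?thesis by blast
qed

text \<open>G applied to the smooth approximations converges to G(f) together with the gradients. On
  the boundary G(a) = 0, so the values are at most L times the distance of the approximations to a,
  and \<open>zero_trace_H0\<close> applies.\<close>

lemma approx_trace_adm:
  assumes lb: "lipschitz_boundary \<Omega>" and ft: "approx_trace f g a t"
    and ab: "AE x in boundary_measure \<Omega>. \<delta> \<le> a x" "AE x in boundary_measure \<Omega>. a x \<le> B" and dB: "\<delta> \<le> B"
  shows "adm \<delta> B f g"
  unfolding adm_def
proof (intro conjI allI impI)
  show T: "Lp M 2 f" and Gt: "Lp M 2 g" using ft unfolding approx_trace_def by blast+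
  have a: "a \<in> borel_measurable (boundary_measure \<Omega>)" and ts: "\<And>k. C1 (t k)" and lt: "L2lim M t f" and lg: "L2lim M (\<lambda>k. grad (t k)) g"
    and ta: "L2_converges (boundary_measure \<Omega>) t a"
    using ft smooth_C1 unfolding approx_trace_def Lp_def by blast+
  show "\<delta> \<le> B" by (rule dB)
  fix G G' :: "real \<Rightarrow> real" and L
  assume "\<forall>t. (G has_real_derivative G' t) (at t)" and Gc: "continuous_on UNIV G'" and "\<forall>t. \<bar>G' t\<bar> \<le> L" and "\<forall>t\<in>{\<delta>..B}. G t = 0"
  then have G: "\<And>t. (G has_real_derivative G' t) (at t)" and GL: "\<And>t. \<bar>G' t\<bar> \<le> L" and G0: "\<And>t. \<delta> \<le> t \<Longrightarrow> t \<le> B \<Longrightarrow> G t = 0" by auto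
  have L0: "L \<ge> 0" using GL[of 0] by linarith
  have lipG: "\<bar>G s - G t\<bar> \<le> L * \<bar>s - t\<bar>" for s t
    using field_differentiable_bound[of UNIV G G' L s t] G GL by simp
  have cG: "continuous_on UNIV G" using G by (meson DERIV_isCont continuous_at_imp_continuous_on)
  have [measurable]: "G \<in> borel_measurable borel" "G' \<in> borel_measurable borel" using cG Gc borel_measurable_continuous_onI by blast+
  note [measurable] = Lp2_measurable[OF T] Lp2_measurable[OF Gt]
  \<comment> \<open>G' is only continuous, so L2 convergence does not pass through it; an almost
    everywhere convergent subsequence and dominated convergence do.\<close>
  obtain r :: "nat \<Rightarrow> nat" where r: "strict_mono r" and ae: "AE x in M. (\<lambda>n. t (r n) x) \<longlonglongrightarrow> f x"
    using L2_tendsto_AE_subseq[OF C1_Lp2(1)[OF ts] T lt] by blast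
  have lt': "L2lim M (\<lambda>k. t (r k)) f" and lg': "L2lim M (\<lambda>k. grad (t (r k))) g"
    using LIMSEQ_subseq_LIMSEQ[OF lt r] LIMSEQ_subseq_LIMSEQ[OF lg r] by (simp_all add: o_def)
  have Ldt: "Lp M 2 (\<lambda>x. t (r k) x - f x)" and Ldg: "Lp M 2 (\<lambda>x. grad (t (r k)) x - g x)" for k by (intro L2_diff(1) C1_Lp2 ts T Gt)+
  have mt: "t k \<in> borel_measurable M" "grad (t k) \<in> borel_measurable M" for k using C1_Lp2[OF ts] Lp2_measurable by blast+
  note [measurable] = mt
  define h where "h x = G (f x)" for x
  define hg where "hg x = G' (f x) *\<^sub>R g x" for x
  have bG: "AE x in M. \<bar>G' (q x)\<bar> \<le> L" for q :: "real^2 \<Rightarrow> real" using GL by simp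
  have Lhg: "Lp M 2 hg" unfolding hg_def by (rule L2_bounded_scaleR(1)[OF Gt _ bG]) measurable
  have Lh: "Lp M 2 h"
  proof (rule Lp2_mono(1))
    show "Lp M 2 (\<lambda>x. L * (f x - \<delta>))" by (intro L2_mult_left(1) L2_diff(1) T continuous_Lp2(1) continuous_on_const)
    show "h \<in> borel_measurable M" unfolding h_def by measurable
    show "AE x in M. norm (h x) \<le> norm (L * (f x - \<delta>))"
      using lipG[of _ \<delta>] G0[of \<delta>] dB L0 by (auto simp: h_def abs_mult)
  qed
  show "H0 (\<lambda>x. G (f x)) (\<lambda>x. G' (f x) *\<^sub>R g x)"
    unfolding h_def[symmetric] hg_def[symmetric]
  proof (rule zero_trace_H0[OF lb C1_compose(1)[OF ts G Gc] Lh Lhg])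
    show "(\<lambda>k. L2n M (\<lambda>x. G (t (r k) x) - h x)) \<longlonglongrightarrow> 0"
    proof (rule L2n_LIMSEQ_0[OF tendsto_mult_right_zero[OF lt', of L]])
      fix k
      have "L2n M (\<lambda>x. G (t (r k) x) - h x) \<le> L2n M (\<lambda>x. L * (t (r k) x - f x))"
        by (rule Lp2_mono(2)[OF L2_mult_left(1)[OF Ldt]]) (use lipG L0 in \<open>auto simp: h_def abs_mult\<close>)
      then show "L2n M (\<lambda>x. G (t (r k) x) - h x) \<le> L * L2n M (\<lambda>x. t (r k) x - f x)"
        using L2_mult_left(2)[OF Ldt, of L k] L0 by simp
    qed
    have dom: "(\<lambda>n. L2n M (\<lambda>x. (G' (t (r n) x) - G' (f x)) *\<^sub>R g x)) \<longlonglongrightarrow> 0"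
    proof (rule L2_dominated_convergence[OF Gt _ _ bG])
      show "AE x in M. (\<lambda>n. G' (t (r n) x)) \<longlonglongrightarrow> G' (f x)"
        using ae
      proof eventually_elim
        case (elim x)
        have "isCont G' (f x)" using Gc by (simp add: continuous_on_eq_continuous_at)
        from isCont_tendsto_compose[OF this elim] show ?case .
      qed
    qed measurable
    show "(\<lambda>k. L2n M (\<lambda>x. grad (\<lambda>x. G (t (r k) x)) x - hg x)) \<longlonglongrightarrow> 0"
    proof (rule L2n_LIMSEQ_0[OF tendsto_add_zero[OF tendsto_mult_right_zero[OF lg', of L] dom]])
      fix k
      have m1: "(\<lambda>x. G' (t (r k) x)) \<in> borel_measurable M" "(\<lambda>x. G' (f x)) \<in> borel_measurable M" by measurable
      let ?p = "\<lambda>x. G' (t (r k) x) *\<^sub>R (grad (t (r k)) x - g x)" and ?q = "\<lambda>x. (G' (t (r k) x) - G' (f x)) *\<^sub>R g x"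
      have p1: "Lp M 2 ?p" "L2n M ?p \<le> L * L2n M (\<lambda>x. grad (t (r k)) x - g x)"
        using L2_bounded_scaleR[OF Ldg m1(1) bG] L0 by auto
      have p2: "Lp M 2 ?q"
        unfolding scaleR_diff_left by (intro L2_diff(1) L2_bounded_scaleR(1)[OF Gt m1(1) bG] L2_bounded_scaleR(1)[OF Gt m1(2) bG])
      have "(\<lambda>x. grad (\<lambda>x. G (t (r k) x)) x - hg x) = (\<lambda>x. ?p x + ?q x)"
        unfolding C1_compose(2)[OF ts G Gc] hg_def by (simp add: algebra_simps)
      then show "L2n M (\<lambda>x. grad (\<lambda>x. G (t (r k) x)) x - hg x) \<le> L * L2n M (\<lambda>x. grad (t (r k)) x - g x) + L2n M ?q"
        using L2_add(2)[OF p1(1) p2] p1(2) by simp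
    qed
    let ?I = "\<lambda>k. \<integral>\<^sup>+x. ennreal ((norm (t k x - a x))\<^sup>2) \<partial>boundary_measure \<Omega>"
    have I0: "(\<lambda>k. ennreal (L\<^sup>2) * ?I (r k)) \<longlonglongrightarrow> 0"
      using ennreal_tendsto_cmult[OF _ LIMSEQ_subseq_LIMSEQ[OF ta[unfolded L2_converges_def] r], of "ennreal (L\<^sup>2)"] by (simp add: o_def)
    have le: "(\<integral>\<^sup>+x. ennreal ((G (t (r k) x))\<^sup>2) \<partial>boundary_measure \<Omega>) \<le> ennreal (L\<^sup>2) * ?I (r k)" for k
    proof -
      have [measurable]: "t (r k) \<in> borel_measurable (boundary_measure \<Omega>)" by (rule borel_measurable_boundary[OF C1_borel[OF ts]])
      note [measurable] = a
      have "(\<integral>\<^sup>+x. ennreal ((G (t (r k) x))\<^sup>2) \<partial>boundary_measure \<Omega>) \<le> (\<integral>\<^sup>+x. ennreal (L\<^sup>2) * ennreal ((norm (t (r k) x - a x))\<^sup>2) \<partial>boundary_measure \<Omega>)"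
      proof (rule nn_integral_mono_AE, use ab in eventually_elim)
        case (elim x)
        have "\<bar>G (t (r k) x)\<bar> \<le> L * \<bar>t (r k) x - a x\<bar>" using lipG[of "t (r k) x" "a x"] G0[of "a x"] elim by simp
        then have "\<bar>G (t (r k) x)\<bar>\<^sup>2 \<le> (L * \<bar>t (r k) x - a x\<bar>)\<^sup>2" by (rule power_mono) simp
        then show ?case by (simp add: power_mult_distrib ennreal_leI flip: ennreal_mult)
      qed
      also have "\<dots> = ennreal (L\<^sup>2) * ?I (r k)" by (rule nn_integral_cmult) measurable
      finally show ?thesis .
    qed
    show "(\<lambda>k. \<integral>\<^sup>+x. ennreal ((G (t (r k) x))\<^sup>2) \<partial>boundary_measure \<Omega>) \<longlonglongrightarrow> 0"
      by (rule tendsto_sandwich[OF _ _ tendsto_const I0]) (use le in auto)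
  qed
qed

lemma adm_H0:
  assumes "adm \<delta> B \<theta> g" "\<And>t. (G has_real_derivative G' t) (at t)" "continuous_on UNIV G'" "\<And>t. \<bar>G' t\<bar> \<le> L" "\<And>t. \<delta> \<le> t \<Longrightarrow> t \<le> B \<Longrightarrow> G t = 0"
  shows "H0 (\<lambda>x. G (\<theta> x)) (\<lambda>x. G' (\<theta> x) *\<^sub>R g x)"
proof -
  have "\<forall>G G' L. (\<forall>t. (G has_real_derivative G' t) (at t)) \<longrightarrow> continuous_on UNIV G' \<longrightarrow>
     (\<forall>t. \<bar>G' t\<bar> \<le> L) \<longrightarrow> (\<forall>t\<in>{\<delta>..B}. G t = 0) \<longrightarrow> H0 (\<lambda>x. G (\<theta> x)) (\<lambda>x. G' (\<theta> x) *\<^sub>R g x)"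
    using assms(1) unfolding adm_def by blast
  from this[rule_format, of G G' L] show ?thesis using assms(2-5) by auto
qed

text \<open>The source and the drift need not be square integrable, so L2 convergence of test
  functions is not enough. The dual bound makes the pairings Cauchy in L1, and Fatou's lemma along
  an almost everywhere convergent subsequence identifies the limit.\<close>

lemma H0_dual:
  assumes f: "Lp M p f" "p > 1" and H: "Lp M 2 u" and v: "\<And>k. tf (v k)" "L2lim M v u"
    and gl: "L2lim M (\<lambda>k. grad (v k)) gu" "Lp M 2 gu"
  shows "integrable M (\<lambda>x. f x * u x)" "(\<lambda>k. (LINT x|M. f x * v k x)) \<longlonglongrightarrow> (LINT x|M. f x * u x)"
proof -
  obtain C where C: "C \<ge> 0" "\<And>\<psi>. tf \<psi> \<Longrightarrow> integrable M (\<lambda>x. f x * \<psi> x)" "\<And>\<psi>. tf \<psi> \<Longrightarrow> (LINT x|M. \<bar>f x * \<psi> x\<bar>) \<le> C * nrm \<psi>"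
    using test_dual_bound[OF f] unfolding nrm_def by blast
  have [measurable]: "f \<in> borel_measurable M" "u \<in> borel_measurable M" "\<And>k. v k \<in> borel_measurable M"
    using f(1) H test_measurable[OF v(1)] by (auto simp: Lp_def)
  obtain r :: "nat \<Rightarrow> nat" where r: "strict_mono r" and ae: "AE x in M. (\<lambda>n. v (r n) x) \<longlonglongrightarrow> u x"
    using L2_tendsto_AE_subseq[OF test_Lp2[OF v(1)] H v(2)] by blast
  have Ldg: "Lp M 2 (\<lambda>x. grad (v k) x - gu x)" for k by (intro L2_diff(1) test_grad_Lp2 v gl(2))
  let ?d = "\<lambda>i. L2n M (\<lambda>x. grad (v i) x - gu x)"
  have nd: "nrm (\<lambda>x. v i x - v j x) \<le> ?d i + ?d j" for i j
    unfolding nrm_def grad_test_simps(2)[OF v(1) v(1)]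
    using L2_diff_triangle[OF test_grad_Lp2[OF v(1)] gl(2) test_grad_Lp2[OF v(1)], of i j] L2n_minus_commute[of M gu "grad (v j)"] by simp
  have key: "integrable M (\<lambda>x. f x * v i x - f x * u x) \<and> (LINT x|M. \<bar>f x * v i x - f x * u x\<bar>) \<le> C * (?d i + e)"
    if e: "e > 0" for i e
  proof -
    let ?b = "C * (?d i + e)"
    have b: "(\<integral>\<^sup>+x. ennreal \<bar>f x * v i x - f x * u x\<bar> \<partial>M) \<le> ennreal ?b"
    proof (rule nn_integral_limit_le)
      show "AE x in M. (\<lambda>k. \<bar>f x * v i x - f x * v (r k) x\<bar>) \<longlonglongrightarrow> \<bar>f x * v i x - f x * u x\<bar>"
        using ae by eventually_elim (intro tendsto_intros)
      have "\<forall>\<^sub>F k in sequentially. ?d (r k) < e"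
        using order_tendstoD(2)[OF LIMSEQ_subseq_LIMSEQ[OF gl(1) r] e] by (simp add: o_def)
      then show "\<forall>\<^sub>F k in sequentially. (\<integral>\<^sup>+x. ennreal \<bar>f x * v i x - f x * v (r k) x\<bar> \<partial>M) \<le> ennreal ?b"
      proof eventually_elim
        case (elim k)
        have tt: "tf (\<lambda>x. v i x - v (r k) x)" by (rule test_function_diff[OF v(1) v(1)])
        have "(\<integral>\<^sup>+x. ennreal \<bar>f x * v i x - f x * v (r k) x\<bar> \<partial>M) = ennreal (LINT x|M. \<bar>f x * (v i x - v (r k) x)\<bar>)"
          unfolding right_diff_distrib[symmetric] by (rule nn_integral_eq_integral) (use C(2)[OF tt] in auto)
        also have "\<dots> \<le> ennreal (C * nrm (\<lambda>x. v i x - v (r k) x))" by (rule ennreal_leI[OF C(3)[OF tt]])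
        also have "\<dots> \<le> ennreal ?b" using nd[of i "r k"] elim C(1) by (intro ennreal_leI mult_left_mono) auto
        finally show ?case .
      qed
    qed simp
    have I: "integrable M (\<lambda>x. f x * v i x - f x * u x)"
      by (rule integrableI_bounded) (use b in \<open>auto simp: less_top[symmetric] top_unique\<close>)
    have "ennreal (LINT x|M. \<bar>f x * v i x - f x * u x\<bar>) \<le> ennreal ?b"
      using b nn_integral_eq_integral[of M "\<lambda>x. \<bar>f x * v i x - f x * u x\<bar>"] I by simp
    moreover have "?b \<ge> 0" using C(1) e by (intro mult_nonneg_nonneg add_nonneg_nonneg) auto
    ultimately show ?thesis using I by (simp add: ennreal_le_iff)
  qed
  have "integrable M (\<lambda>x. f x * v 0 x - (f x * v 0 x - f x * u x))"
    by (rule Bochner_Integration.integrable_diff[OF C(2)[OF v(1)]]) (use key[of 1 0] in simp)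
  then show I: "integrable M (\<lambda>x. f x * u x)" by simp
  have le: "\<bar>(LINT x|M. f x * v k x) - (LINT x|M. f x * u x)\<bar> \<le> C * ?d k" for k
  proof (rule field_le_epsilon)
    fix e :: real assume e: "e > 0"
    have "(LINT x|M. f x * v k x) - (LINT x|M. f x * u x) = (LINT x|M. f x * v k x - f x * u x)"
      using C(2)[OF v(1), of k] I by simp
    also have "\<bar>\<dots>\<bar> \<le> (LINT x|M. \<bar>f x * v k x - f x * u x\<bar>)" by (rule integral_abs_bound)
    also have "\<dots> \<le> C * (?d k + e / (C + 1))" using key[of "e / (C + 1)" k] e C(1) by simp
    also have "\<dots> \<le> C * ?d k + e"
    proof -
      have "C * (e / (C + 1)) \<le> e" using C(1) e by (simp add: field_simps)
      then show ?thesis by (simp add: distrib_left)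
    qed
    finally show "\<bar>(LINT x|M. f x * v k x) - (LINT x|M. f x * u x)\<bar> \<le> C * ?d k + e" .
  qed
  have "(\<lambda>k. (LINT x|M. f x * v k x) - (LINT x|M. f x * u x)) \<longlonglongrightarrow> 0"
    by (rule Lim_null_comparison[OF _ tendsto_mult_right_zero[OF gl(1), of C]]) (use le in simp)
  then show "(\<lambda>k. (LINT x|M. f x * v k x)) \<longlonglongrightarrow> (LINT x|M. f x * u x)" by (rule LIM_zero_cancel)
qed

lemma H0_gagliardo_nirenberg:
  assumes "H0 u gu" shows "(LINT x|M. (u x)\<^sup>2) \<le> (LINT x|M. norm (gu x))\<^sup>2"
proof -
  obtain v where v: "\<And>k. tf (v k)" "L2lim M v u" "L2lim M (\<lambda>k. grad (v k)) gu"
    using assms unfolding H0_def by blast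
  note L = H0_Lp2[OF assms]
  have 1: "(\<lambda>k. (L2n M (v k))\<^sup>2) \<longlonglongrightarrow> (L2n M u)\<^sup>2" by (intro tendsto_power L2n_tendsto test_Lp2 v L)
  have 2: "(\<lambda>k. (LINT x|M. norm (grad (v k) x))) \<longlonglongrightarrow> (LINT x|M. norm (gu x))"
  proof -
    have "\<bar>(LINT x|M. norm (grad (v k) x)) - (LINT x|M. norm (gu x))\<bar> \<le> sqrt (measure M (space M)) * L2n M (\<lambda>x. grad (v k) x - gu x)" for k
    proof -
      have d: "Lp M 2 (\<lambda>x. grad (v k) x - gu x)" by (intro L2_diff(1) test_grad_Lp2 v L)
      have i: "integrable M (\<lambda>x. norm (grad (v k) x))" "integrable M (\<lambda>x. norm (gu x))" "integrable M (\<lambda>x. norm (grad (v k) x - gu x))"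
        using L2_norm_integrable(1) test_grad_Lp2[OF v(1)] L d by blast+
      have "(LINT x|M. norm (grad (v k) x)) - (LINT x|M. norm (gu x)) = (LINT x|M. norm (grad (v k) x) - norm (gu x))" using i by simp
      also have "\<bar>\<dots>\<bar> \<le> (LINT x|M. \<bar>norm (grad (v k) x) - norm (gu x)\<bar>)" by (rule integral_abs_bound)
      also have "\<dots> \<le> (LINT x|M. norm (grad (v k) x - gu x))"
        by (intro integral_mono norm_triangle_ineq3) (use i in auto)
      also note L2_norm_integrable(3)[OF d]
      finally show ?thesis .
    qed
    then have "(\<lambda>k. (LINT x|M. norm (grad (v k) x)) - (LINT x|M. norm (gu x))) \<longlonglongrightarrow> 0"
      by (intro Lim_null_comparison[OF _ tendsto_mult_right_zero[OF v(3), of "sqrt (measure M (space M))"]]) simp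
    then show ?thesis by (rule LIM_zero_cancel)
  qed
  have "(L2n M u)\<^sup>2 \<le> (LINT x|M. norm (gu x))\<^sup>2"
    by (rule LIMSEQ_le[OF 1 tendsto_power[OF 2, of 2]]) (use test_gagliardo_nirenberg[OF v(1)] in \<open>auto simp: L2n_sq\<close>)
  then show ?thesis by (simp add: L2n_sq)
qed

text \<open>Testing the equation with a function of \<open>\<theta>\<close>. The drift term is \<open>b \<bullet> \<nabla>(\<integral>G)(\<theta>)\<close> and disappears
  because \<open>b\<close> is divergence free.\<close>

lemma level_identity:
  assumes A: "adm \<delta> B \<theta> g" and b: "Lp M 3 b" "\<And>\<psi>. tf \<psi> \<Longrightarrow> (LINT x|M. b x \<bullet> grad \<psi> x) = 0"
    and \<kappa>: "\<kappa> \<in> borel_measurable M" "AE x in M. \<bar>\<kappa> x\<bar> \<le> kmax" and h: "Lp M s h" "s > 1"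
    and eq: "\<And>\<psi>. tf \<psi> \<Longrightarrow> (LINT x|M. (b x \<bullet> g x) * \<psi> x) + (LINT x|M. (\<kappa> x *\<^sub>R g x) \<bullet> grad \<psi> x) - (LINT x|M. h x * \<psi> x) = 0"
    and G: "\<And>t. (G has_real_derivative G' t) (at t)" "continuous_on UNIV G'" "\<And>t. \<bar>G' t\<bar> \<le> L" "\<And>t. \<delta> \<le> t \<Longrightarrow> t \<le> B \<Longrightarrow> G t = 0"
    and Gb: "\<And>t. \<bar>G t\<bar> \<le> L2"
  shows "integrable M (\<lambda>x. \<kappa> x * G' (\<theta> x) * (norm (g x))\<^sup>2)" "integrable M (\<lambda>x. h x * G (\<theta> x))"
    "(LINT x|M. \<kappa> x * G' (\<theta> x) * (norm (g x))\<^sup>2) = (LINT x|M. h x * G (\<theta> x))"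
proof -
  have T: "Lp M 2 \<theta>" and Lg: "Lp M 2 g" and dB: "\<delta> \<le> B" using A unfolding adm_def by auto
  have kg: "Lp M 2 (\<lambda>x. \<kappa> x *\<^sub>R g x)" by (rule L2_bounded_scaleR(1)[OF Lg \<kappa>])
  have H: "H0 (\<lambda>x. G (\<theta> x)) (\<lambda>x. G' (\<theta> x) *\<^sub>R g x)" by (rule adm_H0[OF A G])
  have cG: "continuous_on UNIV G" using G(1) by (meson DERIV_isCont continuous_at_imp_continuous_on)
  \<comment> \<open>F has bounded derivative because G is bounded, and vanishes where G does on the
    range of the boundary values; so F(\<theta>) is admissible as well.\<close>
  obtain F where F: "\<And>t. (F has_real_derivative G t) (at t)" "F \<delta> = 0" using antiderivative_exists[OF cG, of \<delta>] by blast
  have F0: "F t = 0" if "\<delta> \<le> t" "t \<le> B" for t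
    using DERIV_zero_interval_const[OF F(1), of \<delta> t] G(4) that F(2) by simp
  have HF: "H0 (\<lambda>x. F (\<theta> x)) (\<lambda>x. G (\<theta> x) *\<^sub>R g x)" by (rule adm_H0[OF A F(1) cG Gb F0])
  have drift: "(LINT x|M. b x \<bullet> (G (\<theta> x) *\<^sub>R g x)) = 0"
  proof -
    obtain v where v: "\<And>k. tf (v k)" "(\<lambda>k. L2n M (\<lambda>x. grad (v k) x - G (\<theta> x) *\<^sub>R g x)) \<longlonglongrightarrow> 0"
      using HF unfolding H0_def by blast
    have "(\<lambda>k. (LINT x|M. b x \<bullet> grad (v k) x)) \<longlonglongrightarrow> (LINT x|M. b x \<bullet> (G (\<theta> x) *\<^sub>R g x))"
      by (rule L2_inner_tendsto[OF test_grad_Lp2[OF v(1)] H0_Lp2(2)[OF HF] Lp3_imp_Lp2[OF b(1)] v(2)])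
    then show ?thesis using b(2)[OF v(1)] by (simp add: LIMSEQ_const_iff)
  qed
  obtain v where v: "\<And>k. tf (v k)" "(\<lambda>k. L2n M (\<lambda>x. v k x - G (\<theta> x))) \<longlonglongrightarrow> 0" "(\<lambda>k. L2n M (\<lambda>x. grad (v k) x - G' (\<theta> x) *\<^sub>R g x)) \<longlonglongrightarrow> 0"
    using H unfolding H0_def by blast
  have "(6/5::real) > 1" by simp
  note l1 = H0_dual[OF Lp3_product[OF b(1) Lg] this H0_Lp2(1)[OF H] v H0_Lp2(2)[OF H]]
  note l3 = H0_dual[OF h H0_Lp2(1)[OF H] v H0_Lp2(2)[OF H]]
  have l2: "(\<lambda>k. (LINT x|M. (\<kappa> x *\<^sub>R g x) \<bullet> grad (v k) x)) \<longlonglongrightarrow> (LINT x|M. (\<kappa> x *\<^sub>R g x) \<bullet> (G' (\<theta> x) *\<^sub>R g x))"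
    by (rule L2_inner_tendsto[OF test_grad_Lp2[OF v(1)] H0_Lp2(2)[OF H] kg v(3)])
  have "(LINT x|M. (b x \<bullet> g x) * G (\<theta> x)) + (LINT x|M. (\<kappa> x *\<^sub>R g x) \<bullet> (G' (\<theta> x) *\<^sub>R g x)) - (LINT x|M. h x * G (\<theta> x)) = 0"
    using tendsto_diff[OF tendsto_add[OF l1(2) l2] l3(2)] unfolding eq[OF v(1)] by (simp only: LIMSEQ_const_iff)
  moreover have "(LINT x|M. (b x \<bullet> g x) * G (\<theta> x)) = 0" using drift by (simp add: mult.commute)
  moreover have e: "(\<kappa> x *\<^sub>R g x) \<bullet> (G' (\<theta> x) *\<^sub>R g x) = \<kappa> x * G' (\<theta> x) * (norm (g x))\<^sup>2" for x
    by (simp add: dot_square_norm)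
  ultimately show "(LINT x|M. \<kappa> x * G' (\<theta> x) * (norm (g x))\<^sup>2) = (LINT x|M. h x * G (\<theta> x))" unfolding e by linarith
  show "integrable M (\<lambda>x. h x * G (\<theta> x))" by (rule l3(1))
  show "integrable M (\<lambda>x. \<kappa> x * G' (\<theta> x) * (norm (g x))\<^sup>2)"
    using L2_inner(1)[OF kg H0_Lp2(2)[OF H]] unfolding e .
qed

end

subsection \<open>Level sets\<close>

text \<open>The slope is a parabola on [k, l], cut off to 0 outside; the factor 6 gives it the
  integral l - k. Its maximum 3/2 is the origin of the constant 9/4 in the level estimates.\<close>

lemma smooth_ramp_exists:
  fixes k l :: real assumes kl: "k < l"
  shows "\<exists>\<sigma> S. continuous_on UNIV \<sigma> \<and> (\<forall>y. 0 \<le> \<sigma> y \<and> \<sigma> y \<le> 3/2) \<and> (\<forall>y. y \<le> k \<or> l \<le> y \<longrightarrow> \<sigma> y = 0) \<and>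
    (\<forall>y. (S has_real_derivative \<sigma> y) (at y)) \<and> (\<forall>y\<le>k. S y = 0) \<and> (\<forall>y\<ge>l. S y = l - k)"
proof -
  define p where "p y = 6 * ((y - k) * (l - y)) / (l - k)\<^sup>2" for y
  define \<sigma> where "\<sigma> y = max 0 (p y)" for y
  have c: "continuous_on UNIV \<sigma>" unfolding \<sigma>_def p_def using kl by (intro continuous_intros) auto
  have le: "\<sigma> y \<le> 3/2" for y
  proof -
    have "0 \<le> (2 * y - k - l)\<^sup>2" by simp
    then have "6 * ((y - k) * (l - y)) \<le> 3/2 * (l - k)\<^sup>2" by (simp add: power2_eq_square algebra_simps)
    then have "p y \<le> 3/2" using kl by (simp add: p_def divide_le_eq)
    then show ?thesis by (simp add: \<sigma>_def)
  qed
  have z: "\<sigma> y = 0" if "y \<le> k \<or> l \<le> y" for y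
  proof -
    have "(y - k) * (l - y) \<le> 0" using that kl by (auto simp: mult_le_0_iff)
    then have "p y \<le> 0" unfolding p_def by (intro divide_nonpos_nonneg) (auto simp: mult.commute)
    then show ?thesis by (simp add: \<sigma>_def)
  qed
  have pos: "\<sigma> y = p y" if "k < y" "y < l" for y
    using that by (simp add: \<sigma>_def p_def max_def)
  obtain S where S: "\<And>y. (S has_real_derivative \<sigma> y) (at y)" "S k = 0" using antiderivative_exists[OF c, of k] by blast
  have S0: "S y = 0" if "y \<le> k" for y
    using DERIV_zero_interval_const[OF S(1), of y k] z that S(2) by simp
  define q where "q y = 3 * (y - k)\<^sup>2 / (l - k) - 2 * (y - k) ^ 3 / (l - k)\<^sup>2" for y
  have dq: "(q has_real_derivative p y) (at y)" for y
  proof -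
    have "(q has_real_derivative 6 * (y - k) / (l - k) - 6 * (y - k)\<^sup>2 / (l - k)\<^sup>2) (at y)"
      unfolding q_def using kl by (auto intro!: derivative_eq_intros simp: power2_eq_square)
    also have "6 * (y - k) / (l - k) - 6 * (y - k)\<^sup>2 / (l - k)\<^sup>2 = p y"
    proof -
      have "6 * a / D - 6 * a\<^sup>2 / D\<^sup>2 = 6 * (a * (D - a)) / D\<^sup>2" if "D \<noteq> 0" for a D :: real
        using that by (simp add: power2_eq_square field_simps)
      from this[of "l - k" "y - k"] show ?thesis using kl by (simp add: p_def)
    qed
    finally show ?thesis .
  qed
  have "(\<lambda>y. S y - q y) l = (\<lambda>y. S y - q y) k"
    by (rule DERIV_zero_interval_const[OF DERIV_diff[OF S(1) dq]]) (use pos kl in auto)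
  then have "S l = l - k" using kl S(2) by (simp add: q_def power2_eq_square power3_eq_cube)
  then have Sl: "S y = l - k" if "l \<le> y" for y
    using DERIV_zero_interval_const[OF S(1), of l y] z that by simp
  have "\<forall>y. 0 \<le> \<sigma> y" by (simp add: \<sigma>_def)
  then show ?thesis using c le z S(1) S0 Sl by blast
qed

text \<open>As E increases, the mean value theorem bounds the primitive by the weight at the same
  point and not merely by its largest value. So the source can be compared with \<open>K\<close>
  pointwise.\<close>

lemma weighted_primitive_exists:
  fixes f E :: "real \<Rightarrow> real"
  assumes kl: "k < l" and f: "continuous_on UNIV f" "\<And>y. 0 \<le> f y" "\<And>y. f y \<le> c * E y" "\<And>y. y \<le> k \<or> l \<le> y \<Longrightarrow> f y = 0"
    and E: "mono E" "\<And>y. E y > 0" and c: "c \<ge> 0"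
  shows "\<exists>Q. (\<forall>y. (Q has_real_derivative f y) (at y)) \<and> (\<forall>y\<le>k. Q y = 0) \<and>
    (\<forall>y. 0 \<le> Q y \<and> Q y \<le> c * (l - k) * E y \<and> Q y \<le> c * (l - k) * E l)"
proof -
  obtain Q where Q: "\<And>y. (Q has_real_derivative f y) (at y)" "Q k = 0" using antiderivative_exists[OF f(1), of k] by blast
  have Q0: "Q y = 0" if "y \<le> k" for y
    using DERIV_zero_interval_const[OF Q(1), of y k] f(4) that Q(2) by simp
  have mid: "0 \<le> Q y \<and> Q y \<le> c * (l - k) * E y" if y: "k < y" "y \<le> l" for y
  proof -
    obtain z where z: "k < z" "z < y" "Q y - Q k = (y - k) * f z" using MVT2[OF y(1), of Q f] Q(1) by blast
    have "f z \<le> c * E y" using f(3)[of z] monoD[OF E(1), of z y] z c by (smt (verit) mult_left_mono)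
    then have "(y - k) * f z \<le> (l - k) * (c * E y)" using y f(2) by (intro mult_mono) auto
    then show ?thesis using z Q(2) f(2)[of z] by (auto simp: mult_ac)
  qed
  have Ql: "Q y = Q l" if "l \<le> y" for y
    using DERIV_zero_interval_const[OF Q(1), of l y] f(4) that by simp
  have ckl: "c * (l - k) \<ge> 0" using c kl by simp
  have Em: "c * (l - k) * E y \<le> c * (l - k) * E y'" if "y \<le> y'" for y y'
    using ckl monoD[OF E(1) that] by (rule mult_left_mono[rotated])
  have Ep: "0 \<le> c * (l - k) * E y" for y using ckl E(2)[of y] by simp
  have "0 \<le> Q y \<and> Q y \<le> c * (l - k) * E y \<and> Q y \<le> c * (l - k) * E l" for y
  proof (cases "y \<le> k")
    case True then show ?thesis using Q0 Ep by simp
  next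
    case k: False
    show ?thesis
    proof (cases "y \<le> l")
      case True then show ?thesis using mid[of y] k Em[of y l] by linarith
    next
      case False then show ?thesis using mid[of l] kl Ql[of y] Em[of l y] by linarith
    qed
  qed
  then show ?thesis using Q(1) Q0 by blast
qed

text \<open>The truncated logarithm has a kink at t = m. As f vanishes outside (k, l) and the value
  at the kink lies outside [k, l], F is constant near that value and the kink disappears in the
  composition.\<close>

lemma DERIV_truncated_log:
  fixes F :: "real \<Rightarrow> real"
  assumes F: "\<And>y. (F has_real_derivative f y) (at y)" and z: "\<And>y. y \<le> k \<or> l \<le> y \<Longrightarrow> f y = 0"
    and m: "m > 0" and out: "s * ln m < k \<or> l < s * ln m"
  shows "((\<lambda>t. F (s * ln (max t m))) has_real_derivative f (s * ln (max t m)) * (s / max t m)) (at t)"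
proof (cases "m < t")
  case True
  have "((\<lambda>t. F (s * ln t)) has_real_derivative f (s * ln t) * (s * (1 / t))) (at t)"
    by (rule DERIV_chain2[OF F]) (use True m in \<open>auto intro!: derivative_eq_intros\<close>)
  moreover have "\<forall>\<^sub>F t' in nhds t. F (s * ln t') = F (s * ln (max t' m))"
    using eventually_nhds_in_open[of "{m<..}" t] True by (auto elim!: eventually_mono simp: max_def)
  ultimately have "((\<lambda>t. F (s * ln (max t m))) has_real_derivative f (s * ln t) * (s * (1 / t))) (at t)"
    by (simp add: DERIV_cong_ev)
  then show ?thesis using True by (simp add: max_def)
next
  case False
  then have t: "max t m = m" by simp
  obtain U where U: "open U" "convex U" "s * ln m \<in> U" "\<And>y. y \<in> U \<Longrightarrow> f y = 0"
  proof -
    consider "s * ln m < k" | "l < s * ln m" using out by blast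
    then show thesis
    proof cases
      case 1 then show thesis by (intro that[of "{..<k}"]) (auto intro!: z)
    next
      case 2 then show thesis by (intro that[of "{l<..}"]) (auto intro!: z)
    qed
  qed
  have "\<exists>e. \<forall>y\<in>U. F y = e"
  proof (rule has_field_derivative_zero_constant[OF U(2)])
    fix y assume "y \<in> U"
    then show "(F has_real_derivative 0) (at y within U)" using DERIV_subset[OF F[of y]] U(4) by simp
  qed
  then obtain e where e: "\<And>y. y \<in> U \<Longrightarrow> F y = e" by blast
  have "isCont (\<lambda>t. s * ln (max t m)) t" using m by (intro continuous_intros) auto
  then have "\<forall>\<^sub>F t' in nhds t. s * ln (max t' m) \<in> U"
    using topological_tendstoD[of "\<lambda>t. s * ln (max t m)" "s * ln (max t m)" "nhds t" U] U(1,3) t by (simp add: isCont_def tendsto_nhds_iff)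
  then have "\<forall>\<^sub>F t' in nhds t. e = F (s * ln (max t' m))" by eventually_elim (simp add: e)
  then have "((\<lambda>t. F (s * ln (max t m))) has_real_derivative 0) (at t)"
    using DERIV_cong_ev[OF refl _ refl, of "\<lambda>_. e" "\<lambda>t. F (s * ln (max t m))" t 0] by simp
  then show ?thesis using U(3,4) t by simp
qed

text \<open>Hoelder's inequality for an indicator, up to the form of the constant: split K at the
  height \<tau> and choose \<tau> so that both parts scale with the same power of the measure of
  A.\<close>

lemma (in finite_measure) integral_Lp_set_bound:
  fixes K :: "'a \<Rightarrow> real"
  assumes K: "Lp M r K" "r > 1" "\<And>x. 0 \<le> K x" and A[measurable]: "A \<in> sets M"
  shows "integrable M K" "(LINT x|M. indicator A x * K x) \<le> measure M A powr (1 - 1 / r) * (1 + (LINT x|M. K x powr r))"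
proof -
  have [measurable]: "K \<in> borel_measurable M" and I: "integrable M (\<lambda>x. K x powr r)" using K(1,3) by (auto simp: Lp_def)
  have bd: "K x \<le> \<tau> + K x powr r * \<tau> powr (1 - r)" if "\<tau> > 0" for \<tau> x
  proof (cases "K x \<le> \<tau>")
    case True then show ?thesis by (simp add: add_increasing2)
  next
    case False
    then have "K x = K x powr r * K x powr (1 - r)" using that by (simp flip: powr_add)
    also have "\<dots> \<le> K x powr r * \<tau> powr (1 - r)" using False that K(2) by (intro mult_left_mono powr_mono2') auto
    finally show ?thesis using that by simp
  qed
  show IK: "integrable M K"
    by (rule Bochner_Integration.integrable_bound[of M "\<lambda>x. 1 + K x powr r"]) (use I bd[of 1] K(3) in auto)
  show "(LINT x|M. indicator A x * K x) \<le> measure M A powr (1 - 1 / r) * (1 + (LINT x|M. K x powr r))"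
  proof (cases "measure M A = 0")
    case True
    then have "A \<in> null_sets M" using A by (simp add: null_sets_def emeasure_eq_measure)
    then have "AE x in M. x \<notin> A" by (rule AE_not_in)
    then have "AE x in M. indicator A x * K x = 0" by eventually_elim simp
    then have "(LINT x|M. indicator A x * K x) = (LINT x|M. 0)" by (intro integral_cong_AE) auto
    then show ?thesis using True by simp
  next
    case False
    define V where "V = measure M A"
    have V: "V > 0" using False by (simp add: V_def zero_less_measure_iff)
    define \<tau> where "\<tau> = V powr (- 1 / r)"
    have \<tau>: "\<tau> > 0" using V by (simp add: \<tau>_def)
    have iA: "integrable M (indicator A :: 'a \<Rightarrow> real)" by (simp add: less_top[symmetric])
    have "(LINT x|M. indicator A x * K x) \<le> (LINT x|M. \<tau> * indicator A x + \<tau> powr (1 - r) * K x powr r)"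
    proof (rule integral_mono)
      show "integrable M (\<lambda>x. indicator A x * K x)" using integrable_mult_indicator[OF A IK] by simp
      show "integrable M (\<lambda>x. \<tau> * indicator A x + \<tau> powr (1 - r) * K x powr r)" using iA I by auto
      show "indicator A x * K x \<le> \<tau> * indicator A x + \<tau> powr (1 - r) * K x powr r" for x
        using bd[OF \<tau>, of x] by (auto simp: indicator_def mult.commute)
    qed
    also have "\<dots> = \<tau> * V + \<tau> powr (1 - r) * (LINT x|M. K x powr r)" using iA I by (simp add: V_def)
    also have "\<tau> * V = V powr (1 - 1 / r)"
    proof -
      have "\<tau> * V = V powr (- 1 / r) * V powr 1" using V by (simp add: \<tau>_def)
      also have "\<dots> = V powr (1 - 1 / r)" unfolding powr_add[symmetric] by simp
      finally show ?thesis .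
    qed
    also have "\<tau> powr (1 - r) = V powr (1 - 1 / r)"
      unfolding \<tau>_def powr_powr using K(2) by (intro arg_cong[of _ _ "(powr) V"]) (simp add: field_simps)
    finally show ?thesis by (simp add: V_def distrib_left)
  qed
qed

context bounded_domain begin

text \<open>The Gagliardo-Nirenberg inequality has the L1 norm of the gradient on the right; since
  the gradient lives on A, Cauchy-Schwarz gains the measure of A. This gain makes the level
  iteration superlinear.\<close>

lemma H0_level_estimate:
  assumes H: "H0 w gw" and A: "A \<in> sets M" "\<And>x. x \<in> \<Omega> \<Longrightarrow> x \<notin> A \<Longrightarrow> gw x = 0"
    and B: "B \<in> sets M" "\<And>x. x \<in> B \<Longrightarrow> a \<le> \<bar>w x\<bar>" and a: "a \<ge> 0"
  shows "a\<^sup>2 * measure M B \<le> measure M A * (LINT x|M. (norm (gw x))\<^sup>2)"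
proof -
  note L = H0_Lp2[OF H]
  have [measurable]: "A \<in> sets M" "B \<in> sets M" by (rule A B)+
  have i2: "integrable M (\<lambda>x. (w x)\<^sup>2)" "integrable M (\<lambda>x. (norm (gw x))\<^sup>2)" using L by (auto simp: Lp2_iff)
  have AB: "A \<inter> \<Omega> = A" "B \<inter> \<Omega> = B" using sets.sets_into_space[OF A(1)] sets.sets_into_space[OF B(1)] by (auto simp: space_restrict_space)
  have LA: "Lp M 2 (indicator A :: real^2 \<Rightarrow> real)" "L2n M (indicator A :: real^2 \<Rightarrow> real) = sqrt (measure M A)"
  proof -
    have "(\<lambda>x. (norm (indicator A x :: real))\<^sup>2) = (indicator A :: real^2 \<Rightarrow> real)" by (auto simp: indicator_def)
    then show "Lp M 2 (indicator A :: real^2 \<Rightarrow> real)" "L2n M (indicator A :: real^2 \<Rightarrow> real) = sqrt (measure M A)"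
      unfolding Lp2_iff L2n_def by (simp_all add: less_top[symmetric] emeasure_eq_measure AB)
  qed
  have Ln: "Lp M 2 (\<lambda>x. norm (gw x))" "L2n M (\<lambda>x. norm (gw x)) = L2n M gw" using L(2) by (auto simp: Lp2_iff L2n_def)
  have "(LINT x|M. norm (gw x)) = (LINT x|M. indicator A x * norm (gw x))"
    by (rule Bochner_Integration.integral_cong) (use A(2) in \<open>auto simp: indicator_def space_restrict_space\<close>)
  also have "\<dots> \<le> sqrt (measure M A) * L2n M gw"
    using L2_inner(2)[OF LA(1) Ln(1)] unfolding LA(2) Ln(2) by simp
  finally have 1: "(LINT x|M. norm (gw x)) \<le> sqrt (measure M A) * L2n M gw" .
  have "a\<^sup>2 * measure M B = (LINT x|M. a\<^sup>2 * indicator B x)" by (simp add: AB)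
  also have "\<dots> \<le> (LINT x|M. (w x)\<^sup>2)"
  proof (rule integral_mono[OF _ i2(1)])
    show "integrable M (\<lambda>x. a\<^sup>2 * indicator B x)" by (simp add: less_top[symmetric] emeasure_eq_measure)
    show "a\<^sup>2 * indicator B x \<le> (w x)\<^sup>2" for x using B(2)[of x] a by (auto simp: indicator_def abs_le_square_iff[symmetric])
  qed
  also note H0_gagliardo_nirenberg[OF H]
  also have "(LINT x|M. norm (gw x))\<^sup>2 \<le> (sqrt (measure M A) * L2n M gw)\<^sup>2" by (rule power_mono[OF 1]) simp
  also have "\<dots> = measure M A * (LINT x|M. (norm (gw x))\<^sup>2)" by (simp add: power_mult_distrib L2n_sq)
  finally show ?thesis .
qed

text \<open>Linear in l - k: the ramp has height l - k, which enters squared, while the test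
  function for the source contributes l - k once.\<close>

definition level_decay :: "real \<Rightarrow> (real^2 \<Rightarrow> real) \<Rightarrow> (real^2 \<Rightarrow> real) \<Rightarrow> real \<Rightarrow> real \<Rightarrow> bool" where
  "level_decay c K y k l \<longleftrightarrow>
     (l - k) * measure M {x\<in>\<Omega>. l \<le> y x} \<le> 9 / (4 * c) * measure M {x\<in>\<Omega>. k < y x} * (LINT x|M. indicator {x\<in>\<Omega>. k < y x} x * K x)"

definition level_bound :: "real \<Rightarrow> (real^2 \<Rightarrow> real) \<Rightarrow> real \<Rightarrow> bool" where
  "level_bound c K d \<longleftrightarrow> (\<forall>y k0. y \<in> borel_measurable M \<longrightarrow>
    (\<forall>k l. k0 \<le> k \<longrightarrow> k < l \<longrightarrow> l < k0 + d \<longrightarrow> level_decay c K y k l) \<longrightarrow> (AE x in M. y x < k0 + d))"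

text \<open>The measure of the level set enters once through the Gagliardo-Nirenberg inequality and
  to the power \<open>1 - 1 / r\<close> through Hoelder's inequality. The total exponent
  \<open>2 - 1 / r\<close> exceeds 1 exactly because r > 1, so the iteration applies.\<close>

lemma level_set_vanishes:
  assumes K: "Lp M r K" "r > 1" "\<And>x. 0 \<le> K x" and c: "c > 0"
  shows "\<exists>d>0. level_bound c K d"
proof -
  define B where "B = 9 / (4 * c) * (1 + (LINT x|M. K x powr r))"
  have I0: "0 \<le> (LINT x|M. K x powr r)" by simp
  have "0 \<le> B" "0 < measure M \<Omega> + 1" "1 < 2 - 1 / r"
    using c I0 K(2) by (auto simp: B_def add_nonneg_pos)
  note stampacchia_iteration[OF this zero_less_one]
  then obtain d where d: "d > 0" and st: "\<forall>\<phi> k0. (\<forall>k. 0 \<le> \<phi> k) \<longrightarrow> \<phi> k0 \<le> measure M \<Omega> + 1 \<longrightarrow> (\<forall>k l. k \<le> l \<longrightarrow> \<phi> l \<le> \<phi> k) \<longrightarrow>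
      (\<forall>k l. k0 \<le> k \<longrightarrow> k < l \<longrightarrow> l < k0 + d \<longrightarrow> \<phi> l * (l - k) ^ 1 \<le> B * \<phi> k powr (2 - 1 / r)) \<longrightarrow> \<phi> (k0 + d) = 0"
    by (elim exE conjE)
  have "AE x in M. y x < k0 + d"
    if y[measurable]: "y \<in> borel_measurable M" and step: "\<And>k l. k0 \<le> k \<Longrightarrow> k < l \<Longrightarrow> l < k0 + d \<Longrightarrow> level_decay c K y k l" for y k0
  proof -
    let ?\<phi> = "\<lambda>k. measure M {x\<in>\<Omega>. k \<le> y x}" and ?\<phi>' = "\<lambda>k. measure M {x\<in>\<Omega>. k < y x}"
    have sp: "space M = \<Omega>" by (simp add: space_restrict_space)
    have mA: "{x\<in>\<Omega>. k < y x} \<in> sets M" "{x\<in>\<Omega>. k \<le> y x} \<in> sets M" for k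
    proof -
      have "{x\<in>space M. k < y x} \<in> sets M" "{x\<in>space M. k \<le> y x} \<in> sets M" by measurable
      then show "{x\<in>\<Omega>. k < y x} \<in> sets M" "{x\<in>\<Omega>. k \<le> y x} \<in> sets M" unfolding sp by blast+
    qed
    have "?\<phi> (k0 + d) = 0"
    proof (rule st[THEN spec, THEN spec, THEN mp, THEN mp, THEN mp, THEN mp])
      show "\<forall>k. 0 \<le> ?\<phi> k" by simp
      show "?\<phi> k0 \<le> measure M \<Omega> + 1" using finite_measure_mono[of "{x\<in>\<Omega>. k0 \<le> y x}" \<Omega>] sets.top[of M] unfolding sp by force
      show "\<forall>k l. k \<le> l \<longrightarrow> ?\<phi> l \<le> ?\<phi> k" by (intro allI impI finite_measure_mono mA) auto
      show "\<forall>k l. k0 \<le> k \<longrightarrow> k < l \<longrightarrow> l < k0 + d \<longrightarrow> ?\<phi> l * (l - k) ^ 1 \<le> B * ?\<phi> k powr (2 - 1 / r)"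
      proof (intro allI impI)
        fix k l assume kl: "k0 \<le> k" "k < l" "l < k0 + d"
        have "?\<phi> l * (l - k) ^ 1 = (l - k) * ?\<phi> l" by simp
        also note step[OF kl, unfolded level_decay_def]
        also have "9 / (4 * c) * ?\<phi>' k * (LINT x|M. indicator {x\<in>\<Omega>. k < y x} x * K x)
            \<le> 9 / (4 * c) * ?\<phi>' k * (?\<phi>' k powr (1 - 1 / r) * (1 + (LINT x|M. K x powr r)))"
          using c by (intro mult_left_mono integral_Lp_set_bound(2)[OF K mA(1)]) auto
        also have "\<dots> = B * (?\<phi>' k powr 1 * ?\<phi>' k powr (1 - 1 / r))" by (simp add: B_def)
        also have "?\<phi>' k powr 1 * ?\<phi>' k powr (1 - 1 / r) = ?\<phi>' k powr (2 - 1 / r)" unfolding powr_add[symmetric] by simp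
        also have "B * ?\<phi>' k powr (2 - 1 / r) \<le> B * ?\<phi> k powr (2 - 1 / r)"
        proof (intro mult_left_mono powr_mono2)
          show "?\<phi>' k \<le> ?\<phi> k" by (rule finite_measure_mono[OF _ mA(2)]) auto
          show "0 \<le> 2 - 1 / r" using K(2) by (simp add: field_simps)
          show "0 \<le> B" using c I0 by (simp add: B_def)
        qed simp
        finally show "?\<phi> l * (l - k) ^ 1 \<le> B * ?\<phi> k powr (2 - 1 / r)" .
      qed
    qed
    then have "emeasure M {x\<in>space M. \<not> y x < k0 + d} = 0" by (simp add: emeasure_eq_measure sp not_less)
    moreover have "{x\<in>space M. \<not> y x < k0 + d} \<in> sets M" by measurable
    ultimately show ?thesis by (simp add: AE_iff_measurable[OF _ refl])
  qed
  then show ?thesis unfolding level_bound_def using d by blast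
qed

end

text \<open>Once the system is solved, the coefficients can be frozen at the solution: both
  equations become linear ones with a coefficient \<kappa> and a source h depending on x, and the
  bounds are proved for this form.\<close>

locale scalar_solution = bounded_domain +
  fixes \<delta> B kmax p :: real and \<theta> \<kappa> h :: "real^2 \<Rightarrow> real" and g b :: "real^2 \<Rightarrow> real^2"
  assumes A: "adm \<delta> B \<theta> g" and b: "Lp M 3 b" "\<And>\<psi>. tf \<psi> \<Longrightarrow> (LINT x|M. b x \<bullet> grad \<psi> x) = 0"
    and \<kappa>: "\<kappa> \<in> borel_measurable M" "AE x in M. \<bar>\<kappa> x\<bar> \<le> kmax" "AE x in M. 0 \<le> \<kappa> x" and h: "Lp M p h" "p > 1"
    and eq: "\<And>\<psi>. tf \<psi> \<Longrightarrow> (LINT x|M. (b x \<bullet> g x) * \<psi> x) + (LINT x|M. (\<kappa> x *\<^sub>R g x) \<bullet> grad \<psi> x) - (LINT x|M. h x * \<psi> x) = 0"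
begin

lemma \<theta>_measurable [measurable]: "\<theta> \<in> borel_measurable M" using A unfolding adm_def Lp_def by blast

text \<open>The level sets of \<open>y = s ln \<theta>\<close>. For \<open>s = 1\<close>, \<open>E = 1\<close> they control \<open>\<theta>\<close> from above, for
  \<open>s = -1\<close>, \<open>E = exp\<close> from below. The test function is \<open>G(\<theta>) = s Q(y)\<close> with \<open>Q' = \<sigma>\<^sup>2 E\<close>, for which
  \<open>G'\<close> dominates the square of the derivative of the ramp \<open>S(y)\<close>; the factor \<open>1/\<theta>\<close> lost by the
  diffusion is made up for by the logarithm.\<close>

lemma level_set_estimate:
  assumes s: "s * s = 1" and E: "continuous_on UNIV E" "mono E" "\<And>y. E y > 0"
    and m: "m > 0" "s * ln m < k \<or> l < s * ln m" and kl: "k < l"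
    and van: "\<And>t. \<delta> \<le> t \<Longrightarrow> t \<le> B \<Longrightarrow> s * ln (max t m) \<le> k"
    and y: "y = (\<lambda>x. s * ln (max (\<theta> x) m))"
    and c: "c > 0" "AE x in M. k < y x \<longrightarrow> c \<le> \<kappa> x * max (\<theta> x) m * E (y x)"
    and K: "integrable M K" "\<And>x. 0 \<le> K x" "AE x in M. k < y x \<longrightarrow> s * h x * E (y x) \<le> K x"
  shows "level_decay c K y k l"
proof -
  have T: "Lp M 2 \<theta>" and Lg: "Lp M 2 g" using A unfolding adm_def by auto
  note [measurable] = Lp2_measurable[OF T] Lp2_measurable[OF Lg]
  have ym[measurable]: "y \<in> borel_measurable M" unfolding y by measurable
  obtain \<sigma> S where \<sigma>: "continuous_on UNIV \<sigma>" "\<And>y. 0 \<le> \<sigma> y" "\<And>y. \<sigma> y \<le> 3/2" "\<And>y. y \<le> k \<or> l \<le> y \<Longrightarrow> \<sigma> y = 0"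
    and S: "\<And>y. (S has_real_derivative \<sigma> y) (at y)" "\<And>y. y \<le> k \<Longrightarrow> S y = 0" "\<And>y. l \<le> y \<Longrightarrow> S y = l - k"
    using smooth_ramp_exists[OF kl] by blast
  define q where "q y = (\<sigma> y)\<^sup>2 * E y" for y
  have \<sigma>2: "(\<sigma> y)\<^sup>2 \<le> 9/4" for y using power_mono[OF \<sigma>(3) \<sigma>(2), of y 2] by (simp add: power2_eq_square)
  have qc: "continuous_on UNIV q" unfolding q_def by (intro continuous_intros \<sigma> E)
  have q0: "0 \<le> q y" and qE: "q y \<le> 9/4 * E y" for y
    using E(3)[of y] \<sigma>2[of y] by (auto simp: q_def intro!: mult_right_mono)
  have qz: "y \<le> k \<or> l \<le> y \<Longrightarrow> q y = 0" for y using \<sigma>(4) by (auto simp: q_def)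
  obtain Q where Q: "\<And>y. (Q has_real_derivative q y) (at y)" "\<And>y. y \<le> k \<Longrightarrow> Q y = 0"
      "\<And>y. 0 \<le> Q y" "\<And>y. Q y \<le> 9/4 * (l - k) * E y" "\<And>y. Q y \<le> 9/4 * (l - k) * E l"
    using weighted_primitive_exists[OF kl qc q0 qE qz E(2,3)] by auto
  define G where "G t = s * Q (s * ln (max t m))" for t
  define G' where "G' t = q (s * ln (max t m)) / max t m" for t
  define S1' where "S1' t = \<sigma> (s * ln (max t m)) * (s / max t m)" for t
  have cy: "continuous_on UNIV (\<lambda>t. s * ln (max t m))" using m(1) by (intro continuous_intros) auto
  have mt: "max t m > 0" "m \<le> max t m" for t using m(1) by auto
  have dG: "(G has_real_derivative G' t) (at t)" for t
  proof -
    have "(G has_real_derivative s * (q (s * ln (max t m)) * (s / max t m))) (at t)"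
      unfolding G_def by (rule DERIV_cmult[OF DERIV_truncated_log[OF Q(1) qz m]])
    also have "s * (q (s * ln (max t m)) * (s / max t m)) = G' t" using s by (simp add: G'_def)
    finally show ?thesis .
  qed
  have cG: "continuous_on UNIV G'" unfolding G'_def
    by (intro continuous_intros continuous_on_compose2[OF qc cy]) (use mt(1) in \<open>auto simp: less_imp_neq[symmetric]\<close>)
  have ql: "q y \<le> 9/4 * E l" for y
  proof (cases "l \<le> y")
    case True then show ?thesis using qz E(3)[of l] by simp
  next
    case False
    then have "E y \<le> E l" using monoD[OF E(2), of y l] by simp
    then show ?thesis using qE[of y] by linarith
  qed
  have bG: "\<bar>G' t\<bar> \<le> 9/4 * E l / m" for t
    using frac_le[OF _ ql m(1) mt(2), of "s * ln (max t m)" t] q0 E(3)[of l] mt(1)[of t] by (simp add: G'_def)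
  have vG: "G t = 0" if "\<delta> \<le> t" "t \<le> B" for t using Q(2)[OF van[OF that]] by (simp add: G_def)
  have s1: "\<bar>s\<bar> = 1" using s by (auto simp: square_eq_1_iff)
  have GL2: "\<bar>G t\<bar> \<le> 9/4 * (l - k) * E l" for t using Q(3,5) s1 by (simp add: G_def abs_mult)
  note li = level_identity[where G = G and G' = G' and h = h and \<kappa> = \<kappa>, OF A b \<kappa>(1,2) h eq dG cG bG vG GL2]
  have dS: "((\<lambda>t. S (s * ln (max t m))) has_real_derivative S1' t) (at t)" for t
    unfolding S1'_def by (rule DERIV_truncated_log[OF S(1) \<sigma>(4) m])
  have cS: "continuous_on UNIV S1'" unfolding S1'_def
    by (intro continuous_intros continuous_on_compose2[OF \<sigma>(1) cy]) (use mt(1) in \<open>auto simp: less_imp_neq[symmetric]\<close>)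
  have bS: "\<bar>S1' t\<bar> \<le> 3/2 / m" for t
    using frac_le[OF _ \<sigma>(3) m(1) mt(2), of "s * ln (max t m)" t] \<sigma>(2) s1 mt(1)[of t] by (simp add: S1'_def abs_mult)
  have vS: "S (s * ln (max t m)) = 0" if "\<delta> \<le> t" "t \<le> B" for t by (rule S(2)[OF van[OF that]])
  have HS: "H0 (\<lambda>x. S (y x)) (\<lambda>x. S1' (\<theta> x) *\<^sub>R g x)" unfolding y by (rule adm_H0[where G = "\<lambda>t. S (s * ln (max t m))", OF A dS cS bS vS])
  let ?A = "{x\<in>\<Omega>. k < y x}" and ?B = "{x\<in>\<Omega>. l \<le> y x}"
  have sp: "space M = \<Omega>" by (simp add: space_restrict_space)
  have "{x\<in>space M. k < y x} \<in> sets M" "{x\<in>space M. l \<le> y x} \<in> sets M" by measurable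
  then have mA: "?A \<in> sets M" and mB: "?B \<in> sets M" unfolding sp by blast+
  let ?N = "\<lambda>x. (norm (S1' (\<theta> x) *\<^sub>R g x))\<^sup>2"
  have i2: "integrable M (\<lambda>x. ?N x)" using H0_Lp2(2)[OF HS] by (simp add: Lp2_iff)
  have iK: "integrable M (\<lambda>x. indicator ?A x * K x)" using integrable_mult_indicator[OF mA K(1)] by simp
  have "c * (LINT x|M. ?N x) = (LINT x|M. c * ?N x)" by simp
  also have "\<dots> \<le> (LINT x|M. \<kappa> x * G' (\<theta> x) * (norm (g x))\<^sup>2)"
  proof (rule integral_mono_AE[OF _ li(1)])
    show "integrable M (\<lambda>x. c * ?N x)" using i2 by simp
    \<comment> \<open>With \<tau> = max \<theta> m, the squared gradient of the ramp contains
      \<open>(\<sigma> (y x))\<^sup>2 / \<tau>\<^sup>2\<close>, whereas G' offers the same square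
      times \<open>E (y x) / \<tau>\<close>; the hypothesis on c supplies the missing
      factor.\<close>
    show "AE x in M. c * ?N x \<le> \<kappa> x * G' (\<theta> x) * (norm (g x))\<^sup>2"
      using c(2) \<kappa>(3)
    proof eventually_elim
      case (elim x)
      let ?\<tau> = "max (\<theta> x) m"
      have ss: "(s / ?\<tau>)\<^sup>2 = 1 / ?\<tau>\<^sup>2" using s by (simp add: power2_eq_square)
      have n: "?N x = (\<sigma> (y x))\<^sup>2 / ?\<tau>\<^sup>2 * (norm (g x))\<^sup>2"
        unfolding norm_scaleR power_mult_distrib power2_abs S1'_def y ss by simp
      have "c * ((\<sigma> (y x))\<^sup>2 / ?\<tau>\<^sup>2) \<le> \<kappa> x * G' (\<theta> x)"
      proof (cases "k < y x")
        case True
        have "c * ((\<sigma> (y x))\<^sup>2 / ?\<tau>\<^sup>2) \<le> (\<kappa> x * ?\<tau> * E (y x)) * ((\<sigma> (y x))\<^sup>2 / ?\<tau>\<^sup>2)"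
          using elim True by (intro mult_right_mono) auto
        also have "\<dots> = \<kappa> x * G' (\<theta> x)" using mt(1)[of "\<theta> x"]
          by (simp add: G'_def q_def y power2_eq_square)
        finally show ?thesis .
      next
        case False then show ?thesis using \<sigma>(4)[of "y x"] qz[of "y x"] by (simp add: G'_def flip: fun_cong[OF y])
      qed
      from mult_right_mono[OF this, of "(norm (g x))\<^sup>2"] show ?case unfolding n by (simp add: mult.assoc)
    qed
  qed
  also have "\<dots> = (LINT x|M. h x * G (\<theta> x))" by (rule li(3))
  also have "\<dots> \<le> (LINT x|M. 9/4 * (l - k) * (indicator ?A x * K x))"
  proof (rule integral_mono_AE[OF li(2)])
    show "integrable M (\<lambda>x. 9/4 * (l - k) * (indicator ?A x * K x))" using iK by simp
    show "AE x in M. h x * G (\<theta> x) \<le> 9/4 * (l - k) * (indicator ?A x * K x)"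
      using K(3) AE_space
    proof eventually_elim
      case (elim x)
      have Gx: "G (\<theta> x) = s * Q (y x)" by (simp add: G_def y)
      show ?case
      proof (cases "k < y x")
        case True
        then have ind: "indicator ?A x = (1::real)" using elim by (simp add: sp)
        \<comment> \<open>Q is nonnegative, so a source of favourable sign may be dropped. Otherwise
          Q is bounded by the weight E at the same point, and the hypothesis on K applies.\<close>
        show ?thesis
        proof (cases "s * h x \<le> 0")
          case True
          then have "s * h x * Q (y x) \<le> 0" using Q(3) by (simp add: mult_le_0_iff)
          moreover have "0 \<le> 9/4 * (l - k) * K x" using kl K(2) by simp
          ultimately show ?thesis unfolding ind Gx by (simp add: mult_ac)
        next
          case False
          then have "s * h x * Q (y x) \<le> s * h x * (9/4 * (l - k) * E (y x))" using Q(4) by (intro mult_left_mono) auto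
          also have "\<dots> = 9/4 * (l - k) * (s * h x * E (y x))" by simp
          also have "\<dots> \<le> 9/4 * (l - k) * K x" using elim True kl by (intro mult_left_mono) auto
          finally show ?thesis unfolding ind Gx by (simp add: mult_ac)
        qed
      next
        case False then show ?thesis using Q(2)[of "y x"] by (simp add: Gx)
      qed
    qed
  qed
  also have "\<dots> = 9/4 * (l - k) * (LINT x|M. indicator ?A x * K x)" by simp
  finally have en: "(LINT x|M. ?N x) \<le> 9 / (4 * c) * (l - k) * (LINT x|M. indicator ?A x * K x)"
    using c(1) by (simp add: field_simps)
  have "(l - k)\<^sup>2 * measure M ?B \<le> measure M ?A * (LINT x|M. ?N x)"
  proof (rule H0_level_estimate[OF HS mA _ mB])
    show "S1' (\<theta> x) *\<^sub>R g x = 0" if "x \<in> \<Omega>" "x \<notin> ?A" for x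
      using that \<sigma>(4)[of "y x"] by (simp add: S1'_def y)
  qed (use S(3) kl in auto)
  also have "\<dots> \<le> measure M ?A * (9 / (4 * c) * (l - k) * (LINT x|M. indicator ?A x * K x))" by (intro mult_left_mono en) simp
  finally have "(l - k) * ((l - k) * measure M ?B) \<le> (l - k) * (9 / (4 * c) * measure M ?A * (LINT x|M. indicator ?A x * K x))"
    by (simp only: power2_eq_square mult_ac)
  then show ?thesis unfolding level_decay_def using kl by (simp only: mult_le_cancel_left_pos diff_gt_0_iff_gt)
qed

text \<open>On levels k > 0 one has \<theta> > 1, so truncating the logarithm at 1 is invisible.
  With constant weight it is the product \<kappa> \<theta> that must be bounded below, and a
  coefficient of order 1 / \<theta> satisfies this.\<close>

lemma upper_bound:
  assumes k0: "k0 > 0" "B \<le> exp k0" and c: "c > 0" "AE x in M. 1 < \<theta> x \<longrightarrow> c \<le> \<kappa> x * \<theta> x"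
    and K: "integrable M K" "\<And>x. 0 \<le> K x" "AE x in M. 1 < \<theta> x \<longrightarrow> h x \<le> K x" and kl: "k0 \<le> k" "k < l"
  shows "level_decay c K (\<lambda>x. ln (max (\<theta> x) 1)) k l"
proof -
  have th: "1 < \<theta> x" "max (\<theta> x) 1 = \<theta> x" if "k < ln (max (\<theta> x) 1)" for x
    using that k0 kl by (auto simp: max_def split: if_splits)
  have "level_decay c K (\<lambda>x. 1 * ln (max (\<theta> x) 1)) k l"
  proof (rule level_set_estimate[where E = "\<lambda>_. 1"])
    show "1 * ln (max t 1) \<le> k" if "t \<le> B" for t
    proof -
      have "ln (max t 1) \<le> ln (exp k0)" using that k0 by (intro ln_mono) (auto intro: order_trans)
      then show ?thesis using kl by simp
    qed
    show "AE x in M. k < 1 * ln (max (\<theta> x) 1) \<longrightarrow> c \<le> \<kappa> x * max (\<theta> x) 1 * 1"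
      using c(2) by eventually_elim (use th in auto)
    show "AE x in M. k < 1 * ln (max (\<theta> x) 1) \<longrightarrow> 1 * h x * 1 \<le> K x"
      using K(3) by eventually_elim (use th in auto)
  qed (use k0 kl c K in \<open>auto simp: monoI\<close>)
  then show ?thesis by simp
qed

text \<open>For a nonpositive source K = 0 is allowed, and a single step from level k0 to k0 + 1
  already gives measure zero. The bound therefore does not involve c.\<close>

lemma maximum_principle:
  assumes k0: "k0 > 0" "B \<le> exp k0" and c: "c > 0" "AE x in M. 1 < \<theta> x \<longrightarrow> c \<le> \<kappa> x * \<theta> x"
    and h0: "AE x in M. h x \<le> 0"
  shows "AE x in M. \<theta> x < exp (k0 + 1)"
proof -
  have sp: "space M = \<Omega>" by (simp add: space_restrict_space)
  have "level_decay c (\<lambda>x. 0) (\<lambda>x. ln (max (\<theta> x) 1)) k0 (k0 + 1)"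
    by (rule upper_bound[OF k0 c]) (use h0 in auto)
  then have "emeasure M {x\<in>space M. \<not> ln (max (\<theta> x) 1) < k0 + 1} = 0"
    by (simp add: level_decay_def emeasure_eq_measure sp not_less measure_le_0_iff)
  moreover have "{x\<in>space M. \<not> ln (max (\<theta> x) 1) < k0 + 1} \<in> sets M" by measurable
  ultimately have "AE x in M. ln (max (\<theta> x) 1) < k0 + 1" by (simp add: AE_iff_measurable[OF _ refl])
  then show ?thesis
  proof eventually_elim
    case (elim x)
    then have "exp (ln (max (\<theta> x) 1)) < exp (k0 + 1)" by (simp only: exp_less_cancel_iff)
    moreover have "exp (ln (max (\<theta> x) 1)) = max (\<theta> x) 1" by (rule exp_ln) simp
    ultimately show ?case by simp
  qed
qed

text \<open>With E = exp the weight is the reciprocal of the truncated \<theta>. It cancels the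
  factor in front of \<kappa>, so a lower bound on \<kappa> itself is used, and it turns a source of
  order \<theta> into one bounded by K. All levels used stay below \<open>k0 + d\<close>, where the
  truncation at m begins.\<close>

lemma lower_bound:
  assumes \<delta>: "exp (- k0) \<le> \<delta>" and m: "m = exp (- (k0 + d))" and c: "c > 0" "AE x in M. c \<le> \<kappa> x"
    and K: "integrable M K" "\<And>x. 0 \<le> K x" "AE x in M. \<theta> x < exp (- k0) \<longrightarrow> - h x \<le> max (\<theta> x) m * K x"
    and kl: "k0 \<le> k" "k < l" "l < k0 + d"
  shows "level_decay c K (\<lambda>x. - ln (max (\<theta> x) m)) k l"
proof -
  have m0: "m > 0" "ln m = - (k0 + d)" by (simp_all add: m)
  have ex: "exp (- ln (max (\<theta> x) m)) = 1 / max (\<theta> x) m" for x using m0 by (simp add: exp_minus inverse_eq_divide)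
  have mx: "max (\<theta> x) m > 0" for x using m0 by simp
  have "level_decay c K (\<lambda>x. - 1 * ln (max (\<theta> x) m)) k l"
  proof (rule level_set_estimate[where E = exp])
    show "- 1 * ln (max t m) \<le> k" if "\<delta> \<le> t" for t
    proof -
      have "ln (exp (- k0)) \<le> ln (max t m)" using that \<delta> m0(1) by (intro ln_mono) auto
      then show ?thesis using kl by simp
    qed
    show "AE x in M. k < - 1 * ln (max (\<theta> x) m) \<longrightarrow> c \<le> \<kappa> x * max (\<theta> x) m * exp (- 1 * ln (max (\<theta> x) m))"
      using c(2)
    proof eventually_elim
      case (elim x) then show ?case using ex[of x] mx[of x] by simp
    qed
    show "AE x in M. k < - 1 * ln (max (\<theta> x) m) \<longrightarrow> - 1 * h x * exp (- 1 * ln (max (\<theta> x) m)) \<le> K x"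
      using K(3)
    proof eventually_elim
      case (elim x)
      show ?case
      proof
        assume "k < - 1 * ln (max (\<theta> x) m)"
        then have "ln (max (\<theta> x) m) < - k0" using kl by simp
        then have "max (\<theta> x) m < exp (- k0)" using mx[of x] by (metis exp_ln exp_less_mono)
        then have "- h x \<le> max (\<theta> x) m * K x" using elim by simp
        then show "- 1 * h x * exp (- 1 * ln (max (\<theta> x) m)) \<le> K x" using ex[of x] mx[of x] pos_divide_le_eq[OF mx[of x], of "- h x" "K x"] by (simp add: mult.commute)
      qed
    qed
  qed (use kl m0 c K in \<open>auto simp: monoI intro: continuous_intros\<close>)
  then show ?thesis by simp
qed

end

section \<open>Integrability of the data, Caratheodory coefficients and traces\<close>

lemma Lp_bounded_scaleR:
  assumes f: "Lp N p f" "p > 0" and k: "k \<in> borel_measurable N" "AE x in N. \<bar>k x\<bar> \<le> K"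
  shows "Lp N p (\<lambda>x. k x *\<^sub>R f x)"
proof -
  have [measurable]: "f \<in> borel_measurable N" "k \<in> borel_measurable N" using f k by (auto simp: Lp_def)
  have "integrable N (\<lambda>x. norm (k x *\<^sub>R f x) powr p)"
  proof (rule Bochner_Integration.integrable_bound)
    show "integrable N (\<lambda>x. \<bar>K\<bar> powr p * norm (f x) powr p)" using f by (simp add: Lp_def)
    show "AE x in N. norm (norm (k x *\<^sub>R f x) powr p) \<le> norm (\<bar>K\<bar> powr p * norm (f x) powr p)"
      using k(2)
    proof eventually_elim
      case (elim x)
      then have "\<bar>k x\<bar> powr p \<le> \<bar>K\<bar> powr p" using f(2) by (intro powr_mono2) auto
      then show ?case by (simp add: powr_mult mult_right_mono)
    qed
  qed measurable
  then show ?thesis by (simp add: Lp_def)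
qed

lemma Lp_add:
  assumes f: "Lp N p f" "Lp N p g" "p > 0"
  shows "Lp N p (\<lambda>x. f x + g x)"
proof -
  have [measurable]: "f \<in> borel_measurable N" "g \<in> borel_measurable N" using f by (auto simp: Lp_def)
  have "integrable N (\<lambda>x. norm (f x + g x) powr p)"
  proof (rule Bochner_Integration.integrable_bound)
    show "integrable N (\<lambda>x. 2 powr p * (norm (f x) powr p + norm (g x) powr p))" using f by (simp add: Lp_def)
    show "AE x in N. norm (norm (f x + g x) powr p) \<le> norm (2 powr p * (norm (f x) powr p + norm (g x) powr p))"
    proof (rule AE_I2)
      fix x
      let ?m = "max (norm (f x)) (norm (g x))"
      have "norm (f x + g x) powr p \<le> (2 * ?m) powr p"
        using norm_triangle_ineq[of "f x" "g x"] f(3) by (intro powr_mono2) auto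
      also have "\<dots> = 2 powr p * ?m powr p" by (simp add: powr_mult)
      also have "\<dots> \<le> 2 powr p * (norm (f x) powr p + norm (g x) powr p)"
        by (intro mult_left_mono) (auto simp: max_def)
      finally show "norm (norm (f x + g x) powr p) \<le> norm (2 powr p * (norm (f x) powr p + norm (g x) powr p))" by simp
    qed
  qed measurable
  then show ?thesis by (simp add: Lp_def)
qed

lemma Lp_abs: fixes f :: "'a \<Rightarrow> real" shows "Lp N p f \<Longrightarrow> Lp N p (\<lambda>x. \<bar>f x\<bar>)"
  by (auto simp: Lp_def)

lemma Lp_Linf_mult: fixes f :: "'a \<Rightarrow> real"
  assumes "Linf N k" "Lp N p f" "p > 0" shows "Lp N p (\<lambda>x. k x * f x)"
proof -
  obtain K where "k \<in> borel_measurable N" "AE x in N. \<bar>k x\<bar> \<le> K" using assms(1) by (auto simp: Linf_def)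
  from Lp_bounded_scaleR[OF assms(2,3) this] show ?thesis by simp
qed

text \<open>With a, b, c, d the entries of the Jacobian, \<open>3 * F - D\<^sup>2\<close> is three
  times the sum of the squares of a - d and b + c. This is special to dimension two.\<close>

lemma div_sq_le_strain: "(div_J J x)\<^sup>2 \<le> 3 * strain_F J (x::real^2)"
proof -
  let ?a = "J x $ 1 $ 1" and ?b = "J x $ 1 $ 2" and ?c = "J x $ 2 $ 1" and ?d = "J x $ 2 $ 2"
  have D: "div_J J x = ?a + ?d" by (simp add: div_J_def trace_def UNIV_2)
  have "strain_F J x = 1/2 * ((2 * ?a)\<^sup>2 + (?b + ?c)\<^sup>2 + ((?c + ?b)\<^sup>2 + (2 * ?d)\<^sup>2)) - 2/3 * (?a + ?d)\<^sup>2"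
    unfolding strain_F_def D by (simp add: UNIV_2 transpose_def)
  moreover have "0 \<le> (?a - ?d)\<^sup>2" "0 \<le> (?b + ?c)\<^sup>2" by simp_all
  ultimately show ?thesis unfolding D by (simp add: power2_eq_square algebra_simps)
qed

text \<open>Difference quotients have integral 0 by translation invariance and converge boundedly,
  on a fixed ball, to the partial derivatives.\<close>

lemma integral_grad_compact_support:
  fixes v :: "'a::euclidean_space \<Rightarrow> real"
  assumes v: "C1 v" and K: "compact K" "\<And>x. x \<notin> K \<Longrightarrow> v x = 0" "\<And>x. x \<notin> K \<Longrightarrow> grad v x = 0"
  shows "integrable lborel (grad v)" "(\<integral>x. grad v x \<partial>lborel) = 0"
proof -
  have cg: "continuous_on UNIV (grad v)" by (rule C1_continuous_grad[OF v])
  have [measurable]: "v \<in> borel_measurable borel" "grad v \<in> borel_measurable borel" using C1_borel[OF v] grad_borel[OF v] by auto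
  have ind: "(\<lambda>x. indicator K x *\<^sub>R f x) = f" if "\<And>x. x \<notin> K \<Longrightarrow> f x = 0" for f :: "'a \<Rightarrow> 'b::real_vector"
    using that by (auto simp: fun_eq_iff indicator_def)
  show Ig: "integrable lborel (grad v)"
    using borel_integrable_compact[OF K(1) continuous_on_subset[OF cg]] by (simp add: ind K(3))
  have Iv: "integrable lborel v"
    using borel_integrable_compact[OF K(1) C1_continuous[OF v]] ind[OF K(2)] by (simp add: scaleR_conv_of_real)
  obtain R where R: "\<And>x. x \<in> K \<Longrightarrow> norm x \<le> R" using compact_imp_bounded[OF K(1)] bounded_iff by blast
  obtain B where B: "\<And>x. norm (grad v x) \<le> B" "B \<ge> 0"
  proof -
    obtain B where B: "\<And>x. x \<in> K \<Longrightarrow> norm (grad v x) \<le> B"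
      using compact_imp_bounded[OF compact_continuous_image[OF continuous_on_subset[OF cg] K(1)]] unfolding bounded_iff by auto
    have "norm (grad v x) \<le> \<bar>B\<bar>" for x using B[of x] K(3)[of x] by (cases "x \<in> K") auto
    then show thesis using that abs_ge_zero by blast
  qed
  have "(\<integral>x. grad v x \<bullet> e \<partial>lborel) = 0" if e: "e \<in> Basis" for e
  proof -
    have ne: "norm e = 1" using e by simp
    let ?q = "\<lambda>n x. real (Suc n) * (v (x + (1 / real (Suc n)) *\<^sub>R e) - v x)"
    have "(\<lambda>n. \<integral>x. ?q n x \<partial>lborel) \<longlonglongrightarrow> (\<integral>x. grad v x \<bullet> e \<partial>lborel)"
    proof (rule integral_dominated_convergence[where w = "\<lambda>x. B * indicator (cball 0 (R + 1)) x"])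
      have "emeasure lborel (cball 0 (R + 1) :: 'a set) < \<infinity>" by (rule emeasure_bounded_finite) simp
      then show "integrable lborel (\<lambda>x. B * indicator (cball (0::'a) (R + 1)) x :: real)"
        by (intro Bochner_Integration.integrable_mult_right integrable_real_indicator) auto
      show "AE x in lborel. (\<lambda>n. ?q n x) \<longlonglongrightarrow> grad v x \<bullet> e"
      proof (rule AE_I2)
        fix x
        have l: "(\<lambda>h. (v (x + h *\<^sub>R e) - v x) / h) \<midarrow>0\<rightarrow> grad v x \<bullet> e"
          using GDERIV_line[of v x 0 e] C1_GDERIV[OF v, of x] by (simp add: DERIV_def)
        have "filterlim (\<lambda>n. 1 / real (Suc n)) (at 0) sequentially"
          using LIMSEQ_inverse_real_of_nat by (auto simp: filterlim_at inverse_eq_divide)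
        from filterlim_compose[OF l this] show "(\<lambda>n. ?q n x) \<longlonglongrightarrow> grad v x \<bullet> e" by (simp add: mult.commute)
      qed
      show "AE x in lborel. norm (?q n x) \<le> B * indicator (cball 0 (R + 1)) x" for n
      proof (rule AE_I2)
        fix x
        let ?h = "1 / real (Suc n)"
        show "norm (?q n x) \<le> B * indicator (cball 0 (R + 1)) x"
        proof (cases "norm x \<le> R + 1")
          case True
          have "norm (v (x + ?h *\<^sub>R e) - v x) \<le> B * norm (x + ?h *\<^sub>R e - x)"
          proof (rule differentiable_bound[OF convex_UNIV, where f' = "\<lambda>y h. h \<bullet> grad v y"])
            show "(v has_derivative (\<lambda>h. h \<bullet> grad v y)) (at y within UNIV)" for y
              using C1_GDERIV[OF v, of y] by (simp add: gderiv_def inner_commute)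
            show "onorm (\<lambda>h. h \<bullet> grad v y) \<le> B" for y
            proof (rule onorm_le)
              fix h
              have "norm (h \<bullet> grad v y) \<le> norm h * norm (grad v y)" using Cauchy_Schwarz_ineq2 by simp
              also have "\<dots> \<le> norm h * B" by (rule mult_left_mono[OF B(1)]) simp
              finally show "norm (h \<bullet> grad v y) \<le> B * norm h" by (simp add: mult.commute)
            qed
          qed auto
          also have "\<dots> = B * ?h" using ne by simp
          finally have "real (Suc n) * \<bar>v (x + ?h *\<^sub>R e) - v x\<bar> \<le> real (Suc n) * (B * ?h)" by (intro mult_left_mono) auto
          then show ?thesis using True by (simp add: abs_mult)
        next
          case False
          have far: "x + z \<notin> K" if "norm z \<le> 1" for z
            using norm_diff_ineq[of x z] R[of "x + z"] that False by force
          have "x \<notin> K" "x + ?h *\<^sub>R e \<notin> K" using far[of 0] far[of "?h *\<^sub>R e"] ne by auto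
          then show ?thesis using K(2) B(2) by simp
        qed
      qed
    qed measurable
    moreover have "(\<integral>x. ?q n x \<partial>lborel) = 0" for n
    proof -
      let ?c = "(1 / real (Suc n)) *\<^sub>R e"
      have d: "lborel = distr lborel borel (\<lambda>x. x + ?c)" using lborel_distr_plus[of ?c] by (simp add: add.commute[of _ ?c] del: of_nat_Suc)
      have "integrable (distr lborel borel (\<lambda>x. x + ?c)) v \<longleftrightarrow> integrable lborel (\<lambda>x. v (x + ?c))" by (rule integrable_distr_eq) auto
      then have i: "integrable lborel (\<lambda>x. v (x + ?c))" using Iv d by simp
      have "(\<integral>x. v x \<partial>distr lborel borel (\<lambda>x. x + ?c)) = (\<integral>x. v (x + ?c) \<partial>lborel)" by (rule integral_distr) auto
      then have "(\<integral>x. v (x + ?c) \<partial>lborel) = (\<integral>x. v x \<partial>lborel)" using d by simp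
      then show ?thesis using i Iv by simp
    qed
    ultimately show ?thesis by (simp add: LIMSEQ_const_iff)
  qed
  then have "(\<integral>x. grad v x \<partial>lborel) \<bullet> e = 0 \<bullet> e" if "e \<in> Basis" for e
    using that integral_inner_left[of e lborel "grad v"] Ig by simp
  then show "(\<integral>x. grad v x \<partial>lborel) = 0" by (rule euclidean_eqI)
qed

context bounded_domain begin

text \<open>Lebesgue measure is complete. Extension by 0 transfers this to the restricted
  measure.\<close>

lemma borel_measurable_AE_domain:
  fixes f :: "real^2 \<Rightarrow> real"
  assumes f: "f \<in> borel_measurable M" and ae: "AE x in M. f x = g x"
  shows "g \<in> borel_measurable M"
proof -
  have "(\<lambda>x. if x \<in> \<Omega> then f x else 0) \<in> borel_measurable lebesgue"
    using f by (simp add: borel_measurable_if domain_lebesgue)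
  moreover have "AE x in lebesgue. (if x \<in> \<Omega> then f x else 0) = (if x \<in> \<Omega> then g x else 0)"
    using ae domain_lebesgue by (subst (asm) AE_restrict_space_iff) (auto elim: eventually_mono)
  ultimately have "(\<lambda>x. if x \<in> \<Omega> then g x else 0) \<in> borel_measurable lebesgue" by (rule borel_measurable_AE)
  then show ?thesis by (simp add: borel_measurable_if domain_lebesgue)
qed

text \<open>Rounding the arguments down to a grid leaves countably many constant arguments, for
  which measurability is given; continuity recovers the composition as a limit at almost every
  x.\<close>

lemma caratheodory_measurable:
  fixes c :: "real^2 \<Rightarrow> real \<Rightarrow> real \<Rightarrow> real"
  assumes m: "\<And>v w. v \<ge> 0 \<Longrightarrow> w \<ge> 0 \<Longrightarrow> (\<lambda>x. c x v w) \<in> borel_measurable M"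
    and cont: "AE x in M. continuous_on ({0..} \<times> {0..}) (\<lambda>(v, w). c x v w)"
    and [measurable]: "p \<in> borel_measurable M" "q \<in> borel_measurable M" and pos: "\<And>x. 0 \<le> p x" "\<And>x. 0 \<le> q x"
  shows "(\<lambda>x. c x (p x) (q x)) \<in> borel_measurable M"
proof -
  \<comment> \<open>The maximum with 0 keeps all grid values, including those of the negative
    integers in the countable family below, in the range where the sections of \<open>c\<close> are
    measurable.\<close>
  define a where "a n t = max 0 (real_of_int \<lfloor>real (Suc n) * t\<rfloor> / real (Suc n))" for n t
  have lim: "(\<lambda>n. a n t) \<longlonglongrightarrow> t" if "t \<ge> 0" for t
  proof -
    have "norm (a n t - t) \<le> inverse (real (Suc n))" for n
    proof -
      let ?z = "real_of_int \<lfloor>real (Suc n) * t\<rfloor>"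
      have z: "real (Suc n) * t - 1 \<le> ?z" "?z \<le> real (Suc n) * t" by linarith+
      have "t - inverse (real (Suc n)) = (real (Suc n) * t - 1) / real (Suc n)" by (simp add: field_simps del: of_nat_Suc)
      also have "\<dots> \<le> ?z / real (Suc n)" by (rule divide_right_mono[OF z(1)]) simp
      finally have "t - inverse (real (Suc n)) \<le> ?z / real (Suc n)" .
      moreover have "?z / real (Suc n) \<le> t" using z(2) by (simp add: divide_le_eq mult.commute del: of_nat_Suc)
      ultimately show ?thesis using that by (auto simp: a_def max_def)
    qed
    then have "(\<lambda>n. a n t - t) \<longlonglongrightarrow> 0" by (intro Lim_null_comparison[OF _ LIMSEQ_inverse_real_of_nat]) simp
    then show ?thesis by (rule LIM_zero_cancel)
  qed
  have fm: "(\<lambda>x. c x (a n (p x)) (a n (q x))) \<in> borel_measurable M" for n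
  proof -
    have "(\<lambda>x. (\<lambda>(i, j) x. c x (max 0 (real_of_int i / real (Suc n))) (max 0 (real_of_int j / real (Suc n))))
        (\<lfloor>real (Suc n) * p x\<rfloor>, \<lfloor>real (Suc n) * q x\<rfloor>) x) \<in> borel_measurable M"
      by (rule measurable_compose_countable) (auto intro: m split: prod.split)
    then show ?thesis by (simp add: a_def)
  qed
  let ?L = "\<lambda>x. lim (\<lambda>n. c x (a n (p x)) (a n (q x)))"
  have "?L \<in> borel_measurable M" by (rule borel_measurable_lim_metric[OF fm])
  moreover have "AE x in M. ?L x = c x (p x) (q x)"
    using cont
  proof eventually_elim
    case (elim x)
    have "(\<lambda>n. (\<lambda>(v, w). c x v w) (a n (p x), a n (q x))) \<longlonglongrightarrow> (\<lambda>(v, w). c x v w) (p x, q x)"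
      by (rule continuous_on_tendsto_compose[OF elim tendsto_Pair[OF lim[OF pos(1)] lim[OF pos(2)]]]) (auto simp: pos a_def)
    then show ?case by (simp add: limI)
  qed
  ultimately show ?thesis by (rule borel_measurable_AE_domain)
qed

text \<open>The condition on bounded arguments is applied to a measurable choice of arguments, taken from
  a countable dense set, at which the coefficient is maximal up to \<open>1\<close>.\<close>

lemma diffusion_bounded:
  assumes C: "diffusion_coefficient \<Omega> c" and R: "R \<ge> 0"
  shows "\<exists>K. AE x in M. \<forall>v\<in>{0..R}. \<forall>w\<in>{0..R}. c x v w \<le> K"
proof -
  have m: "\<And>v w. v \<ge> 0 \<Longrightarrow> w \<ge> 0 \<Longrightarrow> (\<lambda>x. c x v w) \<in> borel_measurable M"
    and cont: "AE x in M. continuous_on ({0..} \<times> {0..}) (\<lambda>(v, w). c x v w)"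
    and bd: "\<And>\<theta> \<phi>. \<forall>x\<in>\<Omega>. 0 \<le> \<theta> x \<and> 0 \<le> \<phi> x \<Longrightarrow> Linf M \<theta> \<Longrightarrow> Linf M \<phi> \<Longrightarrow> Linf M (\<lambda>x. c x (\<theta> x) (\<phi> x))"
    using C unfolding diffusion_coefficient_def by blast+
  define S where "S = {0..R} \<times> {0..R}"
  have S: "compact S" "(0, 0) \<in> S" unfolding S_def using R by (auto intro: compact_Times)
  obtain T where T: "countable T" "T \<subseteq> S" "S \<subseteq> closure T" using separable by blast
  have T0: "T \<noteq> {}" using T(3) S(2) by auto
  define q where "q = from_nat_into T"
  have q: "q n \<in> T" for n unfolding q_def by (rule from_nat_into[OF T0])
  have qs: "fst (q n) \<in> {0..R}" "snd (q n) \<in> {0..R}" for n using q[of n] T(2) by (auto simp: S_def)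
  have qsurj: "\<exists>n. q n = t" if "t \<in> T" for t using from_nat_into_surj[OF T(1) that] unfolding q_def by blast
  define f where "f n x = c x (fst (q n)) (snd (q n))" for n x
  have [measurable]: "f n \<in> borel_measurable M" for n unfolding f_def by (rule m) (use qs[of n] in auto)
  define N where "N x = (LEAST n. \<forall>i. f i x \<le> f n x + 1)" for x
  have N[measurable]: "N \<in> measurable M (count_space UNIV)" unfolding N_def by measurable
  have mq: "(\<lambda>x. fst (q (N x))) \<in> borel_measurable M" "(\<lambda>x. snd (q (N x))) \<in> borel_measurable M"
    by (rule measurable_compose[OF N]; simp)+
  have "Linf M (\<lambda>x. fst (q (N x)))" "Linf M (\<lambda>x. snd (q (N x)))"
    unfolding Linf_def using mq qs by (auto intro!: exI[of _ R])
  from bd[OF _ this] obtain K where K: "AE x in M. norm (c x (fst (q (N x))) (snd (q (N x)))) \<le> K"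
    using qs unfolding Linf_def by auto
  have "AE x in M. \<forall>v\<in>{0..R}. \<forall>w\<in>{0..R}. c x v w \<le> K + 1"
    using cont K
  proof eventually_elim
    case (elim x)
    have cS: "continuous_on S (\<lambda>(v, w). c x v w)" by (rule continuous_on_subset[OF elim(1)]) (auto simp: S_def)
    have cl: "closure T \<subseteq> S" using closure_minimal[OF T(2) compact_imp_closed[OF S(1)]] .
    obtain z0 where "\<forall>z\<in>S. (\<lambda>(v, w). c x v w) z \<le> (\<lambda>(v, w). c x v w) z0"
      using continuous_attains_sup[OF S(1) _ cS] S(2) by blast
    then obtain U where U: "\<And>z. z \<in> S \<Longrightarrow> (\<lambda>(v, w). c x v w) z \<le> U" by blast
    have ub: "f i x \<le> U" for i using U[of "q i"] q[of i] T(2) by (auto simp: f_def split_beta)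
    have "\<exists>n. \<forall>i. f i x \<le> f n x + 1"
    proof -
      have bdd: "bdd_above (range (\<lambda>i. f i x))" by (intro bdd_aboveI[of _ U]) (use ub in auto)
      obtain n where "(SUP i. f i x) - 1 < f n x" using less_cSUP_iff[OF _ bdd, of "(SUP i. f i x) - 1"] by auto
      then have "f i x \<le> f n x + 1" for i using cSUP_upper[OF _ bdd, of i] by simp
      then show ?thesis by blast
    qed
    then have "\<forall>i. f i x \<le> f (N x) x + 1" unfolding N_def by (rule LeastI_ex)
    then have le: "f i x \<le> K + 1" for i using elim(2) by (smt (verit) f_def real_norm_def)
    have "(\<lambda>(v, w). c x v w) z \<le> K + 1" if z: "z \<in> S" for z
    proof (rule continuous_le_on_closure[of T])
      show "continuous_on (closure T) (\<lambda>(v, w). c x v w)" by (rule continuous_on_subset[OF cS cl])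
      show "(\<lambda>(v, w). c x v w) t \<le> K + 1" if "t \<in> T" for t
      proof -
        obtain n where "q n = t" using qsurj[OF \<open>t \<in> T\<close>] by blast
        then show ?thesis using le[of n] by (simp add: f_def split_beta)
      qed
    qed (use z T(3) in blast)
    then show ?case by (auto simp: S_def)
  qed
  then show ?thesis by blast
qed

lemma test_integral_M:
  fixes f :: "real^2 \<Rightarrow> 'b::euclidean_space"
  assumes f: "f \<in> borel_measurable borel" and z: "\<And>x. x \<notin> \<Omega> \<Longrightarrow> f x = 0"
  shows "(LINT x|M. f x) = (\<integral>x. f x \<partial>lborel)"
proof -
  have "(LINT x|M. f x) = (\<integral>x. indicator \<Omega> x *\<^sub>R f x \<partial>lebesgue)"
    using domain_lebesgue by (intro integral_restrict_space) (simp add: sets.Int_space_eq2)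
  also have "(\<lambda>x. indicator \<Omega> x *\<^sub>R f x) = f" using z by (auto simp: fun_eq_iff indicator_def)
  also have "(\<integral>x. f x \<partial>lebesgue) = (\<integral>x. f x \<partial>lborel)" using f by (intro integral_completion) simp
  finally show ?thesis .
qed

lemma smooth_integration_by_parts:
  assumes t: "smooth t" and \<psi>: "tf \<psi>"
  shows "(LINT x|M. t x *\<^sub>R grad \<psi> x) = - (LINT x|M. \<psi> x *\<^sub>R grad t x)"
proof -
  have tp: "tf (\<lambda>x. t x * \<psi> x)" by (rule test_function_mult[OF \<psi> t])
  note c1 = smooth_C1[OF t] test_C1[OF \<psi>] test_C1[OF tp]
  obtain K where K: "compact K" "K \<subseteq> \<Omega>" "\<And>x. x \<notin> K \<Longrightarrow> t x * \<psi> x = 0" "\<And>x. x \<notin> K \<Longrightarrow> grad (\<lambda>x. t x * \<psi> x) x = 0"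
    using test_function_supp[OF tp] by metis
  have "0 = (\<integral>x. grad (\<lambda>x. t x * \<psi> x) x \<partial>lborel)" using integral_grad_compact_support(2)[OF c1(3) K(1,3,4)] by simp
  also have "\<dots> = (LINT x|M. grad (\<lambda>x. t x * \<psi> x) x)" by (rule test_integral_M[symmetric]) (use grad_borel[OF c1(3)] K in auto)
  also have "\<dots> = (LINT x|M. t x *\<^sub>R grad \<psi> x + \<psi> x *\<^sub>R grad t x)" by (simp add: grad_mult[OF c1(1,2)])
  also have "\<dots> = (LINT x|M. t x *\<^sub>R grad \<psi> x) + (LINT x|M. \<psi> x *\<^sub>R grad t x)"
    by (intro Bochner_Integration.integral_add L2_norm_integrable(2) continuous_Lp2 continuous_intros C1_continuous C1_continuous_grad c1)
  finally show ?thesis by (simp add: eq_neg_iff_add_eq_0)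
qed

lemma locally_integrable_M:
  fixes f :: "real^2 \<Rightarrow> 'b::euclidean_space"
  assumes "integrable M f" shows "locally_integrable \<Omega> f"
  unfolding locally_integrable_def
proof (intro allI impI)
  fix K assume K: "compact K \<and> K \<subseteq> \<Omega>"
  then have "K \<in> sets borel" using borel_compact by blast
  then have "K \<in> sets lebesgue" by simp
  then show "integrable (lebesgue_on K) f"
    using assms K domain_lebesgue set_integrable_subset[of lebesgue \<Omega> f K]
    by (simp add: integrable_restrict_space set_integrable_def)
qed

text \<open>Membership in the solution class demands nonnegativity at every point, so the function
  has to be changed on a null set; weak gradient and trace are carried over to the new
  representative.\<close>

lemma approx_trace_H1:
  assumes ft: "approx_trace f g a t" and \<theta>: "\<theta> \<in> borel_measurable M" "AE x in M. f x = \<theta> x"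
  shows "H1 \<Omega> \<theta> g" "has_trace \<Omega> \<theta> a"
proof -
  have f: "Lp M 2 f" and G: "Lp M 2 g" and a: "Lp (boundary_measure \<Omega>) 2 a" and ts: "\<And>k. smooth (t k)" and ltf: "L2lim M t f"
    and lg: "L2lim M (\<lambda>k. grad (t k)) g" and ta: "L2_converges (boundary_measure \<Omega>) t a"
    using ft unfolding approx_trace_def by blast+
  have L\<theta>: "Lp M 2 \<theta>" by (rule Lp2_mono(1)[OF f \<theta>(1)]) (use \<theta>(2) in \<open>auto elim: eventually_mono\<close>)
  have Lt: "Lp M 2 (t k)" "Lp M 2 (grad (t k))" for k using C1_Lp2[OF smooth_C1[OF ts]] by blast+
  have "L2n M (\<lambda>x. t k x - \<theta> x) = L2n M (\<lambda>x. t k x - f x)" for k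
    by (rule L2n_cong_AE) (use \<theta>(2) Lp2_measurable[OF L2_diff(1)[OF Lt(1) L\<theta>]] Lp2_measurable[OF L2_diff(1)[OF Lt(1) f]] in \<open>auto elim: eventually_mono\<close>)
  then have lt: "L2lim M t \<theta>" using ltf by simp
  have "has_weak_grad \<Omega> \<theta> g" unfolding has_weak_grad_def
  proof (intro conjI allI impI)
    show "locally_integrable \<Omega> \<theta>" "locally_integrable \<Omega> g"
      by (intro locally_integrable_M L2_norm_integrable(2) L\<theta> G)+
    fix \<psi> assume \<psi>: "tf \<psi>"
    have "(\<lambda>k. (LINT x|M. t k x *\<^sub>R grad \<psi> x)) \<longlonglongrightarrow> (LINT x|M. \<theta> x *\<^sub>R grad \<psi> x)"
      by (rule L2_bilinear_tendsto[OF bounded_bilinear_scaleR _ Lt(1) L\<theta> lt test_grad_Lp2[OF \<psi>]]) simp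
    moreover have "(\<lambda>k. - (LINT x|M. \<psi> x *\<^sub>R grad (t k) x)) \<longlonglongrightarrow> - (LINT x|M. \<psi> x *\<^sub>R g x)"
      by (intro tendsto_minus L2_bilinear_tendsto[OF bounded_bilinear.flip[OF bounded_bilinear_scaleR] _ Lt(2) G lg test_Lp2[OF \<psi>]]) simp
    ultimately show "(LINT x|M. \<theta> x *\<^sub>R grad \<psi> x) = - (LINT x|M. \<psi> x *\<^sub>R g x)"
      unfolding smooth_integration_by_parts[OF ts \<psi>] by (rule LIMSEQ_unique)
  qed
  then show H1: "H1 \<Omega> \<theta> g" unfolding H1_def using L\<theta> G by blast
  show "has_trace \<Omega> \<theta> a" unfolding has_trace_def
    using a H1 ts ta lt lg L2_converges_iff[OF L\<theta>, of t] L2_converges_iff[OF G, of "\<lambda>k. grad (t k)"] Lt by (intro conjI exI[of _ g] exI[of _ t]) blast+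
qed

end

subsection \<open>Truncated coefficients\<close>

definition truncate :: "real \<Rightarrow> real \<Rightarrow> real \<Rightarrow> real" where
  "truncate m K t = max m (min K t)"

lemma truncate_bounds: "m \<le> K \<Longrightarrow> m \<le> truncate m K t" "m \<le> K \<Longrightarrow> truncate m K t \<le> K"
  by (auto simp: truncate_def)

lemma truncate_id: "m \<le> t \<Longrightarrow> t \<le> K \<Longrightarrow> truncate m K t = t"
  by (simp add: truncate_def)

lemma truncate_eq_max: "m \<le> K \<Longrightarrow> t \<le> K \<Longrightarrow> truncate m K t = max t m"
  by (simp add: truncate_def)

lemma truncate_le: "m \<le> t \<Longrightarrow> truncate m K t \<le> t"
  by (simp add: truncate_def)

lemma continuous_truncate [continuous_intros]: "continuous_on S f \<Longrightarrow> continuous_on S (\<lambda>x. truncate m K (f x))"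
  unfolding truncate_def by (intro continuous_intros)

lemma measurable_truncate [measurable]: "truncate m K \<in> borel_measurable borel"
  unfolding truncate_def by measurable

context bounded_domain begin

text \<open>Two lower bounds are recorded. The one with the truncated arguments keeps the exact
  degeneracy, from which the upper bound of \<theta> profits; the one with \<open>K1 * K2\<close> is
  the uniform ellipticity used for solvability and for the lower bounds.\<close>

lemma truncated_coefficient:
  assumes C: "diffusion_coefficient \<Omega> c" and \<nu>: "\<nu> \<ge> 0" and m: "0 < m1" "m1 \<le> K1" "0 < m2" "m2 \<le> K2"
    and lo: "\<alpha> > 0" "AE x in M. \<forall>v\<ge>0. \<forall>w\<ge>0. \<alpha> \<le> c x v w"
    and k: "k = (\<lambda>x v w. \<nu> + c x (truncate m1 K1 v) (truncate m2 K2 w) / (truncate m1 K1 v * truncate m2 K2 w))"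
  shows "\<And>p q. p \<in> borel_measurable M \<Longrightarrow> q \<in> borel_measurable M \<Longrightarrow> (\<lambda>x. k x (p x) (q x)) \<in> borel_measurable M"
    "AE x in M. continuous_on UNIV (\<lambda>(v, w). k x v w)"
    "AE x in M. \<forall>v w. \<alpha> / (truncate m1 K1 v * truncate m2 K2 w) \<le> k x v w"
    "\<exists>kmax. AE x in M. \<forall>v w. \<alpha> / (K1 * K2) \<le> k x v w \<and> k x v w \<le> kmax"
proof -
  let ?t = "truncate m1 K1" and ?s = "truncate m2 K2"
  have tb: "0 < ?t v" "0 < ?s v" "?t v \<le> K1" "?s v \<le> K2" "m1 \<le> ?t v" "m2 \<le> ?s v" for v
    using truncate_bounds[of m1 K1 v] truncate_bounds[of m2 K2 v] m by linarith+
  have tp: "0 < ?t v * ?s w" "?t v * ?s w \<le> K1 * K2" "m1 * m2 \<le> ?t v * ?s w" for v w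
    using tb[of v] tb[of w] m by (auto intro: mult_mono)
  have mc: "\<And>v w. v \<ge> 0 \<Longrightarrow> w \<ge> 0 \<Longrightarrow> (\<lambda>x. c x v w) \<in> borel_measurable M"
    and cont: "AE x in M. continuous_on ({0..} \<times> {0..}) (\<lambda>(v, w). c x v w)"
    using C unfolding diffusion_coefficient_def by blast+
  show "(\<lambda>x. k x (p x) (q x)) \<in> borel_measurable M" if [measurable]: "p \<in> borel_measurable M" "q \<in> borel_measurable M" for p q
  proof -
    have [measurable]: "(\<lambda>x. c x (?t (p x)) (?s (q x))) \<in> borel_measurable M"
      by (rule caratheodory_measurable[OF mc cont]) (use tb in \<open>auto intro: less_imp_le\<close>)
    show ?thesis unfolding k by measurable
  qed
  show "AE x in M. continuous_on UNIV (\<lambda>(v, w). k x v w)"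
    using cont
  proof eventually_elim
    case (elim x)
    have "continuous_on UNIV (\<lambda>z. (\<lambda>(v, w). c x v w) (?t (fst z), ?s (snd z)))"
      by (rule continuous_on_compose2[OF elim]) (use tb in \<open>auto intro!: continuous_intros intro: less_imp_le\<close>)
    then have "continuous_on UNIV (\<lambda>z. c x (?t (fst z)) (?s (snd z)))" by simp
    moreover have "?t (fst z) \<noteq> 0" "?s (snd z) \<noteq> 0" for z using tb(1)[of "fst z"] tb(2)[of "snd z"] by linarith+
    ultimately show ?case unfolding k split_beta by (intro continuous_intros) auto
  qed
  show low: "AE x in M. \<forall>v w. \<alpha> / (?t v * ?s w) \<le> k x v w"
    using lo(2)
  proof eventually_elim
    case (elim x)
    show ?case
    proof (intro allI)
      fix v w
      have "\<alpha> \<le> c x (?t v) (?s w)" using elim tb(1)[of v] tb(2)[of w] by simp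
      then have "\<alpha> / (?t v * ?s w) \<le> c x (?t v) (?s w) / (?t v * ?s w)" using tp(1)[of v w] by (intro divide_right_mono) auto
      then show "\<alpha> / (?t v * ?s w) \<le> k x v w" using \<nu> by (simp add: k)
    qed
  qed
  obtain K where K: "AE x in M. \<forall>v\<in>{0..max K1 K2}. \<forall>w\<in>{0..max K1 K2}. c x v w \<le> K"
    using diffusion_bounded[OF C, of "max K1 K2"] m by fastforce
  have "AE x in M. \<forall>v w. \<alpha> / (K1 * K2) \<le> k x v w \<and> k x v w \<le> \<nu> + \<bar>K\<bar> / (m1 * m2)"
    using low K
  proof eventually_elim
    case (elim x)
    show ?case
    proof (intro allI conjI)
      fix v w
      have "\<alpha> / (K1 * K2) \<le> \<alpha> / (?t v * ?s w)" using tp[of v w] lo(1) by (intro divide_left_mono) auto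
      then show "\<alpha> / (K1 * K2) \<le> k x v w" using elim(1) by (meson order_trans)
      have "c x (?t v) (?s w) \<le> \<bar>K\<bar>" using elim(2) tb[of v] tb[of w] by (smt (verit) atLeastAtMost_iff max.cobounded1 max.cobounded2)
      then have "c x (?t v) (?s w) / (?t v * ?s w) \<le> \<bar>K\<bar> / (?t v * ?s w)" using tp(1)[of v w] by (intro divide_right_mono) auto
      also have "\<dots> \<le> \<bar>K\<bar> / (m1 * m2)" using tp[of v w] m by (intro divide_left_mono) auto
      finally show "k x v w \<le> \<nu> + \<bar>K\<bar> / (m1 * m2)" by (simp add: k)
    qed
  qed
  then show "\<exists>kmax. AE x in M. \<forall>v w. \<alpha> / (K1 * K2) \<le> k x v w \<and> k x v w \<le> kmax" by blast
qed

lemma Linf_upper_bound: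
  assumes "Linf N a" shows "\<exists>B\<ge>\<delta>. AE x in N. a x \<le> (B::real)"
proof -
  obtain B where "AE x in N. norm (a x) \<le> B" using assms unfolding Linf_def by blast
  then have "AE x in N. a x \<le> max \<delta> B" by eventually_elim auto
  then show ?thesis by (intro exI[of _ "max \<delta> B"]) simp
qed

end

text \<open>With z = T D the left side is at most \<open>C4 * z - C3 * z\<^sup>2 / 3\<close>, whose
  maximum over z is the right side. If C3 = 0 the quotient is 0 by convention, and the left side
  vanishes because C4 does.\<close>

lemma source_upper:
  fixes C3 C4 D F T :: real
  assumes "0 \<le> C3" "C3 = 0 \<longrightarrow> C4 = 0" "D\<^sup>2 \<le> 3 * F"
  shows "- C3 * F * T\<^sup>2 + C4 * T * D \<le> 3/4 * (C4\<^sup>2 / C3)"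
proof (cases "C3 = 0")
  case False
  then have C3: "C3 > 0" using assms by simp
  have "0 \<le> (2 * C3 * (T * D) - 3 * C4)\<^sup>2" by simp
  then have "4 * (C3 * (C4 * T * D)) \<le> 4/3 * (C3\<^sup>2 * (T\<^sup>2 * D\<^sup>2)) + 3 * C4\<^sup>2"
    by (simp add: power2_eq_square algebra_simps)
  moreover have "C3\<^sup>2 * (T\<^sup>2 * D\<^sup>2) \<le> C3\<^sup>2 * (T\<^sup>2 * (3 * F))" using assms by (intro mult_left_mono) auto
  ultimately have "C3 * (4 * (- C3 * F * T\<^sup>2 + C4 * T * D)) \<le> 3 * C4\<^sup>2" by (simp add: power2_eq_square algebra_simps)
  then have "4 * (- C3 * F * T\<^sup>2 + C4 * T * D) \<le> 3 * C4\<^sup>2 / C3" using C3 by (simp only: pos_le_divide_eq mult.commute)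
  then show ?thesis by simp
qed (use assms in simp)

text \<open>With \<open>z = T D\<close> the bracket is at least \<open>(0.014 z\<^sup>2 / 3 - 0.104 z + 0.84) \<rho> / T\<close>, a quadratic
  polynomial with negative discriminant.\<close>

lemma bracket_nonneg:
  fixes \<rho> D F T :: real
  assumes "0 \<le> \<rho>" "0 < T" "D\<^sup>2 \<le> 3 * F"
  shows "0 \<le> \<rho> * 0.014 * T * F - \<rho> * 0.104 * D + \<rho> * 0.84 * inverse T"
proof -
  have "T\<^sup>2 * D\<^sup>2 \<le> T\<^sup>2 * (3 * F)" using assms by (intro mult_left_mono) auto
  \<comment> \<open>The square divided by 10500 is \<open>0.014 / 3 * z\<^sup>2 - 0.104 * z\<close>
    plus a constant below 0.58, with z = T D; so 0.84 leaves room.\<close>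
  moreover have "0 \<le> (7 * (T * D) - 78)\<^sup>2" by simp
  ultimately have "0 \<le> 0.014 * (T\<^sup>2 * F) - 0.104 * (T * D) + 0.84"
    by (simp add: power2_eq_square algebra_simps)
  then have "0 \<le> (\<rho> / T) * (0.014 * (T\<^sup>2 * F) - 0.104 * (T * D) + 0.84)" using assms by (intro mult_nonneg_nonneg) auto
  also have "\<dots> = \<rho> * 0.014 * T * F - \<rho> * 0.104 * D + \<rho> * 0.84 * inverse T"
    using assms(2) by (simp add: field_simps power2_eq_square)
  finally show ?thesis .
qed

section \<open>Choice of the truncation levels and existence of the solution\<close>

theorem theorem2:
  fixes \<Omega> :: "(real^2) set" and r \<nu> \<delta> :: real
    and \<rho> a b :: "real^2 \<Rightarrow> real"
    and u :: "real^2 \<Rightarrow> real^2" and J :: "real^2 \<Rightarrow> real^2^2"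
    and C c :: "nat \<Rightarrow> real^2 \<Rightarrow> real"
    and C\<^sub>\<theta> C\<^sub>\<phi> c\<^sub>\<theta> c\<^sub>\<phi> :: "real^2 \<Rightarrow> real \<Rightarrow> real \<Rightarrow> real"
  assumes r: "r > real CARD(2) / 2"
    and domain: "open \<Omega>" "bounded \<Omega>" "lipschitz_boundary \<Omega>"
    and nu: "\<nu> \<ge> 0"
    and rho: "AE x in lebesgue_on \<Omega>. 0 \<le> \<rho> x" "Linf (lebesgue_on \<Omega>) \<rho>"
      "inverse_Linf (lebesgue_on \<Omega>) \<rho>"
    and u: "Lp (lebesgue_on \<Omega>) 3 u" "has_weak_jacobian \<Omega> u J"
    and F: "AE x in lebesgue_on \<Omega>. 0 \<le> strain_F J x" "Lp (lebesgue_on \<Omega>) r (strain_F J)"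
    and D: "Lp (lebesgue_on \<Omega>) r (div_J J)"
    and div_free: "has_weak_div \<Omega> (\<lambda>x. \<rho> x *\<^sub>R u x) (\<lambda>x. 0)"
    and normal: "normal_trace_zero \<Omega> u (div_J J)"
    and boundary_data: "H_half_boundary \<Omega> a" "Linf (boundary_measure \<Omega>) a"
      "H_half_boundary \<Omega> b" "Linf (boundary_measure \<Omega>) b"
    and delta: "\<delta> > 0" "AE x in boundary_measure \<Omega>. \<delta> \<le> a x" "AE x in boundary_measure \<Omega>. \<delta> \<le> b x"
    and C_form: "\<And>i. i \<in> {3..8} \<Longrightarrow> AE x in lebesgue_on \<Omega>. C i x = \<rho> x * c i x"
      "AE x in lebesgue_on \<Omega>. \<forall>v\<ge>0. \<forall>w\<ge>0. C\<^sub>\<theta> x v w = \<rho> x * c\<^sub>\<theta> x v w"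
      "AE x in lebesgue_on \<Omega>. \<forall>v\<ge>0. \<forall>w\<ge>0. C\<^sub>\<phi> x v w = \<rho> x * c\<^sub>\<phi> x v w"
    and C_nonneg: "\<And>i. i \<in> {3..8} \<Longrightarrow> AE x in lebesgue_on \<Omega>. 0 \<le> C i x"
    and C_Lr: "Lp (lebesgue_on \<Omega>) r (C 5)" "Lp (lebesgue_on \<Omega>) r (C 8)"
    and C_Linf: "\<And>i. i \<in> {3, 4, 6, 7} \<Longrightarrow> Linf (lebesgue_on \<Omega>) (C i)"
    and C_diffusion: "diffusion_coefficient \<Omega> C\<^sub>\<theta>" "diffusion_coefficient \<Omega> C\<^sub>\<phi>"
    and A1_quotient: "AE x in lebesgue_on \<Omega>. C 3 x = 0 \<longrightarrow> C 4 x = 0"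
      "Lp (lebesgue_on \<Omega>) r (\<lambda>x. (C 4 x)\<^sup>2 / C 3 x)"
    and A1_constants: "AE x in lebesgue_on \<Omega>. c 6 x = 0.014"
      "AE x in lebesgue_on \<Omega>. c 7 x = 0.104" "AE x in lebesgue_on \<Omega>. c 8 x = 0.84"
  shows "\<exists>\<theta> \<phi>. weak_solution_Q \<Omega> \<nu> \<rho> u J C\<^sub>\<theta> C\<^sub>\<phi> C a b \<theta> \<phi>"
proof -
  interpret bounded_domain \<Omega> using domain by unfold_locales
  let ?F = "strain_F J" and ?D = "div_J J"
  have r1: "r > 1" and r0: "r > 0" using r by simp_all
  have FD: "(?D x)\<^sup>2 \<le> 3 * ?F x" for x by (rule div_sq_le_strain)
  have F0: "0 \<le> ?F x" for x using order_trans[OF zero_le_power2 FD[of x]] by simp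
  have LC: "Linf M (C 3)" "Linf M (C 4)" "Linf M (C 6)" "Linf M (C 7)" using C_Linf by auto
  have [measurable]: "C 3 \<in> borel_measurable M" "C 4 \<in> borel_measurable M" "C 5 \<in> borel_measurable M" "C 6 \<in> borel_measurable M"
      "C 7 \<in> borel_measurable M" "C 8 \<in> borel_measurable M" "?F \<in> borel_measurable M" "?D \<in> borel_measurable M"
    using LC C_Lr F(2) D unfolding Linf_def Lp_def by blast+
  have C0: "AE x in M. \<forall>i\<in>{3..8}. 0 \<le> C i x" using C_nonneg by (simp add: AE_ball_countable)
  have Linf_const: "Linf M (\<lambda>x. c)" for c :: real by (auto simp: Linf_def)
  have Lc: "Lp M r (\<lambda>x. c * f x)" if "Lp M r f" for c and f :: "real^2 \<Rightarrow> real"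
    by (rule Lp_Linf_mult[OF Linf_const that r0])
  have LF: "Lp M r (\<lambda>x. C i x * ?F x)" "Lp M r (\<lambda>x. C i x * \<bar>?D x\<bar>)" if "Linf M (C i)" for i
    using Lp_Linf_mult[OF that _ r0] F(2) Lp_abs[OF D] by blast+
  define b0 where "b0 x = \<rho> x *\<^sub>R u x" for x
  have b3: "Lp M 3 b0"
  proof -
    obtain R where "\<rho> \<in> borel_measurable M" "AE x in M. \<bar>\<rho> x\<bar> \<le> R" using rho(2) unfolding Linf_def by auto
    from Lp_bounded_scaleR[OF u(1) _ this] show ?thesis by (simp add: b0_def[abs_def])
  qed
  have bdiv: "(LINT x|M. b0 x \<bullet> grad \<psi> x) = 0" if "tf \<psi>" for \<psi>
    using div_free that unfolding has_weak_div_def b0_def by simp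
  obtain \<alpha> where \<alpha>: "\<alpha> > 0" "AE x in M. \<forall>v\<ge>0. \<forall>w\<ge>0. \<alpha> \<le> C\<^sub>\<theta> x v w"
    using C_diffusion(1) unfolding diffusion_coefficient_def by blast
  obtain \<beta> where \<beta>: "\<beta> > 0" "AE x in M. \<forall>v\<ge>0. \<forall>w\<ge>0. \<beta> \<le> C\<^sub>\<phi> x v w"
    using C_diffusion(2) unfolding diffusion_coefficient_def by blast
  obtain fa ga \<psi>a where fa: "approx_trace fa ga a \<psi>a" using approx_trace_exists[OF boundary_data(1)] by blast
  obtain fb gb \<psi>b where fb: "approx_trace fb gb b \<psi>b" using approx_trace_exists[OF boundary_data(3)] by blast
  have Lf: "Lp M 2 fa" "Lp M 2 ga" "Lp M 2 fb" "Lp M 2 gb" using fa fb unfolding approx_trace_def by blast+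
  obtain Ba Bb where Ba: "AE x in boundary_measure \<Omega>. a x \<le> Ba" "\<delta> \<le> Ba" and Bb: "AE x in boundary_measure \<Omega>. b x \<le> Bb" "\<delta> \<le> Bb"
    using Linf_upper_bound[OF boundary_data(2)] Linf_upper_bound[OF boundary_data(4)] by meson
  \<comment> \<open>Starting levels for the logarithms: the inequality
    \<open>1 + t \<le> exp t\<close> places the boundary values of both unknowns below
    \<open>exp ka\<close> and \<open>exp kb\<close>, and \<open>exp (- kd)\<close> lies below
    \<delta>.\<close>
  define ka where "ka = \<bar>Ba\<bar> + 1"
  define kb where "kb = \<bar>Bb\<bar> + 1"
  define kd where "kd = max 0 (- ln \<delta>)"
  have ka: "ka > 0" "Ba \<le> exp ka" and kb: "kb > 0" "Bb \<le> exp kb"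
    using exp_ge_add_one_self[of ka] exp_ge_add_one_self[of kb] by (auto simp: ka_def kb_def)
  have kd: "kd \<ge> 0" "exp (- kd) \<le> \<delta>"
  proof -
    have "exp (- kd) \<le> exp (ln \<delta>)" unfolding exp_le_cancel_iff by (simp add: kd_def)
    then show "exp (- kd) \<le> \<delta>" using delta(1) by simp
  qed (simp add: kd_def)

  define N2 where "N2 = exp (kb + 1)"
  have N2: "N2 \<ge> 1" using kb by (simp add: N2_def)
  \<comment> \<open>What remains of the source of \<theta> from above contains no truncation level.
    Together with the constant \<open>\<alpha> / N2\<close> for the product of coefficient and
    \<theta>, this makes N1 a function of the data and N2.\<close>
  define K1 where "K1 x = \<bar>3/4 * ((C 4 x)\<^sup>2 / C 3 x) + C 5 x\<bar>" for x
  have K1: "Lp M r K1" unfolding K1_def by (intro Lp_abs Lp_add Lc A1_quotient(2) C_Lr(1) r0)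
  have K1': "0 \<le> K1 x" for x by (simp add: K1_def)
  have c1: "\<alpha> / N2 > 0" using \<alpha>(1) N2 by simp
  obtain d1 where d1: "d1 > 0" and van1: "level_bound (\<alpha> / N2) K1 d1"
    using level_set_vanishes[OF K1 r1 K1' c1] by blast
  define N1 where "N1 = exp (ka + d1)"
  have N1: "N1 \<ge> 1" using ka d1 by (simp add: N1_def)
  \<comment> \<open>The negative part of the source of \<theta> divided by \<theta>: one power of
    \<theta> remains in the first term and is bounded by N1, while the nonnegative
    \<open>C 5\<close> is dropped.\<close>
  define K2 where "K2 x = \<bar>N1 * (C 3 x * ?F x) + C 4 x * \<bar>?D x\<bar>\<bar>" for x
  have K2: "Lp M r K2" unfolding K2_def by (intro Lp_abs Lp_add Lc LF LC r0)
  have K2': "0 \<le> K2 x" for x by (simp add: K2_def)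
  have c2: "\<alpha> / (N1 * N2) > 0" and c3: "\<beta> / (N1 * N2) > 0" using \<alpha>(1) \<beta>(1) N1 N2 by simp_all
  obtain d2 where d2: "d2 > 0" and van2: "level_bound (\<alpha> / (N1 * N2)) K2 d2"
    using level_set_vanishes[OF K2 r1 K2' c2] by blast
  define m1 where "m1 = exp (- (kd + d2))"
  have m1: "0 < m1" "m1 \<le> 1" using kd d2 by (simp_all add: m1_def)
  \<comment> \<open>A bound for the bracket in the source of \<phi>. The reciprocal of \<theta> is
    replaced by \<open>1 / m1\<close>, so m2 can only be chosen after m1.\<close>
  let ?B = "\<lambda>x. N1 * (C 6 x * ?F x) + C 7 x * \<bar>?D x\<bar> + 1 / m1 * C 8 x"
  define K3 where "K3 x = \<bar>?B x\<bar>" for x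
  have K3: "Lp M r K3" unfolding K3_def by (intro Lp_abs Lp_add Lc LF LC C_Lr(2) r0)
  have K3': "0 \<le> K3 x" for x by (simp add: K3_def)
  obtain d3 where d3: "d3 > 0" and van3: "level_bound (\<beta> / (N1 * N2)) K3 d3"
    using level_set_vanishes[OF K3 r1 K3' c3] by blast
  define m2 where "m2 = exp (- (kd + d3))"
  have m2: "0 < m2" "m2 \<le> 1" using kd d3 by (simp_all add: m2_def)
  have mN: "m1 \<le> N1" "m2 \<le> N2" using m1 m2 N1 N2 by linarith+

  define T where "T = truncate m1 N1"
  define S where "S = truncate m2 N2"
  have T: "0 < T v" "m1 \<le> T v" "T v \<le> N1" and S: "0 < S v" "m2 \<le> S v" "S v \<le> N2" for v
    using truncate_bounds[OF mN(1), of v] truncate_bounds[OF mN(2), of v] m1 m2 unfolding T_def S_def by linarith+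
  have [measurable]: "T \<in> borel_measurable borel" "S \<in> borel_measurable borel" unfolding T_def S_def by measurable
  have cT: "continuous_on UNIV (\<lambda>z. T (fst z))" "continuous_on UNIV (\<lambda>z. S (snd z))" for z :: "real \<times> real"
    unfolding T_def S_def by (intro continuous_intros)+
  define k1 where "k1 x v w = \<nu> + C\<^sub>\<theta> x (T v) (S w) / (T v * S w)" for x v w
  define k2 where "k2 x v w = \<nu> + C\<^sub>\<phi> x (T v) (S w) / (T v * S w)" for x v w
  define h1 where "h1 x v w = - C 3 x * ?F x * (T v)\<^sup>2 + C 4 x * T v * ?D x + C 5 x" for x and v w :: real
  define h2 where "h2 x v w = - S w * (C 6 x * T v * ?F x - C 7 x * ?D x + C 8 x * inverse (T v))" for x v w
  have k1_eq: "k1 = (\<lambda>x v w. \<nu> + C\<^sub>\<theta> x (truncate m1 N1 v) (truncate m2 N2 w) / (truncate m1 N1 v * truncate m2 N2 w))"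
    and k2_eq: "k2 = (\<lambda>x v w. \<nu> + C\<^sub>\<phi> x (truncate m1 N1 v) (truncate m2 N2 w) / (truncate m1 N1 v * truncate m2 N2 w))"
    by (simp_all add: fun_eq_iff k1_def k2_def T_def S_def)
  note q1 = truncated_coefficient[OF C_diffusion(1) nu m1(1) mN(1) m2(1) mN(2) \<alpha> k1_eq, folded T_def S_def]
  note q2 = truncated_coefficient[OF C_diffusion(2) nu m1(1) mN(1) m2(1) mN(2) \<beta> k2_eq, folded T_def S_def]
  obtain kmax1 where kmax1: "AE x in M. \<forall>v w. \<alpha> / (N1 * N2) \<le> k1 x v w \<and> k1 x v w \<le> kmax1" using q1(4) by blast
  obtain kmax2 where kmax2: "AE x in M. \<forall>v w. \<beta> / (N1 * N2) \<le> k2 x v w \<and> k2 x v w \<le> kmax2" using q2(4) by blast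
  define H1b where "H1b x = N1\<^sup>2 * (C 3 x * ?F x) + N1 * (C 4 x * \<bar>?D x\<bar>) + C 5 x" for x
  define H2b where "H2b x = N2 * ?B x" for x
  have Hb: "Lp M r H1b" "Lp M r H2b" unfolding H1b_def H2b_def by (intro Lp_add Lc LF LC C_Lr r0)+
  have h1b: "AE x in M. \<forall>v w. \<bar>h1 x v w\<bar> \<le> H1b x"
    using C0
  proof eventually_elim
    case (elim x)
    then have C: "0 \<le> C 3 x" "0 \<le> C 4 x" "0 \<le> C 5 x" by auto
    show ?case
    proof (intro allI)
      fix v w
      have "C 3 x * ?F x * (T v)\<^sup>2 \<le> C 3 x * ?F x * N1\<^sup>2" using C F0[of x] T[of v] by (intro mult_left_mono power_mono) auto
      moreover have "\<bar>C 4 x * T v * ?D x\<bar> \<le> N1 * (C 4 x * \<bar>?D x\<bar>)"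
        using C T[of v] mult_right_mono[of "T v" N1 "C 4 x * \<bar>?D x\<bar>"] by (simp add: abs_mult mult_ac)
      moreover have "0 \<le> C 3 x * ?F x * (T v)\<^sup>2" using C F0[of x] by simp
      ultimately show "\<bar>h1 x v w\<bar> \<le> H1b x" using C by (simp add: h1_def H1b_def mult_ac)
    qed
  qed
  have br: "AE x in M. \<forall>v. C 6 x * T v * ?F x + C 7 x * \<bar>?D x\<bar> + C 8 x * inverse (T v) \<le> ?B x"
    using C0
  proof eventually_elim
    case (elim x)
    then have C: "0 \<le> C 6 x" "0 \<le> C 8 x" by auto
    show ?case
    proof
      fix v
      have "C 6 x * T v * ?F x \<le> N1 * (C 6 x * ?F x)"
        using C T[of v] F0[of x] mult_right_mono[of "T v" N1 "C 6 x * ?F x"] by (simp add: mult_ac)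
      moreover have "C 8 x * inverse (T v) \<le> 1 / m1 * C 8 x"
        using C le_imp_inverse_le[OF T(2)[of v] m1(1)] mult_left_mono[of "inverse (T v)" "inverse m1" "C 8 x"] by (simp add: inverse_eq_divide)
      ultimately show "C 6 x * T v * ?F x + C 7 x * \<bar>?D x\<bar> + C 8 x * inverse (T v) \<le> ?B x" by linarith
    qed
  qed
  have h2abs: "AE x in M. \<forall>v w. \<bar>h2 x v w\<bar> \<le> S w * ?B x"
    using C0 br
  proof eventually_elim
    case (elim x)
    then have C: "0 \<le> C 6 x" "0 \<le> C 7 x" "0 \<le> C 8 x" by auto
    show ?case
    proof (intro allI)
      fix v w
      have "\<bar>C 7 x * ?D x\<bar> = C 7 x * \<bar>?D x\<bar>" using C by (simp add: abs_mult)
      moreover have "0 \<le> C 6 x * T v * ?F x" "0 \<le> C 8 x * inverse (T v)" using C F0[of x] T(1)[of v] by (auto intro: mult_nonneg_nonneg)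
      ultimately have "\<bar>C 6 x * T v * ?F x - C 7 x * ?D x + C 8 x * inverse (T v)\<bar> \<le> ?B x"
        using elim(2)[rule_format, of v] by linarith
      from mult_left_mono[OF this, of "S w"] S(1)[of w]
      show "\<bar>h2 x v w\<bar> \<le> S w * ?B x"
        unfolding h2_def abs_mult by simp
    qed
  qed
  have h2b: "AE x in M. \<forall>v w. \<bar>h2 x v w\<bar> \<le> H2b x"
    using h2abs C0
  proof eventually_elim
    case (elim x)
    then have "0 \<le> C 6 x" "0 \<le> C 7 x" "0 \<le> C 8 x" by auto
    then have "0 \<le> ?B x" using N1 m1(1) F0[of x] by (intro add_nonneg_nonneg mult_nonneg_nonneg) auto
    then have "S w * ?B x \<le> H2b x" for w unfolding H2b_def using S(3)[of w] by (rule mult_right_mono[rotated])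
    then show ?case using elim(1) order_trans by blast
  qed
  have h_meas: "(\<lambda>x. h1 x (p x) (q x)) \<in> borel_measurable M" "(\<lambda>x. h2 x (p x) (q x)) \<in> borel_measurable M"
    if [measurable]: "p \<in> borel_measurable M" "q \<in> borel_measurable M" for p q
    unfolding h1_def h2_def by measurable
  have T_ne: "\<forall>z\<in>UNIV. T (fst z) \<noteq> 0" for z :: "real \<times> real" using T(1) by (simp add: less_imp_neq[symmetric])
  have h_cont: "continuous_on UNIV (\<lambda>(v, w). h1 x v w)" "continuous_on UNIV (\<lambda>(v, w). h2 x v w)" for x
    unfolding h1_def h2_def split_beta by (intro continuous_intros cT T_ne)+
  have E1: "equation \<Omega> b0 k1 h1 ga (\<alpha> / (N1 * N2)) kmax1 r H1b"
    by unfold_locales (use b3 bdiv q1(1,2) kmax1 c2 h_meas(1) h_cont(1) h1b Hb(1) r1 Lf(2) in auto)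
  have E2: "equation \<Omega> b0 k2 h2 gb (\<beta> / (N1 * N2)) kmax2 r H2b"
    by unfold_locales (use b3 bdiv q2(1,2) kmax2 c3 h_meas(2) h_cont(2) h2b Hb(2) r1 Lf(4) in auto)
  obtain v1 w1 v2 w2 where H: "H0 v1 w1" "H0 v2 w2" and res: "\<forall>\<psi>. tf \<psi> \<longrightarrow>
     equation.Res \<Omega> b0 k1 h1 ga (\<lambda>x. fa x + v1 x) (\<lambda>x. fb x + v2 x) w1 \<psi> = 0 \<and>
     equation.Res \<Omega> b0 k2 h2 gb (\<lambda>x. fa x + v1 x) (\<lambda>x. fb x + v2 x) w2 \<psi> = 0"
    using quasilinear_system_solvable[OF E1 E2 Lp2_measurable[OF Lf(1)] Lp2_measurable[OF Lf(3)]] by blast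
  define \<theta>0 where "\<theta>0 x = fa x + v1 x" for x
  define \<phi>0 where "\<phi>0 x = fb x + v2 x" for x
  define g1 where "g1 x = ga x + w1 x" for x
  define g2 where "g2 x = gb x + w2 x" for x
  define \<kappa>1 where "\<kappa>1 x = k1 x (\<theta>0 x) (\<phi>0 x)" for x
  define \<kappa>2 where "\<kappa>2 x = k2 x (\<theta>0 x) (\<phi>0 x)" for x
  define s1 where "s1 x = h1 x (\<theta>0 x) (\<phi>0 x)" for x
  define s2 where "s2 x = h2 x (\<theta>0 x) (\<phi>0 x)" for x
  have res1: "(LINT x|M. (b0 x \<bullet> g1 x) * \<psi> x) + (LINT x|M. (\<kappa>1 x *\<^sub>R g1 x) \<bullet> grad \<psi> x) - (LINT x|M. s1 x * \<psi> x) = 0"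
    and res2: "(LINT x|M. (b0 x \<bullet> g2 x) * \<psi> x) + (LINT x|M. (\<kappa>2 x *\<^sub>R g2 x) \<bullet> grad \<psi> x) - (LINT x|M. s2 x * \<psi> x) = 0" if "tf \<psi>" for \<psi>
    using res[rule_format, OF that] unfolding equation.Res_def[OF E1] equation.Res_def[OF E2] \<kappa>1_def \<kappa>2_def s1_def s2_def \<theta>0_def \<phi>0_def g1_def g2_def
    by blast+
  obtain t1 t2 where tr: "approx_trace \<theta>0 g1 a t1" "approx_trace \<phi>0 g2 b t2"
    using approx_trace_add[OF fa H(1)] approx_trace_add[OF fb H(2)] unfolding \<theta>0_def[abs_def] \<phi>0_def[abs_def] g1_def[abs_def] g2_def[abs_def] by blast
  have [measurable]: "\<theta>0 \<in> borel_measurable M" "\<phi>0 \<in> borel_measurable M" using tr unfolding approx_trace_def Lp_def by blast+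
  have adm: "adm \<delta> Ba \<theta>0 g1" "adm \<delta> Bb \<phi>0 g2"
    using approx_trace_adm[OF domain(3) tr(1) delta(2) Ba] approx_trace_adm[OF domain(3) tr(2) delta(3) Bb] by blast+
  have \<kappa>m: "\<kappa>1 \<in> borel_measurable M" "\<kappa>2 \<in> borel_measurable M"
    unfolding \<kappa>1_def[abs_def] \<kappa>2_def[abs_def] by (rule q1(1) q2(1); measurable)+
  have \<kappa>lo: "AE x in M. \<alpha> / (N1 * N2) \<le> \<kappa>1 x \<and> \<kappa>1 x \<le> kmax1" "AE x in M. \<beta> / (N1 * N2) \<le> \<kappa>2 x \<and> \<kappa>2 x \<le> kmax2"
    using kmax1 kmax2 unfolding \<kappa>1_def \<kappa>2_def by (auto elim: eventually_mono)
  have \<kappa>pos: "AE x in M. \<bar>\<kappa>1 x\<bar> \<le> kmax1" "AE x in M. 0 \<le> \<kappa>1 x" "AE x in M. \<bar>\<kappa>2 x\<bar> \<le> kmax2" "AE x in M. 0 \<le> \<kappa>2 x"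
  proof -
    show "AE x in M. \<bar>\<kappa>1 x\<bar> \<le> kmax1" "AE x in M. 0 \<le> \<kappa>1 x" using \<kappa>lo(1) by (eventually_elim, use c2 in linarith)+
    show "AE x in M. \<bar>\<kappa>2 x\<bar> \<le> kmax2" "AE x in M. 0 \<le> \<kappa>2 x" using \<kappa>lo(2) by (eventually_elim, use c3 in linarith)+
  qed
  have Ls: "Lp M r s1" "Lp M r s2"
    using equation.H_Lp[OF E1, of \<theta>0 \<phi>0] equation.H_Lp[OF E2, of \<theta>0 \<phi>0] unfolding s1_def[abs_def] s2_def[abs_def] by auto
  interpret S1: scalar_solution \<Omega> \<delta> Ba kmax1 r \<theta>0 \<kappa>1 s1 g1 b0
    by unfold_locales (use adm(1) b3 bdiv \<kappa>m(1) \<kappa>pos(1,2) Ls(1) r1 res1 in auto)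
  interpret S2: scalar_solution \<Omega> \<delta> Bb kmax2 r \<phi>0 \<kappa>2 s2 g2 b0
    by unfold_locales (use adm(2) b3 bdiv \<kappa>m(2) \<kappa>pos(3,4) Ls(2) r1 res2 in auto)

  \<comment> \<open>The ellipticity constant used here contains N1, which was chosen after N2. This
    is not circular, because the bound of \<open>maximum_principle\<close> does not contain the
    constant.\<close>
  have \<phi>_up: "AE x in M. \<phi>0 x < N2"
    unfolding N2_def
  proof (rule S2.maximum_principle[OF kb c3])
    show "AE x in M. 1 < \<phi>0 x \<longrightarrow> \<beta> / (N1 * N2) \<le> \<kappa>2 x * \<phi>0 x"
      using \<kappa>lo(2)
    proof eventually_elim
      case (elim x)
      show ?case
      proof
        assume "1 < \<phi>0 x"
        moreover have "0 \<le> \<kappa>2 x" using elim c3 by linarith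
        ultimately have "\<kappa>2 x * 1 \<le> \<kappa>2 x * \<phi>0 x" by (intro mult_left_mono) auto
        then show "\<beta> / (N1 * N2) \<le> \<kappa>2 x * \<phi>0 x" using elim by linarith
      qed
    qed
    have "AE x in M. C 6 x = \<rho> x * c 6 x" "AE x in M. C 7 x = \<rho> x * c 7 x" "AE x in M. C 8 x = \<rho> x * c 8 x"
      by (intro C_form(1); simp)+
    then show "AE x in M. s2 x \<le> 0"
      using A1_constants rho(1)
    proof eventually_elim
      case (elim x)
      \<comment> \<open>The bracket is nonnegative for every positive value in the place of
        \<theta>, hence also for the truncated one, before anything is known about \<theta>.\<close>
      have "0 \<le> \<rho> x * 0.014 * T (\<theta>0 x) * ?F x - \<rho> x * 0.104 * ?D x + \<rho> x * 0.84 * inverse (T (\<theta>0 x))"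
        by (rule bracket_nonneg[OF elim(7) T(1) FD])
      then have "0 \<le> C 6 x * T (\<theta>0 x) * ?F x - C 7 x * ?D x + C 8 x * inverse (T (\<theta>0 x))" unfolding elim(1-6) .
      then show ?case unfolding s2_def h2_def using S(1)[of "\<phi>0 x"] by (simp add: mult_le_0_iff)
    qed
  qed
  have iK: "integrable M K1" "integrable M K2" "integrable M K3"
    using integral_Lp_set_bound(1)[OF K1 r1 K1' sets.empty_sets] integral_Lp_set_bound(1)[OF K2 r1 K2' sets.empty_sets]
      integral_Lp_set_bound(1)[OF K3 r1 K3' sets.empty_sets] by blast+
  have \<theta>_up: "AE x in M. \<theta>0 x < N1"
  proof -
    have 1: "AE x in M. 1 < \<theta>0 x \<longrightarrow> \<alpha> / N2 \<le> \<kappa>1 x * \<theta>0 x"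
      using q1(3)
    proof eventually_elim
      case (elim x)
      show ?case
      proof
        assume g: "1 < \<theta>0 x"
        then have t: "T (\<theta>0 x) \<le> \<theta>0 x" unfolding T_def using m1 by (intro truncate_le) linarith
        \<comment> \<open>The factor \<open>T (\<theta>0 x)\<close> in the denominator of the
          coefficient is cancelled by \<theta> itself, since truncation does not increase values
          above m1. Only the bound N2 of the other unknown is left.\<close>
        have "\<alpha> / N2 \<le> \<alpha> / S (\<phi>0 x)" using S[of "\<phi>0 x"] \<alpha>(1) by (intro divide_left_mono) auto
        also have "\<dots> = \<alpha> / (T (\<theta>0 x) * S (\<phi>0 x)) * T (\<theta>0 x)" using T(1)[of "\<theta>0 x"] by simp
        also have "\<dots> \<le> \<kappa>1 x * \<theta>0 x"
        proof (rule mult_mono[OF _ t])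
          show low: "\<alpha> / (T (\<theta>0 x) * S (\<phi>0 x)) \<le> \<kappa>1 x" using elim unfolding \<kappa>1_def by blast
          have "0 < \<alpha> / (T (\<theta>0 x) * S (\<phi>0 x))" using \<alpha>(1) T(1) S(1) by simp
          then show "0 \<le> \<kappa>1 x" using low by linarith
          show "0 \<le> T (\<theta>0 x)" using T(1)[of "\<theta>0 x"] by linarith
        qed
        finally show "\<alpha> / N2 \<le> \<kappa>1 x * \<theta>0 x" .
      qed
    qed
    have 2: "AE x in M. 1 < \<theta>0 x \<longrightarrow> s1 x \<le> K1 x"
      using C0 A1_quotient(1)
    proof eventually_elim
      case (elim x)
      have "- C 3 x * ?F x * (T (\<theta>0 x))\<^sup>2 + C 4 x * T (\<theta>0 x) * ?D x \<le> 3/4 * ((C 4 x)\<^sup>2 / C 3 x)"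
        by (rule source_upper[OF _ elim(2) FD]) (use elim(1) in auto)
      then show ?case unfolding s1_def h1_def K1_def by linarith
    qed
    have "AE x in M. ln (max (\<theta>0 x) 1) < ka + d1"
      by (rule van1[unfolded level_bound_def, rule_format]) (measurable, rule S1.upper_bound[OF ka c1 1 iK(1) K1' 2])
    then show ?thesis
    proof eventually_elim
      case (elim x)
      then have "exp (ln (max (\<theta>0 x) 1)) < N1" unfolding N1_def by (simp only: exp_less_cancel_iff)
      moreover have "exp (ln (max (\<theta>0 x) 1)) = max (\<theta>0 x) 1" by (rule exp_ln) simp
      ultimately show ?case by simp
    qed
  qed
  \<comment> \<open>At t \<le> m the truncated logarithm would be exactly the excluded level, so the
    strict bound shows that the truncation is not reached.\<close>
  have below: "m < t" if "- ln (max t m) < k" "m = exp (- k)" for m t k :: real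
  proof (rule ccontr)
    assume "\<not> m < t"
    then have "max t m = exp (- k)" using that(2) by simp
    then show False using that(1) by simp
  qed
  have ekd: "exp (- kd) \<le> 1" using kd(1) by simp
  have \<theta>_lo: "AE x in M. m1 < \<theta>0 x"
  proof -
    have 1: "AE x in M. \<alpha> / (N1 * N2) \<le> \<kappa>1 x" using \<kappa>lo(1) by (auto elim: eventually_mono)
    have 2: "AE x in M. \<theta>0 x < exp (- kd) \<longrightarrow> - s1 x \<le> max (\<theta>0 x) m1 * K2 x"
      using C0
    proof eventually_elim
      case (elim x)
      then have C: "0 \<le> C 3 x" "0 \<le> C 4 x" "0 \<le> C 5 x" by auto
      show ?case
      proof
        assume "\<theta>0 x < exp (- kd)"
        \<comment> \<open>Below \<open>exp (- kd)\<close>, which is at most 1, the upper truncation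
          cannot act, so only the truncation from below that occurs in the logarithm
          remains.\<close>
        then have t: "T (\<theta>0 x) = max (\<theta>0 x) m1" unfolding T_def by (intro truncate_eq_max[OF mN(1)]) (use ekd N1 in linarith)
        let ?t = "T (\<theta>0 x)"
        have "- s1 x \<le> C 3 x * ?F x * ?t\<^sup>2 - C 4 x * ?t * ?D x" unfolding s1_def h1_def using C by simp
        also have "\<dots> = ?t * (?t * (C 3 x * ?F x) - C 4 x * ?D x)" by (simp add: power2_eq_square algebra_simps)
        also have "\<dots> \<le> ?t * K2 x"
        proof (rule mult_left_mono)
          have "?t * (C 3 x * ?F x) \<le> N1 * (C 3 x * ?F x)" using T(3) C F0[of x] by (intro mult_right_mono) auto
          moreover have "- (C 4 x * ?D x) \<le> C 4 x * \<bar>?D x\<bar>" using C mult_left_mono[of "- ?D x" "\<bar>?D x\<bar>" "C 4 x"] by simp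
          ultimately show "?t * (C 3 x * ?F x) - C 4 x * ?D x \<le> K2 x" unfolding K2_def by linarith
          show "0 \<le> ?t" using T(1)[of "\<theta>0 x"] by linarith
        qed
        finally show "- s1 x \<le> max (\<theta>0 x) m1 * K2 x" unfolding t .
      qed
    qed
    have "AE x in M. - ln (max (\<theta>0 x) m1) < kd + d2"
      by (rule van2[unfolded level_bound_def, rule_format]) (measurable, rule S1.lower_bound[OF kd(2) m1_def c2 1 iK(2) K2' 2])
    then show ?thesis by eventually_elim (rule below[OF _ m1_def])
  qed
  have \<phi>_lo: "AE x in M. m2 < \<phi>0 x"
  proof -
    have 1: "AE x in M. \<beta> / (N1 * N2) \<le> \<kappa>2 x" using \<kappa>lo(2) by (auto elim: eventually_mono)
    have 2: "AE x in M. \<phi>0 x < exp (- kd) \<longrightarrow> - s2 x \<le> max (\<phi>0 x) m2 * K3 x"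
      using h2abs
    proof eventually_elim
      case (elim x)
      show ?case
      proof
        assume "\<phi>0 x < exp (- kd)"
        then have t: "S (\<phi>0 x) = max (\<phi>0 x) m2" unfolding S_def by (intro truncate_eq_max[OF mN(2)]) (use ekd N2 in linarith)
        have "- s2 x \<le> \<bar>h2 x (\<theta>0 x) (\<phi>0 x)\<bar>" unfolding s2_def by simp
        also have "\<dots> \<le> S (\<phi>0 x) * ?B x" using elim by blast
        \<comment> \<open>The absolute bound already has the factor \<open>S (\<phi>0 x)\<close>,
          which the logarithmic weight divides out; no sign of the bracket enters from
          below.\<close>
        also have "\<dots> \<le> S (\<phi>0 x) * K3 x" using S(1)[of "\<phi>0 x"] unfolding K3_def by (intro mult_left_mono) auto
        finally show "- s2 x \<le> max (\<phi>0 x) m2 * K3 x" unfolding t .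
      qed
    qed
    have "AE x in M. - ln (max (\<phi>0 x) m2) < kd + d3"
      by (rule van3[unfolded level_bound_def, rule_format]) (measurable, rule S2.lower_bound[OF kd(2) m2_def c3 1 iK(3) K3' 2])
    then show ?thesis by eventually_elim (rule below[OF _ m2_def])
  qed

  \<comment> \<open>Truncating changes the solution only on a null set but makes its bounds hold at
    every point. The coefficients of the truncated system depend on these truncated values alone, so
    its equations, with the gradients g1 and g2, are already the original ones for \<theta> and
    \<phi>.\<close>
  define \<theta> where "\<theta> x = T (\<theta>0 x)" for x
  define \<phi> where "\<phi> x = S (\<phi>0 x)" for x
  have [measurable]: "\<theta> \<in> borel_measurable M" "\<phi> \<in> borel_measurable M" unfolding \<theta>_def[abs_def] \<phi>_def[abs_def] by measurable
  have eq\<theta>: "AE x in M. \<theta>0 x = \<theta> x"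
    using \<theta>_up \<theta>_lo by eventually_elim (simp add: \<theta>_def T_def truncate_id)
  have eq\<phi>: "AE x in M. \<phi>0 x = \<phi> x"
    using \<phi>_up \<phi>_lo by eventually_elim (simp add: \<phi>_def S_def truncate_id)
  have H\<theta>: "H1 \<Omega> \<theta> g1" "has_trace \<Omega> \<theta> a" using approx_trace_H1[OF tr(1) _ eq\<theta>] by auto
  have H\<phi>: "H1 \<Omega> \<phi> g2" "has_trace \<Omega> \<phi> b" using approx_trace_H1[OF tr(2) _ eq\<phi>] by auto
  have bds: "class_S \<Omega> f" if H: "H1 \<Omega> f g" and m: "f \<in> borel_measurable M" and lo: "0 < m" "\<And>x. m \<le> f x" and up: "\<And>x. f x \<le> N" for f g m N
    unfolding class_S_def inverse_Linf_def Linf_def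
  proof (intro conjI ballI exI)
    have p: "0 < f x" for x using lo(1) lo(2)[of x] by linarith
    show "0 \<le> f x" for x using p[of x] by simp
    show "H1 \<Omega> f g" by (rule H)
    show "f \<in> borel_measurable M" "(\<lambda>x. inverse (f x)) \<in> borel_measurable M" using m by auto
    show "AE x in M. norm (f x) \<le> N" using up p by (auto simp: less_imp_le)
    show "AE x in M. f x \<noteq> 0" using p by (auto simp: less_imp_neq[symmetric])
    show "AE x in M. norm (inverse (f x)) \<le> inverse m"
      using p lo le_imp_inverse_le[OF lo(2) lo(1)] by (auto simp: less_imp_le)
  qed
  have "class_S \<Omega> \<theta>" "class_S \<Omega> \<phi>"
    by (rule bds[OF H\<theta>(1) _ m1(1), of N1] bds[OF H\<phi>(1) _ m2(1), of N2]; use T S in \<open>simp add: \<theta>_def \<phi>_def\<close>)+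
  moreover have "weak_equation \<Omega> \<rho> u (\<lambda>x. \<nu> + C\<^sub>\<theta> x (\<theta> x) (\<phi> x) / (\<theta> x * \<phi> x)) \<theta>
       (\<lambda>x. - C 3 x * ?F x * (\<theta> x)\<^sup>2 + C 4 x * \<theta> x * ?D x + C 5 x)"
    unfolding weak_equation_def
  proof (intro exI[of _ g1] conjI allI impI H\<theta>)
    fix \<psi> assume "tf \<psi>"
    from res1[OF this]
    show "(LINT x|M. \<rho> x * (u x \<bullet> g1 x) * \<psi> x) + (LINT x|M. (\<nu> + C\<^sub>\<theta> x (\<theta> x) (\<phi> x) / (\<theta> x * \<phi> x)) * (g1 x \<bullet> grad \<psi> x))
      = (LINT x|M. (- C 3 x * ?F x * (\<theta> x)\<^sup>2 + C 4 x * \<theta> x * ?D x + C 5 x) * \<psi> x)"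
      by (simp add: b0_def \<kappa>1_def k1_def s1_def h1_def \<theta>_def \<phi>_def)
  qed
  moreover have "weak_equation \<Omega> \<rho> u (\<lambda>x. \<nu> + C\<^sub>\<phi> x (\<theta> x) (\<phi> x) / (\<theta> x * \<phi> x)) \<phi>
       (\<lambda>x. - \<phi> x * (C 6 x * \<theta> x * ?F x - C 7 x * ?D x + C 8 x * inverse (\<theta> x)))"
    unfolding weak_equation_def
  proof (intro exI[of _ g2] conjI allI impI H\<phi>)
    fix \<psi> assume "tf \<psi>"
    from res2[OF this]
    show "(LINT x|M. \<rho> x * (u x \<bullet> g2 x) * \<psi> x) + (LINT x|M. (\<nu> + C\<^sub>\<phi> x (\<theta> x) (\<phi> x) / (\<theta> x * \<phi> x)) * (g2 x \<bullet> grad \<psi> x))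
      = (LINT x|M. - \<phi> x * (C 6 x * \<theta> x * ?F x - C 7 x * ?D x + C 8 x * inverse (\<theta> x)) * \<psi> x)"
      by (simp add: b0_def \<kappa>2_def k2_def s2_def h2_def \<theta>_def \<phi>_def)
  qed
  ultimately show ?thesis unfolding weak_solution_Q_def using H\<theta>(2) H\<phi>(2) by blast
qed

end
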